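(* Let $R$ be a commutative Noetherian ring (not necessarily local), let $n\ge 0$ be an integer, and let $\mathfrak{p}\in\operatorname{Spec}(R)$ be a prime ideal with $\operatorname{grade}(\mathfrak{p})\geq 1$ and $\operatorname{height}(\mathfrak{p})=n+1$. Let $X$ be a finitely generated $R$-module and set $N=\operatorname{Tr}(X)$, the Auslander transpose of $X$. Assume the following conditions hold: (i) $R$ satisfies $(S_{n+1})$. (ii) $X$ is torsion, $X_{\mathfrak{p}}$ is not a free $R_{\mathfrak p}$-module, but $X_{\mathfrak{q}}$ is a free $R_{\mathfrak q}$-module for each $\mathfrak{q}\in\operatorname{Spec}(R)$ with $\mathfrak{q}\nsupseteq\mathfrak{p}$. (iii) $M$ is a nonzero finitely generated $R$-module such that $M$ satisfies $(S_{n+2})$ and $\mathfrak{p}\notin\operatorname{Supp}_R(M)$. Then the following hold: (1) $M\otimes_R N$ satisfies $(S_{n+1})$. (2) $\operatorname{Tor}_i^R(M,N)=0$ for all $i\ge 1$, and $\operatorname{pd}_R(N)=1$. (3) $N$ satisfies $(S_{n})$, but $N$ does not satisfy $(S_{n+1})$.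
   Context: Convention: $\operatorname{depth}(0)=\infty$. For an integer $n\ge 0$, a finitely generated module $M$ over a commutative Noetherian ring $R$ satisfies $(S_n)$ if $\operatorname{depth}_{R_{\mathfrak p}}(M_{\mathfrak p})\ge\min\{n,\dim(R_{\mathfrak p})\}$ for every $\mathfrak p\in\operatorname{Supp}_R(M)$; the ring $R$ satisfies $(S_n)$ if it does so as a module over itself. A module is torsion if each of its elements is annihilated by some non zero-divisor of $R$. The Auslander transpose of a finitely generated $R$-module $X$ is $\operatorname{Tr}(X)=\operatorname{coker}(f^{*}:F_0^{*}\to F_1^{*})$, where $F_1\xrightarrow{f}F_0\to X\to 0$ is a presentation of $X$ by finitely generated free $R$-modules and $(-)^{*}=\operatorname{Hom}_R(-,R)$; it is well defined up to projective direct summands. $\operatorname{pd}$ denotes projective dimension, and $\operatorname{grade}(\mathfrak p)$ is the length of a maximal $R$-regular sequence in $\mathfrak p$. *)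

theory Defs
  imports "HOL-Library.Extended_Nat" "HOL-Algebra.Ring_Divisibility"
begin

section \<open>Modules over a commutative ring\<close>

text \<open>
  Modules are records of type \<^typ>\<open>('a, 'b) module\<close>, subject to the library locale
  \<^locale>\<open>module\<close>. The ring fields \<open>mult\<close> and \<open>one\<close> of such a record carry no meaning for a module
  and are left undefined in the constructions below.
\<close>

definition zero_module :: "('a, 'm) module \<Rightarrow> bool" where
  "zero_module M \<longleftrightarrow> carrier M = {\<zero>\<^bsub>M\<^esub>}"

definition self_module :: "('a, 'r) ring_scheme \<Rightarrow> ('a, 'a) module" where
  "self_module R =
     \<lparr>carrier = carrier R, mult = undefined, one = undefined,
      zero = \<zero>\<^bsub>R\<^esub>, add = (\<lambda>x y. x \<oplus>\<^bsub>R\<^esub> y), smult = (\<lambda>a x. a \<otimes>\<^bsub>R\<^esub> x)\<rparr>"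

definition submodule_span :: "('a, 'r) ring_scheme \<Rightarrow> ('a, 'm) module \<Rightarrow> 'm set \<Rightarrow> 'm set" where
  "submodule_span R M A = \<Inter>{H. submodule H R M \<and> A \<subseteq> H}"

definition fg_module :: "('a, 'r) ring_scheme \<Rightarrow> ('a, 'm) module \<Rightarrow> bool" where
  "fg_module R M \<longleftrightarrow>
     module R M \<and> (\<exists>A. finite A \<and> A \<subseteq> carrier M \<and> submodule_span R M A = carrier M)"

definition quot_module :: "('a, 'm) module \<Rightarrow> 'm set \<Rightarrow> ('a, 'm set) module" where
  "quot_module M H =
     \<lparr>carrier = a_rcosets\<^bsub>M\<^esub> H, mult = undefined, one = undefined,
      zero = H, add = (\<lambda>C D. C <+>\<^bsub>M\<^esub> D),
      smult = (\<lambda>a C. \<Union>x\<in>C. H +>\<^bsub>M\<^esub> (a \<odot>\<^bsub>M\<^esub> x))\<rparr>"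

definition module_hom ::
  "('a, 'r) ring_scheme \<Rightarrow> ('a, 'm) module \<Rightarrow> ('a, 'n) module \<Rightarrow> ('m \<Rightarrow> 'n) set" where
  "module_hom R M N =
     {f \<in> carrier M \<rightarrow> carrier N.
        (\<forall>x\<in>carrier M. \<forall>y\<in>carrier M. f (x \<oplus>\<^bsub>M\<^esub> y) = f x \<oplus>\<^bsub>N\<^esub> f y) \<and>
        (\<forall>a\<in>carrier R. \<forall>x\<in>carrier M. f (a \<odot>\<^bsub>M\<^esub> x) = a \<odot>\<^bsub>N\<^esub> f x)}"

definition module_ker :: "('a, 'm) module \<Rightarrow> ('a, 'n) module \<Rightarrow> ('m \<Rightarrow> 'n) \<Rightarrow> 'm set" where
  "module_ker M N f = {x \<in> carrier M. f x = \<zero>\<^bsub>N\<^esub>}"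

definition coker :: "('a, 'm) module \<Rightarrow> ('a, 'n) module \<Rightarrow> ('m \<Rightarrow> 'n) \<Rightarrow> ('a, 'n set) module" where
  "coker M N f = quot_module N (f ` carrier M)"

definition nonzero_divisor :: "('a, 'r) ring_scheme \<Rightarrow> 'a \<Rightarrow> bool" where
  "nonzero_divisor R a \<longleftrightarrow>
     a \<in> carrier R \<and> (\<forall>b\<in>carrier R. a \<otimes>\<^bsub>R\<^esub> b = \<zero>\<^bsub>R\<^esub> \<longrightarrow> b = \<zero>\<^bsub>R\<^esub>)"

definition torsion_module :: "('a, 'r) ring_scheme \<Rightarrow> ('a, 'm) module \<Rightarrow> bool" where
  "torsion_module R M \<longleftrightarrow>
     (\<forall>x\<in>carrier M. \<exists>a. nonzero_divisor R a \<and> a \<odot>\<^bsub>M\<^esub> x = \<zero>\<^bsub>M\<^esub>)"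

definition module_basis :: "('a, 'r) ring_scheme \<Rightarrow> ('a, 'm) module \<Rightarrow> 'm set \<Rightarrow> bool" where
  "module_basis R M B \<longleftrightarrow>
     B \<subseteq> carrier M \<and>
     (\<forall>x\<in>carrier M. \<exists>!c. c \<in> B \<rightarrow>\<^sub>E carrier R \<and> finite {b \<in> B. c b \<noteq> \<zero>\<^bsub>R\<^esub>} \<and>
        x = (\<Oplus>\<^bsub>M\<^esub>b\<in>{b \<in> B. c b \<noteq> \<zero>\<^bsub>R\<^esub>}. c b \<odot>\<^bsub>M\<^esub> b))"

definition free_module :: "('a, 'r) ring_scheme \<Rightarrow> ('a, 'm) module \<Rightarrow> bool" where
  "free_module R M \<longleftrightarrow> module R M \<and> (\<exists>B. module_basis R M B)"

definition fg_free_module :: "('a, 'r) ring_scheme \<Rightarrow> ('a, 'm) module \<Rightarrow> bool" where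
  "fg_free_module R M \<longleftrightarrow> module R M \<and> (\<exists>B. finite B \<and> module_basis R M B)"


section \<open>Auslander transpose\<close>

text \<open>Homomorphisms are made extensional, so that equality in \<open>Hom(M, R)\<close> is equality of maps.\<close>

definition dual_module :: "('a, 'r) ring_scheme \<Rightarrow> ('a, 'm) module \<Rightarrow> ('a, 'm \<Rightarrow> 'a) module" where
  "dual_module R M =
     \<lparr>carrier = module_hom R M (self_module R) \<inter> extensional (carrier M),
      mult = undefined, one = undefined,
      zero = (\<lambda>x\<in>carrier M. \<zero>\<^bsub>R\<^esub>),
      add = (\<lambda>f g. \<lambda>x\<in>carrier M. f x \<oplus>\<^bsub>R\<^esub> g x),
      smult = (\<lambda>a f. \<lambda>x\<in>carrier M. a \<otimes>\<^bsub>R\<^esub> f x)\<rparr>"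

definition dual_map :: "('a, 'm) module \<Rightarrow> ('m \<Rightarrow> 'n) \<Rightarrow> ('n \<Rightarrow> 'a) \<Rightarrow> ('m \<Rightarrow> 'a)" where
  "dual_map M f g = (\<lambda>x\<in>carrier M. g (f x))"

definition free_presentation ::
  "('a, 'r) ring_scheme \<Rightarrow> ('a, 'f1) module \<Rightarrow> ('a, 'f0) module \<Rightarrow> ('a, 'x) module
     \<Rightarrow> ('f1 \<Rightarrow> 'f0) \<Rightarrow> ('f0 \<Rightarrow> 'x) \<Rightarrow> bool" where
  "free_presentation R F1 F0 X f g \<longleftrightarrow>
     fg_free_module R F1 \<and> fg_free_module R F0 \<and>
     f \<in> module_hom R F1 F0 \<and> g \<in> module_hom R F0 X \<and>
     f ` carrier F1 = module_ker F0 X g \<and> g ` carrier F0 = carrier X"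

text \<open>The transpose of \<open>X\<close> computed from a free presentation \<open>F1 \<rightarrow> F0 \<rightarrow> X \<rightarrow> 0\<close> with first map \<open>f\<close>.\<close>

definition transpose_of ::
  "('a, 'r) ring_scheme \<Rightarrow> ('a, 'f1) module \<Rightarrow> ('a, 'f0) module \<Rightarrow> ('f1 \<Rightarrow> 'f0)
     \<Rightarrow> ('a, ('f1 \<Rightarrow> 'a) set) module" where
  "transpose_of R F1 F0 f = coker (dual_module R F0) (dual_module R F1) (dual_map F1 f)"


section \<open>Localization at a prime ideal\<close>

definition Spec :: "('a, 'r) ring_scheme \<Rightarrow> 'a set set" where
  "Spec R = {p. primeideal p R}"

text \<open>
  \<open>fraction R M p m s\<close> is the fraction \<open>m/s\<close> in \<open>M\<^sub>p\<close>, that is, the set of all pairs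
  \<open>(m', s')\<close> equivalent to \<open>(m, s)\<close>. The operations on fractions are given by unions over
  representatives; they do not depend on the representatives when \<open>p\<close> is prime.
\<close>

definition fraction ::
  "('a, 'r) ring_scheme \<Rightarrow> ('a, 'm) module \<Rightarrow> 'a set \<Rightarrow> 'm \<Rightarrow> 'a \<Rightarrow> ('m \<times> 'a) set" where
  "fraction R M p m s =
     {(m', s'). m' \<in> carrier M \<and> s' \<in> carrier R - p \<and>
        (\<exists>u\<in>carrier R - p. u \<odot>\<^bsub>M\<^esub> (s' \<odot>\<^bsub>M\<^esub> m) = u \<odot>\<^bsub>M\<^esub> (s \<odot>\<^bsub>M\<^esub> m'))}"

definition loc_module ::
  "('a, 'r) ring_scheme \<Rightarrow> 'a set \<Rightarrow> ('a, 'm) module \<Rightarrow> (('a \<times> 'a) set, ('m \<times> 'a) set) module" where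
  "loc_module R p M =
     \<lparr>carrier = {fraction R M p m s | m s. m \<in> carrier M \<and> s \<in> carrier R - p},
      mult = undefined, one = undefined,
      zero = fraction R M p \<zero>\<^bsub>M\<^esub> \<one>\<^bsub>R\<^esub>,
      add = (\<lambda>C D. \<Union>(x, s)\<in>C. \<Union>(y, t)\<in>D.
               fraction R M p (t \<odot>\<^bsub>M\<^esub> x \<oplus>\<^bsub>M\<^esub> s \<odot>\<^bsub>M\<^esub> y) (s \<otimes>\<^bsub>R\<^esub> t)),
      smult = (\<lambda>A C. \<Union>(a, s)\<in>A. \<Union>(x, t)\<in>C. fraction R M p (a \<odot>\<^bsub>M\<^esub> x) (s \<otimes>\<^bsub>R\<^esub> t))\<rparr>"

definition loc_ring :: "('a, 'r) ring_scheme \<Rightarrow> 'a set \<Rightarrow> ('a \<times> 'a) set ring" where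
  "loc_ring R p =
     (let L = loc_module R p (self_module R) in
     \<lparr>carrier = carrier L, mult = smult L, one = fraction R (self_module R) p \<one>\<^bsub>R\<^esub> \<one>\<^bsub>R\<^esub>,
      zero = zero L, add = add L\<rparr>)"

definition Supp :: "('a, 'r) ring_scheme \<Rightarrow> ('a, 'm) module \<Rightarrow> 'a set set" where
  "Supp R M = {p \<in> Spec R. \<not> zero_module (loc_module R p M)}"


section \<open>Height, dimension, depth, and Serre's condition\<close>

definition prime_chain :: "('a, 'r) ring_scheme \<Rightarrow> 'a set list \<Rightarrow> bool" where
  "prime_chain R ps \<longleftrightarrow> ps \<noteq> [] \<and> set ps \<subseteq> Spec R \<and> sorted_wrt (\<subset>) ps"

definition height :: "('a, 'r) ring_scheme \<Rightarrow> 'a set \<Rightarrow> enat" where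
  "height R p = (SUP ps\<in>{ps. prime_chain R ps \<and> last ps = p}. enat (length ps - 1))"

definition krull_dim :: "('a, 'r) ring_scheme \<Rightarrow> enat" where
  "krull_dim R = (SUP ps\<in>{ps. prime_chain R ps}. enat (length ps - 1))"

text \<open>The submodule \<open>(x\<^sub>1, \<dots>, x\<^sub>k)M\<close> of \<open>M\<close>.\<close>

definition seq_submodule ::
  "('a, 'r) ring_scheme \<Rightarrow> ('a, 'm) module \<Rightarrow> 'a list \<Rightarrow> 'm set" where
  "seq_submodule R M xs = submodule_span R M {x \<odot>\<^bsub>M\<^esub> m | x m. x \<in> set xs \<and> m \<in> carrier M}"

definition regular_sequence ::
  "('a, 'r) ring_scheme \<Rightarrow> ('a, 'm) module \<Rightarrow> 'a list \<Rightarrow> bool" where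
  "regular_sequence R M xs \<longleftrightarrow>
     set xs \<subseteq> carrier R \<and>
     (\<forall>i<length xs. let Q = quot_module M (seq_submodule R M (take i xs)) in
        \<forall>z\<in>carrier Q. (xs ! i) \<odot>\<^bsub>Q\<^esub> z = \<zero>\<^bsub>Q\<^esub> \<longrightarrow> z = \<zero>\<^bsub>Q\<^esub>) \<and>
     \<not> zero_module (quot_module M (seq_submodule R M xs))"

text \<open>
  For a finitely generated module \<open>M\<close> over a Noetherian ring with \<open>I M \<noteq> M\<close>, all maximal
  \<open>M\<close>-regular sequences in \<open>I\<close> have the same finite length, which is then the supremum below.
\<close>

definition depth_in ::
  "('a, 'r) ring_scheme \<Rightarrow> 'a set \<Rightarrow> ('a, 'm) module \<Rightarrow> enat" where
  "depth_in R I M =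
     (if zero_module M then \<infinity>
      else SUP xs\<in>{xs. set xs \<subseteq> I \<and> regular_sequence R M xs}. enat (length xs))"

definition grade :: "('a, 'r) ring_scheme \<Rightarrow> 'a set \<Rightarrow> enat" where
  "grade R I = depth_in R I (self_module R)"

text \<open>Depth of a module over a local ring.\<close>

definition depth :: "('a, 'r) ring_scheme \<Rightarrow> ('a, 'm) module \<Rightarrow> enat" where
  "depth R M = depth_in R (THE m. maximalideal m R) M"

definition serre_condition :: "('a, 'r) ring_scheme \<Rightarrow> nat \<Rightarrow> ('a, 'm) module \<Rightarrow> bool" where
  "serre_condition R n M \<longleftrightarrow>
     (\<forall>p\<in>Supp R M. depth (loc_ring R p) (loc_module R p M) \<ge> min (enat n) (krull_dim (loc_ring R p)))"


section \<open>Tensor products\<close>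

text \<open>The free module on a set \<open>S\<close>, realized by finitely supported functions.\<close>

definition free_on :: "('a, 'r) ring_scheme \<Rightarrow> 's set \<Rightarrow> ('a, 's \<Rightarrow> 'a) module" where
  "free_on R S =
     \<lparr>carrier = {c. range c \<subseteq> carrier R \<and> finite {s. c s \<noteq> \<zero>\<^bsub>R\<^esub>} \<and> {s. c s \<noteq> \<zero>\<^bsub>R\<^esub>} \<subseteq> S},
      mult = undefined, one = undefined,
      zero = (\<lambda>s. \<zero>\<^bsub>R\<^esub>),
      add = (\<lambda>c d s. c s \<oplus>\<^bsub>R\<^esub> d s),
      smult = (\<lambda>a c s. a \<otimes>\<^bsub>R\<^esub> c s)\<rparr>"

definition free_gen :: "('a, 'r) ring_scheme \<Rightarrow> 's \<Rightarrow> ('s \<Rightarrow> 'a)" where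
  "free_gen R s = (\<lambda>t. if t = s then \<one>\<^bsub>R\<^esub> else \<zero>\<^bsub>R\<^esub>)"

definition tensor_relations ::
  "('a, 'r) ring_scheme \<Rightarrow> ('a, 'm) module \<Rightarrow> ('a, 'n) module \<Rightarrow> ('m \<times> 'n \<Rightarrow> 'a) set" where
  "tensor_relations R M N =
     (let F = free_on R (carrier M \<times> carrier N); e = free_gen R in
      submodule_span R F
        ({e (x \<oplus>\<^bsub>M\<^esub> x', y) \<ominus>\<^bsub>F\<^esub> (e (x, y) \<oplus>\<^bsub>F\<^esub> e (x', y)) | x x' y.
            x \<in> carrier M \<and> x' \<in> carrier M \<and> y \<in> carrier N} \<union>
         {e (x, y \<oplus>\<^bsub>N\<^esub> y') \<ominus>\<^bsub>F\<^esub> (e (x, y) \<oplus>\<^bsub>F\<^esub> e (x, y')) | x y y'.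
            x \<in> carrier M \<and> y \<in> carrier N \<and> y' \<in> carrier N} \<union>
         {e (a \<odot>\<^bsub>M\<^esub> x, y) \<ominus>\<^bsub>F\<^esub> a \<odot>\<^bsub>F\<^esub> e (x, y) | a x y.
            a \<in> carrier R \<and> x \<in> carrier M \<and> y \<in> carrier N} \<union>
         {e (x, a \<odot>\<^bsub>N\<^esub> y) \<ominus>\<^bsub>F\<^esub> a \<odot>\<^bsub>F\<^esub> e (x, y) | a x y.
            a \<in> carrier R \<and> x \<in> carrier M \<and> y \<in> carrier N}))"

definition tensor_product ::
  "('a, 'r) ring_scheme \<Rightarrow> ('a, 'm) module \<Rightarrow> ('a, 'n) module
     \<Rightarrow> ('a, ('m \<times> 'n \<Rightarrow> 'a) set) module" where
  "tensor_product R M N =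
     quot_module (free_on R (carrier M \<times> carrier N)) (tensor_relations R M N)"

definition pure_tensor ::
  "('a, 'r) ring_scheme \<Rightarrow> ('a, 'm) module \<Rightarrow> ('a, 'n) module \<Rightarrow> 'm \<Rightarrow> 'n \<Rightarrow> ('m \<times> 'n \<Rightarrow> 'a) set"
  where
  "pure_tensor R M N x y =
     tensor_relations R M N +>\<^bsub>free_on R (carrier M \<times> carrier N)\<^esub> free_gen R (x, y)"

text \<open>\<open>tensor_map R M N N' f\<close> is the map \<open>id \<otimes> f : M \<otimes> N \<rightarrow> M \<otimes> N'\<close> for a homomorphism \<open>f : N \<rightarrow> N'\<close>.\<close>

definition tensor_map ::
  "('a, 'r) ring_scheme \<Rightarrow> ('a, 'm) module \<Rightarrow> ('a, 'n) module \<Rightarrow> ('a, 'k) module \<Rightarrow> ('n \<Rightarrow> 'k)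
     \<Rightarrow> ('m \<times> 'n \<Rightarrow> 'a) set \<Rightarrow> ('m \<times> 'k \<Rightarrow> 'a) set" where
  "tensor_map R M N N' f =
     (THE h. h \<in> module_hom R (tensor_product R M N) (tensor_product R M N') \<and>
        h \<in> extensional (carrier (tensor_product R M N)) \<and>
        (\<forall>x\<in>carrier M. \<forall>y\<in>carrier N. h (pure_tensor R M N x y) = pure_tensor R M N' x (f y)))"


section \<open>Projective dimension and Tor\<close>

text \<open>
  A definition cannot quantify over all types, so some existential and universal quantifiers over
  modules below are restricted to modules with elements in \<^typ>\<open>('a \<times> 'b) list\<close>, where \<open>'a\<close> is the
  element type of the ring and \<open>'b\<close> that of the given module \<open>P\<close>. This loses nothing: the type is
  infinite and at least as large as \<open>'a\<close> and \<open>'b\<close>, so it contains a copy of \<open>P\<close>, of the free module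
  on the elements of \<open>P\<close>, of the kernel of its canonical map onto \<open>P\<close>, and so on. In particular the
  lifting property against these modules makes \<open>P\<close> a direct summand of a free module, hence
  yields the lifting property against all modules.
\<close>

definition projective_module :: "('a, 'r) ring_scheme \<Rightarrow> ('a, 'p) module \<Rightarrow> bool" where
  "projective_module R P \<longleftrightarrow> module R P \<and>
     (\<forall>(A :: ('a, ('a \<times> 'p) list) module) (B :: ('a, ('a \<times> 'p) list) module) g h.
        module R A \<and> module R B \<and> g \<in> module_hom R A B \<and> g ` carrier A = carrier B \<and>
        h \<in> module_hom R P B \<longrightarrow>
        (\<exists>k\<in>module_hom R P A. \<forall>x\<in>carrier P. g (k x) = h x))"

text \<open>
  An exact complex \<open>\<dots> \<rightarrow> P 2 \<rightarrow> P 1 \<rightarrow> P 0 \<rightarrow> N \<rightarrow> 0\<close> of projective modules \<open>P i\<close>, with maps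
  \<open>d i : P (i + 1) \<rightarrow> P i\<close> and augmentation \<open>e : P 0 \<rightarrow> N\<close>.
\<close>

definition projective_resolution ::
  "('a, 'r) ring_scheme \<Rightarrow> ('a, 'n) module \<Rightarrow> (nat \<Rightarrow> ('a, 'p) module) \<Rightarrow> (nat \<Rightarrow> 'p \<Rightarrow> 'p)
     \<Rightarrow> ('p \<Rightarrow> 'n) \<Rightarrow> bool" where
  "projective_resolution R N P d e \<longleftrightarrow>
     (\<forall>i. projective_module R (P i)) \<and>
     (\<forall>i. d i \<in> module_hom R (P (Suc i)) (P i)) \<and>
     e \<in> module_hom R (P 0) N \<and>
     e ` carrier (P 0) = carrier N \<and>
     d 0 ` carrier (P 1) = module_ker (P 0) N e \<and>
     (\<forall>i. d (Suc i) ` carrier (P (Suc (Suc i))) = module_ker (P (Suc i)) (P i) (d i))"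

text \<open>The infimum of the empty set is \<open>\<infinity>\<close>; the zero module gets projective dimension \<open>0\<close>.\<close>

definition proj_dim :: "('a, 'r) ring_scheme \<Rightarrow> ('a, 'n) module \<Rightarrow> enat" where
  "proj_dim R N =
     (INF n\<in>{n. \<exists>(P :: nat \<Rightarrow> ('a, ('a \<times> 'n) list) module) d e.
                 projective_resolution R N P d e \<and> (\<forall>i>n. zero_module (P i))}. enat n)"

definition some_resolution ::
  "('a, 'r) ring_scheme \<Rightarrow> ('a, 'n) module \<Rightarrow>
     (nat \<Rightarrow> ('a, ('a \<times> 'n) list) module) \<times> (nat \<Rightarrow> ('a \<times> 'n) list \<Rightarrow> ('a \<times> 'n) list) \<times>
     (('a \<times> 'n) list \<Rightarrow> 'n)" where
  "some_resolution R N = (SOME (P, d, e). projective_resolution R N P d e)"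

text \<open>
  \<open>Tor\<^sub>i(M, N)\<close> is the \<open>i\<close>-th left derived functor of \<open>M \<otimes> -\<close> at \<open>N\<close>: the \<open>i\<close>-th homology of
  \<open>M \<otimes> P\<close> for a projective resolution \<open>P\<close> of \<open>N\<close>. Up to isomorphism this does not depend on the
  chosen resolution.
\<close>

definition tor ::
  "('a, 'r) ring_scheme \<Rightarrow> nat \<Rightarrow> ('a, 'm) module \<Rightarrow> ('a, 'n) module
     \<Rightarrow> ('a, ('m \<times> ('a \<times> 'n) list \<Rightarrow> 'a) set set) module" where
  "tor R i M N =
     (case some_resolution R N of (P, d, e) \<Rightarrow>
        let T = (\<lambda>j. tensor_product R M (P j));
            \<delta> = (\<lambda>j. tensor_map R M (P (Suc j)) (P j) (d j));
            Z = (case i of 0 \<Rightarrow> carrier (T 0) | Suc j \<Rightarrow> module_ker (T (Suc j)) (T j) (\<delta> j))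
        in quot_module ((T i)\<lparr>carrier := Z\<rparr>) (\<delta> i ` carrier (T (Suc i))))"

end

theory Submission
  imports Defs
begin

text \<open>
  Let \<open>C : R\<^sup>a \<rightarrow> R\<^sup>b\<close> be the transpose of the presentation matrix of \<open>X\<close>. As \<open>X\<close> is torsion, \<open>C\<close> is
  injective, so \<open>N = coker C\<close> has a free resolution of length one. At a prime \<open>q\<close> not containing \<open>\<pp>\<close>
  the module \<open>X\<^sub>q\<close> is free and torsion, hence zero, and \<open>C\<close> splits locally; all depths of \<open>M\<^sub>q\<close> are then
  inherited by \<open>(M \<otimes> N)\<^sub>q\<close>. The associated primes of \<open>M\<close> do not contain \<open>\<pp>\<close>, because \<open>M\<close> has positive
  depth at every prime of positive height in its support; therefore \<open>C\<close> stays injective after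
  tensoring with \<open>M\<close>. This kills all \<open>Tor\<^sub>i(M, N)\<close>, and at the remaining primes, which have height
  at least \<open>n + 2\<close> whenever they lie in the support of \<open>M\<close>, passing to the cokernel costs at most one
  in depth. Finally \<open>X\<^sub>\<pp> \<noteq> 0\<close> yields a vector with a unit entry that \<open>C\<close> maps into \<open>\<pp> R\<^sup>b\<close>; modulo a
  maximal regular sequence its multiple by a socle element is killed, so \<open>N\<^sub>\<pp>\<close> has depth
  exactly \<open>n\<close>.
\<close>

section \<open>Modules and submodules\<close>

text \<open>Localizing changes the type of elements, and every further quotient by a regular element
  changes it again; an induction on depth cannot run through such a tower of types. Hence a quotient
  of a localization is represented by a submodule of the fixed module, and depth by the recursive
  predicate \<open>depth_ge\<close>, which merely asserts that some regular sequence exists. It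
  becomes usable once any regular element may be taken first; this is obtained without Ext, by
  comparing socles modulo two regular elements and by prime avoidance. The matrix C acts on powers
  of R, M and X alike, so one set of lemmas serves all three. That N fails (S_{n+1}) needs the exact
  depth n+1 of R at \<pp>: (S_{n+1}) for R bounds it from below, the height of \<pp> from above. Tor
  is defined through an arbitrarily chosen projective resolution. The resolution of length one is
  therefore compared with it by a chain homotopy, which survives tensoring with M.\<close>

lemma module_homD:
  assumes "f \<in> module_hom R M N"
  shows "x \<in> carrier M \<Longrightarrow> f x \<in> carrier N"
    and "x \<in> carrier M \<Longrightarrow> y \<in> carrier M \<Longrightarrow> f (x \<oplus>\<^bsub>M\<^esub> y) = f x \<oplus>\<^bsub>N\<^esub> f y"
    and "a \<in> carrier R \<Longrightarrow> x \<in> carrier M \<Longrightarrow> f (a \<odot>\<^bsub>M\<^esub> x) = a \<odot>\<^bsub>N\<^esub> f x"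
  using assms by (auto simp: module_hom_def)

lemma module_homI:
  assumes "\<And>x. x \<in> carrier M \<Longrightarrow> f x \<in> carrier N"
    and "\<And>x y. x \<in> carrier M \<Longrightarrow> y \<in> carrier M \<Longrightarrow> f (x \<oplus>\<^bsub>M\<^esub> y) = f x \<oplus>\<^bsub>N\<^esub> f y"
    and "\<And>a x. a \<in> carrier R \<Longrightarrow> x \<in> carrier M \<Longrightarrow> f (a \<odot>\<^bsub>M\<^esub> x) = a \<odot>\<^bsub>N\<^esub> f x"
  shows "f \<in> module_hom R M N"
  using assms by (auto simp: module_hom_def)

lemma module_hom_comp:
  assumes "f \<in> module_hom R M N" "g \<in> module_hom R N K"
  shows "(\<lambda>x. g (f x)) \<in> module_hom R M K"
  using assms by (intro module_homI) (simp_all add: module_homD[of f] module_homD[of g])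

locale modl = module R M for R :: "('a, 'r) ring_scheme" (structure) and M :: "('a, 'm) module" (structure)
begin

lemma sub_in: "submodule H R M \<Longrightarrow> x \<in> H \<Longrightarrow> x \<in> carrier M"
  using submoduleE(1) by blast

lemma sub_zero: "submodule H R M \<Longrightarrow> \<zero>\<^bsub>M\<^esub> \<in> H"
  using subgroup.one_closed[OF submodule.axioms(1), of H R M] by simp

lemma sub_minus: "submodule H R M \<Longrightarrow> x \<in> H \<Longrightarrow> y \<in> H \<Longrightarrow> x \<ominus>\<^bsub>M\<^esub> y \<in> H"
  by (simp add: M.minus_eq submoduleE(3,5))

lemma sub_cancel:
  assumes "submodule H R M" "h \<in> H" "h \<oplus>\<^bsub>M\<^esub> x \<in> H" "x \<in> carrier M"
  shows "x \<in> H"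
proof -
  have "\<ominus>\<^bsub>M\<^esub> h \<oplus>\<^bsub>M\<^esub> (h \<oplus>\<^bsub>M\<^esub> x) \<in> H"
    using assms submoduleE(3,5)[OF assms(1)] by blast
  then show ?thesis
    using assms sub_in[OF assms(1)] by (simp add: M.r_neg1)
qed

lemmas sub_closed = sub_zero submoduleE(3,4,5) sub_minus

lemma smult_commute:
  "a \<in> carrier R \<Longrightarrow> b \<in> carrier R \<Longrightarrow> x \<in> carrier M \<Longrightarrow> a \<odot>\<^bsub>M\<^esub> (b \<odot>\<^bsub>M\<^esub> x) = b \<odot>\<^bsub>M\<^esub> (a \<odot>\<^bsub>M\<^esub> x)"
  by (metis R.m_comm smult_assoc1)

lemma sub_zero_submodule: "submodule {\<zero>\<^bsub>M\<^esub>} R M"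
  by (rule submoduleI) auto

lemma submodule_finsum:
  assumes "submodule H R M" "\<And>i. i \<in> I \<Longrightarrow> f i \<in> H"
  shows "(\<Oplus>\<^bsub>M\<^esub>i\<in>I. f i) \<in> H"
  using assms(2)
proof (induction I rule: infinite_finite_induct)
  case (insert x F)
  then have "(\<Oplus>\<^bsub>M\<^esub>i\<in>insert x F. f i) = f x \<oplus>\<^bsub>M\<^esub> (\<Oplus>\<^bsub>M\<^esub>i\<in>F. f i)"
    using sub_in[OF assms(1)] by (subst M.finsum_insert) auto
  then show ?case
    using insert submoduleE(5)[OF assms(1)] by auto
qed (auto simp: sub_zero[OF assms(1)])

lemma finsum_smult_rdistr:
  assumes "finite I" "x \<in> carrier M" "\<And>i. i \<in> I \<Longrightarrow> c i \<in> carrier R"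
  shows "(\<Oplus>\<^bsub>M\<^esub>i\<in>I. c i \<odot>\<^bsub>M\<^esub> x) = (\<Oplus>\<^bsub>R\<^esub>i\<in>I. c i) \<odot>\<^bsub>M\<^esub> x"
  using assms(1,3)
proof (induction I)
  case (insert j I)
  have "(\<Oplus>\<^bsub>M\<^esub>i\<in>insert j I. c i \<odot>\<^bsub>M\<^esub> x) = c j \<odot>\<^bsub>M\<^esub> x \<oplus>\<^bsub>M\<^esub> (\<Oplus>\<^bsub>M\<^esub>i\<in>I. c i \<odot>\<^bsub>M\<^esub> x)"
    using insert assms by (subst M.finsum_insert) auto
  moreover have "(\<Oplus>\<^bsub>R\<^esub>i\<in>insert j I. c i) = c j \<oplus> (\<Oplus>\<^bsub>R\<^esub>i\<in>I. c i)"
    using insert by (subst R.finsum_insert) auto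
  moreover have "(\<Oplus>\<^bsub>R\<^esub>i\<in>I. c i) \<in> carrier R"
    using insert by (intro R.finsum_closed) auto
  ultimately show ?case
    using insert assms by (simp add: smult_l_distr)
qed (use assms in auto)

lemma span_submodule:
  assumes "A \<subseteq> carrier M"
  shows "submodule (submodule_span R M A) R M"
proof (rule submoduleI)
  show "submodule_span R M A \<subseteq> carrier M"
    unfolding submodule_span_def using carrier_is_submodule assms by blast
qed (auto simp: submodule_span_def sub_closed)

lemma span_least: "submodule H R M \<Longrightarrow> A \<subseteq> H \<Longrightarrow> submodule_span R M A \<subseteq> H"
  unfolding submodule_span_def by blast

lemma span_superset: "A \<subseteq> submodule_span R M A"
  unfolding submodule_span_def by blast

lemma span_empty: "submodule_span R M {} = {\<zero>\<^bsub>M\<^esub>}"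
  using span_least[OF sub_zero_submodule, of "{}"] sub_zero[OF span_submodule[of "{}"]] by auto

lemma sum_submodule:
  assumes "submodule H R M" "submodule K R M"
  shows "submodule {h \<oplus>\<^bsub>M\<^esub> k | h k. h \<in> H \<and> k \<in> K} R M"
proof (rule submoduleI, goal_cases)
  case 1 then show ?case using sub_in[OF assms(1)] sub_in[OF assms(2)] by auto
next
  case 2 then show ?case using sub_zero[OF assms(1)] sub_zero[OF assms(2)] by force
next
  case (3 a)
  then obtain h k where "a = h \<oplus>\<^bsub>M\<^esub> k" "h \<in> H" "k \<in> K" by auto
  then have "\<ominus>\<^bsub>M\<^esub> a = \<ominus>\<^bsub>M\<^esub> h \<oplus>\<^bsub>M\<^esub> \<ominus>\<^bsub>M\<^esub> k"
    using sub_in[OF assms(1)] sub_in[OF assms(2)] M.minus_add by simp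
  then show ?case using submoduleE(3)[OF assms(1)] submoduleE(3)[OF assms(2)] \<open>h \<in> H\<close> \<open>k \<in> K\<close> by blast
next
  case (4 a b)
  then obtain h k h' k' where *: "a = h \<oplus>\<^bsub>M\<^esub> k" "h \<in> H" "k \<in> K" "b = h' \<oplus>\<^bsub>M\<^esub> k'" "h' \<in> H" "k' \<in> K" by auto
  then have "a \<oplus>\<^bsub>M\<^esub> b = (h \<oplus>\<^bsub>M\<^esub> h') \<oplus>\<^bsub>M\<^esub> (k \<oplus>\<^bsub>M\<^esub> k')"
    using sub_in[OF assms(1)] sub_in[OF assms(2)] by (simp add: M.a_ac)
  then show ?case using submoduleE(5)[OF assms(1)] submoduleE(5)[OF assms(2)] * by blast
next
  case (5 a x)
  then obtain h k where *: "x = h \<oplus>\<^bsub>M\<^esub> k" "h \<in> H" "k \<in> K" by auto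
  then have "a \<odot>\<^bsub>M\<^esub> x = a \<odot>\<^bsub>M\<^esub> h \<oplus>\<^bsub>M\<^esub> a \<odot>\<^bsub>M\<^esub> k"
    using sub_in[OF assms(1)] sub_in[OF assms(2)] 5 by (simp add: smult_r_distr)
  then show ?case using submoduleE(4)[OF assms(1)] submoduleE(4)[OF assms(2)] * 5 by blast
qed

lemma cyclic_submodule:
  assumes "y \<in> carrier M"
  shows "submodule {r \<odot>\<^bsub>M\<^esub> y | r. r \<in> carrier R} R M"
proof (rule submoduleI, goal_cases)
  case 2 then show ?case using assms by (auto intro!: exI[of _ \<zero>])
next
  case (3 a)
  then obtain r where r: "a = r \<odot>\<^bsub>M\<^esub> y" "r \<in> carrier R" by auto
  then have "\<ominus>\<^bsub>M\<^esub> a = (\<ominus> r) \<odot>\<^bsub>M\<^esub> y" using assms by (simp add: smult_l_minus)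
  moreover have "\<ominus> r \<in> carrier R" using r by simp
  ultimately show ?case by blast
next
  case (4 a b)
  then obtain r r' where "a = r \<odot>\<^bsub>M\<^esub> y" "b = r' \<odot>\<^bsub>M\<^esub> y" "r \<in> carrier R" "r' \<in> carrier R" by auto
  then have "a \<oplus>\<^bsub>M\<^esub> b = (r \<oplus> r') \<odot>\<^bsub>M\<^esub> y" "r \<oplus> r' \<in> carrier R" using assms by (auto simp: smult_l_distr)
  then show ?case by blast
next
  case (5 a x) then show ?case using assms by (auto simp: smult_assoc1[symmetric])
qed (use assms in auto)

lemma adjoin_submodule:
  assumes "submodule K R M" "y \<in> carrier M"
  shows "submodule {k \<oplus>\<^bsub>M\<^esub> r \<odot>\<^bsub>M\<^esub> y | k r. k \<in> K \<and> r \<in> carrier R} R M"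
proof -
  have "{k \<oplus>\<^bsub>M\<^esub> r \<odot>\<^bsub>M\<^esub> y | k r. k \<in> K \<and> r \<in> carrier R}
    = {h \<oplus>\<^bsub>M\<^esub> k | h k. h \<in> K \<and> k \<in> {r \<odot>\<^bsub>M\<^esub> y | r. r \<in> carrier R}}" by auto
  then show ?thesis using sum_submodule[OF assms(1) cyclic_submodule[OF assms(2)]] by simp
qed

lemma adjoin_superset:
  assumes "submodule K R M" "y \<in> carrier M"
  shows "K \<subseteq> {k \<oplus>\<^bsub>M\<^esub> r \<odot>\<^bsub>M\<^esub> y | k r. k \<in> K \<and> r \<in> carrier R}"
    and "y \<in> {k \<oplus>\<^bsub>M\<^esub> r \<odot>\<^bsub>M\<^esub> y | k r. k \<in> K \<and> r \<in> carrier R}"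
proof -
  show "K \<subseteq> {k \<oplus>\<^bsub>M\<^esub> r \<odot>\<^bsub>M\<^esub> y | k r. k \<in> K \<and> r \<in> carrier R}"
  proof
    fix k assume "k \<in> K"
    then have "k = k \<oplus>\<^bsub>M\<^esub> \<zero> \<odot>\<^bsub>M\<^esub> y" using assms sub_in[OF assms(1)] by simp
    then show "k \<in> {k \<oplus>\<^bsub>M\<^esub> r \<odot>\<^bsub>M\<^esub> y | k r. k \<in> K \<and> r \<in> carrier R}" using \<open>k \<in> K\<close> by blast
  qed
  have "y = \<zero>\<^bsub>M\<^esub> \<oplus>\<^bsub>M\<^esub> \<one> \<odot>\<^bsub>M\<^esub> y" using assms by simp
  then show "y \<in> {k \<oplus>\<^bsub>M\<^esub> r \<odot>\<^bsub>M\<^esub> y | k r. k \<in> K \<and> r \<in> carrier R}" using sub_zero[OF assms(1)] by blast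
qed

lemma hom_zero:
  assumes "module R N" "f \<in> module_hom R M N"
  shows "f \<zero>\<^bsub>M\<^esub> = \<zero>\<^bsub>N\<^esub>"
proof -
  interpret N: modl R N by (rule modl.intro) fact
  show ?thesis
    using module_homD(3)[OF assms(2), of \<zero> "\<zero>\<^bsub>M\<^esub>"] module_homD(1)[OF assms(2), of "\<zero>\<^bsub>M\<^esub>"] by simp
qed

lemma hom_neg:
  assumes "module R N" "f \<in> module_hom R M N" "x \<in> carrier M"
  shows "f (\<ominus>\<^bsub>M\<^esub> x) = \<ominus>\<^bsub>N\<^esub> f x"
proof -
  interpret N: modl R N by (rule modl.intro) fact
  note f = module_homD[OF assms(2)]
  have "f (\<ominus>\<^bsub>M\<^esub> x) \<oplus>\<^bsub>N\<^esub> f x = \<zero>\<^bsub>N\<^esub>"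
    using f(2)[of "\<ominus>\<^bsub>M\<^esub> x" x] assms(3) by (simp add: M.l_neg hom_zero[OF assms(1,2)])
  then show ?thesis
    using N.minus_equality[of "f (\<ominus>\<^bsub>M\<^esub> x)" "f x"] f(1) assms(3) by simp
qed

lemma module_hom_submodule_eq:
  assumes "module R N" "f \<in> module_hom R M N" "submodule H R N"
  shows "submodule {x \<in> carrier M. f x \<in> H} R M"
proof -
  interpret N: modl R N by (rule modl.intro) fact
  note f = module_homD[OF assms(2)]
  have z: "f \<zero>\<^bsub>M\<^esub> = \<zero>\<^bsub>N\<^esub>" using f(3)[of \<zero> "\<zero>\<^bsub>M\<^esub>"] f(1)[of "\<zero>\<^bsub>M\<^esub>"] by simp
  note n = hom_neg[OF assms(1,2)]
  show ?thesis
    by (rule submoduleI) (auto simp: z n f N.sub_closed[OF assms(3)])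
qed

lemma hom_minus:
  assumes "module R N" "f \<in> module_hom R M N" "x \<in> carrier M" "y \<in> carrier M"
  shows "f (x \<ominus>\<^bsub>M\<^esub> y) = f x \<ominus>\<^bsub>N\<^esub> f y"
proof -
  interpret N: modl R N by (rule modl.intro) fact
  show ?thesis
    using assms hom_neg[OF assms(1,2)] module_homD[OF assms(2)] by (simp add: M.minus_eq N.minus_eq)
qed

lemma hom_finsum:
  assumes "module R N" "f \<in> module_hom R M N" "\<And>i. i \<in> I \<Longrightarrow> g i \<in> carrier M"
  shows "f (\<Oplus>\<^bsub>M\<^esub>i\<in>I. g i) = (\<Oplus>\<^bsub>N\<^esub>i\<in>I. f (g i))"
proof -
  interpret N: modl R N by (rule modl.intro) fact
  note f = module_homD[OF assms(2)]
  show ?thesis using assms(3)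
  proof (induction I rule: infinite_finite_induct)
    case (insert x F)
    then show ?case using f(1) by (simp add: f Pi_def)
  qed (auto simp: hom_zero[OF assms(1,2)])
qed

lemma hom_image_submodule:
  assumes "module R N" "f \<in> module_hom R M N" "submodule H R M"
  shows "submodule (f ` H) R N"
proof -
  interpret N: modl R N by (rule modl.intro) fact
  note f = module_homD[OF assms(2)]
  note H = sub_in[OF assms(3)] sub_closed[OF assms(3)]
  show ?thesis
  proof (rule N.submoduleI, goal_cases)
    case 1 then show ?case using f H by auto
  next
    case 2 then show ?case using H hom_zero[OF assms(1,2)] by (metis imageI)
  next
    case (3 a) then show ?case using H hom_neg[OF assms(1,2)] by (metis (no_types, lifting) imageE imageI)
  next
    case (4 a b) then show ?case using H f(2) by (smt (verit) imageE imageI)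
  next
    case (5 a x) then show ?case using H f(3) by (smt (verit) imageE imageI)
  qed
qed

text \<open>The equalizer of two homomorphisms is a submodule; once it contains the generators it is
  everything.\<close>

lemma hom_eq_on_span:
  assumes "module R N" "f \<in> module_hom R M N" "g \<in> module_hom R M N"
    and "A \<subseteq> carrier M" "submodule_span R M A = carrier M" "\<And>x. x \<in> A \<Longrightarrow> f x = g x" "x \<in> carrier M"
  shows "f x = g x"
proof -
  interpret N: modl R N by (rule modl.intro) fact
  note f = module_homD[OF assms(2)] and g = module_homD[OF assms(3)]
  have "submodule {x \<in> carrier M. f x = g x} R M"
    by (rule submoduleI) (auto simp: f g hom_zero[OF assms(1,2)] hom_zero[OF assms(1,3)]
        hom_neg[OF assms(1,2)] hom_neg[OF assms(1,3)])
  then have "submodule_span R M A \<subseteq> {x \<in> carrier M. f x = g x}"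
    using assms by (intro span_least) auto
  then show ?thesis using assms by auto
qed

end

lemma self_module_simps [simp]:
  "carrier (self_module R) = carrier R" "\<zero>\<^bsub>self_module R\<^esub> = \<zero>\<^bsub>R\<^esub>"
  "x \<oplus>\<^bsub>self_module R\<^esub> y = x \<oplus>\<^bsub>R\<^esub> y" "a \<odot>\<^bsub>self_module R\<^esub> y = a \<otimes>\<^bsub>R\<^esub> y"
  by (auto simp: self_module_def)

lemma abelian_groupI':
  fixes G (structure)
  assumes "\<And>x y. x \<in> carrier G \<Longrightarrow> y \<in> carrier G \<Longrightarrow> x \<oplus> y \<in> carrier G"
    and "\<zero> \<in> carrier G"
    and "\<And>x y z. x \<in> carrier G \<Longrightarrow> y \<in> carrier G \<Longrightarrow> z \<in> carrier G \<Longrightarrow> (x \<oplus> y) \<oplus> z = x \<oplus> (y \<oplus> z)"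
    and "\<And>x y. x \<in> carrier G \<Longrightarrow> y \<in> carrier G \<Longrightarrow> x \<oplus> y = y \<oplus> x"
    and "\<And>x. x \<in> carrier G \<Longrightarrow> \<zero> \<oplus> x = x"
    and "\<And>x. x \<in> carrier G \<Longrightarrow> \<exists>y\<in>carrier G. y \<oplus> x = \<zero>"
  shows "abelian_group G"
  using assms by (intro abelian_groupI) auto

lemma self_module_module:
  fixes R (structure)
  assumes "cring R" shows "module R (self_module R)"
proof -
  interpret cring R by fact
  show ?thesis
    by (intro moduleI abelian_groupI' assms)
      (auto simp: a_ac m_ac l_distr r_distr intro: bexI[of _ "\<ominus> _"] l_neg)
qed

lemma self_module_finsum:
  assumes "cring R" "\<And>i. i \<in> I \<Longrightarrow> f i \<in> carrier R"
  shows "(\<Oplus>\<^bsub>self_module R\<^esub>i\<in>I. f i) = (\<Oplus>\<^bsub>R\<^esub>i\<in>I. f i)"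
proof -
  interpret cring R by fact
  interpret S: modl R "self_module R" by (rule modl.intro[OF self_module_module[OF assms(1)]])
  show ?thesis using assms(2)
    by (induction I rule: infinite_finite_induct) (auto simp: Pi_def)
qed

lemma ideal_iff_submodule:
  fixes R (structure)
  assumes "cring R"
  shows "ideal I R \<longleftrightarrow> submodule I R (self_module R)"
proof -
  interpret cring R by fact
  interpret S: modl R "self_module R" by (rule modl.intro[OF self_module_module[OF assms(1)]])
  show ?thesis
  proof
    assume "ideal I R"
    then interpret I: ideal I R .
    show "submodule I R (self_module R)"
    proof (rule S.submoduleI)
      fix a assume "a \<in> I"
      then have "\<ominus>\<^bsub>self_module R\<^esub> a = \<ominus> a"
        by (intro S.minus_equality) (auto simp: l_neg)
      then show "\<ominus>\<^bsub>self_module R\<^esub> a \<in> I" using \<open>a \<in> I\<close> by simp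
    qed (auto simp: I.I_l_closed)
  next
    assume H: "submodule I R (self_module R)"
    note S = S.sub_in[OF H, simplified] S.sub_closed[OF H, simplified]
    show "ideal I R"
    proof (rule idealI)
      show "ring R" by (rule ring_axioms)
      show "subgroup I (add_monoid R)"
      proof (rule add.subgroupI)
        fix a assume "a \<in> I"
        then have "\<ominus> a = (\<ominus> \<one>) \<otimes> a" using S(1) by (simp add: l_minus)
        then show "\<ominus> a \<in> I" using S \<open>a \<in> I\<close> by simp
      qed (use S in auto)
      fix a x assume "a \<in> I" "x \<in> carrier R"
      then show "x \<otimes> a \<in> I" "a \<otimes> x \<in> I" using S(1)[of a] S(4)[of x a] by (simp_all add: m_comm)
    qed
  qed
qed

section \<open>Chain conditions\<close>

text \<open>The chain condition is confined to submodules below K inside one ambient module, so that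
  the induction over generators needs neither submodules as modules of their own nor
  quotients.\<close>

definition acc_below where
  "acc_below R M K \<longleftrightarrow> (\<forall>S :: nat \<Rightarrow> 'm set.
     (\<forall>n. submodule (S n) R (M :: ('a, 'm) module) \<and> S n \<subseteq> K \<and> S n \<subseteq> S (Suc n)) \<longrightarrow> (\<exists>n. \<forall>k\<ge>n. S k = S n))"

lemma acc_below_mono: "acc_below R M K \<Longrightarrow> K' \<subseteq> K \<Longrightarrow> acc_below R M K'"
  unfolding acc_below_def by (meson subset_trans)

context modl
begin

text \<open>Hilbert's argument: a submodule of K + Ry is controlled by its part in K and by the
  ideal of coefficients of y that occur in it. Along a chain the first stabilizes by
  \<open>acc\<close>, the second because R is Noetherian.\<close>

lemma acc_below_adjoin:
  assumes noeth: "noetherian_ring R" and K: "submodule K R M" and y: "y \<in> carrier M" and acc: "acc_below R M K"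
  shows "acc_below R M {k \<oplus>\<^bsub>M\<^esub> r \<odot>\<^bsub>M\<^esub> y | k r. k \<in> K \<and> r \<in> carrier R}"
  unfolding acc_below_def
proof (intro allI impI)
  interpret NR: noetherian_ring R by fact
  fix S
  assume *: "\<forall>n. submodule (S n) R M \<and> S n \<subseteq> {k \<oplus>\<^bsub>M\<^esub> r \<odot>\<^bsub>M\<^esub> y |k r. k \<in> K \<and> r \<in> carrier R} \<and> S n \<subseteq> S (Suc n)"
  have sub: "submodule (S n) R M" for n using * by blast
  note SD = sub_in[OF sub] sub_closed[OF sub]
  note KD = sub_in[OF K] sub_closed[OF K]
  have mono: "S n \<subseteq> S m" if "n \<le> m" for n m
    using * lift_Suc_mono_le[of S, OF _ that] by auto
  define I where "I n = {r \<in> carrier R. \<exists>k\<in>K. k \<oplus>\<^bsub>M\<^esub> r \<odot>\<^bsub>M\<^esub> y \<in> S n}" for n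
  have I: "ideal (I n) R" for n
    unfolding ideal_iff_submodule[OF R.is_cring]
  proof -
    interpret S: modl R "self_module R" by (rule modl.intro[OF self_module_module[OF R.is_cring]])
    have a: "a \<otimes> r \<in> I n" if ar: "a \<in> carrier R" "r \<in> I n" for a r n
    proof -
      obtain k where k: "k \<in> K" "k \<oplus>\<^bsub>M\<^esub> r \<odot>\<^bsub>M\<^esub> y \<in> S n" "r \<in> carrier R" using ar unfolding I_def by blast
      have "a \<odot>\<^bsub>M\<^esub> (k \<oplus>\<^bsub>M\<^esub> r \<odot>\<^bsub>M\<^esub> y) \<in> S n" using SD that k by blast
      then have "a \<odot>\<^bsub>M\<^esub> k \<oplus>\<^bsub>M\<^esub> (a \<otimes> r) \<odot>\<^bsub>M\<^esub> y \<in> S n"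
        using KD that k y by (simp add: smult_r_distr smult_assoc1)
      then show ?thesis unfolding I_def using KD that k by blast
    qed
    show "submodule (I n) R (self_module R)"
    proof (rule S.submoduleI, goal_cases)
      case 2
      show ?case unfolding I_def using SD KD y
        by (auto intro!: bexI[of _ "\<zero>\<^bsub>M\<^esub>"])
    next
      case (3 r)
      then have "\<ominus> \<one> \<otimes> r \<in> I n" using a by simp
      moreover have "\<ominus>\<^bsub>self_module R\<^esub> r = \<ominus> \<one> \<otimes> r"
        using 3 by (intro S.minus_equality) (auto simp: I_def R.l_neg R.l_minus)
      ultimately show ?case by simp
    next
      case (4 r r')
      then obtain k k' where k: "k \<in> K" "k \<oplus>\<^bsub>M\<^esub> r \<odot>\<^bsub>M\<^esub> y \<in> S n" "r \<in> carrier R"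
        "k' \<in> K" "k' \<oplus>\<^bsub>M\<^esub> r' \<odot>\<^bsub>M\<^esub> y \<in> S n" "r' \<in> carrier R" by (auto simp: I_def)
      have "(k \<oplus>\<^bsub>M\<^esub> r \<odot>\<^bsub>M\<^esub> y) \<oplus>\<^bsub>M\<^esub> (k' \<oplus>\<^bsub>M\<^esub> r' \<odot>\<^bsub>M\<^esub> y) \<in> S n" using SD k by blast
      moreover have "(k \<oplus>\<^bsub>M\<^esub> r \<odot>\<^bsub>M\<^esub> y) \<oplus>\<^bsub>M\<^esub> (k' \<oplus>\<^bsub>M\<^esub> r' \<odot>\<^bsub>M\<^esub> y) = (k \<oplus>\<^bsub>M\<^esub> k') \<oplus>\<^bsub>M\<^esub> (r \<oplus> r') \<odot>\<^bsub>M\<^esub> y"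
        using KD k y by (simp add: smult_l_distr M.a_ac)
      ultimately show ?case unfolding I_def using KD k by auto
    next
      case (5 a r) then show ?case using a by simp
    qed (auto simp: I_def)
  qed
  have Imono: "I n \<subseteq> I m" if "n \<le> m" for n m
    using mono[OF that] by (auto simp: I_def)
  have "I i \<subseteq> I j \<or> I j \<subseteq> I i" for i j by (meson Imono nat_le_linear)
  then have "subset.chain {I. ideal I R} (range I)"
    using I unfolding pred_on.chain_def by blast
  then have "\<Union>(range I) \<in> range I"
    using NR.ideal_chain_is_trivial[of "range I"] by auto
  then obtain n1 where n1: "\<Union>(range I) = I n1" by auto
  have "\<exists>n. \<forall>k\<ge>n. S k \<inter> K = S n \<inter> K"
  proof -
    have "submodule (S n \<inter> K) R M" for n
      by (rule submoduleI) (use SD KD in auto)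
    then show ?thesis using acc * unfolding acc_below_def
      by (elim allE[of _ "\<lambda>n. S n \<inter> K"]) auto
  qed
  then obtain n2 where n2: "\<And>k. k \<ge> n2 \<Longrightarrow> S k \<inter> K = S n2 \<inter> K" by blast
  define n where "n = max n1 n2"
  have "S k = S n" if "k \<ge> n" for k
  proof
    show "S n \<subseteq> S k" using mono[OF that] .
    show "S k \<subseteq> S n"
    proof
      fix h assume h: "h \<in> S k"
      then obtain l r where lr: "h = l \<oplus>\<^bsub>M\<^esub> r \<odot>\<^bsub>M\<^esub> y" "l \<in> K" "r \<in> carrier R" using * by blast
      then have "r \<in> I k" using h by (auto simp: I_def)
      then have "r \<in> I n" using n1 Imono[of n1 n] by (auto simp: n_def)
      then obtain l' where l': "l' \<in> K" "l' \<oplus>\<^bsub>M\<^esub> r \<odot>\<^bsub>M\<^esub> y \<in> S n" by (auto simp: I_def)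
      let ?h' = "l' \<oplus>\<^bsub>M\<^esub> r \<odot>\<^bsub>M\<^esub> y"
      let ?t = "r \<odot>\<^bsub>M\<^esub> y"
      have c: "l \<in> carrier M" "l' \<in> carrier M" "?t \<in> carrier M" using lr l' KD y by auto
      \<comment> \<open>Equal coefficients of y cancel, so the difference lies in
        \<open>S k \<inter> K\<close>, which has already stabilized.\<close>
      have "h \<ominus>\<^bsub>M\<^esub> ?h' = (l \<oplus>\<^bsub>M\<^esub> ?t) \<oplus>\<^bsub>M\<^esub> (\<ominus>\<^bsub>M\<^esub> l' \<oplus>\<^bsub>M\<^esub> \<ominus>\<^bsub>M\<^esub> ?t)"
        using c lr(1) by (simp add: M.minus_eq M.minus_add)
      also have "\<dots> = (l \<oplus>\<^bsub>M\<^esub> \<ominus>\<^bsub>M\<^esub> l') \<oplus>\<^bsub>M\<^esub> (?t \<oplus>\<^bsub>M\<^esub> \<ominus>\<^bsub>M\<^esub> ?t)"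
        using c by (simp only: M.a_ac M.a_inv_closed M.a_closed)
      finally have e: "h \<ominus>\<^bsub>M\<^esub> ?h' = l \<ominus>\<^bsub>M\<^esub> l'"
        using c by (simp add: M.minus_eq M.r_neg)
      have "h \<ominus>\<^bsub>M\<^esub> ?h' \<in> S k" using sub_minus[OF sub h, of ?h'] l' mono[OF that] by blast
      moreover have "l \<ominus>\<^bsub>M\<^esub> l' \<in> K" by (rule sub_minus[OF K lr(2) l'(1)])
      ultimately have "h \<ominus>\<^bsub>M\<^esub> ?h' \<in> S k \<inter> K" using e by simp
      then have "h \<ominus>\<^bsub>M\<^esub> ?h' \<in> S n" using n2[of k] n2[of n] that by (auto simp: n_def)
      then have "(h \<ominus>\<^bsub>M\<^esub> ?h') \<oplus>\<^bsub>M\<^esub> ?h' \<in> S n" by (rule submoduleE(5)[OF sub _ l'(2)])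
      moreover have "(h \<ominus>\<^bsub>M\<^esub> ?h') \<oplus>\<^bsub>M\<^esub> ?h' = h"
        using SD(1)[OF h] SD(1)[OF l'(2)] by (simp add: M.minus_eq M.a_assoc M.l_neg)
      ultimately show "h \<in> S n" by simp
    qed
  qed
  then show "\<exists>n. \<forall>k\<ge>n. S k = S n" by blast
qed

lemma fg_acc_below:
  assumes "noetherian_ring R" "fg_module R M"
  shows "acc_below R M (carrier M)"
proof -
  obtain A where A: "finite A" "A \<subseteq> carrier M" "submodule_span R M A = carrier M"
    using assms unfolding fg_module_def by auto
  have "acc_below R M (submodule_span R M A)" using A(1,2)
  proof (induction A)
    case empty
    show ?case unfolding span_empty acc_below_def
      by (metis sub_zero subset_singletonD empty_iff order_refl)
  next
    case (insert y A)
    let ?K = "submodule_span R M A"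
    have K: "submodule ?K R M" "y \<in> carrier M" using insert by (auto intro: span_submodule)
    have "submodule_span R M (insert y A) \<subseteq> {k \<oplus>\<^bsub>M\<^esub> r \<odot>\<^bsub>M\<^esub> y | k r. k \<in> ?K \<and> r \<in> carrier R}"
      using adjoin_superset[OF K] span_superset[of A]
      by (intro span_least adjoin_submodule K) blast
    then show ?case
      using acc_below_adjoin[OF assms(1) K] insert acc_below_mono by blast
  qed
  then show ?thesis using A by simp
qed

text \<open>A family without a maximal member would give, by iterating a choice of strictly larger
  members, a chain that never stops. All maximality arguments below rest on this: associated primes,
  residue field quotients, primes avoiding a multiplicative set.\<close>

lemma fg_maximal_submodule:
  assumes "noetherian_ring R" "fg_module R M"
    and "\<F> \<noteq> {}" "\<And>H. H \<in> \<F> \<Longrightarrow> submodule H R M"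
  obtains H where "H \<in> \<F>" "\<And>K. K \<in> \<F> \<Longrightarrow> H \<subseteq> K \<Longrightarrow> K = H"
proof (rule ccontr)
  assume "\<not> thesis"
  then have "\<forall>H\<in>\<F>. \<exists>K. K \<in> \<F> \<and> H \<subset> K" using that by blast
  then obtain s where s: "\<And>H. H \<in> \<F> \<Longrightarrow> s H \<in> \<F> \<and> H \<subset> s H" by metis
  obtain H0 where H0: "H0 \<in> \<F>" using assms by auto
  define S where "S n = (s ^^ n) H0" for n
  have S: "S n \<in> \<F>" for n by (induction n) (auto simp: S_def H0 s)
  have "S n \<subset> S (Suc n)" for n using s[OF S[of n]] by (simp add: S_def)
  moreover have "\<exists>n. \<forall>k\<ge>n. S k = S n"
    using fg_acc_below[OF assms(1,2)] unfolding acc_below_def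
    using S assms(4) calculation sub_in by (metis psubset_imp_subset subsetI)
  ultimately show False by (metis le_SucI order_refl psubset_eq)
qed

end

lemma self_module_fg:
  fixes R (structure)
  assumes "cring R" shows "fg_module R (self_module R)"
proof -
  interpret cring R by fact
  interpret S: modl R "self_module R" by (rule modl.intro[OF self_module_module[OF assms(1)]])
  have "x \<in> submodule_span R (self_module R) {\<one>}" if "x \<in> carrier R" for x
  proof -
    have "x \<odot>\<^bsub>self_module R\<^esub> \<one> \<in> submodule_span R (self_module R) {\<one>}"
      using S.submoduleE(4)[OF S.span_submodule[of "{\<one>}"], of x \<one>] S.span_superset[of "{\<one>}"] that by simp
    then show ?thesis using that by (simp add: self_module_simps)
  qed
  then have "submodule_span R (self_module R) {\<one>} = carrier (self_module R)"
    using S.sub_in[OF S.span_submodule[of "{\<one>}"]] by auto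
  then show ?thesis unfolding fg_module_def using S.module_axioms by (auto intro!: exI[of _ "{\<one>}"])
qed

lemma noetherian_maximal_ideal:
  assumes "cring R" "noetherian_ring R" "\<F> \<noteq> {}" "\<And>I. I \<in> \<F> \<Longrightarrow> ideal I R"
  obtains I where "I \<in> \<F>" "\<And>J. J \<in> \<F> \<Longrightarrow> I \<subseteq> J \<Longrightarrow> J = I"
  using modl.fg_maximal_submodule[OF modl.intro, OF self_module_module[OF assms(1)] assms(2) self_module_fg[OF assms(1)] assms(3)]
    assms(4) ideal_iff_submodule[OF assms(1)] by metis

section \<open>Saturated submodules and depth at a prime\<close>

text \<open>
  Instead of passing to the localization at a prime \<open>q\<close>, all computations are made with
  \<open>q\<close>-saturated submodules of the original module; they correspond to the submodules of the localization.
\<close>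

definition satur :: "('a, 'r) ring_scheme \<Rightarrow> 'a set \<Rightarrow> ('a, 'm) module \<Rightarrow> 'm set \<Rightarrow> 'm set" where
  "satur R q M K = {m \<in> carrier M. \<exists>s\<in>carrier R - q. s \<odot>\<^bsub>M\<^esub> m \<in> K}"

definition saturated_submodule :: "('a, 'r) ring_scheme \<Rightarrow> 'a set \<Rightarrow> ('a, 'm) module \<Rightarrow> 'm set \<Rightarrow> bool" where
  "saturated_submodule R q M H \<longleftrightarrow> submodule H R M \<and>
     (\<forall>m\<in>carrier M. \<forall>s\<in>carrier R - q. s \<odot>\<^bsub>M\<^esub> m \<in> H \<longrightarrow> m \<in> H)"

text \<open>x is a nonzerodivisor on M/H. If H is all of M, this holds for every x, even for
  zero.\<close>

definition regular_mod :: "('a, 'm) module \<Rightarrow> 'a \<Rightarrow> 'm set \<Rightarrow> bool" where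
  "regular_mod M x H \<longleftrightarrow> (\<forall>m\<in>carrier M. x \<odot>\<^bsub>M\<^esub> m \<in> H \<longrightarrow> m \<in> H)"

text \<open>The submodule of M that corresponds to \<open>H_q + x M_q\<close>: replacing H by it
  divides the module \<open>M_q/H_q\<close> by x.\<close>

definition quot_step :: "('a, 'r) ring_scheme \<Rightarrow> 'a set \<Rightarrow> ('a, 'm) module \<Rightarrow> 'm set \<Rightarrow> 'a \<Rightarrow> 'm set" where
  "quot_step R q M H x = satur R q M {h \<oplus>\<^bsub>M\<^esub> k | h k. h \<in> H \<and> k \<in> {x \<odot>\<^bsub>M\<^esub> m | m. m \<in> carrier M}}"

text \<open>Depth of \<open>M_q/H_q\<close> at least k, by recursion along a regular sequence in q.
  That the successive quotients are nonzero is not part of the recursion: for a proper saturated H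
  it follows from Nakayama's lemma, and if H is all of M every depth is reached, in accordance with
  depth(0) = infinity.\<close>

primrec depth_ge :: "('a, 'r) ring_scheme \<Rightarrow> 'a set \<Rightarrow> ('a, 'm) module \<Rightarrow> nat \<Rightarrow> 'm set \<Rightarrow> bool" where
  "depth_ge R q M 0 H \<longleftrightarrow> True"
| "depth_ge R q M (Suc k) H \<longleftrightarrow> (\<exists>x\<in>q. regular_mod M x H \<and> depth_ge R q M k (quot_step R q M H x))"

text \<open>Vanishing of Hom(R/q, M/H), the socle of M/H with respect to q.\<close>

definition socle_free :: "'a set \<Rightarrow> ('a, 'm) module \<Rightarrow> 'm set \<Rightarrow> bool" where
  "socle_free q M H \<longleftrightarrow> (\<forall>m\<in>carrier M. (\<forall>r\<in>q. r \<odot>\<^bsub>M\<^esub> m \<in> H) \<longrightarrow> m \<in> H)"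

definition mod_cong :: "('a, 'm) module \<Rightarrow> 'm set \<Rightarrow> 'm \<Rightarrow> 'm \<Rightarrow> bool" where
  "mod_cong M H a b \<longleftrightarrow> a \<in> carrier M \<and> b \<in> carrier M \<and> a \<ominus>\<^bsub>M\<^esub> b \<in> H"

text \<open>The colon ideal (H : y), the annihilator of the class of y in M/H.\<close>

definition ann_mod :: "('a, 'r) ring_scheme \<Rightarrow> ('a, 'm) module \<Rightarrow> 'm set \<Rightarrow> 'm \<Rightarrow> 'a set" where
  "ann_mod R M H y = {r \<in> carrier R. r \<odot>\<^bsub>M\<^esub> y \<in> H}"

lemma satur_submoduleD:
  assumes "saturated_submodule R q M H"
  shows "submodule H R M" and "m \<in> carrier M \<Longrightarrow> s \<in> carrier R - q \<Longrightarrow> s \<odot>\<^bsub>M\<^esub> m \<in> H \<Longrightarrow> m \<in> H"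
  using assms by (auto simp: saturated_submodule_def)

context modl
begin

lemma cong_refl: "submodule H R M \<Longrightarrow> a \<in> carrier M \<Longrightarrow> mod_cong M H a a"
  by (simp add: mod_cong_def M.minus_eq M.r_neg sub_zero)

lemma cong_sym:
  assumes "submodule H R M" "mod_cong M H a b" shows "mod_cong M H b a"
proof -
  have "\<ominus>\<^bsub>M\<^esub> (a \<ominus>\<^bsub>M\<^esub> b) \<in> H" using assms submoduleE(3) by (auto simp: mod_cong_def)
  moreover have "\<ominus>\<^bsub>M\<^esub> (a \<ominus>\<^bsub>M\<^esub> b) = b \<ominus>\<^bsub>M\<^esub> a"
    using assms by (simp add: mod_cong_def M.minus_eq M.minus_add M.a_comm)
  ultimately show ?thesis using assms by (simp add: mod_cong_def)
qed

lemma cong_trans: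
  assumes "mod_cong M H a b" "mod_cong M H b c" "submodule H R M" shows "mod_cong M H a c"
proof -
  have "(a \<ominus>\<^bsub>M\<^esub> b) \<oplus>\<^bsub>M\<^esub> (b \<ominus>\<^bsub>M\<^esub> c) \<in> H" using assms submoduleE(5)[OF assms(3)] by (auto simp: mod_cong_def)
  moreover have "(a \<ominus>\<^bsub>M\<^esub> b) \<oplus>\<^bsub>M\<^esub> (b \<ominus>\<^bsub>M\<^esub> c) = a \<ominus>\<^bsub>M\<^esub> c"
    using assms by (simp add: mod_cong_def M.minus_eq M.a_assoc M.r_neg1)
  ultimately show ?thesis using assms by (simp add: mod_cong_def)
qed

lemma cong_smult:
  assumes "submodule H R M" "mod_cong M H a b" "r \<in> carrier R" shows "mod_cong M H (r \<odot>\<^bsub>M\<^esub> a) (r \<odot>\<^bsub>M\<^esub> b)"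
proof -
  have "r \<odot>\<^bsub>M\<^esub> (a \<ominus>\<^bsub>M\<^esub> b) \<in> H" using assms submoduleE(4)[OF assms(1)] by (auto simp: mod_cong_def)
  moreover have "r \<odot>\<^bsub>M\<^esub> (a \<ominus>\<^bsub>M\<^esub> b) = r \<odot>\<^bsub>M\<^esub> a \<ominus>\<^bsub>M\<^esub> r \<odot>\<^bsub>M\<^esub> b"
    using assms by (simp add: mod_cong_def M.minus_eq smult_r_distr smult_r_minus)
  ultimately show ?thesis using assms by (simp add: mod_cong_def)
qed

lemma cong_add:
  assumes "submodule H R M" "mod_cong M H a b" "mod_cong M H c d"
  shows "mod_cong M H (a \<oplus>\<^bsub>M\<^esub> c) (b \<oplus>\<^bsub>M\<^esub> d)"
proof -
  have "(a \<ominus>\<^bsub>M\<^esub> b) \<oplus>\<^bsub>M\<^esub> (c \<ominus>\<^bsub>M\<^esub> d) \<in> H" using assms submoduleE(5)[OF assms(1)] by (auto simp: mod_cong_def)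
  moreover have "(a \<ominus>\<^bsub>M\<^esub> b) \<oplus>\<^bsub>M\<^esub> (c \<ominus>\<^bsub>M\<^esub> d) = (a \<oplus>\<^bsub>M\<^esub> c) \<ominus>\<^bsub>M\<^esub> (b \<oplus>\<^bsub>M\<^esub> d)"
    using assms by (simp add: mod_cong_def M.minus_eq M.minus_add M.a_ac)
  ultimately show ?thesis using assms by (simp add: mod_cong_def)
qed

lemma cong_in_iff:
  assumes "submodule H R M" "mod_cong M H a b" shows "a \<in> H \<longleftrightarrow> b \<in> H"
proof -
  have *: "a \<in> H" if "b \<in> H" "mod_cong M H a b" for a b
  proof -
    have "(a \<ominus>\<^bsub>M\<^esub> b) \<oplus>\<^bsub>M\<^esub> b \<in> H" using that submoduleE(5)[OF assms(1)] by (auto simp: mod_cong_def)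
    moreover have "(a \<ominus>\<^bsub>M\<^esub> b) \<oplus>\<^bsub>M\<^esub> b = a" using that by (simp add: mod_cong_def M.minus_eq M.a_assoc M.l_neg)
    ultimately show ?thesis by simp
  qed
  then show ?thesis using cong_sym[OF assms] assms by blast
qed

lemma neg_zero: "\<ominus>\<^bsub>M\<^esub> \<zero>\<^bsub>M\<^esub> = \<zero>\<^bsub>M\<^esub>"
  by (rule M.minus_equality) simp_all

lemma cong_zero_iff: "submodule H R M \<Longrightarrow> mod_cong M H a \<zero>\<^bsub>M\<^esub> \<longleftrightarrow> a \<in> H"
  using sub_in by (auto simp: mod_cong_def M.minus_eq neg_zero)

lemma cong_of_sum:
  assumes "submodule H R M" "a = h \<oplus>\<^bsub>M\<^esub> b" "h \<in> H" "b \<in> carrier M"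
  shows "mod_cong M H a b"
  using assms sub_in[OF assms(1,3)] by (simp add: mod_cong_def M.minus_eq M.a_assoc M.r_neg)

lemma cong_diff:
  assumes "mod_cong M H a b"
  shows "a = (a \<ominus>\<^bsub>M\<^esub> b) \<oplus>\<^bsub>M\<^esub> b" "a \<ominus>\<^bsub>M\<^esub> b \<in> H"
  using assms by (auto simp: mod_cong_def M.minus_eq M.a_assoc M.l_neg)

lemma regular_mod_cong:
  assumes "submodule H R M" "regular_mod M x H" "x \<in> carrier R" "a \<in> carrier M" "b \<in> carrier M"
    and "mod_cong M H (x \<odot>\<^bsub>M\<^esub> a) (x \<odot>\<^bsub>M\<^esub> b)"
  shows "mod_cong M H a b"
proof -
  have "x \<odot>\<^bsub>M\<^esub> (a \<ominus>\<^bsub>M\<^esub> b) \<in> H"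
    using assms by (simp add: mod_cong_def M.minus_eq smult_r_distr smult_r_minus)
  then show ?thesis using assms by (auto simp: mod_cong_def regular_mod_def)
qed

lemma ann_mod_ideal:
  assumes "submodule H R M" "y \<in> carrier M" shows "ideal (ann_mod R M H y) R"
proof -
  interpret S: modl R "self_module R" by (rule modl.intro[OF self_module_module[OF R.is_cring]])
  have "(\<lambda>r. r \<odot>\<^bsub>M\<^esub> y) \<in> module_hom R (self_module R) M"
    using assms by (intro module_homI) (auto simp: smult_l_distr smult_assoc1)
  then have "submodule {r \<in> carrier (self_module R). r \<odot>\<^bsub>M\<^esub> y \<in> H} R (self_module R)"
    using S.module_hom_submodule_eq[OF module_axioms _ assms(1)] by blast
  then show ?thesis by (simp add: ideal_iff_submodule[OF R.is_cring] ann_mod_def)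
qed

end

subsection \<open>Associated primes and prime avoidance\<close>

text \<open>Multiply an element of J outside p by one element of each p' outside p; primality of p
  keeps the product outside p.\<close>

lemma avoid_product:
  fixes R (structure)
  assumes "cring R" "primeideal p R" "finite P" "\<And>p'. p' \<in> P \<Longrightarrow> ideal p' R \<and> \<not> p' \<subseteq> p" "ideal J R" "\<not> J \<subseteq> p"
  shows "\<exists>y\<in>J - p. \<forall>p'\<in>P. y \<in> p'"
  using assms(3,4)
proof (induction P)
  case empty then show ?case using assms by auto
next
  case (insert p' P)
  interpret cring R by fact
  interpret p: primeideal p R by fact
  interpret J: ideal J R by fact
  interpret p': ideal p' R using insert by auto
  obtain y where y: "y \<in> J" "y \<notin> p" "\<forall>p'\<in>P. y \<in> p'" using insert by auto
  obtain a where a: "a \<in> p'" "a \<notin> p" using insert by auto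
  have c: "y \<in> carrier R" "a \<in> carrier R" using y a by auto
  have "y \<otimes> a \<notin> p" using p.I_prime[OF c] y a by auto
  moreover have "y \<otimes> a \<in> J" using J.I_r_closed y c by auto
  moreover have "y \<otimes> a \<in> p'" using p'.I_l_closed a c by auto
  moreover have "y \<otimes> a \<in> p''" if "p'' \<in> P" for p''
    using ideal.I_r_closed[of p'' R y a] insert(4)[of p''] y that c by auto
  ultimately show ?case by blast
qed

lemma ideal_add_cancel:
  fixes R (structure)
  assumes "cring R" "ideal I R" "x \<in> I" "y \<in> carrier R" "x \<oplus> y \<in> I \<or> y \<oplus> x \<in> I"
  shows "y \<in> I"
proof -
  interpret cring R by fact
  have x: "x \<in> carrier R" using ideal.Icarr[OF assms(2,3)] .
  have m: "\<ominus> x \<in> I" using additive_subgroup.a_inv_closed[OF ideal.axioms(1)[OF assms(2)] assms(3)] .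
  have "x \<oplus> y \<in> I" using assms(4,5) x a_comm by auto
  then have "\<ominus> x \<oplus> (x \<oplus> y) \<in> I" by (rule additive_subgroup.a_closed[OF ideal.axioms(1)[OF assms(2)] m])
  then show ?thesis using x assms(4) by (simp add: r_neg1)
qed

text \<open>Induction on the number of primes. With p removed, some x in J avoids the others; if x
  lies in p, it is corrected by adding some y in J that lies in all the others but not in p.\<close>

lemma prime_avoidance:
  fixes R (structure)
  assumes "cring R" "finite P" "\<And>p. p \<in> P \<Longrightarrow> primeideal p R \<and> \<not> J \<subseteq> p" "ideal J R"
  shows "\<exists>x\<in>J. \<forall>p\<in>P. x \<notin> p"
  using assms(2,3)
proof (induction "card P" arbitrary: P)
  case 0
  have "P = {}" using 0 by simp
  then have "\<forall>p\<in>P. \<zero> \<notin> p" by simp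
  then show ?case by (rule bexI[OF _ additive_subgroup.zero_closed[OF ideal.axioms(1)[OF assms(4)]]])
next
  case (Suc n)
  have "P \<noteq> {}" using Suc by auto
  \<comment> \<open>A prime minimal under inclusion is removed, since then none of the remaining
    ones is contained in it, as \<open>avoid_product\<close> requires.\<close>
  then obtain p where p: "p \<in> P" "\<And>p'. p' \<in> P \<Longrightarrow> p' \<subseteq> p \<Longrightarrow> p = p'"
    using finite_has_minimal[OF Suc.prems(1)] by metis
  have prime: "primeideal p' R" if "p' \<in> P" for p' using Suc that by auto
  have "card (P - {p}) = n" using Suc p by auto
  then have "\<exists>x\<in>J. \<forall>p'\<in>P - {p}. x \<notin> p'"
    using Suc.hyps(1)[of "P - {p}"] Suc.prems by auto
  then obtain x where x: "x \<in> J" "\<And>p'. p' \<in> P - {p} \<Longrightarrow> x \<notin> p'" by auto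
  show ?case
  proof (cases "x \<in> p")
    case False then show ?thesis using x by auto
  next
    case True
    have "\<exists>y\<in>J - p. \<forall>p'\<in>P - {p}. y \<in> p'"
    proof (rule avoid_product[OF assms(1) prime[OF p(1)]])
      show "finite (P - {p})" using Suc.prems(1) by simp
      show "ideal J R" by (rule assms(4))
      show "\<not> J \<subseteq> p" using Suc.prems(2)[OF p(1)] by simp
      fix p' assume p': "p' \<in> P - {p}"
      then have "ideal p' R" using primeideal.axioms(1)[OF prime, of p'] by simp
      moreover have "\<not> p' \<subseteq> p" using p(2)[of p'] p' by auto
      ultimately show "ideal p' R \<and> \<not> p' \<subseteq> p" by simp
    qed
    then obtain y where y: "y \<in> J" "y \<notin> p" "\<And>p'. p' \<in> P - {p} \<Longrightarrow> y \<in> p'" by auto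
    have xy: "x \<in> carrier R" "y \<in> carrier R" using x(1) y(1) ideal.Icarr[OF assms(4)] by auto
    have "x \<oplus> y \<notin> p'" if p': "p' \<in> P" for p'
    proof
      assume *: "x \<oplus> y \<in> p'"
      note id = primeideal.axioms(1)[OF prime[OF p']]
      show False
      proof (cases "p' = p")
        case t: True
        then show False using ideal_add_cancel[OF assms(1) id, of x y] True xy y * by auto
      next
        case False
        then show False using ideal_add_cancel[OF assms(1) id, of y x] x y p' xy * by auto
      qed
    qed
    moreover have "x \<oplus> y \<in> J"
      by (rule additive_subgroup.a_closed[OF ideal.axioms(1)[OF assms(4)] x(1) y(1)])
    ultimately show ?thesis by auto
  qed
qed

locale noeth_modl = modl +
  assumes noeth: "noetherian_ring R" and fg: "fg_module R M"
begin

text \<open>An ideal maximal among the annihilators of nonzero multiples of the class of y is prime: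
  if ab kills cy but b does not, then bcy has the same annihilator by maximality, and a belongs to
  it.\<close>

lemma ex_assoc_prime:
  assumes "submodule H R M" "y \<in> carrier M" "y \<notin> H"
  shows "\<exists>c\<in>carrier R. primeideal (ann_mod R M H (c \<odot>\<^bsub>M\<^esub> y)) R"
proof -
  let ?F = "{ann_mod R M H (c \<odot>\<^bsub>M\<^esub> y) | c. c \<in> carrier R \<and> c \<odot>\<^bsub>M\<^esub> y \<notin> H}"
  have "ann_mod R M H (\<one> \<odot>\<^bsub>M\<^esub> y) \<in> ?F" using assms by force
  then have ne: "?F \<noteq> {}" by blast
  obtain I where I: "I \<in> ?F" "\<And>J. J \<in> ?F \<Longrightarrow> I \<subseteq> J \<Longrightarrow> J = I"
    by (rule noetherian_maximal_ideal[OF R.is_cring noeth ne])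
      (auto intro: ann_mod_ideal[OF assms(1)] assms)
  then obtain c where c: "I = ann_mod R M H (c \<odot>\<^bsub>M\<^esub> y)" "c \<in> carrier R" "c \<odot>\<^bsub>M\<^esub> y \<notin> H" by auto
  have "primeideal I R"
  proof (rule primeidealI)
    show "ideal I R" using c ann_mod_ideal assms by simp
    show "cring R" by (rule R.is_cring)
    show "carrier R \<noteq> I"
    proof
      assume "carrier R = I"
      then have "\<one> \<in> I" by auto
      then show False using c assms by (simp add: ann_mod_def)
    qed
  next
    fix a b assume ab: "a \<in> carrier R" "b \<in> carrier R" "a \<otimes> b \<in> I"
    show "a \<in> I \<or> b \<in> I"
    proof (cases "b \<in> I")
      case False
      have "I \<subseteq> ann_mod R M H ((b \<otimes> c) \<odot>\<^bsub>M\<^esub> y)"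
      proof
        fix r assume r: "r \<in> I"
        then have "b \<odot>\<^bsub>M\<^esub> (r \<odot>\<^bsub>M\<^esub> (c \<odot>\<^bsub>M\<^esub> y)) \<in> H" using submoduleE(4)[OF assms(1)] ab c by (auto simp: ann_mod_def)
        then show "r \<in> ann_mod R M H ((b \<otimes> c) \<odot>\<^bsub>M\<^esub> y)"
          using r ab c assms by (auto simp: ann_mod_def smult_assoc1 smult_commute)
      qed
      moreover have "(b \<otimes> c) \<odot>\<^bsub>M\<^esub> y \<notin> H" using False ab c assms by (auto simp: ann_mod_def smult_assoc1)
      moreover have "b \<otimes> c \<in> carrier R" using ab c by simp
      ultimately have "ann_mod R M H ((b \<otimes> c) \<odot>\<^bsub>M\<^esub> y) = I"
        by (intro I(2) CollectI exI[of _ "b \<otimes> c"] conjI) simp_all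
      moreover have "a \<in> ann_mod R M H ((b \<otimes> c) \<odot>\<^bsub>M\<^esub> y)"
        using ab c assms by (auto simp: ann_mod_def smult_assoc1)
      ultimately show ?thesis by simp
    qed simp
  qed
  then show ?thesis using c by blast
qed

lemma ann_mod_mono:
  assumes "submodule H R M" "y \<in> carrier M" "c \<in> carrier R"
  shows "ann_mod R M H y \<subseteq> ann_mod R M H (c \<odot>\<^bsub>M\<^esub> y)"
proof
  fix r assume r: "r \<in> ann_mod R M H y"
  then have "c \<odot>\<^bsub>M\<^esub> (r \<odot>\<^bsub>M\<^esub> y) \<in> H" using submoduleE(4)[OF assms(1)] assms by (auto simp: ann_mod_def)
  then show "r \<in> ann_mod R M H (c \<odot>\<^bsub>M\<^esub> y)"
    using r assms by (auto simp: ann_mod_def smult_commute)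
qed

text \<open>Noetherian induction in place of a prime filtration: K is maximal among the submodules
  above H whose elements contribute only finitely many associated primes of M/H. If K were proper,
  adjoining some y with (K : y) prime would add at most this one prime.\<close>

lemma finite_assoc_primes:
  assumes H: "submodule H R M"
  shows "\<exists>P. finite P \<and> (\<forall>y\<in>carrier M. primeideal (ann_mod R M H y) R \<longrightarrow> ann_mod R M H y \<in> P)"
proof -
  let ?good = "\<lambda>K. \<exists>P. finite P \<and> (\<forall>y\<in>K. primeideal (ann_mod R M H y) R \<longrightarrow> ann_mod R M H y \<in> P)"
  let ?F = "{K. submodule K R M \<and> H \<subseteq> K \<and> ?good K}"
  have np: "\<not> primeideal (ann_mod R M H y) R" if "y \<in> H" for y
  proof
    assume p: "primeideal (ann_mod R M H y) R"
    have "ann_mod R M H y = carrier R" using submoduleE(4)[OF H _ that] by (auto simp: ann_mod_def)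
    then show False using primeideal.I_notcarr[OF p] by simp
  qed
  have "H \<in> ?F" using H np by (auto intro!: exI[of _ "{}"])
  then have ne: "?F \<noteq> {}" by blast
  obtain K where K: "K \<in> ?F" "\<And>J. J \<in> ?F \<Longrightarrow> K \<subseteq> J \<Longrightarrow> J = K"
    by (rule fg_maximal_submodule[OF noeth fg ne]) blast+
  then obtain P where P: "finite P" "\<And>y. y \<in> K \<Longrightarrow> primeideal (ann_mod R M H y) R \<Longrightarrow> ann_mod R M H y \<in> P" by auto
  have Ks: "submodule K R M" "H \<subseteq> K" using K by auto
  have "K = carrier M"
  proof (rule ccontr)
    assume "K \<noteq> carrier M"
    then obtain y0 where y0: "y0 \<in> carrier M" "y0 \<notin> K" using sub_in[OF Ks(1)] by blast
    obtain c where c: "c \<in> carrier R" "primeideal (ann_mod R M K (c \<odot>\<^bsub>M\<^esub> y0)) R"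
      using ex_assoc_prime[OF Ks(1) y0] by blast
    define y where "y = c \<odot>\<^bsub>M\<^esub> y0"
    define p where "p = ann_mod R M K y"
    have y: "y \<in> carrier M" using c y0 by (simp add: y_def)
    have yK: "y \<notin> K"
    proof
      assume "y \<in> K"
      then have "p = carrier R" using submoduleE(4)[OF Ks(1)] by (auto simp: p_def ann_mod_def)
      moreover have "primeideal p R" using c by (simp add: y_def p_def)
      ultimately show False using primeideal.I_notcarr by metis
    qed
    have pp: "primeideal p R" using c by (simp add: y_def p_def)
    let ?K' = "{k \<oplus>\<^bsub>M\<^esub> r \<odot>\<^bsub>M\<^esub> y | k r. k \<in> K \<and> r \<in> carrier R}"
    have "ann_mod R M H z \<in> insert p P" if z: "z \<in> ?K'" and pr: "primeideal (ann_mod R M H z) R" for z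
    proof -
      obtain k r where kr: "z = k \<oplus>\<^bsub>M\<^esub> r \<odot>\<^bsub>M\<^esub> y" "k \<in> K" "r \<in> carrier R" using z by auto
      have kM: "k \<in> carrier M" using kr sub_in[OF Ks(1)] by auto
      have zM: "z \<in> carrier M" using kr kM y by auto
      show ?thesis
      \<comment> \<open>Either Rz meets K outside H, and then a multiple of z in K has the same
        prime annihilator as z; or multiples of z lie in H as soon as they lie in K, and then the
        annihilator of z is (K : y), because r is outside this prime.\<close>
      proof (cases "\<exists>c\<in>carrier R. c \<odot>\<^bsub>M\<^esub> z \<in> K \<and> c \<odot>\<^bsub>M\<^esub> z \<notin> H")
        case True
        then obtain c where c: "c \<in> carrier R" "c \<odot>\<^bsub>M\<^esub> z \<in> K" "c \<odot>\<^bsub>M\<^esub> z \<notin> H" by auto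
        have "ann_mod R M H (c \<odot>\<^bsub>M\<^esub> z) \<subseteq> ann_mod R M H z"
        proof
          fix r assume r: "r \<in> ann_mod R M H (c \<odot>\<^bsub>M\<^esub> z)"
          then have "r \<otimes> c \<in> ann_mod R M H z" using c zM by (auto simp: ann_mod_def smult_assoc1)
          then have "r \<in> ann_mod R M H z \<or> c \<in> ann_mod R M H z"
            using primeideal.I_prime[OF pr] r c by (auto simp: ann_mod_def)
          then show "r \<in> ann_mod R M H z" using c by (auto simp: ann_mod_def)
        qed
        then have e: "ann_mod R M H (c \<odot>\<^bsub>M\<^esub> z) = ann_mod R M H z"
          using ann_mod_mono[OF H zM c(1)] by blast
        then have "ann_mod R M H (c \<odot>\<^bsub>M\<^esub> z) \<in> P" using P(2)[OF c(2)] pr by simp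
        then show ?thesis using e by simp
      next
        case False
        have "z \<notin> H" using np pr by blast
        then have zK: "z \<notin> K" using False zM by (metis R.one_closed smult_one)
        have "r \<notin> p"
        proof
          assume "r \<in> p"
          then show False using zK kr submoduleE(5)[OF Ks(1)] by (auto simp: p_def ann_mod_def)
        qed
        have "c \<in> ann_mod R M H z \<longleftrightarrow> c \<in> p" if c: "c \<in> carrier R" for c
        proof -
          have "c \<odot>\<^bsub>M\<^esub> z \<in> H \<longleftrightarrow> c \<odot>\<^bsub>M\<^esub> z \<in> K" using False c Ks by blast
          moreover have e: "c \<odot>\<^bsub>M\<^esub> z = c \<odot>\<^bsub>M\<^esub> k \<oplus>\<^bsub>M\<^esub> (c \<otimes> r) \<odot>\<^bsub>M\<^esub> y"
            using c kr kM y by (simp add: smult_r_distr smult_assoc1)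
          moreover have "c \<odot>\<^bsub>M\<^esub> z \<in> K \<longleftrightarrow> (c \<otimes> r) \<odot>\<^bsub>M\<^esub> y \<in> K"
            unfolding e using sub_cancel[OF Ks(1)] submoduleE(4,5)[OF Ks(1)] c kr y by (metis R.m_closed smult_closed)
          moreover have "(c \<otimes> r) \<odot>\<^bsub>M\<^esub> y \<in> K \<longleftrightarrow> c \<otimes> r \<in> p" using c kr by (simp add: p_def ann_mod_def)
          moreover have "c \<otimes> r \<in> p \<longleftrightarrow> c \<in> p"
            using primeideal.I_prime[OF pp c kr(3)] \<open>r \<notin> p\<close> ideal.I_r_closed[OF primeideal.axioms(1)[OF pp]] kr(3) by auto
          ultimately show ?thesis using c by (simp add: ann_mod_def)
        qed
        then have "ann_mod R M H z = p" by (auto simp: ann_mod_def p_def)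
        then show ?thesis by simp
      qed
    qed
    then have "?good ?K'" using P by (intro exI[of _ "insert p P"]) auto
    moreover have "submodule ?K' R M" by (rule adjoin_submodule[OF Ks(1) y])
    moreover have "K \<subseteq> ?K'" "y \<in> ?K'" using adjoin_superset[OF Ks(1) y] by auto
    ultimately have "?K' = K" using K(2)[of ?K'] Ks by blast
    then show False using \<open>y \<in> ?K'\<close> yK by simp
  qed
  then show ?thesis using P by blast
qed

end

subsection \<open>Depth at a prime\<close>

locale prime_modl = noeth_modl R M + primeideal q R for q and R (structure) and M (structure)
begin

abbreviation "sat_sub \<equiv> saturated_submodule R q M"
abbreviation "step \<equiv> quot_step R q M"
abbreviation "dge \<equiv> depth_ge R q M"
abbreviation "cong \<equiv> mod_cong M"

lemma q_carrier: "x \<in> q \<Longrightarrow> x \<in> carrier R" by (rule a_Hcarr)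

lemma compl_mult: "s \<in> carrier R - q \<Longrightarrow> t \<in> carrier R - q \<Longrightarrow> s \<otimes> t \<in> carrier R - q"
  using I_prime by auto

lemma compl_one: "\<one> \<in> carrier R - q"
  using I_notcarr one_imp_carrier by auto

text \<open>The product of the individual denominators works, since the last assumption makes Q
  stable under enlarging a denominator.\<close>

lemma common_denominator:
  assumes "finite I" "\<And>i. i \<in> I \<Longrightarrow> \<exists>s\<in>carrier R - q. Q i s"
    and "\<And>i s t. i \<in> I \<Longrightarrow> s \<in> carrier R - q \<Longrightarrow> t \<in> carrier R - q \<Longrightarrow> Q i s \<Longrightarrow> Q i (t \<otimes> s)"
  shows "\<exists>s\<in>carrier R - q. \<forall>i\<in>I. Q i s"
  using assms
proof (induction I)
  case empty then show ?case using compl_one by auto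
next
  case (insert j I)
  then obtain s where s: "s \<in> carrier R - q" "\<And>i. i \<in> I \<Longrightarrow> Q i s" by (metis insertCI)
  obtain t where t: "t \<in> carrier R - q" "Q j t" using insert.prems(1)[of j] by blast
  have "Q i (s \<otimes> t)" if "i \<in> insert j I" for i
  proof (cases "i = j")
    case True then show ?thesis using insert.prems(2)[of j t s] s t by auto
  next
    case False
    then have "Q i (t \<otimes> s)" using insert.prems(2)[of i s t] s t that by auto
    then show ?thesis using m_comm s t by auto
  qed
  then show ?case using compl_mult s t by (intro bexI[of _ "s \<otimes> t"]) auto
qed

lemma satur_sat_sub:
  assumes K: "submodule K R M" shows "sat_sub (satur R q M K)"
proof -
  note KD = sub_in[OF K] sub_closed[OF K]
  have "submodule (satur R q M K) R M"
  proof (rule submoduleI, goal_cases)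
    case 1 then show ?case by (auto simp: satur_def)
  next
    case 2 then show ?case using KD compl_one by (auto simp: satur_def intro!: bexI[of _ \<one>])
  next
    case (3 a) then show ?case using KD by (auto simp: satur_def smult_r_minus intro!: bexI)
  next
    case (4 a b)
    then obtain s t where st: "s \<in> carrier R - q" "t \<in> carrier R - q" "s \<odot>\<^bsub>M\<^esub> a \<in> K" "t \<odot>\<^bsub>M\<^esub> b \<in> K"
      and ab: "a \<in> carrier M" "b \<in> carrier M" by (auto simp: satur_def)
    have "t \<odot>\<^bsub>M\<^esub> (s \<odot>\<^bsub>M\<^esub> a) \<oplus>\<^bsub>M\<^esub> s \<odot>\<^bsub>M\<^esub> (t \<odot>\<^bsub>M\<^esub> b) \<in> K"
      using st by (intro submoduleE(5)[OF K submoduleE(4)[OF K _ st(3)] submoduleE(4)[OF K _ st(4)]]) auto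
    then have "(s \<otimes> t) \<odot>\<^bsub>M\<^esub> (a \<oplus>\<^bsub>M\<^esub> b) \<in> K"
      using st ab by (simp add: smult_r_distr smult_assoc1 smult_commute[of t s])
    then show ?case using compl_mult st ab by (auto simp: satur_def)
  next
    case (5 r a)
    then obtain s where s: "s \<in> carrier R - q" "s \<odot>\<^bsub>M\<^esub> a \<in> K" "a \<in> carrier M" by (auto simp: satur_def)
    then have "s \<odot>\<^bsub>M\<^esub> (r \<odot>\<^bsub>M\<^esub> a) \<in> K" using KD 5 smult_commute[of s r a] by auto
    then show ?case using s 5 by (auto simp: satur_def)
  qed
  moreover have "m \<in> satur R q M K" if ms: "m \<in> carrier M" "s \<in> carrier R - q" "s \<odot>\<^bsub>M\<^esub> m \<in> satur R q M K" for m s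
  proof -
    obtain t where "t \<in> carrier R - q" "t \<odot>\<^bsub>M\<^esub> (s \<odot>\<^bsub>M\<^esub> m) \<in> K" using ms(3) by (auto simp: satur_def)
    then show ?thesis using ms compl_mult[of t s] by (auto simp: satur_def smult_assoc1[symmetric])
  qed
  ultimately show ?thesis by (auto simp: saturated_submodule_def)
qed

lemma satur_superset:
  assumes "submodule K R M" shows "K \<subseteq> satur R q M K"
  using compl_one sub_in[OF assms] by (auto simp: satur_def intro!: bexI[of _ \<one>])

lemma satur_least: "sat_sub H \<Longrightarrow> K \<subseteq> H \<Longrightarrow> satur R q M K \<subseteq> H"
  by (auto simp: satur_def saturated_submodule_def)

lemma step_sub:
  assumes "submodule H R M" "x \<in> carrier R"
  shows "submodule {h \<oplus>\<^bsub>M\<^esub> k | h k. h \<in> H \<and> k \<in> {x \<odot>\<^bsub>M\<^esub> m | m. m \<in> carrier M}} R M"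
proof -
  have "(\<lambda>m. x \<odot>\<^bsub>M\<^esub> m) \<in> module_hom R M M"
    using assms by (intro module_homI) (auto simp: smult_r_distr smult_commute)
  then have "submodule ((\<lambda>m. x \<odot>\<^bsub>M\<^esub> m) ` carrier M) R M"
    by (rule hom_image_submodule[OF module_axioms _ carrier_is_submodule])
  moreover have "(\<lambda>m. x \<odot>\<^bsub>M\<^esub> m) ` carrier M = {x \<odot>\<^bsub>M\<^esub> m | m. m \<in> carrier M}" by auto
  ultimately have "submodule {x \<odot>\<^bsub>M\<^esub> m | m. m \<in> carrier M} R M" by (simp only:)
  from sum_submodule[OF assms(1) this] show ?thesis .
qed

lemma step_sat: "submodule H R M \<Longrightarrow> x \<in> carrier R \<Longrightarrow> sat_sub (step H x)"
  unfolding quot_step_def by (intro satur_sat_sub step_sub)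

text \<open>Clears the saturation from \<open>quot_step\<close>, so that localized arguments become
  computations with congruences modulo H and explicit denominators.\<close>

lemma mem_step:
  assumes "submodule H R M" "x \<in> carrier R"
  shows "m \<in> step H x \<longleftrightarrow> m \<in> carrier M \<and> (\<exists>s\<in>carrier R - q. \<exists>w\<in>carrier M. cong H (s \<odot>\<^bsub>M\<^esub> m) (x \<odot>\<^bsub>M\<^esub> w))"
proof
  assume "m \<in> step H x"
  then obtain s h w where "m \<in> carrier M" "s \<in> carrier R - q" "h \<in> H" "w \<in> carrier M" "s \<odot>\<^bsub>M\<^esub> m = h \<oplus>\<^bsub>M\<^esub> x \<odot>\<^bsub>M\<^esub> w"
    by (auto simp: quot_step_def satur_def)
  then show "m \<in> carrier M \<and> (\<exists>s\<in>carrier R - q. \<exists>w\<in>carrier M. cong H (s \<odot>\<^bsub>M\<^esub> m) (x \<odot>\<^bsub>M\<^esub> w))"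
    using cong_of_sum[OF assms(1)] assms by blast
next
  assume "m \<in> carrier M \<and> (\<exists>s\<in>carrier R - q. \<exists>w\<in>carrier M. cong H (s \<odot>\<^bsub>M\<^esub> m) (x \<odot>\<^bsub>M\<^esub> w))"
  then obtain s w where *: "m \<in> carrier M" "s \<in> carrier R - q" "w \<in> carrier M" "cong H (s \<odot>\<^bsub>M\<^esub> m) (x \<odot>\<^bsub>M\<^esub> w)" by auto
  show "m \<in> step H x"
    unfolding quot_step_def satur_def using * cong_diff[OF *(4)] by blast
qed

lemma step_superset:
  assumes "submodule H R M" "x \<in> carrier R" shows "H \<subseteq> step H x"
proof
  fix h assume "h \<in> H"
  then have "cong H (\<one> \<odot>\<^bsub>M\<^esub> h) (x \<odot>\<^bsub>M\<^esub> \<zero>\<^bsub>M\<^esub>)" using sub_in[OF assms(1)] cong_zero_iff[OF assms(1)] assms by simp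
  then show "h \<in> step H x" using mem_step[OF assms] compl_one \<open>h \<in> H\<close> sub_in[OF assms(1)] M.zero_closed by blast
qed

lemma step_smult:
  assumes "submodule H R M" "x \<in> carrier R" "m \<in> carrier M" shows "x \<odot>\<^bsub>M\<^esub> m \<in> step H x"
proof -
  have "cong H (\<one> \<odot>\<^bsub>M\<^esub> (x \<odot>\<^bsub>M\<^esub> m)) (x \<odot>\<^bsub>M\<^esub> m)" using cong_refl assms by simp
  then show ?thesis using mem_step[OF assms(1,2)] compl_one assms by blast
qed

lemma step_least:
  assumes "sat_sub K" "H \<subseteq> K" "\<And>m. m \<in> carrier M \<Longrightarrow> x \<odot>\<^bsub>M\<^esub> m \<in> K"
  shows "step H x \<subseteq> K"
  unfolding quot_step_def
  by (rule satur_least[OF assms(1)]) (use assms(2,3) submoduleE(5)[OF satur_submoduleD(1)[OF assms(1)]] in blast)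

text \<open>Both sides are the least saturated submodule containing H, xM and yM.\<close>

lemma step_commute:
  assumes "submodule H R M" "x \<in> carrier R" "y \<in> carrier R"
  shows "step (step H x) y = step (step H y) x"
proof -
  have "step (step H x) y \<subseteq> step (step H y) x" if "x \<in> carrier R" "y \<in> carrier R" for x y
  proof -
    note S = satur_submoduleD(1)[OF step_sat[OF assms(1) that(2)]]
    have K: "sat_sub (step (step H y) x)" by (rule step_sat[OF S that(1)])
    have i: "step H y \<subseteq> step (step H y) x" by (rule step_superset[OF S that(1)])
    have "step H x \<subseteq> step (step H y) x"
      by (rule step_least[OF K]) (use i step_superset[OF assms(1) that(2)] step_smult[OF S that(1)] in auto)
    then show ?thesis
      by (rule step_least[OF K]) (use i step_smult[OF assms(1) that(2)] in auto)
  qed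
  then show ?thesis using assms by blast
qed

lemmas smult_ac = smult_assoc1[symmetric] R.m_ac

text \<open>For x and y regular on A, the socles of A/xA and A/yA are both Ext^1(k, A); here A is
  \<open>M_q/H_q\<close> and k the residue field. The proof follows one element through this
  isomorphism: m goes to the w with ym = xw.\<close>

lemma socle_free_swap:
  assumes H: "sat_sub H" and x: "x \<in> q" "regular_mod M x H" and y: "y \<in> q" "regular_mod M y H"
    and soc: "socle_free q M (step H y)"
  shows "socle_free q M (step H x)"
  unfolding socle_free_def
proof (intro ballI impI)
  note Hs = satur_submoduleD(1)[OF H]
  note [simp] = q_carrier[OF x(1)] q_carrier[OF y(1)] q_carrier
  note tr = cong_trans[OF _ _ Hs]
  fix m assume m: "m \<in> carrier M" "\<forall>r\<in>q. r \<odot>\<^bsub>M\<^esub> m \<in> step H x"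
  obtain s w where s: "s \<in> carrier R - q" "w \<in> carrier M" "cong H (s \<odot>\<^bsub>M\<^esub> (y \<odot>\<^bsub>M\<^esub> m)) (x \<odot>\<^bsub>M\<^esub> w)"
    using m y mem_step[OF Hs, of x] by auto
  \<comment> \<open>Up to denominators x(rw) = r(ym) = y(rm), and rm is a multiple xw'; cancelling x
    shows that rw is a multiple of y.\<close>
  have "r \<odot>\<^bsub>M\<^esub> w \<in> step H y" if r: "r \<in> q" for r
  proof -
    obtain s' w' where s': "s' \<in> carrier R - q" "w' \<in> carrier M" "cong H (s' \<odot>\<^bsub>M\<^esub> (r \<odot>\<^bsub>M\<^esub> m)) (x \<odot>\<^bsub>M\<^esub> w')"
      using m r mem_step[OF Hs, of x] by auto
    have e1: "cong H ((s' \<otimes> r) \<odot>\<^bsub>M\<^esub> (x \<odot>\<^bsub>M\<^esub> w)) ((s' \<otimes> r) \<odot>\<^bsub>M\<^esub> (s \<odot>\<^bsub>M\<^esub> (y \<odot>\<^bsub>M\<^esub> m)))"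
      using cong_smult[OF Hs cong_sym[OF Hs s(3)], of "s' \<otimes> r"] s' r by auto
    have e2: "cong H ((s \<otimes> y) \<odot>\<^bsub>M\<^esub> (s' \<odot>\<^bsub>M\<^esub> (r \<odot>\<^bsub>M\<^esub> m))) ((s \<otimes> y) \<odot>\<^bsub>M\<^esub> (x \<odot>\<^bsub>M\<^esub> w'))"
      using cong_smult[OF Hs s'(3), of "s \<otimes> y"] s by auto
    have "(s' \<otimes> r) \<odot>\<^bsub>M\<^esub> (s \<odot>\<^bsub>M\<^esub> (y \<odot>\<^bsub>M\<^esub> m)) = (s \<otimes> y) \<odot>\<^bsub>M\<^esub> (s' \<odot>\<^bsub>M\<^esub> (r \<odot>\<^bsub>M\<^esub> m))"
      using s s' r m by (simp add: smult_ac)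
    then have e3: "cong H ((s' \<otimes> r) \<odot>\<^bsub>M\<^esub> (x \<odot>\<^bsub>M\<^esub> w)) ((s \<otimes> y) \<odot>\<^bsub>M\<^esub> (x \<odot>\<^bsub>M\<^esub> w'))"
      using tr[OF e1] e2 by simp
    have "cong H (x \<odot>\<^bsub>M\<^esub> (s' \<odot>\<^bsub>M\<^esub> (r \<odot>\<^bsub>M\<^esub> w))) (x \<odot>\<^bsub>M\<^esub> (y \<odot>\<^bsub>M\<^esub> (s \<odot>\<^bsub>M\<^esub> w')))"
      using e3 s s' r by (simp add: smult_ac)
    then have "cong H (s' \<odot>\<^bsub>M\<^esub> (r \<odot>\<^bsub>M\<^esub> w)) (y \<odot>\<^bsub>M\<^esub> (s \<odot>\<^bsub>M\<^esub> w'))"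
      using regular_mod_cong[OF Hs x(2)] s s' r by simp
    then show ?thesis using mem_step[OF Hs, of y] s s' r by (auto intro!: bexI[of _ s'] bexI[of _ "s \<odot>\<^bsub>M\<^esub> w'"])
  qed
  \<comment> \<open>Now w = yv, so ym = x(yv), and y can be cancelled.\<close>
  then have "w \<in> step H y" using soc s by (auto simp: socle_free_def)
  then obtain t v where t: "t \<in> carrier R - q" "v \<in> carrier M" "cong H (t \<odot>\<^bsub>M\<^esub> w) (y \<odot>\<^bsub>M\<^esub> v)"
    using mem_step[OF Hs, of y] by auto
  have e1: "cong H (t \<odot>\<^bsub>M\<^esub> (s \<odot>\<^bsub>M\<^esub> (y \<odot>\<^bsub>M\<^esub> m))) (t \<odot>\<^bsub>M\<^esub> (x \<odot>\<^bsub>M\<^esub> w))"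
    using cong_smult[OF Hs s(3), of t] t by auto
  have e2: "cong H (x \<odot>\<^bsub>M\<^esub> (t \<odot>\<^bsub>M\<^esub> w)) (x \<odot>\<^bsub>M\<^esub> (y \<odot>\<^bsub>M\<^esub> v))"
    using cong_smult[OF Hs t(3), of x] by auto
  have "t \<odot>\<^bsub>M\<^esub> (x \<odot>\<^bsub>M\<^esub> w) = x \<odot>\<^bsub>M\<^esub> (t \<odot>\<^bsub>M\<^esub> w)" using t s by (simp add: smult_ac)
  then have e3: "cong H (t \<odot>\<^bsub>M\<^esub> (s \<odot>\<^bsub>M\<^esub> (y \<odot>\<^bsub>M\<^esub> m))) (x \<odot>\<^bsub>M\<^esub> (y \<odot>\<^bsub>M\<^esub> v))"
    using tr[OF e1] e2 by simp
  then have "cong H (y \<odot>\<^bsub>M\<^esub> ((t \<otimes> s) \<odot>\<^bsub>M\<^esub> m)) (y \<odot>\<^bsub>M\<^esub> (x \<odot>\<^bsub>M\<^esub> v))"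
    using t s m by (simp add: smult_ac)
  then have "cong H ((t \<otimes> s) \<odot>\<^bsub>M\<^esub> m) (x \<odot>\<^bsub>M\<^esub> v)"
    using regular_mod_cong[OF Hs y(2)] t s m by simp
  then show "m \<in> step H x" using mem_step[OF Hs, of x] compl_mult[OF t(1) s(1)] t m by auto
qed

text \<open>If yb = za, then a is a multiple of y because z is regular modulo y; cancelling y makes
  b a multiple of z. This half of permuting a regular sequence is purely formal.\<close>

lemma regular_mod_swap:
  assumes Hs: "submodule H R M" and y: "y \<in> q" "regular_mod M y H" and z: "z \<in> q" "regular_mod M z (step H y)"
  shows "regular_mod M y (step H z)"
  unfolding regular_mod_def
proof (intro ballI impI)
  note [simp] = q_carrier[OF y(1)] q_carrier[OF z(1)]
  fix b assume b: "b \<in> carrier M" "y \<odot>\<^bsub>M\<^esub> b \<in> step H z"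
  obtain s a where s: "s \<in> carrier R - q" "a \<in> carrier M" "cong H (s \<odot>\<^bsub>M\<^esub> (y \<odot>\<^bsub>M\<^esub> b)) (z \<odot>\<^bsub>M\<^esub> a)"
    using b mem_step[OF Hs, of z] by auto
  have "cong H (\<one> \<odot>\<^bsub>M\<^esub> (z \<odot>\<^bsub>M\<^esub> a)) (y \<odot>\<^bsub>M\<^esub> (s \<odot>\<^bsub>M\<^esub> b))"
    using cong_sym[OF Hs s(3)] s b by (simp add: smult_ac)
  then have "z \<odot>\<^bsub>M\<^esub> a \<in> step H y" using mem_step[OF Hs, of y] compl_one s b
    by (auto intro!: bexI[of _ \<one>] bexI[of _ "s \<odot>\<^bsub>M\<^esub> b"])
  then have "a \<in> step H y" using z s by (auto simp: regular_mod_def)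
  then obtain t a' where t: "t \<in> carrier R - q" "a' \<in> carrier M" "cong H (t \<odot>\<^bsub>M\<^esub> a) (y \<odot>\<^bsub>M\<^esub> a')"
    using mem_step[OF Hs, of y] by auto
  have e1: "cong H (t \<odot>\<^bsub>M\<^esub> (s \<odot>\<^bsub>M\<^esub> (y \<odot>\<^bsub>M\<^esub> b))) (t \<odot>\<^bsub>M\<^esub> (z \<odot>\<^bsub>M\<^esub> a))"
    using cong_smult[OF Hs s(3), of t] t by auto
  have e2: "cong H (z \<odot>\<^bsub>M\<^esub> (t \<odot>\<^bsub>M\<^esub> a)) (z \<odot>\<^bsub>M\<^esub> (y \<odot>\<^bsub>M\<^esub> a'))"
    using cong_smult[OF Hs t(3), of z] by auto
  have "t \<odot>\<^bsub>M\<^esub> (z \<odot>\<^bsub>M\<^esub> a) = z \<odot>\<^bsub>M\<^esub> (t \<odot>\<^bsub>M\<^esub> a)" using t s by (simp add: smult_ac)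
  then have e3: "cong H (t \<odot>\<^bsub>M\<^esub> (s \<odot>\<^bsub>M\<^esub> (y \<odot>\<^bsub>M\<^esub> b))) (z \<odot>\<^bsub>M\<^esub> (y \<odot>\<^bsub>M\<^esub> a'))"
    using cong_trans[OF e1 _ Hs] e2 by simp
  then have "cong H (y \<odot>\<^bsub>M\<^esub> ((t \<otimes> s) \<odot>\<^bsub>M\<^esub> b)) (y \<odot>\<^bsub>M\<^esub> (z \<odot>\<^bsub>M\<^esub> a'))"
    using t s b by (simp add: smult_ac)
  then have "cong H ((t \<otimes> s) \<odot>\<^bsub>M\<^esub> b) (z \<odot>\<^bsub>M\<^esub> a')"
    using regular_mod_cong[OF Hs y(2)] t s b by simp
  then show "b \<in> step H z" using mem_step[OF Hs, of z] compl_mult[OF t(1) s(1)] t b by auto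
qed

text \<open>P consists of the associated primes of M/H. If one of them contained q, the element it
  annihilates would lie in the socle. Listing the primes to avoid, rather than producing one regular
  element, allows the lists of several modules to be united.\<close>

lemma socle_free_avoid:
  assumes H: "sat_sub H" and soc: "socle_free q M H"
  shows "\<exists>P. finite P \<and> (\<forall>p\<in>P. primeideal p R \<and> \<not> q \<subseteq> p) \<and> (\<forall>x\<in>q. (\<forall>p\<in>P. x \<notin> p) \<longrightarrow> regular_mod M x H)" (is "\<exists>P. ?avoid P")
proof -
  note Hs = satur_submoduleD(1)[OF H]
  obtain P0 where P0: "finite P0" "\<And>y. y \<in> carrier M \<Longrightarrow> primeideal (ann_mod R M H y) R \<Longrightarrow> ann_mod R M H y \<in> P0"
    using finite_assoc_primes[OF Hs] by blast
  define P where "P = {ann_mod R M H y | y. y \<in> carrier M \<and> primeideal (ann_mod R M H y) R}"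
  have "finite P" by (rule finite_subset[OF _ P0(1)]) (auto simp: P_def P0(2))
  moreover have "\<not> q \<subseteq> p" if "p \<in> P" for p
  proof
    assume qp: "q \<subseteq> p"
    obtain y where y: "y \<in> carrier M" "p = ann_mod R M H y" "primeideal p R" using \<open>p \<in> P\<close> unfolding P_def by blast
    then have "y \<in> H" using soc qp by (auto simp: socle_free_def ann_mod_def)
    then have "\<one> \<in> p" using y by (auto simp: ann_mod_def)
    then show False using y(3) primeideal.I_notcarr ideal.one_imp_carrier primeideal.axioms(1) by metis
  qed
  moreover have "regular_mod M x H" if x: "x \<in> q" "\<forall>p\<in>P. x \<notin> p" for x
    unfolding regular_mod_def
  proof (intro ballI impI, rule ccontr)
    fix m assume m: "m \<in> carrier M" "x \<odot>\<^bsub>M\<^esub> m \<in> H" "m \<notin> H"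
    obtain c where c: "c \<in> carrier R" "primeideal (ann_mod R M H (c \<odot>\<^bsub>M\<^esub> m)) R" using ex_assoc_prime[OF Hs m(1,3)] by auto
    have "x \<in> ann_mod R M H m" using m q_carrier x by (auto simp: ann_mod_def)
    then have "x \<in> ann_mod R M H (c \<odot>\<^bsub>M\<^esub> m)" using ann_mod_mono[OF Hs m(1) c(1)] by auto
    moreover have "ann_mod R M H (c \<odot>\<^bsub>M\<^esub> m) \<in> P" unfolding P_def using c m smult_closed by blast
    ultimately show False using x by blast
  qed
  ultimately show ?thesis by (intro exI[of _ P]) (auto simp: P_def)
qed

lemma depth_ge_socle_free: "dge (Suc k) H \<Longrightarrow> socle_free q M H"
  by (auto simp: socle_free_def regular_mod_def)

lemma avoid_in_q:
  assumes "finite P" "\<And>p. p \<in> P \<Longrightarrow> primeideal p R \<and> \<not> q \<subseteq> p"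
  obtains x where "x \<in> q" "\<And>p. p \<in> P \<Longrightarrow> x \<notin> p"
  using prime_avoidance[OF is_cring assms(1), of q] assms(2) is_ideal by blast

lemma depth_ge_one:
  assumes H: "sat_sub H" and soc: "socle_free q M H"
  shows "dge (Suc 0) H"
proof -
  obtain P where P: "finite P" "\<forall>p\<in>P. primeideal p R \<and> \<not> q \<subseteq> p"
    "\<forall>x\<in>q. (\<forall>p\<in>P. x \<notin> p) \<longrightarrow> regular_mod M x H"
    using socle_free_avoid[OF assms] by (elim exE conjE)
  obtain x where "x \<in> q" "\<And>p. p \<in> P \<Longrightarrow> x \<notin> p" using avoid_in_q[of P] P by blast
  then show ?thesis using P(3) by auto
qed

text \<open>Invariance of depth: any regular x may be taken first. The recursion provides some y; it
  is exchanged for the given x through an auxiliary z that is regular modulo x and modulo y.\<close>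

lemma depth_ge_step:
  assumes "sat_sub H" "x \<in> q" "regular_mod M x H" "dge (Suc k) H"
  shows "dge k (step H x)"
  using assms
proof (induction k arbitrary: H x)
  case (Suc k)
  note Hs = satur_submoduleD(1)[OF Suc.prems(1)]
  obtain y where y: "y \<in> q" "regular_mod M y H" "dge (Suc k) (step H y)" using Suc.prems by auto
  note xy = q_carrier[OF Suc.prems(2)] q_carrier[OF y(1)]
  have Hx: "sat_sub (step H x)" and Hy: "sat_sub (step H y)" using step_sat[OF Hs] xy by auto
  have sy: "socle_free q M (step H y)" by (rule depth_ge_socle_free[OF y(3)])
  \<comment> \<open>This is what puts a regular element modulo x within reach of prime
    avoidance.\<close>
  have sx: "socle_free q M (step H x)" by (rule socle_free_swap[OF Suc.prems(1-3) y(1,2) sy])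
  have s: "socle_free q M H" by (rule depth_ge_socle_free[OF Suc.prems(4)])
  obtain P1 where P1: "finite P1" "\<forall>p\<in>P1. primeideal p R \<and> \<not> q \<subseteq> p"
    "\<forall>x\<in>q. (\<forall>p\<in>P1. x \<notin> p) \<longrightarrow> regular_mod M x H"
    using socle_free_avoid[OF Suc.prems(1) s] by (elim exE conjE)
  obtain P2 where P2: "finite P2" "\<forall>p\<in>P2. primeideal p R \<and> \<not> q \<subseteq> p"
    "\<forall>z\<in>q. (\<forall>p\<in>P2. z \<notin> p) \<longrightarrow> regular_mod M z (step H x)"
    using socle_free_avoid[OF Hx sx] by (elim exE conjE)
  obtain P3 where P3: "finite P3" "\<forall>p\<in>P3. primeideal p R \<and> \<not> q \<subseteq> p"
    "\<forall>z\<in>q. (\<forall>p\<in>P3. z \<notin> p) \<longrightarrow> regular_mod M z (step H y)"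
    using socle_free_avoid[OF Hy sy] by (elim exE conjE)
  obtain z where zz: "z \<in> q" "\<And>p. p \<in> P1 \<union> P2 \<union> P3 \<Longrightarrow> z \<notin> p"
    using avoid_in_q[of "P1 \<union> P2 \<union> P3"] P1(1,2) P2(1,2) P3(1,2) by (metis Un_iff finite_Un)
  then have z: "z \<in> q" "regular_mod M z H" "regular_mod M z (step H x)" "regular_mod M z (step H y)" using P1(3) P2(3) P3(3) by auto
  have Hz: "sat_sub (step H z)" using step_sat[OF Hs] q_carrier z by auto
  \<comment> \<open>The induction hypothesis is used twice, dividing by z modulo y and by x modulo
    z; commuting the steps leads from y over z to x.\<close>
  have "dge k (step (step H y) z)" by (rule Suc.IH[OF Hy z(1,4) y(3)])
  then have "dge k (step (step H z) y)" using step_commute[OF Hs] q_carrier z y by simp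
  moreover have "regular_mod M y (step H z)" by (rule regular_mod_swap[OF Hs y(1,2) z(1,4)])
  ultimately have "dge (Suc k) (step H z)" using y by auto
  moreover have "regular_mod M x (step H z)" by (rule regular_mod_swap[OF Hs Suc.prems(2,3) z(1,3)])
  ultimately have "dge k (step (step H z) x)" using Suc.IH[OF Hz Suc.prems(2)] by blast
  then have "dge k (step (step H x) z)" using step_commute[OF Hs] q_carrier z Suc.prems(2) by simp
  then show ?case using z by auto
qed simp

end

section \<open>Powers of a module and matrices\<close>

definition pow_module :: "('a, 'm) module \<Rightarrow> 'i set \<Rightarrow> ('a, 'i \<Rightarrow> 'm) module" where
  "pow_module M B =
     \<lparr>carrier = B \<rightarrow>\<^sub>E carrier M, mult = undefined, one = undefined,
      zero = (\<lambda>i\<in>B. \<zero>\<^bsub>M\<^esub>), add = (\<lambda>f g. \<lambda>i\<in>B. f i \<oplus>\<^bsub>M\<^esub> g i),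
      smult = (\<lambda>a f. \<lambda>i\<in>B. a \<odot>\<^bsub>M\<^esub> f i)\<rparr>"

text \<open>A matrix over R acts on powers of every module, J indexing rows and I columns. On powers
  of M this is the matrix tensored with M, expressed without a tensor product.\<close>

definition mat_apply :: "('a, 'm) module \<Rightarrow> 'j set \<Rightarrow> 'i set \<Rightarrow> ('j \<Rightarrow> 'i \<Rightarrow> 'a) \<Rightarrow> ('i \<Rightarrow> 'm) \<Rightarrow> 'j \<Rightarrow> 'm" where
  "mat_apply M J I C u = (\<lambda>j\<in>J. \<Oplus>\<^bsub>M\<^esub>i\<in>I. C j i \<odot>\<^bsub>M\<^esub> u i)"

lemma pow_module_simps [simp]:
  "carrier (pow_module M B) = B \<rightarrow>\<^sub>E carrier M"
  "\<zero>\<^bsub>pow_module M B\<^esub> = (\<lambda>i\<in>B. \<zero>\<^bsub>M\<^esub>)"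
  "f \<oplus>\<^bsub>pow_module M B\<^esub> g = (\<lambda>i\<in>B. f i \<oplus>\<^bsub>M\<^esub> g i)"
  "a \<odot>\<^bsub>pow_module M B\<^esub> f = (\<lambda>i\<in>B. a \<odot>\<^bsub>M\<^esub> f i)"
  by (auto simp: pow_module_def)

lemma (in abelian_monoid) finsum_swap:
  assumes "finite A" "finite B" "\<And>a b. a \<in> A \<Longrightarrow> b \<in> B \<Longrightarrow> f a b \<in> carrier G"
  shows "(\<Oplus>a\<in>A. \<Oplus>b\<in>B. f a b) = (\<Oplus>b\<in>B. \<Oplus>a\<in>A. f a b)"
  using assms(1,3)
proof (induction A)
  case empty
  then show ?case by simp
next
  case (insert a A)
  have "(\<Oplus>b\<in>B. \<Oplus>a\<in>insert a A. f a b) = (\<Oplus>b\<in>B. f a b \<oplus> (\<Oplus>a\<in>A. f a b))"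
    using insert by (intro finsum_cong') (auto simp: Pi_def intro!: finsum_insert)
  also have "\<dots> = (\<Oplus>b\<in>B. f a b) \<oplus> (\<Oplus>b\<in>B. \<Oplus>a\<in>A. f a b)"
    using insert by (intro finsum_addf) auto
  also have "(\<Oplus>b\<in>B. \<Oplus>a\<in>A. f a b) = (\<Oplus>a\<in>A. \<Oplus>b\<in>B. f a b)"
    using insert by simp
  finally show ?case using insert by (subst finsum_insert) auto
qed

context modl
begin

lemma pow_module_module: "module R (pow_module M B)"
proof (intro moduleI abelian_groupI' R.is_cring, goal_cases)
  case (6 x)
  then show ?case
    by (intro bexI[of _ "\<lambda>i\<in>B. \<ominus>\<^bsub>M\<^esub> x i"]) (auto simp: PiE_iff M.l_neg intro!: restrict_ext)
qed (auto simp: PiE_iff M.a_ac smult_l_distr smult_r_distr smult_assoc1 extensional_def intro!: restrict_ext)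

lemma pow_modl: "modl R (pow_module M B)"
  by (rule modl.intro[OF pow_module_module])

lemma pow_minus:
  assumes "f \<in> carrier (pow_module M B)" "g \<in> carrier (pow_module M B)" "i \<in> B"
  shows "(f \<ominus>\<^bsub>pow_module M B\<^esub> g) i = f i \<ominus>\<^bsub>M\<^esub> g i"
proof -
  interpret P: modl R "pow_module M B" by (rule pow_modl)
  have "\<ominus>\<^bsub>pow_module M B\<^esub> g = (\<lambda>i\<in>B. \<ominus>\<^bsub>M\<^esub> g i)"
    by (rule P.minus_equality) (use assms in \<open>auto simp: PiE_iff M.l_neg intro!: restrict_ext\<close>)
  then show ?thesis using assms by (simp add: P.minus_eq M.minus_eq)
qed

lemma pow_eval_hom: "i \<in> B \<Longrightarrow> (\<lambda>f. f i) \<in> module_hom R (pow_module M B) M"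
  by (rule module_homI) auto

lemma pow_submodule:
  assumes "submodule H R M" shows "submodule (B \<rightarrow>\<^sub>E H) R (pow_module M B)"
proof -
  interpret P: modl R "pow_module M B" by (rule pow_modl)
  note HD = sub_in[OF assms] sub_closed[OF assms]
  show ?thesis
  proof (rule P.submoduleI, goal_cases)
    case (3 f)
    then have f: "f \<in> carrier (pow_module M B)" using HD by (auto simp: PiE_iff)
    have "\<ominus>\<^bsub>pow_module M B\<^esub> f = (\<lambda>i\<in>B. \<ominus>\<^bsub>M\<^esub> f i)"
      by (rule P.minus_equality) (use f in \<open>auto simp: PiE_iff M.l_neg intro!: restrict_ext\<close>)
    then show ?case using 3 HD by auto
  qed (use HD in \<open>auto simp: PiE_iff\<close>)
qed

lemma pow_fg:
  assumes "fg_module R M" "finite B" shows "fg_module R (pow_module M B)"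
proof -
  interpret P: modl R "pow_module M B" by (rule pow_modl)
  obtain A where A: "finite A" "A \<subseteq> carrier M" "submodule_span R M A = carrier M"
    using assms unfolding fg_module_def by auto
  define e where "e b m = (\<lambda>i\<in>B. if i = b then m else \<zero>\<^bsub>M\<^esub>)" for b m
  have eh: "e b \<in> module_hom R M (pow_module M B)" for b
    by (rule module_homI) (auto simp: e_def intro!: restrict_ext)
  let ?G = "(\<lambda>(b, m). e b m) ` (B \<times> A)"
  let ?S = "submodule_span R (pow_module M B) ?G"
  have G: "?G \<subseteq> carrier (pow_module M B)" using A module_homD(1)[OF eh] by (force simp del: pow_module_simps)
  note S = P.span_submodule[OF G]
  have eS: "e b m \<in> ?S" if "b \<in> B" "m \<in> carrier M" for b m
  proof -
    have "submodule {m \<in> carrier M. e b m \<in> ?S} R M"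
      by (rule module_hom_submodule_eq[OF pow_module_module eh S])
    moreover have "A \<subseteq> {m \<in> carrier M. e b m \<in> ?S}"
      using A P.span_superset[of ?G] that by auto
    ultimately have "submodule_span R M A \<subseteq> {m \<in> carrier M. e b m \<in> ?S}" by (rule span_least)
    then show ?thesis using A that by auto
  qed
  have "(\<lambda>i\<in>B. if i \<in> B' then f i else \<zero>\<^bsub>M\<^esub>) \<in> ?S"
    if f: "f \<in> carrier (pow_module M B)" and B': "B' \<subseteq> B" for f B'
    using finite_subset[OF B' assms(2)] B'
  proof (induction B')
    case empty
    have "(\<lambda>i\<in>B. if i \<in> {} then f i else \<zero>\<^bsub>M\<^esub>) = \<zero>\<^bsub>pow_module M B\<^esub>" by (auto intro!: restrict_ext)
    then show ?case using P.sub_zero[OF S] by (simp only:)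
  next
    case (insert b B')
    have "(\<lambda>i\<in>B. if i \<in> insert b B' then f i else \<zero>\<^bsub>M\<^esub>)
      = e b (f b) \<oplus>\<^bsub>pow_module M B\<^esub> (\<lambda>i\<in>B. if i \<in> B' then f i else \<zero>\<^bsub>M\<^esub>)"
      using insert f by (auto simp: e_def PiE_iff intro!: restrict_ext)
    moreover have "e b (f b) \<in> ?S" using eS[of b "f b"] insert f by auto
    moreover have "(\<lambda>i\<in>B. if i \<in> B' then f i else \<zero>\<^bsub>M\<^esub>) \<in> ?S" using insert by blast
    ultimately show ?case using P.submoduleE(5)[OF S] by (simp only:)
  qed
  note * = this
  have "f \<in> ?S" if "f \<in> carrier (pow_module M B)" for f
  proof -
    have "(\<lambda>i\<in>B. if i \<in> B then f i else \<zero>\<^bsub>M\<^esub>) = f" using that by (auto simp: PiE_iff extensional_def fun_eq_iff)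
    then show ?thesis using *[OF that, of B] by simp
  qed
  then have "?S = carrier (pow_module M B)" using P.sub_in[OF S] by blast
  moreover have "finite ?G" using A assms by auto
  ultimately show ?thesis using G pow_module_module unfolding fg_module_def by blast
qed

lemma mat_apply_closed:
  assumes "\<And>j i. j \<in> J \<Longrightarrow> i \<in> I \<Longrightarrow> C j i \<in> carrier R" "u \<in> carrier (pow_module M I)"
  shows "mat_apply M J I C u \<in> carrier (pow_module M J)"
  using assms by (auto simp: mat_apply_def PiE_iff intro!: M.finsum_closed)

lemma mat_apply_hom:
  assumes "finite I" "\<And>j i. j \<in> J \<Longrightarrow> i \<in> I \<Longrightarrow> C j i \<in> carrier R"
  shows "mat_apply M J I C \<in> module_hom R (pow_module M I) (pow_module M J)"
proof (rule module_homI, goal_cases)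
  case (1 u) then show ?case using mat_apply_closed assms by blast
next
  case (2 u v)
  have "(\<Oplus>\<^bsub>M\<^esub>i\<in>I. C j i \<odot>\<^bsub>M\<^esub> (u \<oplus>\<^bsub>pow_module M I\<^esub> v) i)
     = (\<Oplus>\<^bsub>M\<^esub>i\<in>I. C j i \<odot>\<^bsub>M\<^esub> u i) \<oplus>\<^bsub>M\<^esub> (\<Oplus>\<^bsub>M\<^esub>i\<in>I. C j i \<odot>\<^bsub>M\<^esub> v i)" if j: "j \<in> J" for j
  proof -
    have "(\<Oplus>\<^bsub>M\<^esub>i\<in>I. C j i \<odot>\<^bsub>M\<^esub> (u \<oplus>\<^bsub>pow_module M I\<^esub> v) i) = (\<Oplus>\<^bsub>M\<^esub>i\<in>I. C j i \<odot>\<^bsub>M\<^esub> u i \<oplus>\<^bsub>M\<^esub> C j i \<odot>\<^bsub>M\<^esub> v i)"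
      using 2 assms j by (intro M.finsum_cong') (auto simp: PiE_iff smult_r_distr)
    then show ?thesis using 2 assms j by (subst (asm) M.finsum_addf) (auto simp: PiE_iff)
  qed
  then show ?case by (simp add: mat_apply_def cong: restrict_cong)
next
  case (3 a u)
  have "(\<Oplus>\<^bsub>M\<^esub>i\<in>I. C j i \<odot>\<^bsub>M\<^esub> (a \<odot>\<^bsub>pow_module M I\<^esub> u) i) = a \<odot>\<^bsub>M\<^esub> (\<Oplus>\<^bsub>M\<^esub>i\<in>I. C j i \<odot>\<^bsub>M\<^esub> u i)" if j: "j \<in> J" for j
  proof -
    have "a \<odot>\<^bsub>M\<^esub> (\<Oplus>\<^bsub>M\<^esub>i\<in>I. C j i \<odot>\<^bsub>M\<^esub> u i) = (\<Oplus>\<^bsub>M\<^esub>i\<in>I. a \<odot>\<^bsub>M\<^esub> (C j i \<odot>\<^bsub>M\<^esub> u i))"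
      using 3 assms j by (intro finsum_smult_ldistr) (auto simp: PiE_iff)
    also have "\<dots> = (\<Oplus>\<^bsub>M\<^esub>i\<in>I. C j i \<odot>\<^bsub>M\<^esub> (a \<odot>\<^bsub>pow_module M I\<^esub> u) i)"
      using 3 assms j by (intro M.finsum_cong') (auto simp: PiE_iff smult_commute)
    finally show ?thesis by simp
  qed
  then show ?case by (simp add: mat_apply_def cong: restrict_cong)
qed

lemma mat_apply_mem:
  assumes "submodule H R M" "\<And>j i. j \<in> J \<Longrightarrow> i \<in> I \<Longrightarrow> C j i \<in> carrier R" "\<And>i. i \<in> I \<Longrightarrow> u i \<in> H" "j \<in> J"
  shows "mat_apply M J I C u j \<in> H"
  using assms by (auto simp: mat_apply_def intro!: submodule_finsum[OF assms(1)] submoduleE(4)[OF assms(1)])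

text \<open>A matrix identity DC = s over R becomes an identity of maps on the powers of every
  module. For s outside q it says that C splits at q.\<close>

lemma mat_apply_compose:
  assumes fin: "finite I" "finite J"
    and C: "\<And>j i. j \<in> J \<Longrightarrow> i \<in> I \<Longrightarrow> C j i \<in> carrier R" and D: "\<And>j i. j \<in> J \<Longrightarrow> i \<in> I \<Longrightarrow> D i j \<in> carrier R"
    and s: "s \<in> carrier R"
    and DC: "\<And>i i'. i \<in> I \<Longrightarrow> i' \<in> I \<Longrightarrow> (\<Oplus>\<^bsub>R\<^esub>j\<in>J. D i j \<otimes> C j i') = (if i = i' then s else \<zero>)"
    and u: "u \<in> carrier (pow_module M I)"
  shows "mat_apply M I J D (mat_apply M J I C u) = s \<odot>\<^bsub>pow_module M I\<^esub> u"
proof -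
  have uM: "u i \<in> carrier M" if "i \<in> I" for i using u that by auto
  have "(\<Oplus>\<^bsub>M\<^esub>j\<in>J. D i j \<odot>\<^bsub>M\<^esub> mat_apply M J I C u j) = s \<odot>\<^bsub>M\<^esub> u i" if i: "i \<in> I" for i
  proof -
    have "(\<Oplus>\<^bsub>M\<^esub>j\<in>J. D i j \<odot>\<^bsub>M\<^esub> mat_apply M J I C u j) = (\<Oplus>\<^bsub>M\<^esub>j\<in>J. \<Oplus>\<^bsub>M\<^esub>i'\<in>I. (D i j \<otimes> C j i') \<odot>\<^bsub>M\<^esub> u i')"
    proof (intro M.finsum_cong' refl)
      fix j assume j: "j \<in> J"
      have "D i j \<odot>\<^bsub>M\<^esub> mat_apply M J I C u j = (\<Oplus>\<^bsub>M\<^esub>i'\<in>I. D i j \<odot>\<^bsub>M\<^esub> (C j i' \<odot>\<^bsub>M\<^esub> u i'))"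
        using j i fin C D uM by (auto simp: mat_apply_def intro!: finsum_smult_ldistr)
      also have "\<dots> = (\<Oplus>\<^bsub>M\<^esub>i'\<in>I. (D i j \<otimes> C j i') \<odot>\<^bsub>M\<^esub> u i')"
        using j i C D uM by (intro M.finsum_cong') (auto simp: smult_assoc1)
      finally show "D i j \<odot>\<^bsub>M\<^esub> mat_apply M J I C u j = (\<Oplus>\<^bsub>M\<^esub>i'\<in>I. (D i j \<otimes> C j i') \<odot>\<^bsub>M\<^esub> u i')" .
    qed (use i C D uM in \<open>auto intro!: M.finsum_closed\<close>)
    also have "\<dots> = (\<Oplus>\<^bsub>M\<^esub>i'\<in>I. \<Oplus>\<^bsub>M\<^esub>j\<in>J. (D i j \<otimes> C j i') \<odot>\<^bsub>M\<^esub> u i')"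
      using i C D uM fin by (intro M.finsum_swap) auto
    also have "\<dots> = (\<Oplus>\<^bsub>M\<^esub>i'\<in>I. if i = i' then s \<odot>\<^bsub>M\<^esub> u i' else \<zero>\<^bsub>M\<^esub>)"
    proof (intro M.finsum_cong' refl)
      fix i' assume i': "i' \<in> I"
      have "(\<Oplus>\<^bsub>M\<^esub>j\<in>J. (D i j \<otimes> C j i') \<odot>\<^bsub>M\<^esub> u i') = (\<Oplus>\<^bsub>R\<^esub>j\<in>J. D i j \<otimes> C j i') \<odot>\<^bsub>M\<^esub> u i'"
        using i i' C D uM fin by (intro finsum_smult_rdistr) auto
      then show "(\<Oplus>\<^bsub>M\<^esub>j\<in>J. (D i j \<otimes> C j i') \<odot>\<^bsub>M\<^esub> u i') = (if i = i' then s \<odot>\<^bsub>M\<^esub> u i' else \<zero>\<^bsub>M\<^esub>)"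
        using DC[OF i i'] uM[OF i'] by simp
    qed (use s uM in auto)
    also have "\<dots> = s \<odot>\<^bsub>M\<^esub> u i"
      using i fin s uM by (intro M.add.finprod_singleton[of i I "\<lambda>i. s \<odot>\<^bsub>M\<^esub> u i"]) auto
    finally show ?thesis .
  qed
  then show ?thesis by (auto simp: mat_apply_def intro!: restrict_ext)
qed

end

section \<open>Depth of cokernels\<close>

lemma (in prime_modl) pow_prime_modl: "finite B \<Longrightarrow> prime_modl q R (pow_module M B)"
  by (intro prime_modl.intro noeth_modl.intro noeth_modl_axioms.intro pow_modl noeth pow_fg fg primeideal_axioms)

locale matrix_modl = prime_modl q R M
  for q and R :: "('a, 'r) ring_scheme" (structure) and M :: "('a, 'm) module" (structure) +
  fixes J :: "'j set" and I :: "'i set" and C :: "'j \<Rightarrow> 'i \<Rightarrow> 'a"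
  assumes finI: "finite I" and finJ: "finite J" and C_closed: "j \<in> J \<Longrightarrow> i \<in> I \<Longrightarrow> C j i \<in> carrier R"

sublocale matrix_modl \<subseteq> P: prime_modl q R "pow_module M J"
  by (rule pow_prime_modl[OF finJ])

context matrix_modl
begin

abbreviation "\<Phi> \<equiv> mat_apply M J I C"

text \<open>The quotient of the J-th power of M by this submodule is, at q, the cokernel of C on the
  powers of M/H.\<close>

definition coker_sub :: "'m set \<Rightarrow> ('j \<Rightarrow> 'm) set" where
  "coker_sub H = satur R q (pow_module M J)
     {u \<oplus>\<^bsub>pow_module M J\<^esub> h | u h. u \<in> \<Phi> ` carrier (pow_module M I) \<and> h \<in> J \<rightarrow>\<^sub>E H}"

text \<open>Injectivity of C on the powers of M/H; for saturated H this is also injectivity at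
  q.\<close>

definition inj_mod :: "'m set \<Rightarrow> bool" where
  "inj_mod H \<longleftrightarrow> (\<forall>u\<in>carrier (pow_module M I). (\<forall>j\<in>J. \<Phi> u j \<in> H) \<longrightarrow> (\<forall>i\<in>I. u i \<in> H))"

lemma Phi_hom: "\<Phi> \<in> module_hom R (pow_module M I) (pow_module M J)"
  by (rule mat_apply_hom[OF finI C_closed])

lemma Phi_closed: "u \<in> carrier (pow_module M I) \<Longrightarrow> j \<in> J \<Longrightarrow> \<Phi> u j \<in> carrier M"
  using module_homD(1)[OF Phi_hom, of u] by auto

lemma Phi_smult:
  assumes "a \<in> carrier R" "u \<in> carrier (pow_module M I)" "j \<in> J"
  shows "\<Phi> (\<lambda>i\<in>I. a \<odot>\<^bsub>M\<^esub> u i) j = a \<odot>\<^bsub>M\<^esub> \<Phi> u j"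
  using module_homD(3)[OF Phi_hom assms(1,2)] assms(3) by simp

lemma Phi_minus:
  assumes "u \<in> carrier (pow_module M I)" "v \<in> carrier (pow_module M I)" "j \<in> J"
  shows "\<Phi> (u \<ominus>\<^bsub>pow_module M I\<^esub> v) j = \<Phi> u j \<ominus>\<^bsub>M\<^esub> \<Phi> v j"
  using modl.hom_minus[OF pow_modl pow_module_module Phi_hom assms(1,2)]
    pow_minus[of "\<Phi> u" J "\<Phi> v" j] module_homD(1)[OF Phi_hom] assms by simp

lemma smult_pow: "a \<in> carrier R \<Longrightarrow> u \<in> carrier (pow_module M I) \<Longrightarrow> (\<lambda>i\<in>I. a \<odot>\<^bsub>M\<^esub> u i) \<in> carrier (pow_module M I)"
  by (auto simp: PiE_iff)

lemma minus_pow: "u \<in> carrier (pow_module M I) \<Longrightarrow> v \<in> carrier (pow_module M I) \<Longrightarrow> u \<ominus>\<^bsub>pow_module M I\<^esub> v \<in> carrier (pow_module M I)"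
proof -
  interpret Q: modl R "pow_module M I" by (rule pow_modl)
  show "u \<in> carrier (pow_module M I) \<Longrightarrow> v \<in> carrier (pow_module M I) \<Longrightarrow> u \<ominus>\<^bsub>pow_module M I\<^esub> v \<in> carrier (pow_module M I)"
    by (rule Q.minus_closed)
qed

lemma inj_mod_cong:
  assumes "inj_mod H" "u \<in> carrier (pow_module M I)" "v \<in> carrier (pow_module M I)"
    "\<And>j. j \<in> J \<Longrightarrow> cong H (\<Phi> u j) (\<Phi> v j)" "i \<in> I"
  shows "cong H (u i) (v i)"
proof -
  let ?d = "u \<ominus>\<^bsub>pow_module M I\<^esub> v"
  have "\<Phi> ?d j \<in> H" if "j \<in> J" for j
    using assms(4)[OF that] Phi_minus[OF assms(2,3) that] by (simp add: mod_cong_def)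
  then have "?d i \<in> H" using assms(1,5) minus_pow[OF assms(2,3)] by (auto simp: inj_mod_def)
  then show ?thesis using pow_minus[OF assms(2,3,5)] assms(2,3,5) by (auto simp: mod_cong_def PiE_iff)
qed

lemma Phi_cong:
  assumes "submodule H R M" "u \<in> carrier (pow_module M I)" "v \<in> carrier (pow_module M I)"
    "\<And>i. i \<in> I \<Longrightarrow> cong H (u i) (v i)" "j \<in> J"
  shows "cong H (\<Phi> u j) (\<Phi> v j)"
proof -
  let ?d = "u \<ominus>\<^bsub>pow_module M I\<^esub> v"
  have "?d i \<in> H" if "i \<in> I" for i
    using assms(4)[OF that] pow_minus[OF assms(2,3) that] by (simp add: mod_cong_def)
  then have "\<Phi> ?d j \<in> H" by (intro mat_apply_mem assms(1,5) C_closed)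
  then show ?thesis using Phi_minus[OF assms(2,3,5)] Phi_closed assms(2,3,5) by (simp add: mod_cong_def)
qed

lemma coker_sat:
  assumes "submodule H R M" shows "P.sat_sub (coker_sub H)"
  unfolding coker_sub_def
  by (intro P.satur_sat_sub P.sum_submodule pow_submodule assms)
    (rule modl.hom_image_submodule[OF pow_modl pow_module_module Phi_hom module.carrier_is_submodule[OF pow_module_module]])

lemma mem_coker:
  assumes H: "submodule H R M"
  shows "w \<in> coker_sub H \<longleftrightarrow> w \<in> carrier (pow_module M J) \<and>
    (\<exists>s\<in>carrier R - q. \<exists>u\<in>carrier (pow_module M I). \<forall>j\<in>J. cong H (s \<odot>\<^bsub>M\<^esub> w j) (\<Phi> u j))"
proof
  assume "w \<in> coker_sub H"
  then obtain s u h where w: "w \<in> carrier (pow_module M J)" "s \<in> carrier R - q" "u \<in> carrier (pow_module M I)"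
    "h \<in> J \<rightarrow>\<^sub>E H" and e: "s \<odot>\<^bsub>pow_module M J\<^esub> w = \<Phi> u \<oplus>\<^bsub>pow_module M J\<^esub> h"
    unfolding coker_sub_def satur_def by blast
  have "cong H (s \<odot>\<^bsub>M\<^esub> w j) (\<Phi> u j)" if j: "j \<in> J" for j
  proof (rule cong_of_sum[OF H])
    show "s \<odot>\<^bsub>M\<^esub> w j = h j \<oplus>\<^bsub>M\<^esub> \<Phi> u j"
      using fun_cong[OF e, of j] j Phi_closed[OF w(3) j] sub_in[OF H, of "h j"] PiE_mem[OF w(4) j] by (simp add: M.a_comm)
  qed (use j w Phi_closed in auto)
  then show "w \<in> carrier (pow_module M J) \<and>
    (\<exists>s\<in>carrier R - q. \<exists>u\<in>carrier (pow_module M I). \<forall>j\<in>J. cong H (s \<odot>\<^bsub>M\<^esub> w j) (\<Phi> u j))" using w by blast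
next
  assume "w \<in> carrier (pow_module M J) \<and>
    (\<exists>s\<in>carrier R - q. \<exists>u\<in>carrier (pow_module M I). \<forall>j\<in>J. cong H (s \<odot>\<^bsub>M\<^esub> w j) (\<Phi> u j))"
  then obtain s u where w: "w \<in> carrier (pow_module M J)" "s \<in> carrier R - q" "u \<in> carrier (pow_module M I)"
    and c: "\<And>j. j \<in> J \<Longrightarrow> cong H (s \<odot>\<^bsub>M\<^esub> w j) (\<Phi> u j)" by blast
  define h where "h = (\<lambda>j\<in>J. s \<odot>\<^bsub>M\<^esub> w j \<ominus>\<^bsub>M\<^esub> \<Phi> u j)"
  have "s \<odot>\<^bsub>pow_module M J\<^esub> w = \<Phi> u \<oplus>\<^bsub>pow_module M J\<^esub> h"
    using cong_diff[OF c] c by (auto simp: h_def mod_cong_def M.a_comm intro!: restrict_ext)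
  moreover have "h \<in> J \<rightarrow>\<^sub>E H" using cong_diff(2)[OF c] by (auto simp: h_def)
  ultimately show "w \<in> coker_sub H" unfolding coker_sub_def satur_def using w by blast
qed

lemma choose_pow:
  assumes "\<And>i. i \<in> B \<Longrightarrow> \<exists>v\<in>carrier M. Q i v"
  obtains V where "V \<in> carrier (pow_module M B)" "\<And>i. i \<in> B \<Longrightarrow> Q i (V i)"
proof -
  obtain g where "\<And>i. i \<in> B \<Longrightarrow> g i \<in> carrier M \<and> Q i (g i)" using assms by metis
  then show ?thesis by (intro that[of "restrict g B"]) auto
qed

lemma step_common:
  assumes "finite B" "submodule H R M" "x \<in> carrier R" "\<And>i. i \<in> B \<Longrightarrow> u i \<in> step H x"
  obtains t V where "t \<in> carrier R - q" "V \<in> carrier (pow_module M B)"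
    "\<And>i. i \<in> B \<Longrightarrow> cong H (t \<odot>\<^bsub>M\<^esub> u i) (x \<odot>\<^bsub>M\<^esub> V i)"
proof -
  have um: "u i \<in> carrier M" if "i \<in> B" for i using mem_step[OF assms(2,3)] assms(4)[OF that] by auto
  have "\<exists>t\<in>carrier R - q. \<forall>i\<in>B. \<exists>v\<in>carrier M. cong H (t \<odot>\<^bsub>M\<^esub> u i) (x \<odot>\<^bsub>M\<^esub> v)"
  proof (rule common_denominator[OF assms(1)])
    fix i assume "i \<in> B"
    then show "\<exists>t\<in>carrier R - q. \<exists>v\<in>carrier M. cong H (t \<odot>\<^bsub>M\<^esub> u i) (x \<odot>\<^bsub>M\<^esub> v)"
      using mem_step[OF assms(2,3)] assms(4) by auto
  next
    fix i s t assume i: "i \<in> B" and st: "s \<in> carrier R - q" "t \<in> carrier R - q"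
      and "\<exists>v\<in>carrier M. cong H (s \<odot>\<^bsub>M\<^esub> u i) (x \<odot>\<^bsub>M\<^esub> v)"
    then obtain v where v: "v \<in> carrier M" "cong H (s \<odot>\<^bsub>M\<^esub> u i) (x \<odot>\<^bsub>M\<^esub> v)" by auto
    have "cong H ((t \<otimes> s) \<odot>\<^bsub>M\<^esub> u i) (x \<odot>\<^bsub>M\<^esub> (t \<odot>\<^bsub>M\<^esub> v))"
      using cong_smult[OF assms(2) v(2), of t] st um[OF i] v assms(3) by (simp add: smult_assoc1 smult_commute[of t x])
    then show "\<exists>v\<in>carrier M. cong H ((t \<otimes> s) \<odot>\<^bsub>M\<^esub> u i) (x \<odot>\<^bsub>M\<^esub> v)" using st v by auto
  qed
  then obtain t where t: "t \<in> carrier R - q" "\<And>i. i \<in> B \<Longrightarrow> \<exists>v\<in>carrier M. cong H (t \<odot>\<^bsub>M\<^esub> u i) (x \<odot>\<^bsub>M\<^esub> v)" by auto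
  obtain V where "V \<in> carrier (pow_module M B)" "\<And>i. i \<in> B \<Longrightarrow> cong H (t \<odot>\<^bsub>M\<^esub> u i) (x \<odot>\<^bsub>M\<^esub> V i)"
    using choose_pow[of B "\<lambda>i v. cong H (t \<odot>\<^bsub>M\<^esub> u i) (x \<odot>\<^bsub>M\<^esub> v)"] t(2) by auto
  then show ?thesis using that t(1) by blast
qed

lemma powI: "u \<in> carrier (pow_module M B) \<Longrightarrow> i \<in> B \<Longrightarrow> u i \<in> carrier M"
  by auto

text \<open>Consider 0 -> A^I -> A^J -> coker -> 0 with A = M/H at q. Since x is regular on A, there
  is no socle in A, so the socle of the cokernel embeds into Ext^1(k, A^I), which is the socle of
  the I-th power of A/xA.\<close>

lemma coker_socle_free:
  assumes H: "sat_sub H" and x: "x \<in> q" "regular_mod M x H" and inj: "inj_mod H"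
    and soc: "socle_free q M (step H x)"
  shows "socle_free q (pow_module M J) (coker_sub H)"
  unfolding socle_free_def
proof (intro ballI impI)
  note Hs = satur_submoduleD(1)[OF H]
  note xR = q_carrier[OF x(1)]
  note tr = cong_trans[OF _ _ Hs]
  fix w assume w: "w \<in> carrier (pow_module M J)" and qw: "\<forall>r\<in>q. r \<odot>\<^bsub>pow_module M J\<^esub> w \<in> coker_sub H"
  note wM = powI[OF w]
  have qw': "\<exists>s\<in>carrier R - q. \<exists>u\<in>carrier (pow_module M I). \<forall>j\<in>J. cong H (s \<odot>\<^bsub>M\<^esub> (r \<odot>\<^bsub>M\<^esub> w j)) (\<Phi> u j)" if "r \<in> q" for r
  proof -
    have "r \<odot>\<^bsub>pow_module M J\<^esub> w \<in> coker_sub H" using qw that by blast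
    then show ?thesis unfolding mem_coker[OF Hs] by (simp cong: ball_cong)
  qed
  obtain s u where s: "s \<in> carrier R - q" and u: "u \<in> carrier (pow_module M I)"
    and su: "\<And>j. j \<in> J \<Longrightarrow> cong H (s \<odot>\<^bsub>M\<^esub> (x \<odot>\<^bsub>M\<^esub> w j)) (\<Phi> u j)" using qw'[OF x(1)] by blast
  have sR: "s \<in> carrier R" using s by simp
  \<comment> \<open>u represents the connecting map applied to w. For r in q also rw lies in the
    image of C, say rw = Cu'; then C(ru) = C(xu'), and injectivity gives ru = xu', all up to
    denominators.\<close>
  have "u i \<in> step H x" if i: "i \<in> I" for i
  proof -
    have "r \<odot>\<^bsub>M\<^esub> u i \<in> step H x" if r: "r \<in> q" for r
    proof -
      note rR = q_carrier[OF r]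
      obtain s' u' where s': "s' \<in> carrier R - q" and u': "u' \<in> carrier (pow_module M I)"
        and su': "\<And>j. j \<in> J \<Longrightarrow> cong H (s' \<odot>\<^bsub>M\<^esub> (r \<odot>\<^bsub>M\<^esub> w j)) (\<Phi> u' j)" using qw'[OF r] by blast
      have s'R: "s' \<in> carrier R" using s' by simp
      have "cong H (\<Phi> (\<lambda>i\<in>I. (s' \<otimes> r) \<odot>\<^bsub>M\<^esub> u i) j) (\<Phi> (\<lambda>i\<in>I. (s \<otimes> x) \<odot>\<^bsub>M\<^esub> u' i) j)" if j: "j \<in> J" for j
      proof -
        have e1: "cong H ((s' \<otimes> r) \<odot>\<^bsub>M\<^esub> \<Phi> u j) ((s' \<otimes> r) \<odot>\<^bsub>M\<^esub> (s \<odot>\<^bsub>M\<^esub> (x \<odot>\<^bsub>M\<^esub> w j)))"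
          using cong_smult[OF Hs cong_sym[OF Hs su[OF j]], of "s' \<otimes> r"] s'R rR by auto
        have e2: "cong H ((s \<otimes> x) \<odot>\<^bsub>M\<^esub> (s' \<odot>\<^bsub>M\<^esub> (r \<odot>\<^bsub>M\<^esub> w j))) ((s \<otimes> x) \<odot>\<^bsub>M\<^esub> \<Phi> u' j)"
          using cong_smult[OF Hs su'[OF j], of "s \<otimes> x"] sR xR by auto
        have "(s' \<otimes> r) \<odot>\<^bsub>M\<^esub> (s \<odot>\<^bsub>M\<^esub> (x \<odot>\<^bsub>M\<^esub> w j)) = (s \<otimes> x) \<odot>\<^bsub>M\<^esub> (s' \<odot>\<^bsub>M\<^esub> (r \<odot>\<^bsub>M\<^esub> w j))"
          using sR s'R rR xR wM[OF j] by (simp add: smult_ac)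
        then have "cong H ((s' \<otimes> r) \<odot>\<^bsub>M\<^esub> \<Phi> u j) ((s \<otimes> x) \<odot>\<^bsub>M\<^esub> \<Phi> u' j)" using tr[OF e1] e2 by simp
        then show ?thesis using Phi_smult[OF _ u j, of "s' \<otimes> r"] Phi_smult[OF _ u' j, of "s \<otimes> x"] sR s'R rR xR by simp
      qed
      note cc = this
      have "cong H ((\<lambda>i\<in>I. (s' \<otimes> r) \<odot>\<^bsub>M\<^esub> u i) i) ((\<lambda>i\<in>I. (s \<otimes> x) \<odot>\<^bsub>M\<^esub> u' i) i)"
        by (rule inj_mod_cong[OF inj smult_pow[OF m_closed[OF s'R rR] u] smult_pow[OF m_closed[OF sR xR] u'] cc i])
      then have "cong H (s' \<odot>\<^bsub>M\<^esub> (r \<odot>\<^bsub>M\<^esub> u i)) (x \<odot>\<^bsub>M\<^esub> (s \<odot>\<^bsub>M\<^esub> u' i))"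
        using i sR s'R rR xR powI[OF u i] powI[OF u' i] by (simp add: smult_ac)
      then show ?thesis unfolding mem_step[OF Hs xR] using s' sR rR powI[OF u i] powI[OF u' i] by blast
    qed
    then show ?thesis using soc powI[OF u i] by (auto simp: socle_free_def)
  qed
  then obtain t V where t: "t \<in> carrier R - q" and V: "V \<in> carrier (pow_module M I)"
    and tV: "\<And>i. i \<in> I \<Longrightarrow> cong H (t \<odot>\<^bsub>M\<^esub> u i) (x \<odot>\<^bsub>M\<^esub> V i)"
    using step_common[OF finI Hs xR, of u] by metis
  have tR: "t \<in> carrier R" using t by simp
  \<comment> \<open>Now u = xV up to t, so xw = Cu = x(CV), and x can be cancelled because it is
    regular on M/H.\<close>
  have "cong H ((t \<otimes> s) \<odot>\<^bsub>M\<^esub> w j) (\<Phi> V j)" if j: "j \<in> J" for j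
  proof -
    have "cong H (\<Phi> (\<lambda>i\<in>I. t \<odot>\<^bsub>M\<^esub> u i) j) (\<Phi> (\<lambda>i\<in>I. x \<odot>\<^bsub>M\<^esub> V i) j)"
      by (rule Phi_cong[OF Hs smult_pow[OF tR u] smult_pow[OF xR V] _ j]) (use tV in auto)
    then have e1: "cong H (t \<odot>\<^bsub>M\<^esub> \<Phi> u j) (x \<odot>\<^bsub>M\<^esub> \<Phi> V j)" using Phi_smult[OF tR u j] Phi_smult[OF xR V j] by simp
    have e2: "cong H (t \<odot>\<^bsub>M\<^esub> (s \<odot>\<^bsub>M\<^esub> (x \<odot>\<^bsub>M\<^esub> w j))) (t \<odot>\<^bsub>M\<^esub> \<Phi> u j)"
      by (rule cong_smult[OF Hs su[OF j] tR])
    have "cong H (x \<odot>\<^bsub>M\<^esub> ((t \<otimes> s) \<odot>\<^bsub>M\<^esub> w j)) (x \<odot>\<^bsub>M\<^esub> \<Phi> V j)"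
      using tr[OF e2 e1] tR sR xR wM[OF j] by (simp add: smult_ac)
    then show ?thesis using regular_mod_cong[OF Hs x(2) xR] tR sR wM[OF j] Phi_closed[OF V j] by simp
  qed
  then show "w \<in> coker_sub H" unfolding mem_coker[OF Hs] using w V compl_mult[OF t s] by blast
qed

text \<open>Tor_1 of the cokernel with R/x vanishes when x is regular on the cokernel: if Cu = xW,
  then W is itself an image Cu', and injectivity turns Cu = C(xu') into u = xu'.\<close>

lemma inj_mod_step:
  assumes H: "sat_sub H" and x: "x \<in> q" "regular_mod (pow_module M J) x (coker_sub H)" and inj: "inj_mod H"
    and xH: "regular_mod M x H"
  shows "inj_mod (step H x)"
  unfolding inj_mod_def
proof (intro ballI impI)
  note Hs = satur_submoduleD(1)[OF H]
  note xR = q_carrier[OF x(1)]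
  fix u i assume u: "u \<in> carrier (pow_module M I)" and uj: "\<forall>j\<in>J. \<Phi> u j \<in> step H x" and i: "i \<in> I"
  obtain s W where s: "s \<in> carrier R - q" and W: "W \<in> carrier (pow_module M J)"
    and sW: "\<And>j. j \<in> J \<Longrightarrow> cong H (s \<odot>\<^bsub>M\<^esub> \<Phi> u j) (x \<odot>\<^bsub>M\<^esub> W j)"
    using step_common[OF finJ Hs xR, of "\<Phi> u"] uj by metis
  have sR: "s \<in> carrier R" using s by simp
  have "cong H (\<one> \<odot>\<^bsub>M\<^esub> (x \<odot>\<^bsub>pow_module M J\<^esub> W) j) (\<Phi> (\<lambda>i\<in>I. s \<odot>\<^bsub>M\<^esub> u i) j)" if j: "j \<in> J" for j
    using cong_sym[OF Hs sW[OF j]] Phi_smult[OF sR u j] j powI[OF W j] xR by simp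
  moreover have "x \<odot>\<^bsub>pow_module M J\<^esub> W \<in> carrier (pow_module M J)" using W xR by (auto simp: PiE_iff)
  ultimately have "x \<odot>\<^bsub>pow_module M J\<^esub> W \<in> coker_sub H"
    unfolding mem_coker[OF Hs] using compl_one smult_pow[OF sR u] by blast
  then have "W \<in> coker_sub H" using x(2) W unfolding regular_mod_def by blast
  then obtain t u' where t: "t \<in> carrier R - q" and u': "u' \<in> carrier (pow_module M I)"
    and tu: "\<And>j. j \<in> J \<Longrightarrow> cong H (t \<odot>\<^bsub>M\<^esub> W j) (\<Phi> u' j)" unfolding mem_coker[OF Hs] by blast
  have tR: "t \<in> carrier R" using t by simp
  have "cong H (\<Phi> (\<lambda>i\<in>I. (t \<otimes> s) \<odot>\<^bsub>M\<^esub> u i) j) (\<Phi> (\<lambda>i\<in>I. x \<odot>\<^bsub>M\<^esub> u' i) j)" if j: "j \<in> J" for j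
  proof -
    have e1: "cong H (t \<odot>\<^bsub>M\<^esub> (s \<odot>\<^bsub>M\<^esub> \<Phi> u j)) (t \<odot>\<^bsub>M\<^esub> (x \<odot>\<^bsub>M\<^esub> W j))" by (rule cong_smult[OF Hs sW[OF j] tR])
    have e2: "cong H (x \<odot>\<^bsub>M\<^esub> (t \<odot>\<^bsub>M\<^esub> W j)) (x \<odot>\<^bsub>M\<^esub> \<Phi> u' j)" by (rule cong_smult[OF Hs tu[OF j] xR])
    have "cong H ((t \<otimes> s) \<odot>\<^bsub>M\<^esub> \<Phi> u j) (x \<odot>\<^bsub>M\<^esub> \<Phi> u' j)"
      using cong_trans[OF e1 _ Hs] e2 tR sR xR powI[OF W j] Phi_closed[OF u j] by (simp add: smult_ac)
    then show ?thesis using Phi_smult[OF xR u' j] Phi_smult[OF _ u j, of "t \<otimes> s"] tR sR by simp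
  qed
  note cc = this
  have "cong H ((\<lambda>i\<in>I. (t \<otimes> s) \<odot>\<^bsub>M\<^esub> u i) i) ((\<lambda>i\<in>I. x \<odot>\<^bsub>M\<^esub> u' i) i)"
    by (rule inj_mod_cong[OF inj smult_pow[OF m_closed[OF tR sR] u] smult_pow[OF xR u'] cc i])
  then show "u i \<in> step H x" unfolding mem_step[OF Hs xR]
    using compl_mult[OF t s] i powI[OF u i] powI[OF u' i] by auto
qed

text \<open>Right exactness: dividing the cokernel by x gives the cokernel over M/(H + xM).\<close>

lemma coker_step:
  assumes Hs: "submodule H R M" and xR: "x \<in> carrier R"
  shows "P.step (coker_sub H) x = coker_sub (step H x)"
proof
  note Ss = satur_submoduleD(1)[OF step_sat[OF Hs xR]]
  note Cs = satur_submoduleD(1)[OF coker_sat[OF Hs]]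
  have mono: "cong (step H x) a b" if "cong H a b" for a b
    using that step_superset[OF Hs xR] by (auto simp: mod_cong_def)
  show "P.step (coker_sub H) x \<subseteq> coker_sub (step H x)"
  proof (rule P.step_least[OF coker_sat[OF Ss]])
    show "coker_sub H \<subseteq> coker_sub (step H x)"
      unfolding mem_coker[OF Hs] mem_coker[OF Ss] subset_iff using mono by metis
    fix w assume w: "w \<in> carrier (pow_module M J)"
    let ?z = "\<lambda>i\<in>I. \<zero>\<^bsub>M\<^esub>"
    have z: "?z \<in> carrier (pow_module M I)" by auto
    have "\<Phi> ?z j \<in> {\<zero>\<^bsub>M\<^esub>}" if "j \<in> J" for j
      by (rule mat_apply_mem[OF sub_zero_submodule C_closed _ that]) auto
    then have "cong (step H x) (\<one> \<odot>\<^bsub>M\<^esub> (x \<odot>\<^bsub>pow_module M J\<^esub> w) j) (\<Phi> ?z j)" if j: "j \<in> J" for j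
      using cong_zero_iff[OF Ss] step_smult[OF Hs xR powI[OF w j]] powI[OF w j] j xR by simp
    moreover have "x \<odot>\<^bsub>pow_module M J\<^esub> w \<in> carrier (pow_module M J)" using w xR by (auto simp: PiE_iff)
    ultimately show "x \<odot>\<^bsub>pow_module M J\<^esub> w \<in> coker_sub (step H x)"
      unfolding mem_coker[OF Ss] using z compl_one by blast
  qed
  show "coker_sub (step H x) \<subseteq> P.step (coker_sub H) x"
  proof
    fix w assume "w \<in> coker_sub (step H x)"
    then obtain s u where w: "w \<in> carrier (pow_module M J)" and s: "s \<in> carrier R - q" and u: "u \<in> carrier (pow_module M I)"
      and su: "\<And>j. j \<in> J \<Longrightarrow> cong (step H x) (s \<odot>\<^bsub>M\<^esub> w j) (\<Phi> u j)" unfolding mem_coker[OF Ss] by blast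
    have sR: "s \<in> carrier R" using s by simp
    obtain t V where t: "t \<in> carrier R - q" and V: "V \<in> carrier (pow_module M J)"
      and tV: "\<And>j. j \<in> J \<Longrightarrow> cong H (t \<odot>\<^bsub>M\<^esub> (s \<odot>\<^bsub>M\<^esub> w j \<ominus>\<^bsub>M\<^esub> \<Phi> u j)) (x \<odot>\<^bsub>M\<^esub> V j)"
      using step_common[OF finJ Hs xR, of "\<lambda>j. s \<odot>\<^bsub>M\<^esub> w j \<ominus>\<^bsub>M\<^esub> \<Phi> u j"] su unfolding mod_cong_def by metis
    have tR: "t \<in> carrier R" using t by simp
    let ?a = "(t \<otimes> s) \<odot>\<^bsub>pow_module M J\<^esub> w" and ?b = "x \<odot>\<^bsub>pow_module M J\<^esub> V"
    have ab: "?a \<in> carrier (pow_module M J)" "?b \<in> carrier (pow_module M J)"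
      using w V xR tR sR by (auto simp: PiE_iff)
    have abm: "?a \<ominus>\<^bsub>pow_module M J\<^esub> ?b \<in> carrier (pow_module M J)" by (rule P.M.minus_closed[OF ab])
    have "cong H (\<one> \<odot>\<^bsub>M\<^esub> (?a \<ominus>\<^bsub>pow_module M J\<^esub> ?b) j) (\<Phi> (\<lambda>i\<in>I. t \<odot>\<^bsub>M\<^esub> u i) j)" if j: "j \<in> J" for j
    proof -
      note c = powI[OF w j] powI[OF V j] Phi_closed[OF u j]
      have "(?a \<ominus>\<^bsub>pow_module M J\<^esub> ?b) j = (t \<otimes> s) \<odot>\<^bsub>M\<^esub> w j \<ominus>\<^bsub>M\<^esub> x \<odot>\<^bsub>M\<^esub> V j"
        using pow_minus[OF ab j] j by simp
      moreover have "t \<odot>\<^bsub>M\<^esub> (s \<odot>\<^bsub>M\<^esub> w j \<ominus>\<^bsub>M\<^esub> \<Phi> u j) \<ominus>\<^bsub>M\<^esub> x \<odot>\<^bsub>M\<^esub> V j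
        = ((t \<otimes> s) \<odot>\<^bsub>M\<^esub> w j \<ominus>\<^bsub>M\<^esub> x \<odot>\<^bsub>M\<^esub> V j) \<ominus>\<^bsub>M\<^esub> t \<odot>\<^bsub>M\<^esub> \<Phi> u j"
        using c tR sR xR by (simp add: M.minus_eq smult_r_distr smult_r_minus smult_assoc1 M.a_assoc M.a_comm[of "\<ominus>\<^bsub>M\<^esub> (t \<odot>\<^bsub>M\<^esub> \<Phi> u j)"])
      ultimately show ?thesis using tV[OF j] c tR sR xR Phi_smult[OF tR u j] by (simp add: mod_cong_def)
    qed
    then have "?a \<ominus>\<^bsub>pow_module M J\<^esub> ?b \<in> coker_sub H"
      unfolding mem_coker[OF Hs] using abm compl_one smult_pow[OF tR u] by blast
    then have "P.cong (coker_sub H) ?a ?b" using ab by (simp add: mod_cong_def)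
    then show "w \<in> P.step (coker_sub H) x"
      unfolding P.mem_step[OF Cs xR] using w V compl_mult[OF t s] by blast
  qed
qed

text \<open>The two lists of primes from \<open>socle_free_avoid\<close> are avoided at
  once.\<close>

lemma common_regular:
  assumes H: "sat_sub H" and soc: "socle_free q M H" "socle_free q (pow_module M J) (coker_sub H)"
  obtains x where "x \<in> q" "regular_mod M x H" "regular_mod (pow_module M J) x (coker_sub H)"
proof -
  have C: "P.sat_sub (coker_sub H)" by (rule coker_sat[OF satur_submoduleD(1)[OF H]])
  obtain P1 where P1: "finite P1" "\<forall>p\<in>P1. primeideal p R \<and> \<not> q \<subseteq> p"
    "\<forall>x\<in>q. (\<forall>p\<in>P1. x \<notin> p) \<longrightarrow> regular_mod M x H"
    using socle_free_avoid[OF H soc(1)] by (elim exE conjE)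
  obtain P2 where P2: "finite P2" "\<forall>p\<in>P2. primeideal p R \<and> \<not> q \<subseteq> p"
    "\<forall>z\<in>q. (\<forall>p\<in>P2. z \<notin> p) \<longrightarrow> regular_mod (pow_module M J) z (coker_sub H)"
    using P.socle_free_avoid[OF C soc(2)] by (elim exE conjE)
  obtain z where "z \<in> q" "\<And>p. p \<in> P1 \<union> P2 \<Longrightarrow> z \<notin> p"
    using avoid_in_q[of "P1 \<union> P2"] P1(1,2) P2(1,2) by (metis Un_iff finite_Un)
  then show ?thesis using that[of z] P1(3) P2(3) by auto
qed

text \<open>The depth lemma for 0 -> A^I -> A^J -> coker -> 0. Modulo an x regular on A and on the
  cokernel the sequence stays exact, so both depths drop together. The loss of one comes from
  \<open>coker_socle_free\<close>, where a positive depth of A/xA is spent on a positive depth of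
  the cokernel.\<close>

lemma depth_coker:
  assumes "sat_sub H" "inj_mod H" "dge (Suc k) H"
  shows "P.dge k (coker_sub H)"
  using assms
proof (induction k arbitrary: H)
  case (Suc k)
  note Hs = satur_submoduleD(1)[OF Suc.prems(1)]
  obtain y where y: "y \<in> q" "regular_mod M y H" "dge (Suc k) (step H y)" using Suc.prems(3) by auto
  have "socle_free q (pow_module M J) (coker_sub H)"
    by (rule coker_socle_free[OF Suc.prems(1) y(1,2) Suc.prems(2) depth_ge_socle_free[OF y(3)]])
  then obtain x where x: "x \<in> q" "regular_mod M x H" "regular_mod (pow_module M J) x (coker_sub H)"
    using common_regular[OF Suc.prems(1) depth_ge_socle_free[OF Suc.prems(3)]] by blast
  note xR = q_carrier[OF x(1)]
  have "P.dge k (coker_sub (step H x))"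
    by (rule Suc.IH[OF step_sat[OF Hs xR] inj_mod_step[OF Suc.prems(1) x(1,3) Suc.prems(2) x(2)]
          depth_ge_step[OF Suc.prems(1) x(1,2) Suc.prems(3)]])
  then show ?case using x coker_step[OF Hs xR] by auto
qed simp

text \<open>At q the relation DC = s with s a unit makes the cokernel a direct summand of A^J, A
  being M/H. Elements regular on A stay regular on it, and no depth is lost.\<close>

lemma depth_coker_split:
  assumes D: "\<And>i j. i \<in> I \<Longrightarrow> j \<in> J \<Longrightarrow> D i j \<in> carrier R" and s: "s \<in> carrier R - q"
    and DC: "\<And>i i'. i \<in> I \<Longrightarrow> i' \<in> I \<Longrightarrow> (\<Oplus>\<^bsub>R\<^esub>j\<in>J. D i j \<otimes> C j i') = (if i = i' then s else \<zero>)"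
    and H: "sat_sub H" and k: "dge k H"
  shows "P.dge k (coker_sub H)"
  using H k
proof (induction k arbitrary: H)
  case (Suc k)
  note Hs = satur_submoduleD(1)[OF Suc.prems(1)]
  have sR: "s \<in> carrier R" using s by simp
  interpret T: matrix_modl q R M I J D
    by (intro matrix_modl.intro matrix_modl_axioms.intro prime_modl_axioms finI finJ D)
  obtain x where x: "x \<in> q" "regular_mod M x H" "dge k (step H x)" using Suc.prems by auto
  note xR = q_carrier[OF x(1)]
  have "regular_mod (pow_module M J) x (coker_sub H)"
    unfolding regular_mod_def
  proof (intro ballI impI)
    fix w assume w: "w \<in> carrier (pow_module M J)" and xw: "x \<odot>\<^bsub>pow_module M J\<^esub> w \<in> coker_sub H"
    obtain t u where t: "t \<in> carrier R - q" and u: "u \<in> carrier (pow_module M I)"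
      and tu: "\<And>j. j \<in> J \<Longrightarrow> cong H (t \<odot>\<^bsub>M\<^esub> (x \<odot>\<^bsub>M\<^esub> w j)) (\<Phi> u j)"
      using xw unfolding mem_coker[OF Hs] by (auto cong: ball_cong)
    have tR: "t \<in> carrier R" using t by simp
    \<comment> \<open>Applying D to t(xw) = Cu gives su = xD(tw). Hence D(tw) is, up to
      denominators, the preimage of w under C that has to be found.\<close>
    let ?y = "mat_apply M I J D (\<lambda>j\<in>J. t \<odot>\<^bsub>M\<^esub> w j)"
    have tw: "(\<lambda>j\<in>J. t \<odot>\<^bsub>M\<^esub> w j) \<in> carrier (pow_module M J)" using w tR by (auto simp: PiE_iff)
    have y: "?y \<in> carrier (pow_module M I)" using module_homD(1)[OF T.Phi_hom tw] .
    have "cong H (s \<odot>\<^bsub>M\<^esub> u i) (x \<odot>\<^bsub>M\<^esub> ?y i)" if i: "i \<in> I" for i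
    proof -
      have "cong H (mat_apply M I J D (\<lambda>j\<in>J. x \<odot>\<^bsub>M\<^esub> (\<lambda>j\<in>J. t \<odot>\<^bsub>M\<^esub> w j) j) i) (mat_apply M I J D (\<Phi> u) i)"
      proof (rule T.Phi_cong[OF Hs T.smult_pow[OF xR tw] module_homD(1)[OF Phi_hom u] _ i])
        fix j assume j: "j \<in> J"
        then show "cong H ((\<lambda>j\<in>J. x \<odot>\<^bsub>M\<^esub> (\<lambda>j\<in>J. t \<odot>\<^bsub>M\<^esub> w j) j) j) (\<Phi> u j)"
          using tu[OF j] xR tR powI[OF w j] by (simp add: smult_commute)
      qed
      then have "cong H (x \<odot>\<^bsub>M\<^esub> ?y i) (mat_apply M I J D (\<Phi> u) i)" using T.Phi_smult[OF xR tw i] by simp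
      moreover have "mat_apply M I J D (\<Phi> u) = s \<odot>\<^bsub>pow_module M I\<^esub> u"
        by (rule mat_apply_compose[OF finI finJ C_closed D sR DC u])
      ultimately show ?thesis using cong_sym[OF Hs] i by simp
    qed
    note su = this
    have "cong H ((s \<otimes> t) \<odot>\<^bsub>M\<^esub> w j) (\<Phi> ?y j)" if j: "j \<in> J" for j
    proof -
      have "cong H (\<Phi> (\<lambda>i\<in>I. s \<odot>\<^bsub>M\<^esub> u i) j) (\<Phi> (\<lambda>i\<in>I. x \<odot>\<^bsub>M\<^esub> ?y i) j)"
        by (rule Phi_cong[OF Hs smult_pow[OF sR u] smult_pow[OF xR y] _ j]) (use su in auto)
      then have e1: "cong H (s \<odot>\<^bsub>M\<^esub> \<Phi> u j) (x \<odot>\<^bsub>M\<^esub> \<Phi> ?y j)" using Phi_smult[OF sR u j] Phi_smult[OF xR y j] by simp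
      have e2: "cong H (s \<odot>\<^bsub>M\<^esub> (t \<odot>\<^bsub>M\<^esub> (x \<odot>\<^bsub>M\<^esub> w j))) (s \<odot>\<^bsub>M\<^esub> \<Phi> u j)"
        by (rule cong_smult[OF Hs tu[OF j] sR])
      have "cong H (x \<odot>\<^bsub>M\<^esub> ((s \<otimes> t) \<odot>\<^bsub>M\<^esub> w j)) (x \<odot>\<^bsub>M\<^esub> \<Phi> ?y j)"
        using cong_trans[OF e2 e1 Hs] tR sR xR powI[OF w j] by (simp add: smult_ac)
      then show ?thesis using regular_mod_cong[OF Hs x(2) xR] tR sR powI[OF w j] Phi_closed[OF y j] by simp
    qed
    then show "w \<in> coker_sub H" unfolding mem_coker[OF Hs] using w y compl_mult[OF s t] by blast
  qed
  moreover have "P.dge k (coker_sub (step H x))"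
    by (rule Suc.IH[OF step_sat[OF Hs xR] x(3)])
  ultimately show ?case using x coker_step[OF Hs xR] by auto
qed simp

text \<open>
  If the cokernel had the same depth \<open>k\<close> as \<open>M\<close>, the matrix would stay injective modulo a maximal
  regular sequence, while \<open>v\<close> times a socle element is killed.
\<close>

lemma no_residual_kernel:
  assumes "sat_sub H" "inj_mod H" "dge k H" "P.dge k (coker_sub H)" "\<not> dge (Suc k) H"
    and v: "\<And>i. i \<in> I \<Longrightarrow> v i \<in> carrier R" "i0 \<in> I" "v i0 \<notin> q"
    and Cv: "\<And>j. j \<in> J \<Longrightarrow> (\<Oplus>\<^bsub>R\<^esub>i\<in>I. C j i \<otimes> v i) \<in> q"
  shows False
  using assms(1-5)
proof (induction k arbitrary: H)
  case 0
  note Hs = satur_submoduleD(1)[OF 0(1)]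
  have "\<not> socle_free q M H" using depth_ge_one[OF 0(1)] 0(5) by blast
  then obtain w where w: "w \<in> carrier M" "\<And>r. r \<in> q \<Longrightarrow> r \<odot>\<^bsub>M\<^esub> w \<in> H" "w \<notin> H" by (auto simp: socle_free_def)
  \<comment> \<open>C maps this vector into qw, hence into H, whereas its entry at \<open>i0\<close>
    is a unit multiple of w at q.\<close>
  let ?u = "\<lambda>i\<in>I. v i \<odot>\<^bsub>M\<^esub> w"
  have u: "?u \<in> carrier (pow_module M I)" using v w by auto
  have "\<Phi> ?u j \<in> H" if j: "j \<in> J" for j
  proof -
    have "\<Phi> ?u j = (\<Oplus>\<^bsub>M\<^esub>i\<in>I. (C j i \<otimes> v i) \<odot>\<^bsub>M\<^esub> w)"
      unfolding mat_apply_def using j C_closed v w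
      by (simp, intro M.finsum_cong') (auto simp: smult_assoc1)
    also have "\<dots> = (\<Oplus>\<^bsub>R\<^esub>i\<in>I. C j i \<otimes> v i) \<odot>\<^bsub>M\<^esub> w"
      using j C_closed v w finI by (intro finsum_smult_rdistr) auto
    finally show ?thesis using w(2)[OF Cv[OF j]] by simp
  qed
  then have "?u i0 \<in> H" using 0(2) u v(2) unfolding inj_mod_def by blast
  then have "v i0 \<odot>\<^bsub>M\<^esub> w \<in> H" using v(2) by simp
  then show ?case using satur_submoduleD(2)[OF 0(1) w(1), of "v i0"] v w(3) by blast
next
  case (Suc k)
  note Hs = satur_submoduleD(1)[OF Suc.prems(1)]
  note C = coker_sat[OF Hs]
  \<comment> \<open>Both modules have positive depth, so one x serves for both. Dividing by it keeps
    C injective and lowers all three depth statements by one.\<close>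
  obtain x where x: "x \<in> q" "regular_mod M x H" "regular_mod (pow_module M J) x (coker_sub H)"
    using common_regular[OF Suc.prems(1) depth_ge_socle_free[OF Suc.prems(3)] P.depth_ge_socle_free[OF Suc.prems(4)]] by blast
  note xR = q_carrier[OF x(1)]
  show ?case
  proof (rule Suc.IH[OF step_sat[OF Hs xR] inj_mod_step[OF Suc.prems(1) x(1,3) Suc.prems(2) x(2)]
          depth_ge_step[OF Suc.prems(1) x(1,2) Suc.prems(3)]])
    show "P.dge k (coker_sub (step H x))"
      using P.depth_ge_step[OF C x(1,3) Suc.prems(4)] coker_step[OF Hs xR] by simp
    show "\<not> dge (Suc k) (step H x)" using Suc.prems(5) x by auto
  qed
qed

end

context modl
begin

lemma cong_finsum:
  assumes "submodule H R M" "\<And>i. i \<in> I \<Longrightarrow> mod_cong M H (f i) (g i)"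
  shows "mod_cong M H (\<Oplus>\<^bsub>M\<^esub>i\<in>I. f i) (\<Oplus>\<^bsub>M\<^esub>i\<in>I. g i)"
  using assms(2)
proof (induction I rule: infinite_finite_induct)
  case (insert i I)
  have c: "f j \<in> carrier M" "g j \<in> carrier M" if "j \<in> insert i I" for j
    using insert.prems[OF that] by (auto simp: mod_cong_def)
  have "(\<Oplus>\<^bsub>M\<^esub>j\<in>insert i I. f j) = f i \<oplus>\<^bsub>M\<^esub> (\<Oplus>\<^bsub>M\<^esub>j\<in>I. f j)"
    "(\<Oplus>\<^bsub>M\<^esub>j\<in>insert i I. g j) = g i \<oplus>\<^bsub>M\<^esub> (\<Oplus>\<^bsub>M\<^esub>j\<in>I. g j)"
    using insert.hyps c by (auto intro!: M.finsum_insert)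
  then show ?case using cong_add[OF assms(1) insert.prems[of i] insert.IH] insert.prems by auto
qed (auto intro: cong_refl[OF assms(1)])

end

context prime_modl
begin

subsection \<open>Maximal saturated submodules\<close>

text \<open>At q the quotient M/H is simple, hence the residue field: each y outside H generates it,
  and q annihilates it. This is the form in which Nakayama's lemma enters.\<close>

lemma maximal_saturated:
  assumes "satur R q M {\<zero>\<^bsub>M\<^esub>} \<noteq> carrier M"
  shows "\<exists>H. sat_sub H \<and> H \<noteq> carrier M \<and>
    (\<forall>y\<in>carrier M. \<forall>m\<in>carrier M. y \<notin> H \<longrightarrow>
       (\<exists>s\<in>carrier R - q. \<exists>r\<in>carrier R. cong H (s \<odot>\<^bsub>M\<^esub> m) (r \<odot>\<^bsub>M\<^esub> y))) \<and>
    (\<forall>r\<in>q. \<forall>y\<in>carrier M. r \<odot>\<^bsub>M\<^esub> y \<in> H)"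
proof -
  let ?F = "{H. sat_sub H \<and> H \<noteq> carrier M}"
  have "satur R q M {\<zero>\<^bsub>M\<^esub>} \<in> ?F" using assms satur_sat_sub[OF sub_zero_submodule] by simp
  then have ne: "?F \<noteq> {}" by (metis empty_iff)
  obtain H where H: "H \<in> ?F" "\<And>K. K \<in> ?F \<Longrightarrow> H \<subseteq> K \<Longrightarrow> K = H"
    by (rule fg_maximal_submodule[OF noeth fg ne]) (auto intro: satur_submoduleD(1))
  have Hsat: "sat_sub H" and Hne: "H \<noteq> carrier M" using H(1) by auto
  note Hs = satur_submoduleD(1)[OF Hsat]
  have gen: "\<exists>s\<in>carrier R - q. \<exists>r\<in>carrier R. cong H (s \<odot>\<^bsub>M\<^esub> m) (r \<odot>\<^bsub>M\<^esub> y)"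
    if y: "y \<in> carrier M" "y \<notin> H" and m: "m \<in> carrier M" for y m
  proof -
    let ?A = "{k \<oplus>\<^bsub>M\<^esub> r \<odot>\<^bsub>M\<^esub> y | k r. k \<in> H \<and> r \<in> carrier R}"
    note A = adjoin_submodule[OF Hs y(1)]
    have hs: "H \<subseteq> satur R q M ?A" and ys: "y \<in> satur R q M ?A"
      using satur_superset[OF A] adjoin_superset[OF Hs y(1)] by (meson subset_trans subsetD)+
    have "satur R q M ?A \<notin> ?F"
    proof
      assume "satur R q M ?A \<in> ?F"
      from H(2)[OF this hs] ys have "y \<in> H" by (simp only:)
      then show False using y(2) by simp
    qed
    then have "satur R q M ?A = carrier M" using satur_sat_sub[OF A] by simp
    then have "m \<in> satur R q M ?A" using m by simp
    then obtain s k r where s: "s \<in> carrier R - q" "k \<in> H" "r \<in> carrier R" "s \<odot>\<^bsub>M\<^esub> m = k \<oplus>\<^bsub>M\<^esub> r \<odot>\<^bsub>M\<^esub> y"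
      unfolding satur_def by blast
    have "cong H (s \<odot>\<^bsub>M\<^esub> m) (r \<odot>\<^bsub>M\<^esub> y)"
      by (rule cong_of_sum[OF Hs s(4,2)]) (use s(3) y in simp)
    then show ?thesis using s(1,3) by (intro bexI[of _ s] bexI[of _ r])
  qed
  have "r \<odot>\<^bsub>M\<^esub> y \<in> H" if r: "r \<in> q" and y: "y \<in> carrier M" for r y
  proof (rule ccontr)
    note rR = q_carrier[OF r]
    assume n: "r \<odot>\<^bsub>M\<^esub> y \<notin> H"
    \<comment> \<open>If ry generated the quotient, y would be a multiple of ry at q, so that s -
      r'r kills y modulo H; but s - r'r is outside q, which puts y into H.\<close>
    obtain s r' where s: "s \<in> carrier R - q" "r' \<in> carrier R" "cong H (s \<odot>\<^bsub>M\<^esub> y) (r' \<odot>\<^bsub>M\<^esub> (r \<odot>\<^bsub>M\<^esub> y))"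
      using gen[OF _ n y] rR y by auto
    have sR: "s \<in> carrier R" using s by simp
    have e: "s \<odot>\<^bsub>M\<^esub> y \<ominus>\<^bsub>M\<^esub> r' \<odot>\<^bsub>M\<^esub> (r \<odot>\<^bsub>M\<^esub> y) = (s \<ominus> r' \<otimes> r) \<odot>\<^bsub>M\<^esub> y"
      using sR s(2) rR y by (simp add: M.minus_eq R.minus_eq smult_l_distr smult_l_minus smult_assoc1)
    have "s \<ominus> r' \<otimes> r \<notin> q"
    proof
      assume "s \<ominus> r' \<otimes> r \<in> q"
      moreover have "r' \<otimes> r \<in> q" using I_l_closed[OF r s(2)] .
      ultimately have "(s \<ominus> r' \<otimes> r) \<oplus> r' \<otimes> r \<in> q" by (rule a_closed)
      then have "s \<in> q" using sR s(2) rR by (simp add: R.minus_eq R.a_assoc R.l_neg)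
      then show False using s(1) by simp
    qed
    moreover have "(s \<ominus> r' \<otimes> r) \<odot>\<^bsub>M\<^esub> y \<in> H" using s(3) e by (simp add: mod_cong_def)
    ultimately have "y \<in> H" using satur_submoduleD(2)[OF Hsat y, of "s \<ominus> r' \<otimes> r"] sR s(2) rR by simp
    then show False using n submoduleE(4)[OF Hs rR] by simp
  qed
  then show ?thesis using Hsat Hne gen by (intro exI[of _ H] conjI ballI impI)
qed

text \<open>v collects the coordinates of the generators \<open>e i\<close> in the residue field
  quotient at q, cleared of denominators. The relations Ce = 0 turn into Cv in q, and some entry of
  v is a unit because the generators do not all vanish in the quotient.\<close>

lemma residual_vector:
  assumes e: "e ` I \<subseteq> carrier M" "submodule_span R M (e ` I) = carrier M" "finite I"
    and C: "\<And>j i. j \<in> J \<Longrightarrow> i \<in> I \<Longrightarrow> C j i \<in> carrier R"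
    and Ce: "\<And>j. j \<in> J \<Longrightarrow> (\<Oplus>\<^bsub>M\<^esub>i\<in>I. C j i \<odot>\<^bsub>M\<^esub> e i) = \<zero>\<^bsub>M\<^esub>"
    and ne: "satur R q M {\<zero>\<^bsub>M\<^esub>} \<noteq> carrier M"
  obtains v i0 where "\<And>i. i \<in> I \<Longrightarrow> v i \<in> carrier R" "i0 \<in> I" "v i0 \<notin> q"
    "\<And>j. j \<in> J \<Longrightarrow> (\<Oplus>\<^bsub>R\<^esub>i\<in>I. C j i \<otimes> v i) \<in> q"
proof -
  obtain H where H: "sat_sub H" "H \<noteq> carrier M"
    and gen': "\<forall>y\<in>carrier M. \<forall>m\<in>carrier M. y \<notin> H \<longrightarrow>
       (\<exists>s\<in>carrier R - q. \<exists>r\<in>carrier R. cong H (s \<odot>\<^bsub>M\<^esub> m) (r \<odot>\<^bsub>M\<^esub> y))"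
    and qH': "\<forall>r\<in>q. \<forall>y\<in>carrier M. r \<odot>\<^bsub>M\<^esub> y \<in> H"
    using maximal_saturated[OF ne] by (elim exE conjE)
  note gen = gen'[rule_format] and qH = qH'[rule_format]
  note Hs = satur_submoduleD(1)[OF H(1)]
  obtain y where y: "y \<in> carrier M" "y \<notin> H" using H(2) sub_in[OF Hs] by (metis subsetI subset_antisym)
  have eM: "e i \<in> carrier M" if "i \<in> I" for i using e that by auto
  have "\<exists>s\<in>carrier R - q. \<forall>i\<in>I. \<exists>r\<in>carrier R. cong H (s \<odot>\<^bsub>M\<^esub> e i) (r \<odot>\<^bsub>M\<^esub> y)"
  proof (rule common_denominator[OF e(3)])
    fix i assume "i \<in> I"
    then show "\<exists>s\<in>carrier R - q. \<exists>r\<in>carrier R. cong H (s \<odot>\<^bsub>M\<^esub> e i) (r \<odot>\<^bsub>M\<^esub> y)" using gen[OF y(1) eM y(2)] by simp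
  next
    fix i s t assume i: "i \<in> I" and st: "s \<in> carrier R - q" "t \<in> carrier R - q"
      and "\<exists>r\<in>carrier R. cong H (s \<odot>\<^bsub>M\<^esub> e i) (r \<odot>\<^bsub>M\<^esub> y)"
    then obtain r where r: "r \<in> carrier R" "cong H (s \<odot>\<^bsub>M\<^esub> e i) (r \<odot>\<^bsub>M\<^esub> y)" by auto
    have "cong H ((t \<otimes> s) \<odot>\<^bsub>M\<^esub> e i) ((t \<otimes> r) \<odot>\<^bsub>M\<^esub> y)"
      using cong_smult[OF Hs r(2), of t] st eM[OF i] r y by (simp add: smult_assoc1)
    then show "\<exists>r\<in>carrier R. cong H ((t \<otimes> s) \<odot>\<^bsub>M\<^esub> e i) (r \<odot>\<^bsub>M\<^esub> y)" using st r by (intro bexI[of _ "t \<otimes> r"]) auto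
  qed
  then obtain s where s: "s \<in> carrier R - q"
    and sr: "\<And>i. i \<in> I \<Longrightarrow> \<exists>r\<in>carrier R. cong H (s \<odot>\<^bsub>M\<^esub> e i) (r \<odot>\<^bsub>M\<^esub> y)" by auto
  obtain v where v: "\<And>i. i \<in> I \<Longrightarrow> v i \<in> carrier R \<and> cong H (s \<odot>\<^bsub>M\<^esub> e i) (v i \<odot>\<^bsub>M\<^esub> y)" using sr by metis
  have sR: "s \<in> carrier R" using s by simp
  have "(\<Oplus>\<^bsub>R\<^esub>i\<in>I. C j i \<otimes> v i) \<in> q" if j: "j \<in> J" for j
  proof -
    have c: "(\<Oplus>\<^bsub>R\<^esub>i\<in>I. C j i \<otimes> v i) \<in> carrier R" using C j v by (intro R.finsum_closed) auto
    have "cong H (\<Oplus>\<^bsub>M\<^esub>i\<in>I. C j i \<odot>\<^bsub>M\<^esub> (s \<odot>\<^bsub>M\<^esub> e i)) (\<Oplus>\<^bsub>M\<^esub>i\<in>I. C j i \<odot>\<^bsub>M\<^esub> (v i \<odot>\<^bsub>M\<^esub> y))"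
      by (rule cong_finsum[OF Hs]) (use cong_smult[OF Hs] v C j in blast)
    moreover have "(\<Oplus>\<^bsub>M\<^esub>i\<in>I. C j i \<odot>\<^bsub>M\<^esub> (s \<odot>\<^bsub>M\<^esub> e i)) = s \<odot>\<^bsub>M\<^esub> (\<Oplus>\<^bsub>M\<^esub>i\<in>I. C j i \<odot>\<^bsub>M\<^esub> e i)"
    proof -
      have "s \<odot>\<^bsub>M\<^esub> (\<Oplus>\<^bsub>M\<^esub>i\<in>I. C j i \<odot>\<^bsub>M\<^esub> e i) = (\<Oplus>\<^bsub>M\<^esub>i\<in>I. s \<odot>\<^bsub>M\<^esub> (C j i \<odot>\<^bsub>M\<^esub> e i))"
        using C j eM e(3) sR by (intro finsum_smult_ldistr) auto
      also have "\<dots> = (\<Oplus>\<^bsub>M\<^esub>i\<in>I. C j i \<odot>\<^bsub>M\<^esub> (s \<odot>\<^bsub>M\<^esub> e i))"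
        using C j eM sR by (intro M.finsum_cong') (auto simp: smult_commute)
      finally show ?thesis by simp
    qed
    moreover have "(\<Oplus>\<^bsub>M\<^esub>i\<in>I. C j i \<odot>\<^bsub>M\<^esub> (v i \<odot>\<^bsub>M\<^esub> y)) = (\<Oplus>\<^bsub>R\<^esub>i\<in>I. C j i \<otimes> v i) \<odot>\<^bsub>M\<^esub> y"
    proof -
      have "(\<Oplus>\<^bsub>M\<^esub>i\<in>I. C j i \<odot>\<^bsub>M\<^esub> (v i \<odot>\<^bsub>M\<^esub> y)) = (\<Oplus>\<^bsub>M\<^esub>i\<in>I. (C j i \<otimes> v i) \<odot>\<^bsub>M\<^esub> y)"
        using C j v y by (intro M.finsum_cong') (auto simp: smult_assoc1)
      also have "\<dots> = (\<Oplus>\<^bsub>R\<^esub>i\<in>I. C j i \<otimes> v i) \<odot>\<^bsub>M\<^esub> y"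
        using C j v y e(3) by (intro finsum_smult_rdistr) auto
      finally show ?thesis .
    qed
    ultimately have "cong H \<zero>\<^bsub>M\<^esub> ((\<Oplus>\<^bsub>R\<^esub>i\<in>I. C j i \<otimes> v i) \<odot>\<^bsub>M\<^esub> y)" using Ce[OF j] sR by simp
    then have "(\<Oplus>\<^bsub>R\<^esub>i\<in>I. C j i \<otimes> v i) \<odot>\<^bsub>M\<^esub> y \<in> H" using cong_in_iff[OF Hs] sub_zero[OF Hs] by metis
    then show ?thesis using satur_submoduleD(2)[OF H(1) y(1), of "\<Oplus>\<^bsub>R\<^esub>i\<in>I. C j i \<otimes> v i"] c y(2) by (metis DiffI)
  qed
  moreover have "\<exists>i0\<in>I. v i0 \<notin> q"
  proof (rule ccontr)
    assume n: "\<not> (\<exists>i0\<in>I. v i0 \<notin> q)"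
    have "e i \<in> H" if i: "i \<in> I" for i
    proof -
      have "v i \<odot>\<^bsub>M\<^esub> y \<in> H" using n i qH y by metis
      then have "s \<odot>\<^bsub>M\<^esub> e i \<in> H" using v[OF i] cong_in_iff[OF Hs] by metis
      then show ?thesis using satur_submoduleD(2)[OF H(1) eM[OF i] s] by simp
    qed
    then have "submodule_span R M (e ` I) \<subseteq> H" by (intro span_least[OF Hs]) auto
    then show False using y e(2) by auto
  qed
  ultimately show ?thesis using that v by metis
qed

end

subsection \<open>Depth and chains of primes\<close>

text \<open>An ideal maximal among those that contain H and miss T is prime: for a and b outside it,
  both enlarged ideals meet T, and the product of the two elements of T would lie in the ideal if ab
  did.\<close>

lemma ex_prime_disjoint:
  fixes R (structure)
  assumes "cring R" "noetherian_ring R" "ideal H R" "T \<subseteq> carrier R" "\<one> \<in> T"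
    and mult: "\<And>s t. s \<in> T \<Longrightarrow> t \<in> T \<Longrightarrow> s \<otimes> t \<in> T" and dis: "H \<inter> T = {}"
  obtains Q where "primeideal Q R" "H \<subseteq> Q" "Q \<inter> T = {}"
proof -
  interpret cring R by fact
  interpret S: modl R "self_module R" by (rule modl.intro[OF self_module_module[OF assms(1)]])
  let ?F = "{I. ideal I R \<and> H \<subseteq> I \<and> I \<inter> T = {}}"
  have "H \<in> ?F" using assms by simp
  then have ne: "?F \<noteq> {}" by (metis empty_iff)
  obtain I where I: "I \<in> ?F" "\<And>J. J \<in> ?F \<Longrightarrow> I \<subseteq> J \<Longrightarrow> J = I"
    by (rule noetherian_maximal_ideal[OF assms(1,2) ne]) auto
  have Ii: "ideal I R" and HI: "H \<subseteq> I" and IT: "I \<inter> T = {}" using I(1) by auto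
  have IS: "submodule I R (self_module R)" using Ii ideal_iff_submodule[OF assms(1)] by simp
  have meet: "\<exists>k\<in>I. \<exists>r\<in>carrier R. k \<oplus> r \<otimes> a \<in> T" if a: "a \<in> carrier R" "a \<notin> I" for a
  proof -
    let ?A = "{k \<oplus>\<^bsub>self_module R\<^esub> r \<odot>\<^bsub>self_module R\<^esub> a | k r. k \<in> I \<and> r \<in> carrier R}"
    have "submodule ?A R (self_module R)" using S.adjoin_submodule[OF IS, of a] a by simp
    then have "ideal ?A R" by (simp only: ideal_iff_submodule[OF assms(1)])
    moreover have Is: "I \<subseteq> ?A" and as: "a \<in> ?A" using S.adjoin_superset[OF IS, of a] a by simp_all
    moreover have "?A \<notin> ?F"
    proof
      assume "?A \<in> ?F"
      from I(2)[OF this Is] as have "a \<in> I" by (simp only:)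
      then show False using a(2) by simp
    qed
    moreover have "H \<subseteq> ?A" by (rule subset_trans[OF HI Is])
    ultimately have "?A \<inter> T \<noteq> {}" by simp
    then show ?thesis by auto
  qed
  have "primeideal I R"
  proof (rule primeidealI[OF Ii assms(1)])
    show "carrier R \<noteq> I" using IT assms(5) by auto
  next
    fix a b assume ab: "a \<in> carrier R" "b \<in> carrier R" "a \<otimes> b \<in> I"
    show "a \<in> I \<or> b \<in> I"
    proof (rule ccontr)
      assume "\<not> (a \<in> I \<or> b \<in> I)"
      then obtain k r k' r' where k: "k \<in> I" "r \<in> carrier R" "k \<oplus> r \<otimes> a \<in> T" and k': "k' \<in> I" "r' \<in> carrier R" "k' \<oplus> r' \<otimes> b \<in> T"
        using meet ab by meson
      note kR = ideal.Icarr[OF Ii k(1)] ideal.Icarr[OF Ii k'(1)]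
      have "(k \<oplus> r \<otimes> a) \<otimes> (k' \<oplus> r' \<otimes> b) \<in> T" using mult k k' by simp
      moreover have "(k \<oplus> r \<otimes> a) \<otimes> (k' \<oplus> r' \<otimes> b) = ((k' \<oplus> r' \<otimes> b) \<otimes> k \<oplus> (r \<otimes> a) \<otimes> k') \<oplus> (r \<otimes> r') \<otimes> (a \<otimes> b)"
        using kR k k' ab by algebra
      moreover have "((k' \<oplus> r' \<otimes> b) \<otimes> k \<oplus> (r \<otimes> a) \<otimes> k') \<oplus> (r \<otimes> r') \<otimes> (a \<otimes> b) \<in> I"
      proof (intro additive_subgroup.a_closed[OF ideal.axioms(1)[OF Ii]])
        show "(k' \<oplus> r' \<otimes> b) \<otimes> k \<in> I" by (rule ideal.I_l_closed[OF Ii k(1)]) (use kR k' ab in simp)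
        show "(r \<otimes> a) \<otimes> k' \<in> I" by (rule ideal.I_l_closed[OF Ii k'(1)]) (use k ab in simp)
        show "(r \<otimes> r') \<otimes> (a \<otimes> b) \<in> I" by (rule ideal.I_l_closed[OF Ii ab(3)]) (use k k' in simp)
      qed
      ultimately show False using IT by auto
    qed
  qed
  then show ?thesis using that HI IT by blast
qed

text \<open>Depth is at most height. The chain grows downwards from q: a regular x at H contributes
  a prime \<open>Q0\<close> over H without x, strictly below the bottom prime \<open>Q1\<close> of
  the chain already found above H + xR.\<close>

lemma depth_prime_chain:
  fixes R (structure)
  assumes "prime_modl q R (self_module R)" and H: "saturated_submodule R q (self_module R) H" "H \<subseteq> q"
    and "depth_ge R q (self_module R) k H"
  shows "\<exists>ps. prime_chain R ps \<and> last ps = q \<and> length ps = Suc k \<and> H \<subseteq> hd ps"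
  using assms(2-4)
proof (induction k arbitrary: H)
  case 0
  interpret prime_modl q R "self_module R" by fact
  show ?case using 0
    by (intro exI[of _ "[q]"]) (auto simp: prime_chain_def Spec_def primeideal_axioms)
next
  case (Suc k)
  interpret prime_modl q R "self_module R" by fact
  note Hs = satur_submoduleD(1)[OF Suc.prems(1)]
  obtain x where x: "x \<in> q" "regular_mod (self_module R) x H" "dge k (step H x)" using Suc.prems by auto
  note xR = q_carrier[OF x(1)]
  have qsat: "sat_sub q"
    unfolding saturated_submodule_def
    using ideal_iff_submodule[OF R.is_cring] is_ideal I_prime by auto
  have "step H x \<subseteq> q"
    by (rule step_least[OF qsat Suc.prems(2)]) (use x(1) I_r_closed in auto)
  then obtain ps where ps: "prime_chain R ps" "last ps = q" "length ps = Suc k" "step H x \<subseteq> hd ps"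
    using Suc.IH[OF step_sat[OF Hs xR] _ x(3)] by metis
  obtain Q1 qs where Q1: "ps = Q1 # qs" using ps(3) by (cases ps) auto
  have pQ1: "primeideal Q1 R" using ps(1) Q1 by (auto simp: prime_chain_def Spec_def)
  have idQ1: "ideal Q1 R" using primeideal.axioms(1)[OF pQ1] .
  have H1: "H \<subseteq> Q1" using step_superset[OF Hs xR] ps(4) Q1 by auto
  have "x \<odot>\<^bsub>self_module R\<^esub> \<one> \<in> step H x" using step_smult[OF Hs xR] by simp
  then have x1: "x \<in> Q1" using ps(4) Q1 xR by auto
  \<comment> \<open>A prime disjoint from this set lies inside \<open>Q1\<close> (take i = 0) and
    omits x (take u = 1). H misses the set because x is regular modulo H and H lies in
    \<open>Q1\<close>.\<close>
  let ?T = "{x [^] (i::nat) \<otimes> u | i u. u \<in> carrier R - Q1}"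
  have oneQ: "\<one> \<in> carrier R - Q1" using primeideal.I_notcarr[OF pQ1] ideal.one_imp_carrier[OF idQ1] by auto
  have Hid: "ideal H R" using Hs ideal_iff_submodule[OF R.is_cring] by simp
  have pw: "u \<in> H" if "x [^] (i::nat) \<otimes> u \<in> H" "u \<in> carrier R" for i u
    using that(1)
  proof (induction i)
    case 0 then show ?case using that(2) by simp
  next
    case (Suc i)
    have "x \<odot>\<^bsub>self_module R\<^esub> (x [^] i \<otimes> u) \<in> H"
      using Suc.prems that(2) xR by (simp add: R.m_ac)
    then have "x [^] i \<otimes> u \<in> H" using x(2) that(2) xR by (auto simp: regular_mod_def)
    then show ?case by (rule Suc.IH)
  qed
  obtain Q0 where Q0: "primeideal Q0 R" "H \<subseteq> Q0" "Q0 \<inter> ?T = {}"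
  proof (rule ex_prime_disjoint[OF R.is_cring noeth Hid, of ?T])
    show "?T \<subseteq> carrier R" using xR by auto
    show "\<one> \<in> ?T" using oneQ by (intro CollectI exI[of _ "0::nat"] exI[of _ \<one>]) simp
    show "H \<inter> ?T = {}" using pw H1 by auto
  next
    fix s t assume "s \<in> ?T" "t \<in> ?T"
    then obtain i u i' u' where s: "s = x [^] (i::nat) \<otimes> u" "t = x [^] (i'::nat) \<otimes> u'" "u \<in> carrier R - Q1" "u' \<in> carrier R - Q1"
      by auto
    have "u \<otimes> u' \<in> carrier R - Q1" using primeideal.I_prime[OF pQ1] s by auto
    moreover have "s \<otimes> t = x [^] (i + i') \<otimes> (u \<otimes> u')"
      using s xR by (simp add: R.nat_pow_mult[symmetric] R.m_ac)
    ultimately show "s \<otimes> t \<in> ?T" by blast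
  qed
  have "Q0 \<subseteq> Q1"
  proof
    fix a assume a: "a \<in> Q0"
    then have "a \<in> carrier R" using ideal.Icarr[OF primeideal.axioms(1)[OF Q0(1)]] by auto
    moreover have "a \<notin> ?T" using Q0(3) a by auto
    ultimately show "a \<in> Q1" by (auto dest!: spec[of _ "0::nat"])
  qed
  moreover have "x \<in> ?T" using xR oneQ by (intro CollectI exI[of _ "1::nat"] exI[of _ \<one>]) simp
  then have "x \<notin> Q0" using Q0(3) by auto
  ultimately have sub: "Q0 \<subset> Q1" using x1 by auto
  have "prime_chain R (Q0 # ps)"
    using ps(1) Q0(1) sub unfolding prime_chain_def Q1 Spec_def by fastforce
  then show ?case using ps Q0(2) Q1 by (intro exI[of _ "Q0 # ps"]) auto
qed

subsection \<open>Pulling back along surjections\<close>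

text \<open>By the isomorphism theorem, M modulo the preimage of H is N/H. Depths of a quotient are
  thus computed inside the module that covers it.\<close>

lemma depth_ge_pullback:
  assumes A: "prime_modl q R M" and B: "prime_modl q R N" and p: "\<pi> \<in> module_hom R M N" "\<pi> ` carrier M = carrier N"
    and H: "saturated_submodule R q N H"
  shows "depth_ge R q M k {m \<in> carrier M. \<pi> m \<in> H} \<longleftrightarrow> depth_ge R q N k H"
  using H
proof (induction k arbitrary: H)
  case (Suc k)
  interpret A: prime_modl q R M by fact
  interpret B: prime_modl q R N by fact
  note h = module_homD[OF p(1)]
  note Hs = satur_submoduleD(1)[OF Suc.prems]
  let ?V = "\<lambda>H. {m \<in> carrier M. \<pi> m \<in> H}"
  have V: "A.sat_sub (?V H)" if "B.sat_sub H" for H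
    using A.module_hom_submodule_eq[OF B.module_axioms p(1) satur_submoduleD(1)[OF that]] satur_submoduleD(2)[OF that]
    unfolding saturated_submodule_def by (auto simp: h)
  note Vs = satur_submoduleD(1)[OF V[OF Suc.prems]]
  have st: "A.step (?V H) x = ?V (B.step H x)" if x: "x \<in> carrier R" for x
  proof
    show "A.step (?V H) x \<subseteq> ?V (B.step H x)"
    proof (rule A.step_least[OF V[OF B.step_sat[OF Hs x]]])
      show "?V H \<subseteq> ?V (B.step H x)" using B.step_superset[OF Hs x] by blast
      fix m assume m: "m \<in> carrier M"
      then show "x \<odot>\<^bsub>M\<^esub> m \<in> ?V (B.step H x)" using B.step_smult[OF Hs x h(1)[OF m]] x by (simp add: h)
    qed
    show "?V (B.step H x) \<subseteq> A.step (?V H) x"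
    proof
      fix m assume "m \<in> ?V (B.step H x)"
      then have m: "m \<in> carrier M" "\<pi> m \<in> B.step H x" by auto
      then obtain s w where s: "s \<in> carrier R - q" "w \<in> carrier N" "B.cong H (s \<odot>\<^bsub>N\<^esub> \<pi> m) (x \<odot>\<^bsub>N\<^esub> w)"
        unfolding B.mem_step[OF Hs x] by metis
      obtain w' where w': "w' \<in> carrier M" "w = \<pi> w'" using s(2) p(2) by (metis imageE)
      have sR: "s \<in> carrier R" using s by simp
      have "\<pi> (s \<odot>\<^bsub>M\<^esub> m \<ominus>\<^bsub>M\<^esub> x \<odot>\<^bsub>M\<^esub> w') = s \<odot>\<^bsub>N\<^esub> \<pi> m \<ominus>\<^bsub>N\<^esub> x \<odot>\<^bsub>N\<^esub> w"
        using A.hom_minus[OF B.module_axioms p(1)] sR m w' x by (simp add: h)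
      then have c: "A.cong (?V H) (s \<odot>\<^bsub>M\<^esub> m) (x \<odot>\<^bsub>M\<^esub> w')" using s sR m w' x by (simp add: mod_cong_def)
      show "m \<in> A.step (?V H) x" unfolding A.mem_step[OF Vs x]
        using c m(1) s(1) w'(1) by (intro conjI bexI[of _ s] bexI[of _ w'])
    qed
  qed
  have "regular_mod M x (?V H) \<longleftrightarrow> regular_mod N x H" if x: "x \<in> q" for x
  proof -
    have xR: "x \<in> carrier R" by (rule A.q_carrier[OF x])
    have "regular_mod M x (?V H) \<longleftrightarrow> (\<forall>m\<in>carrier M. x \<odot>\<^bsub>N\<^esub> \<pi> m \<in> H \<longrightarrow> \<pi> m \<in> H)"
      using xR by (simp add: regular_mod_def h)
    also have "\<dots> \<longleftrightarrow> regular_mod N x H" unfolding regular_mod_def p(2)[symmetric] by simp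
    finally show ?thesis .
  qed
  moreover have "depth_ge R q M k (A.step (?V H) x) \<longleftrightarrow> depth_ge R q N k (B.step H x)" if "x \<in> q" for x
    using Suc.IH[OF B.step_sat[OF Hs A.q_carrier[OF that]]] st[OF A.q_carrier[OF that]] by simp
  ultimately show ?case by auto
qed simp

section \<open>Quotient modules and regular sequences\<close>

lemma quot_module_simps:
  "carrier (quot_module M H) = {H +>\<^bsub>M\<^esub> x | x. x \<in> carrier M}"
  "\<zero>\<^bsub>quot_module M H\<^esub> = H"
  by (auto simp: quot_module_def A_RCOSETS_def')

context modl
begin

lemma minus_zero_eq:
  assumes "x \<in> carrier M" "y \<in> carrier M" "x \<ominus>\<^bsub>M\<^esub> y = \<zero>\<^bsub>M\<^esub>"
  shows "x = y"
proof -
  have "(x \<ominus>\<^bsub>M\<^esub> y) \<oplus>\<^bsub>M\<^esub> y = x" using assms(1,2) by (simp add: M.minus_eq M.a_assoc M.l_neg)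
  then show ?thesis using assms by simp
qed

lemma coset_mem:
  assumes "submodule H R M" "x \<in> carrier M"
  shows "z \<in> H +>\<^bsub>M\<^esub> x \<longleftrightarrow> mod_cong M H z x"
proof
  assume "z \<in> H +>\<^bsub>M\<^esub> x"
  then obtain h where "h \<in> H" "z = h \<oplus>\<^bsub>M\<^esub> x" by (auto simp: a_r_coset_def')
  then show "mod_cong M H z x" using cong_of_sum[OF assms(1)] assms(2) by blast
next
  assume "mod_cong M H z x"
  then show "z \<in> H +>\<^bsub>M\<^esub> x" using cong_diff by (fastforce simp: a_r_coset_def')
qed

lemma coset_eq_iff:
  assumes "submodule H R M" "x \<in> carrier M" "y \<in> carrier M"
  shows "H +>\<^bsub>M\<^esub> x = H +>\<^bsub>M\<^esub> y \<longleftrightarrow> mod_cong M H x y"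
proof
  assume "H +>\<^bsub>M\<^esub> x = H +>\<^bsub>M\<^esub> y"
  moreover have "x \<in> H +>\<^bsub>M\<^esub> x" using coset_mem[OF assms(1,2)] cong_refl assms by blast
  ultimately show "mod_cong M H x y" using coset_mem[OF assms(1,3)] by blast
next
  assume "mod_cong M H x y"
  then show "H +>\<^bsub>M\<^esub> x = H +>\<^bsub>M\<^esub> y"
    using coset_mem[OF assms(1,3)] coset_mem[OF assms(1,2)] cong_trans cong_sym assms(1) by blast
qed

lemma coset_eq_sub:
  assumes "submodule H R M" "x \<in> carrier M"
  shows "H +>\<^bsub>M\<^esub> x = H \<longleftrightarrow> x \<in> H"
proof -
  have "H +>\<^bsub>M\<^esub> \<zero>\<^bsub>M\<^esub> = H" using sub_in[OF assms(1)] by (force simp: a_r_coset_def')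
  then show ?thesis using coset_eq_iff[OF assms, of "\<zero>\<^bsub>M\<^esub>"] cong_zero_iff[OF assms(1)] by auto
qed

lemma coset_add:
  assumes "submodule H R M" "x \<in> carrier M" "y \<in> carrier M"
  shows "(H +>\<^bsub>M\<^esub> x) \<oplus>\<^bsub>quot_module M H\<^esub> (H +>\<^bsub>M\<^esub> y) = H +>\<^bsub>M\<^esub> (x \<oplus>\<^bsub>M\<^esub> y)"
proof -
  have "additive_subgroup H M" using submodule.axioms(1)[OF assms(1)] by (rule additive_subgroup.intro)
  then have "abelian_subgroup H M" by (intro abelian_subgroupI3 M.abelian_group_axioms)
  then show ?thesis using abelian_subgroup.a_rcos_sum assms by (simp add: quot_module_def)
qed

lemma coset_smult:
  assumes "submodule H R M" "x \<in> carrier M" "a \<in> carrier R"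
  shows "a \<odot>\<^bsub>quot_module M H\<^esub> (H +>\<^bsub>M\<^esub> x) = H +>\<^bsub>M\<^esub> (a \<odot>\<^bsub>M\<^esub> x)"
proof -
  have e: "H +>\<^bsub>M\<^esub> (a \<odot>\<^bsub>M\<^esub> z) = H +>\<^bsub>M\<^esub> (a \<odot>\<^bsub>M\<^esub> x)" if "z \<in> H +>\<^bsub>M\<^esub> x" for z
  proof -
    have c: "mod_cong M H z x" using that coset_mem[OF assms(1,2)] by simp
    then have "z \<in> carrier M" by (simp add: mod_cong_def)
    then show ?thesis using cong_smult[OF assms(1) c assms(3)] coset_eq_iff[OF assms(1)] assms by simp
  qed
  have "x \<in> H +>\<^bsub>M\<^esub> x" using coset_mem[OF assms(1,2)] cong_refl assms by blast
  then have "(\<Union>z\<in>H +>\<^bsub>M\<^esub> x. H +>\<^bsub>M\<^esub> (a \<odot>\<^bsub>M\<^esub> z)) = H +>\<^bsub>M\<^esub> (a \<odot>\<^bsub>M\<^esub> x)"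
    by (rule UN_constant_eq) (use e in blast)
  then show ?thesis by (simp add: quot_module_def)
qed

lemma quot_module_module:
  assumes H: "submodule H R M"
  shows "module R (quot_module M H)"
proof -
  let ?Q = "quot_module M H"
  note cl = quot_module_simps(1)[of M H]
  have zero: "\<zero>\<^bsub>?Q\<^esub> = H +>\<^bsub>M\<^esub> \<zero>\<^bsub>M\<^esub>"
    using coset_eq_sub[OF H, of "\<zero>\<^bsub>M\<^esub>"] sub_zero[OF H] by (simp add: quot_module_simps)
  have ex: "\<exists>x\<in>carrier M. C = H +>\<^bsub>M\<^esub> x" if "C \<in> carrier ?Q" for C using that cl by auto
  have mem: "H +>\<^bsub>M\<^esub> x \<in> carrier ?Q" if "x \<in> carrier M" for x using that cl by auto
  show ?thesis
  proof (intro moduleI abelian_groupI' R.is_cring)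
    fix C D assume "C \<in> carrier ?Q" "D \<in> carrier ?Q"
    then obtain x y where xy: "x \<in> carrier M" "C = H +>\<^bsub>M\<^esub> x" "y \<in> carrier M" "D = H +>\<^bsub>M\<^esub> y" using ex by metis
    then show "C \<oplus>\<^bsub>?Q\<^esub> D \<in> carrier ?Q" "C \<oplus>\<^bsub>?Q\<^esub> D = D \<oplus>\<^bsub>?Q\<^esub> C"
      by (simp_all add: coset_add[OF H] mem M.a_comm)
    { fix E assume "E \<in> carrier ?Q"
      then obtain z where z: "z \<in> carrier M" "E = H +>\<^bsub>M\<^esub> z" using ex by metis
      then show "(C \<oplus>\<^bsub>?Q\<^esub> D) \<oplus>\<^bsub>?Q\<^esub> E = C \<oplus>\<^bsub>?Q\<^esub> (D \<oplus>\<^bsub>?Q\<^esub> E)"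
        using xy by (simp add: coset_add[OF H] M.a_assoc) }
    { fix a assume a: "a \<in> carrier R"
      then show "a \<odot>\<^bsub>?Q\<^esub> (C \<oplus>\<^bsub>?Q\<^esub> D) = a \<odot>\<^bsub>?Q\<^esub> C \<oplus>\<^bsub>?Q\<^esub> a \<odot>\<^bsub>?Q\<^esub> D"
        using xy by (simp add: coset_add[OF H] coset_smult[OF H] smult_r_distr) }
  next
    show "\<zero>\<^bsub>?Q\<^esub> \<in> carrier ?Q" using zero mem by simp
  next
    fix C assume "C \<in> carrier ?Q"
    then obtain x where x: "x \<in> carrier M" "C = H +>\<^bsub>M\<^esub> x" using ex by metis
    then show "\<zero>\<^bsub>?Q\<^esub> \<oplus>\<^bsub>?Q\<^esub> C = C" "\<one> \<odot>\<^bsub>?Q\<^esub> C = C"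
      by (simp_all add: zero coset_add[OF H] coset_smult[OF H])
    show "\<exists>D\<in>carrier ?Q. D \<oplus>\<^bsub>?Q\<^esub> C = \<zero>\<^bsub>?Q\<^esub>"
      by (rule bexI[of _ "H +>\<^bsub>M\<^esub> (\<ominus>\<^bsub>M\<^esub> x)"]) (use x in \<open>simp_all add: zero coset_add[OF H] mem M.l_neg\<close>)
    { fix a assume a: "a \<in> carrier R"
      then show "a \<odot>\<^bsub>?Q\<^esub> C \<in> carrier ?Q" using x by (simp add: coset_smult[OF H] mem)
      fix b assume b: "b \<in> carrier R"
      then show "(a \<oplus> b) \<odot>\<^bsub>?Q\<^esub> C = a \<odot>\<^bsub>?Q\<^esub> C \<oplus>\<^bsub>?Q\<^esub> b \<odot>\<^bsub>?Q\<^esub> C"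
        "(a \<otimes> b) \<odot>\<^bsub>?Q\<^esub> C = a \<odot>\<^bsub>?Q\<^esub> (b \<odot>\<^bsub>?Q\<^esub> C)"
        using a x by (simp_all add: coset_smult[OF H] coset_add[OF H] smult_l_distr smult_assoc1) }
  qed
qed

lemma quot_proj_hom: "submodule H R M \<Longrightarrow> (\<lambda>x. H +>\<^bsub>M\<^esub> x) \<in> module_hom R M (quot_module M H)"
  by (rule module_homI) (auto simp: coset_add coset_smult quot_module_simps)

lemma quot_factor:
  assumes H: "submodule H R M" and T: "module R T" and k: "k \<in> module_hom R M T" and kH: "\<And>x. x \<in> H \<Longrightarrow> k x = \<zero>\<^bsub>T\<^esub>"
  obtains h where "h \<in> module_hom R (quot_module M H) T" "\<And>x. x \<in> carrier M \<Longrightarrow> h (H +>\<^bsub>M\<^esub> x) = k x"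
proof -
  interpret T: modl R T by (rule modl.intro[OF T])
  note kk = module_homD[OF k]
  define h where "h C = k (SOME x. x \<in> carrier M \<and> H +>\<^bsub>M\<^esub> x = C)" for C
  have h: "h (H +>\<^bsub>M\<^esub> x) = k x" if x: "x \<in> carrier M" for x
  proof -
    let ?y = "SOME y. y \<in> carrier M \<and> H +>\<^bsub>M\<^esub> y = H +>\<^bsub>M\<^esub> x"
    have y: "?y \<in> carrier M \<and> H +>\<^bsub>M\<^esub> ?y = H +>\<^bsub>M\<^esub> x" by (rule someI[of _ x]) (use x in simp)
    then have "mod_cong M H ?y x" using coset_eq_iff[OF H] x by blast
    then have "k (?y \<ominus>\<^bsub>M\<^esub> x) = \<zero>\<^bsub>T\<^esub>" using kH by (simp add: mod_cong_def)
    then have "k ?y \<ominus>\<^bsub>T\<^esub> k x = \<zero>\<^bsub>T\<^esub>" using hom_minus[OF T k] y x by simp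
    then have "k ?y = k x" using T.minus_zero_eq[OF kk(1) kk(1)] y x by blast
    then show ?thesis by (simp add: h_def)
  qed
  have ex: "\<exists>x\<in>carrier M. C = H +>\<^bsub>M\<^esub> x" if "C \<in> carrier (quot_module M H)" for C
    using that quot_module_simps(1)[of M H] by auto
  have "h \<in> module_hom R (quot_module M H) T"
  proof (rule module_homI)
    fix C assume "C \<in> carrier (quot_module M H)"
    then obtain x where x: "x \<in> carrier M" "C = H +>\<^bsub>M\<^esub> x" using ex by metis
    then show "h C \<in> carrier T" by (simp add: h kk)
    fix a assume "a \<in> carrier R"
    then show "h (a \<odot>\<^bsub>quot_module M H\<^esub> C) = a \<odot>\<^bsub>T\<^esub> h C" using x by (simp add: coset_smult[OF H] h kk)
  next
    fix C D assume "C \<in> carrier (quot_module M H)" "D \<in> carrier (quot_module M H)"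
    then obtain x y where xy: "x \<in> carrier M" "C = H +>\<^bsub>M\<^esub> x" "y \<in> carrier M" "D = H +>\<^bsub>M\<^esub> y" using ex by metis
    then show "h (C \<oplus>\<^bsub>quot_module M H\<^esub> D) = h C \<oplus>\<^bsub>T\<^esub> h D" by (simp add: coset_add[OF H] h kk)
  qed
  then show ?thesis using that h by blast
qed

lemma zero_quot_module: "submodule H R M \<Longrightarrow> zero_module (quot_module M H) \<longleftrightarrow> H = carrier M"
proof -
  assume H: "submodule H R M"
  have "zero_module (quot_module M H) \<longleftrightarrow> (\<forall>x\<in>carrier M. H +>\<^bsub>M\<^esub> x = H)"
    unfolding zero_module_def quot_module_simps using M.zero_closed by auto
  also have "\<dots> \<longleftrightarrow> H = carrier M" using coset_eq_sub[OF H] sub_in[OF H] by auto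
  finally show ?thesis .
qed

lemma seq_submodule_sub: "set xs \<subseteq> carrier R \<Longrightarrow> submodule (seq_submodule R M xs) R M"
  unfolding seq_submodule_def by (rule span_submodule) auto

lemma seq_submodule_Nil: "seq_submodule R M [] = {\<zero>\<^bsub>M\<^esub>}"
  by (simp add: seq_submodule_def span_empty)

lemma seq_submodule_snoc:
  assumes "set xs \<subseteq> carrier R" "x \<in> carrier R"
  shows "seq_submodule R M (xs @ [x])
    = {h \<oplus>\<^bsub>M\<^esub> k | h k. h \<in> seq_submodule R M xs \<and> k \<in> {x \<odot>\<^bsub>M\<^esub> m | m. m \<in> carrier M}}" (is "?L = ?R")
proof
  let ?g = "\<lambda>xs. {x \<odot>\<^bsub>M\<^esub> m | x m. x \<in> set xs \<and> m \<in> carrier M}"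
  have g: "?g (xs @ [x]) \<subseteq> carrier M" using assms by auto
  note L = span_submodule[OF g]
  note S = seq_submodule_sub[OF assms(1)]
  have "(\<lambda>m. x \<odot>\<^bsub>M\<^esub> m) \<in> module_hom R M M"
    using assms by (intro module_homI) (auto simp: smult_r_distr smult_commute)
  then have "submodule ((\<lambda>m. x \<odot>\<^bsub>M\<^esub> m) ` carrier M) R M"
    by (rule hom_image_submodule[OF module_axioms _ carrier_is_submodule])
  moreover have "(\<lambda>m. x \<odot>\<^bsub>M\<^esub> m) ` carrier M = {x \<odot>\<^bsub>M\<^esub> m | m. m \<in> carrier M}" by auto
  ultimately have X: "submodule {x \<odot>\<^bsub>M\<^esub> m | m. m \<in> carrier M} R M" by (simp only:)
  have "z \<in> ?R" if z: "z \<in> ?g (xs @ [x])" for z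
  proof -
    obtain y m where y: "z = y \<odot>\<^bsub>M\<^esub> m" "m \<in> carrier M" "y = x \<or> y \<in> set xs" using z by auto
    then have zM: "z \<in> carrier M" using assms by auto
    show ?thesis
    proof (cases "y = x")
      case True
      then have "z = \<zero>\<^bsub>M\<^esub> \<oplus>\<^bsub>M\<^esub> x \<odot>\<^bsub>M\<^esub> m" using y zM by simp
      then show ?thesis using sub_zero[OF S] y by blast
    next
      case False
      then have "z \<in> ?g xs" using y by auto
      then have "z \<in> seq_submodule R M xs" unfolding seq_submodule_def using span_superset[of "?g xs"] by blast
      moreover have "z = z \<oplus>\<^bsub>M\<^esub> \<zero>\<^bsub>M\<^esub>" using zM by simp
      ultimately show ?thesis using sub_zero[OF X] by blast
    qed
  qed
  then show "?L \<subseteq> ?R" unfolding seq_submodule_def[of R M "xs @ [x]"]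
    by (intro span_least sum_submodule[OF S X]) blast
  have "seq_submodule R M xs \<subseteq> ?L" unfolding seq_submodule_def
    by (rule span_least[OF L]) (use span_superset[of "?g (xs @ [x])"] in auto)
  moreover have "x \<odot>\<^bsub>M\<^esub> m \<in> ?L" if "m \<in> carrier M" for m unfolding seq_submodule_def
    using span_superset[of "?g (xs @ [x])"] that by auto
  ultimately show "?R \<subseteq> ?L" using submoduleE(5)[OF L] unfolding seq_submodule_def[of R M "xs @ [x]"] by blast
qed

text \<open>Replaces cosets by membership in submodules, the language of
  \<open>regular_mod\<close>.\<close>

lemma regular_sequence_iff:
  "regular_sequence R M xs \<longleftrightarrow> set xs \<subseteq> carrier R \<and>
     (\<forall>i<length xs. regular_mod M (xs ! i) (seq_submodule R M (take i xs))) \<and>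
     seq_submodule R M xs \<noteq> carrier M"
proof (cases "set xs \<subseteq> carrier R")
  case True
  have "(\<forall>z\<in>carrier (quot_module M H). x \<odot>\<^bsub>quot_module M H\<^esub> z = \<zero>\<^bsub>quot_module M H\<^esub> \<longrightarrow> z = \<zero>\<^bsub>quot_module M H\<^esub>)
    \<longleftrightarrow> regular_mod M x H" if H: "submodule H R M" and x: "x \<in> carrier R" for H x
  proof -
    have "(\<forall>z\<in>carrier (quot_module M H). x \<odot>\<^bsub>quot_module M H\<^esub> z = \<zero>\<^bsub>quot_module M H\<^esub> \<longrightarrow> z = \<zero>\<^bsub>quot_module M H\<^esub>)
     \<longleftrightarrow> (\<forall>m\<in>carrier M. x \<odot>\<^bsub>quot_module M H\<^esub> (H +>\<^bsub>M\<^esub> m) = H \<longrightarrow> H +>\<^bsub>M\<^esub> m = H)"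
      unfolding quot_module_simps by blast
    also have "\<dots> \<longleftrightarrow> regular_mod M x H"
      unfolding regular_mod_def using coset_smult[OF H _ x] coset_eq_sub[OF H] x by auto
    finally show ?thesis .
  qed
  moreover have "submodule (seq_submodule R M (take i xs)) R M" for i
    using True set_take_subset[of i xs] by (intro seq_submodule_sub) blast
  moreover have "xs ! i \<in> carrier R" if "i < length xs" for i using that True by auto
  ultimately show ?thesis
    unfolding regular_sequence_def Let_def using zero_quot_module[OF seq_submodule_sub[OF True]] by auto
qed (simp add: regular_sequence_def)

end

section \<open>Localization\<close>

locale loc_modl = modl R M for R :: "('a, 'r) ring_scheme" (structure) and M :: "('a, 'm) module" (structure) +
  fixes q assumes prime: "primeideal q R"
begin

abbreviation "S \<equiv> carrier R - q"
abbreviation "fr \<equiv> fraction R M q"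
abbreviation "Rq \<equiv> loc_ring R q"
abbreviation "Mq \<equiv> loc_module R q M"

lemma S_mult: "s \<in> S \<Longrightarrow> t \<in> S \<Longrightarrow> s \<otimes> t \<in> S"
  using primeideal.I_prime[OF prime] by auto

lemma S_one: "\<one> \<in> S"
  using primeideal.I_notcarr[OF prime] ideal.one_imp_carrier[OF primeideal.axioms(1)[OF prime]] by auto

lemma S_R: "s \<in> S \<Longrightarrow> s \<in> carrier R" by simp

lemmas sm_ac = smult_assoc1[symmetric] R.m_ac

lemma fr_mem: "(m', s') \<in> fr m s \<longleftrightarrow> m' \<in> carrier M \<and> s' \<in> S \<and>
    (\<exists>u\<in>S. u \<odot>\<^bsub>M\<^esub> (s' \<odot>\<^bsub>M\<^esub> m) = u \<odot>\<^bsub>M\<^esub> (s \<odot>\<^bsub>M\<^esub> m'))"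
  by (simp add: fraction_def)

lemma fr_self: "m \<in> carrier M \<Longrightarrow> s \<in> S \<Longrightarrow> (m, s) \<in> fr m s"
  using S_one by (auto simp: fr_mem)

lemma fr_trans:
  assumes m: "m \<in> carrier M" "m' \<in> carrier M" "m'' \<in> carrier M" and s: "s \<in> S" "s' \<in> S" "s'' \<in> S"
    and u: "u \<in> S" "u \<odot>\<^bsub>M\<^esub> (s' \<odot>\<^bsub>M\<^esub> m) = u \<odot>\<^bsub>M\<^esub> (s \<odot>\<^bsub>M\<^esub> m')"
    and v: "v \<in> S" "v \<odot>\<^bsub>M\<^esub> (s'' \<odot>\<^bsub>M\<^esub> m') = v \<odot>\<^bsub>M\<^esub> (s' \<odot>\<^bsub>M\<^esub> m'')"
  shows "\<exists>w\<in>S. w \<odot>\<^bsub>M\<^esub> (s'' \<odot>\<^bsub>M\<^esub> m) = w \<odot>\<^bsub>M\<^esub> (s \<odot>\<^bsub>M\<^esub> m'')"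
proof (rule bexI)
  note R = S_R[OF s(1)] S_R[OF s(2)] S_R[OF s(3)] S_R[OF u(1)] S_R[OF v(1)]
  \<comment> \<open>The middle denominator s' belongs to the witness, since the two given equations
    are linked only after multiplication by it.\<close>
  have "(u \<otimes> v \<otimes> s') \<odot>\<^bsub>M\<^esub> (s'' \<odot>\<^bsub>M\<^esub> m) = (v \<otimes> s'') \<odot>\<^bsub>M\<^esub> (u \<odot>\<^bsub>M\<^esub> (s' \<odot>\<^bsub>M\<^esub> m))"
    using R m by (simp add: sm_ac)
  also have "\<dots> = (u \<otimes> s) \<odot>\<^bsub>M\<^esub> (v \<odot>\<^bsub>M\<^esub> (s'' \<odot>\<^bsub>M\<^esub> m'))"
    unfolding u(2) using R m by (simp add: sm_ac)
  also have "\<dots> = (u \<otimes> v \<otimes> s') \<odot>\<^bsub>M\<^esub> (s \<odot>\<^bsub>M\<^esub> m'')"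
    unfolding v(2) using R m by (simp add: sm_ac)
  finally show "(u \<otimes> v \<otimes> s') \<odot>\<^bsub>M\<^esub> (s'' \<odot>\<^bsub>M\<^esub> m) = (u \<otimes> v \<otimes> s') \<odot>\<^bsub>M\<^esub> (s \<odot>\<^bsub>M\<^esub> m'')" .
  show "u \<otimes> v \<otimes> s' \<in> S" by (intro S_mult u v s)
qed

lemma fr_eq:
  assumes m: "m \<in> carrier M" "m' \<in> carrier M" and s: "s \<in> S" "s' \<in> S"
  shows "fr m s = fr m' s' \<longleftrightarrow> (\<exists>u\<in>S. u \<odot>\<^bsub>M\<^esub> (s' \<odot>\<^bsub>M\<^esub> m) = u \<odot>\<^bsub>M\<^esub> (s \<odot>\<^bsub>M\<^esub> m'))"
proof
  assume "fr m s = fr m' s'"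
  then have "(m', s') \<in> fr m s" using fr_self[OF m(2) s(2)] by simp
  then show "\<exists>u\<in>S. u \<odot>\<^bsub>M\<^esub> (s' \<odot>\<^bsub>M\<^esub> m) = u \<odot>\<^bsub>M\<^esub> (s \<odot>\<^bsub>M\<^esub> m')" unfolding fr_mem by metis
next
  assume "\<exists>u\<in>S. u \<odot>\<^bsub>M\<^esub> (s' \<odot>\<^bsub>M\<^esub> m) = u \<odot>\<^bsub>M\<^esub> (s \<odot>\<^bsub>M\<^esub> m')"
  then obtain u where u: "u \<in> S" "u \<odot>\<^bsub>M\<^esub> (s' \<odot>\<^bsub>M\<^esub> m) = u \<odot>\<^bsub>M\<^esub> (s \<odot>\<^bsub>M\<^esub> m')" by metis
  have "(x, a) \<in> fr m s \<longleftrightarrow> (x, a) \<in> fr m' s'" for x a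
  proof (cases "x \<in> carrier M \<and> a \<in> S")
    case True
    then have xa: "x \<in> carrier M" "a \<in> S" by auto
    show ?thesis
    proof
      assume "(x, a) \<in> fr m s"
      then obtain v where v: "v \<in> S" "v \<odot>\<^bsub>M\<^esub> (a \<odot>\<^bsub>M\<^esub> m) = v \<odot>\<^bsub>M\<^esub> (s \<odot>\<^bsub>M\<^esub> x)" unfolding fr_mem by metis
      show "(x, a) \<in> fr m' s'" unfolding fr_mem
        using fr_trans[OF m(2,1) xa(1) s(2,1) xa(2) u(1) u(2)[symmetric] v] xa by simp
    next
      assume "(x, a) \<in> fr m' s'"
      then obtain v where v: "v \<in> S" "v \<odot>\<^bsub>M\<^esub> (a \<odot>\<^bsub>M\<^esub> m') = v \<odot>\<^bsub>M\<^esub> (s' \<odot>\<^bsub>M\<^esub> x)" unfolding fr_mem by metis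
      show "(x, a) \<in> fr m s" unfolding fr_mem
        using fr_trans[OF m xa(1) s xa(2) u v] xa by simp
    qed
  next
    case False
    then show ?thesis unfolding fr_mem by auto
  qed
  then show "fr m s = fr m' s'" by auto
qed

lemma fr_eqI:
  assumes "m \<in> carrier M" "m' \<in> carrier M" "s \<in> S" "s' \<in> S" "u \<in> S" "u \<odot>\<^bsub>M\<^esub> (s' \<odot>\<^bsub>M\<^esub> m) = u \<odot>\<^bsub>M\<^esub> (s \<odot>\<^bsub>M\<^esub> m')"
  shows "fr m s = fr m' s'"
  using fr_eq[OF assms(1-4)] assms(5,6) by metis

lemma fr_memD:
  assumes "m \<in> carrier M" "s \<in> S" "(x, a) \<in> fr m s"
  obtains u where "x \<in> carrier M" "a \<in> S" "u \<in> S" "u \<odot>\<^bsub>M\<^esub> (a \<odot>\<^bsub>M\<^esub> m) = u \<odot>\<^bsub>M\<^esub> (s \<odot>\<^bsub>M\<^esub> x)"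
  using assms(3) unfolding fr_mem by metis

lemma carrier_Mq: "carrier Mq = {fr m s | m s. m \<in> carrier M \<and> s \<in> S}"
  by (simp add: loc_module_def)

lemma Mq_cases:
  assumes "C \<in> carrier Mq" obtains m s where "m \<in> carrier M" "s \<in> S" "C = fr m s"
  using assms unfolding carrier_Mq by blast

lemma fr_closed: "m \<in> carrier M \<Longrightarrow> s \<in> S \<Longrightarrow> fr m s \<in> carrier Mq"
  unfolding carrier_Mq by blast

lemma zero_Mq: "\<zero>\<^bsub>Mq\<^esub> = fr \<zero>\<^bsub>M\<^esub> \<one>" by (simp add: loc_module_def)

text \<open>The sum is defined as a union over all pairs of representatives. All members of this
  union coincide, so it equals the fraction formed from any one pair.\<close>

lemma fr_add:
  assumes m: "m \<in> carrier M" "m' \<in> carrier M" and s: "s \<in> S" "s' \<in> S"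
  shows "fr m s \<oplus>\<^bsub>Mq\<^esub> fr m' s' = fr (s' \<odot>\<^bsub>M\<^esub> m \<oplus>\<^bsub>M\<^esub> s \<odot>\<^bsub>M\<^esub> m') (s \<otimes> s')"
proof -
  have e: "fr (b \<odot>\<^bsub>M\<^esub> x \<oplus>\<^bsub>M\<^esub> a \<odot>\<^bsub>M\<^esub> y) (a \<otimes> b) = fr (s' \<odot>\<^bsub>M\<^esub> m \<oplus>\<^bsub>M\<^esub> s \<odot>\<^bsub>M\<^esub> m') (s \<otimes> s')"
    if xa: "(x, a) \<in> fr m s" and yb: "(y, b) \<in> fr m' s'" for x a y b
  proof -
    obtain u where u: "x \<in> carrier M" "a \<in> S" "u \<in> S" "u \<odot>\<^bsub>M\<^esub> (a \<odot>\<^bsub>M\<^esub> m) = u \<odot>\<^bsub>M\<^esub> (s \<odot>\<^bsub>M\<^esub> x)"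
      by (rule fr_memD[OF m(1) s(1) xa])
    obtain v where v: "y \<in> carrier M" "b \<in> S" "v \<in> S" "v \<odot>\<^bsub>M\<^esub> (b \<odot>\<^bsub>M\<^esub> m') = v \<odot>\<^bsub>M\<^esub> (s' \<odot>\<^bsub>M\<^esub> y)"
      by (rule fr_memD[OF m(2) s(2) yb])
    note R = S_R[OF s(1)] S_R[OF s(2)] S_R[OF u(2)] S_R[OF u(3)] S_R[OF v(2)] S_R[OF v(3)] u(1) v(1) m
    have e1: "(u \<otimes> v) \<odot>\<^bsub>M\<^esub> ((s \<otimes> s') \<odot>\<^bsub>M\<^esub> (b \<odot>\<^bsub>M\<^esub> x)) = (u \<otimes> v) \<odot>\<^bsub>M\<^esub> ((a \<otimes> b) \<odot>\<^bsub>M\<^esub> (s' \<odot>\<^bsub>M\<^esub> m))"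
    proof -
      have "(u \<otimes> v) \<odot>\<^bsub>M\<^esub> ((s \<otimes> s') \<odot>\<^bsub>M\<^esub> (b \<odot>\<^bsub>M\<^esub> x)) = (v \<otimes> s' \<otimes> b) \<odot>\<^bsub>M\<^esub> (u \<odot>\<^bsub>M\<^esub> (s \<odot>\<^bsub>M\<^esub> x))"
        using R by (simp add: sm_ac)
      also have "\<dots> = (u \<otimes> v) \<odot>\<^bsub>M\<^esub> ((a \<otimes> b) \<odot>\<^bsub>M\<^esub> (s' \<odot>\<^bsub>M\<^esub> m))"
        unfolding u(4)[symmetric] using R by (simp add: sm_ac)
      finally show ?thesis .
    qed
    have e2: "(u \<otimes> v) \<odot>\<^bsub>M\<^esub> ((s \<otimes> s') \<odot>\<^bsub>M\<^esub> (a \<odot>\<^bsub>M\<^esub> y)) = (u \<otimes> v) \<odot>\<^bsub>M\<^esub> ((a \<otimes> b) \<odot>\<^bsub>M\<^esub> (s \<odot>\<^bsub>M\<^esub> m'))"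
    proof -
      have "(u \<otimes> v) \<odot>\<^bsub>M\<^esub> ((s \<otimes> s') \<odot>\<^bsub>M\<^esub> (a \<odot>\<^bsub>M\<^esub> y)) = (u \<otimes> s \<otimes> a) \<odot>\<^bsub>M\<^esub> (v \<odot>\<^bsub>M\<^esub> (s' \<odot>\<^bsub>M\<^esub> y))"
        using R by (simp add: sm_ac)
      also have "\<dots> = (u \<otimes> v) \<odot>\<^bsub>M\<^esub> ((a \<otimes> b) \<odot>\<^bsub>M\<^esub> (s \<odot>\<^bsub>M\<^esub> m'))"
        unfolding v(4)[symmetric] using R by (simp add: sm_ac)
      finally show ?thesis .
    qed
    show ?thesis
      by (rule fr_eqI[OF _ _ S_mult[OF u(2) v(2)] S_mult[OF s] S_mult[OF u(3) v(3)]])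
        (use R e1 e2 in \<open>simp_all add: smult_r_distr\<close>)
  qed
  have "fr m s \<oplus>\<^bsub>Mq\<^esub> fr m' s' = (\<Union>(x, a)\<in>fr m s. \<Union>(y, b)\<in>fr m' s'. fr (b \<odot>\<^bsub>M\<^esub> x \<oplus>\<^bsub>M\<^esub> a \<odot>\<^bsub>M\<^esub> y) (a \<otimes> b))"
    by (simp add: loc_module_def)
  also have "\<dots> = (\<Union>(x, a)\<in>fr m s. \<Union>(y, b)\<in>fr m' s'. fr (s' \<odot>\<^bsub>M\<^esub> m \<oplus>\<^bsub>M\<^esub> s \<odot>\<^bsub>M\<^esub> m') (s \<otimes> s'))"
    using e by (intro SUP_cong refl) auto
  also have "\<dots> = fr (s' \<odot>\<^bsub>M\<^esub> m \<oplus>\<^bsub>M\<^esub> s \<odot>\<^bsub>M\<^esub> m') (s \<otimes> s')"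
    using fr_self[OF m(1) s(1)] fr_self[OF m(2) s(2)] by blast
  finally show ?thesis .
qed

lemma fr_common:
  assumes "m \<in> carrier M" "s \<in> S" "t \<in> S"
  shows "fr (t \<odot>\<^bsub>M\<^esub> m) (t \<otimes> s) = fr m s"
  by (rule fr_eqI[OF _ _ S_mult[OF assms(3,2)] assms(2) S_one])
    (use assms S_R[OF assms(2)] S_R[OF assms(3)] in \<open>simp_all add: sm_ac\<close>)

end

sublocale loc_modl \<subseteq> self: loc_modl R "self_module R" q
  by (intro loc_modl.intro modl.intro self_module_module R.is_cring loc_modl_axioms.intro prime)

context loc_modl
begin

lemma carrier_Rq: "carrier Rq = {self.fr a s | a s. a \<in> carrier R \<and> s \<in> S}"
  using self.carrier_Mq by (simp add: loc_ring_def Let_def)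

lemma Rq_simps:
  "x \<oplus>\<^bsub>Rq\<^esub> y = x \<oplus>\<^bsub>self.Mq\<^esub> y" "x \<otimes>\<^bsub>Rq\<^esub> y = x \<odot>\<^bsub>self.Mq\<^esub> y"
  "\<zero>\<^bsub>Rq\<^esub> = self.fr \<zero> \<one>" "\<one>\<^bsub>Rq\<^esub> = self.fr \<one> \<one>"
  by (simp_all add: loc_ring_def Let_def self.zero_Mq)

lemma Rq_cases:
  assumes "A \<in> carrier Rq" obtains a s where "a \<in> carrier R" "s \<in> S" "A = self.fr a s"
  using assms unfolding carrier_Rq by blast

lemma Rq_closed: "a \<in> carrier R \<Longrightarrow> s \<in> S \<Longrightarrow> self.fr a s \<in> carrier Rq"
  unfolding carrier_Rq by blast

text \<open>The union over representatives again has equal members. Applied to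
  \<open>self_module R\<close>, this also describes the product in \<open>Rq\<close>.\<close>

lemma fr_smult:
  assumes a: "a \<in> carrier R" "s \<in> S" and m: "m \<in> carrier M" "t \<in> S"
  shows "self.fr a s \<odot>\<^bsub>Mq\<^esub> fr m t = fr (a \<odot>\<^bsub>M\<^esub> m) (s \<otimes> t)"
proof -
  have e: "fr (b \<odot>\<^bsub>M\<^esub> x) (s' \<otimes> t') = fr (a \<odot>\<^bsub>M\<^esub> m) (s \<otimes> t)"
    if bs: "(b, s') \<in> self.fr a s" and xt: "(x, t') \<in> fr m t" for b s' x t'
  proof -
    obtain u where u: "b \<in> carrier R" "s' \<in> S" "u \<in> S" "u \<otimes> (s' \<otimes> a) = u \<otimes> (s \<otimes> b)"
      using self.fr_memD[of a s b s'] a bs by auto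
    obtain v where v: "x \<in> carrier M" "t' \<in> S" "v \<in> S" "v \<odot>\<^bsub>M\<^esub> (t' \<odot>\<^bsub>M\<^esub> m) = v \<odot>\<^bsub>M\<^esub> (t \<odot>\<^bsub>M\<^esub> x)"
      by (rule fr_memD[OF m xt])
    note R = S_R[OF a(2)] S_R[OF m(2)] S_R[OF u(2)] S_R[OF u(3)] S_R[OF v(2)] S_R[OF v(3)] u(1) v(1) a(1) m(1)
    have "(u \<otimes> v) \<odot>\<^bsub>M\<^esub> ((s \<otimes> t) \<odot>\<^bsub>M\<^esub> (b \<odot>\<^bsub>M\<^esub> x)) = (u \<otimes> (s \<otimes> b)) \<odot>\<^bsub>M\<^esub> (v \<odot>\<^bsub>M\<^esub> (t \<odot>\<^bsub>M\<^esub> x))"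
      using R by (simp add: sm_ac)
    also have "\<dots> = (u \<otimes> v) \<odot>\<^bsub>M\<^esub> ((s' \<otimes> t') \<odot>\<^bsub>M\<^esub> (a \<odot>\<^bsub>M\<^esub> m))"
      unfolding v(4)[symmetric] u(4)[symmetric] using R by (simp add: sm_ac)
    finally show ?thesis
      by (intro fr_eqI[OF _ _ S_mult[OF u(2) v(2)] S_mult[OF a(2) m(2)] S_mult[OF u(3) v(3)]]) (use R in simp_all)
  qed
  have "self.fr a s \<odot>\<^bsub>Mq\<^esub> fr m t = (\<Union>(b, s')\<in>self.fr a s. \<Union>(x, t')\<in>fr m t. fr (b \<odot>\<^bsub>M\<^esub> x) (s' \<otimes> t'))"
    by (simp add: loc_module_def)
  also have "\<dots> = (\<Union>(b, s')\<in>self.fr a s. \<Union>(x, t')\<in>fr m t. fr (a \<odot>\<^bsub>M\<^esub> m) (s \<otimes> t))"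
    using e by (intro SUP_cong refl) auto
  also have "\<dots> = fr (a \<odot>\<^bsub>M\<^esub> m) (s \<otimes> t)"
    using self.fr_self[of a s] a fr_self[OF m] by auto
  finally show ?thesis .
qed

end

section \<open>Module and ring axioms for the localization\<close>

context loc_modl
begin

lemma fr_add_same:
  assumes "m \<in> carrier M" "m' \<in> carrier M" "s \<in> S"
  shows "fr m s \<oplus>\<^bsub>Mq\<^esub> fr m' s = fr (m \<oplus>\<^bsub>M\<^esub> m') s"
  using fr_add[OF assms(1,2) assms(3,3)] fr_common[of "m \<oplus>\<^bsub>M\<^esub> m'" s s] assms S_R[OF assms(3)]
  by (simp add: smult_r_distr)

lemma fr_zero:
  assumes "m \<in> carrier M" "s \<in> S"
  shows "fr m s = \<zero>\<^bsub>Mq\<^esub> \<longleftrightarrow> m \<in> satur R q M {\<zero>\<^bsub>M\<^esub>}"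
  unfolding zero_Mq fr_eq[OF assms(1) M.zero_closed assms(2) S_one] satur_def
  using assms S_R by auto

lemma Mq_abelian_group: "abelian_group Mq"
proof (rule abelian_groupI')
  fix C D assume "C \<in> carrier Mq" "D \<in> carrier Mq"
  obtain m s where C: "m \<in> carrier M" "s \<in> S" "C = fr m s" by (rule Mq_cases[OF \<open>C \<in> carrier Mq\<close>])
  obtain m' s' where D: "m' \<in> carrier M" "s' \<in> S" "D = fr m' s'" by (rule Mq_cases[OF \<open>D \<in> carrier Mq\<close>])
  note R = S_R[OF C(2)] S_R[OF D(2)]
  show "C \<oplus>\<^bsub>Mq\<^esub> D \<in> carrier Mq" unfolding C(3) D(3) fr_add[OF C(1) D(1) C(2) D(2)]
    by (intro fr_closed S_mult C D) (use C D R in simp)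
  show "C \<oplus>\<^bsub>Mq\<^esub> D = D \<oplus>\<^bsub>Mq\<^esub> C" unfolding C(3) D(3) fr_add[OF C(1) D(1) C(2) D(2)] fr_add[OF D(1) C(1) D(2) C(2)]
    using C(1) D(1) R by (simp add: M.a_comm R.m_comm)
  fix E assume "E \<in> carrier Mq"
  obtain m'' s'' where E: "m'' \<in> carrier M" "s'' \<in> S" "E = fr m'' s''" by (rule Mq_cases[OF \<open>E \<in> carrier Mq\<close>])
  note R' = R S_R[OF E(2)]
  have "C \<oplus>\<^bsub>Mq\<^esub> D \<oplus>\<^bsub>Mq\<^esub> E
    = fr (s'' \<odot>\<^bsub>M\<^esub> (s' \<odot>\<^bsub>M\<^esub> m \<oplus>\<^bsub>M\<^esub> s \<odot>\<^bsub>M\<^esub> m') \<oplus>\<^bsub>M\<^esub> (s \<otimes> s') \<odot>\<^bsub>M\<^esub> m'') (s \<otimes> s' \<otimes> s'')"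
    unfolding C(3) D(3) E(3) fr_add[OF C(1) D(1) C(2) D(2)]
    by (rule fr_add[OF _ E(1) S_mult[OF C(2) D(2)] E(2)]) (use R C D in simp)
  moreover have "C \<oplus>\<^bsub>Mq\<^esub> (D \<oplus>\<^bsub>Mq\<^esub> E)
    = fr ((s' \<otimes> s'') \<odot>\<^bsub>M\<^esub> m \<oplus>\<^bsub>M\<^esub> s \<odot>\<^bsub>M\<^esub> (s'' \<odot>\<^bsub>M\<^esub> m' \<oplus>\<^bsub>M\<^esub> s' \<odot>\<^bsub>M\<^esub> m'')) (s \<otimes> (s' \<otimes> s''))"
    unfolding C(3) D(3) E(3) fr_add[OF D(1) E(1) D(2) E(2)]
    by (rule fr_add[OF C(1) _ C(2) S_mult[OF D(2) E(2)]]) (use R' D E in simp)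
  ultimately show "C \<oplus>\<^bsub>Mq\<^esub> D \<oplus>\<^bsub>Mq\<^esub> E = C \<oplus>\<^bsub>Mq\<^esub> (D \<oplus>\<^bsub>Mq\<^esub> E)"
    using C(1) D(1) E(1) R' by (simp add: smult_r_distr sm_ac M.a_assoc)
next
  show "\<zero>\<^bsub>Mq\<^esub> \<in> carrier Mq" unfolding zero_Mq by (rule fr_closed[OF M.zero_closed S_one])
next
  fix C assume "C \<in> carrier Mq"
  obtain m s where C: "m \<in> carrier M" "s \<in> S" "C = fr m s" by (rule Mq_cases[OF \<open>C \<in> carrier Mq\<close>])
  show "\<zero>\<^bsub>Mq\<^esub> \<oplus>\<^bsub>Mq\<^esub> C = C" unfolding C(3) zero_Mq fr_add[OF M.zero_closed C(1) S_one C(2)]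
    using C(1) S_R[OF C(2)] by simp
  have "fr (\<ominus>\<^bsub>M\<^esub> m) s \<oplus>\<^bsub>Mq\<^esub> C = fr \<zero>\<^bsub>M\<^esub> s" unfolding C(3)
    using fr_add_same[of "\<ominus>\<^bsub>M\<^esub> m" m s] C by (simp add: M.l_neg)
  also have "\<dots> = \<zero>\<^bsub>Mq\<^esub>" unfolding zero_Mq
    by (rule fr_eqI[OF _ _ C(2) S_one S_one]) (use S_R[OF C(2)] in simp_all)
  finally show "\<exists>D\<in>carrier Mq. D \<oplus>\<^bsub>Mq\<^esub> C = \<zero>\<^bsub>Mq\<^esub>"
    using fr_closed[of "\<ominus>\<^bsub>M\<^esub> m" s] C by auto
qed

lemma Mq_smult_r:
  assumes "A \<in> carrier Rq" "C \<in> carrier Mq" "D \<in> carrier Mq"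
  shows "A \<odot>\<^bsub>Mq\<^esub> (C \<oplus>\<^bsub>Mq\<^esub> D) = A \<odot>\<^bsub>Mq\<^esub> C \<oplus>\<^bsub>Mq\<^esub> A \<odot>\<^bsub>Mq\<^esub> D"
proof -
  obtain a r where A: "a \<in> carrier R" "r \<in> S" "A = self.fr a r" by (rule Rq_cases[OF assms(1)])
  obtain m s where C: "m \<in> carrier M" "s \<in> S" "C = fr m s" by (rule Mq_cases[OF assms(2)])
  obtain m' s' where D: "m' \<in> carrier M" "s' \<in> S" "D = fr m' s'" by (rule Mq_cases[OF assms(3)])
  note R = S_R[OF A(2)] S_R[OF C(2)] S_R[OF D(2)] A(1) C(1) D(1)
  have "A \<odot>\<^bsub>Mq\<^esub> (C \<oplus>\<^bsub>Mq\<^esub> D) = fr (a \<odot>\<^bsub>M\<^esub> (s' \<odot>\<^bsub>M\<^esub> m \<oplus>\<^bsub>M\<^esub> s \<odot>\<^bsub>M\<^esub> m')) (r \<otimes> (s \<otimes> s'))"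
    unfolding A(3) C(3) D(3) fr_add[OF C(1) D(1) C(2) D(2)]
    by (rule fr_smult[OF A(1,2) _ S_mult[OF C(2) D(2)]]) (use R in simp)
  also have "\<dots> = fr ((r \<otimes> s') \<odot>\<^bsub>M\<^esub> (a \<odot>\<^bsub>M\<^esub> m) \<oplus>\<^bsub>M\<^esub> (r \<otimes> s) \<odot>\<^bsub>M\<^esub> (a \<odot>\<^bsub>M\<^esub> m')) ((r \<otimes> s) \<otimes> (r \<otimes> s'))"
    by (rule fr_eqI[OF _ _ S_mult[OF A(2) S_mult[OF C(2) D(2)]] S_mult[OF S_mult[OF A(2) C(2)] S_mult[OF A(2) D(2)]] S_one])
      (use R in \<open>simp_all add: smult_r_distr sm_ac\<close>)
  also have "\<dots> = A \<odot>\<^bsub>Mq\<^esub> C \<oplus>\<^bsub>Mq\<^esub> A \<odot>\<^bsub>Mq\<^esub> D"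
    unfolding A(3) C(3) D(3) fr_smult[OF A(1,2) C(1,2)] fr_smult[OF A(1,2) D(1,2)]
    by (rule fr_add[symmetric, OF _ _ S_mult[OF A(2) C(2)] S_mult[OF A(2) D(2)]]) (use R in simp_all)
  finally show ?thesis .
qed

lemma Mq_smult_assoc:
  assumes "A \<in> carrier Rq" "B \<in> carrier Rq" "C \<in> carrier Mq"
  shows "(A \<otimes>\<^bsub>Rq\<^esub> B) \<odot>\<^bsub>Mq\<^esub> C = A \<odot>\<^bsub>Mq\<^esub> (B \<odot>\<^bsub>Mq\<^esub> C)"
proof -
  obtain a r where A: "a \<in> carrier R" "r \<in> S" "A = self.fr a r" by (rule Rq_cases[OF assms(1)])
  obtain b t where B: "b \<in> carrier R" "t \<in> S" "B = self.fr b t" by (rule Rq_cases[OF assms(2)])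
  obtain m s where C: "m \<in> carrier M" "s \<in> S" "C = fr m s" by (rule Mq_cases[OF assms(3)])
  note R = S_R[OF A(2)] S_R[OF B(2)] S_R[OF C(2)] A(1) B(1) C(1)
  have "A \<otimes>\<^bsub>Rq\<^esub> B = self.fr (a \<otimes> b) (r \<otimes> t)"
    unfolding A(3) B(3) Rq_simps using self.fr_smult[OF A(1,2) _ B(2), of b] B(1) by simp
  then have "(A \<otimes>\<^bsub>Rq\<^esub> B) \<odot>\<^bsub>Mq\<^esub> C = fr ((a \<otimes> b) \<odot>\<^bsub>M\<^esub> m) ((r \<otimes> t) \<otimes> s)"
    unfolding C(3) using fr_smult[OF _ S_mult[OF A(2) B(2)] C(1,2), of "a \<otimes> b"] R by simp
  moreover have "A \<odot>\<^bsub>Mq\<^esub> (B \<odot>\<^bsub>Mq\<^esub> C) = fr (a \<odot>\<^bsub>M\<^esub> (b \<odot>\<^bsub>M\<^esub> m)) (r \<otimes> (t \<otimes> s))"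
    unfolding A(3) B(3) C(3) fr_smult[OF B(1,2) C(1,2)]
    by (rule fr_smult[OF A(1,2) _ S_mult[OF B(2) C(2)]]) (use R in simp)
  ultimately show ?thesis using R by (simp add: sm_ac)
qed

lemma Mq_smult_l:
  assumes "A \<in> carrier Rq" "B \<in> carrier Rq" "C \<in> carrier Mq"
  shows "(A \<oplus>\<^bsub>Rq\<^esub> B) \<odot>\<^bsub>Mq\<^esub> C = A \<odot>\<^bsub>Mq\<^esub> C \<oplus>\<^bsub>Mq\<^esub> B \<odot>\<^bsub>Mq\<^esub> C"
proof -
  obtain a r where A: "a \<in> carrier R" "r \<in> S" "A = self.fr a r" by (rule Rq_cases[OF assms(1)])
  obtain b t where B: "b \<in> carrier R" "t \<in> S" "B = self.fr b t" by (rule Rq_cases[OF assms(2)])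
  obtain m s where C: "m \<in> carrier M" "s \<in> S" "C = fr m s" by (rule Mq_cases[OF assms(3)])
  note R = S_R[OF A(2)] S_R[OF B(2)] S_R[OF C(2)] A(1) B(1) C(1)
  have "A \<oplus>\<^bsub>Rq\<^esub> B = self.fr (t \<otimes> a \<oplus> r \<otimes> b) (r \<otimes> t)"
    unfolding A(3) B(3) Rq_simps using self.fr_add[of a b r t] A B by simp
  then have "(A \<oplus>\<^bsub>Rq\<^esub> B) \<odot>\<^bsub>Mq\<^esub> C = fr ((t \<otimes> a \<oplus> r \<otimes> b) \<odot>\<^bsub>M\<^esub> m) ((r \<otimes> t) \<otimes> s)"
    unfolding C(3) using fr_smult[OF _ S_mult[OF A(2) B(2)] C(1,2), of "t \<otimes> a \<oplus> r \<otimes> b"] R by simp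
  also have "\<dots> = fr ((t \<otimes> s) \<odot>\<^bsub>M\<^esub> (a \<odot>\<^bsub>M\<^esub> m) \<oplus>\<^bsub>M\<^esub> (r \<otimes> s) \<odot>\<^bsub>M\<^esub> (b \<odot>\<^bsub>M\<^esub> m)) ((r \<otimes> s) \<otimes> (t \<otimes> s))"
    by (rule fr_eqI[OF _ _ S_mult[OF S_mult[OF A(2) B(2)] C(2)] S_mult[OF S_mult[OF A(2) C(2)] S_mult[OF B(2) C(2)]] S_one])
      (use R in \<open>simp_all add: smult_r_distr smult_l_distr R.r_distr R.l_distr sm_ac\<close>)
  also have "\<dots> = A \<odot>\<^bsub>Mq\<^esub> C \<oplus>\<^bsub>Mq\<^esub> B \<odot>\<^bsub>Mq\<^esub> C"
    unfolding A(3) B(3) C(3) fr_smult[OF A(1,2) C(1,2)] fr_smult[OF B(1,2) C(1,2)]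
    by (rule fr_add[symmetric, OF _ _ S_mult[OF A(2) C(2)] S_mult[OF B(2) C(2)]]) (use R in simp_all)
  finally show ?thesis .
qed

lemma Mq_smult_closed:
  assumes "A \<in> carrier Rq" "C \<in> carrier Mq"
  shows "A \<odot>\<^bsub>Mq\<^esub> C \<in> carrier Mq"
proof -
  obtain a r where A: "a \<in> carrier R" "r \<in> S" "A = self.fr a r" by (rule Rq_cases[OF assms(1)])
  obtain m s where C: "m \<in> carrier M" "s \<in> S" "C = fr m s" by (rule Mq_cases[OF assms(2)])
  show ?thesis unfolding A(3) C(3) fr_smult[OF A(1,2) C(1,2)]
    by (intro fr_closed S_mult A C smult_closed)
qed

lemma Mq_smult_one:
  assumes "C \<in> carrier Mq"
  shows "\<one>\<^bsub>Rq\<^esub> \<odot>\<^bsub>Mq\<^esub> C = C"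
proof -
  obtain m s where C: "m \<in> carrier M" "s \<in> S" "C = fr m s" by (rule Mq_cases[OF assms])
  show ?thesis unfolding Rq_simps C(3) fr_smult[OF R.one_closed S_one C(1,2)] using C(1) S_R[OF C(2)] by simp
qed

end

context loc_modl
begin

lemma carrier_Rq': "carrier self.Mq = carrier Rq"
  using carrier_Rq self.carrier_Mq by simp

text \<open>\<open>Rq\<close> shares its operations with the localization of
  \<open>self_module R\<close>, so most ring laws are module laws read again; commutativity of the
  product is checked on fractions.\<close>

lemma Rq_cring: "cring Rq"
proof (intro cringI abelian_groupI' comm_monoidI)
  interpret G: abelian_group self.Mq by (rule self.Mq_abelian_group)
  note cl = carrier_Rq'
  have z: "\<zero>\<^bsub>Rq\<^esub> = \<zero>\<^bsub>self.Mq\<^esub>" by (simp add: Rq_simps self.zero_Mq)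
  {
    fix A B assume AB: "A \<in> carrier Rq" "B \<in> carrier Rq"
    obtain a r where A: "a \<in> carrier R" "r \<in> S" "A = self.fr a r" by (rule Rq_cases[OF AB(1)])
    obtain b t where B: "b \<in> carrier R" "t \<in> S" "B = self.fr b t" by (rule Rq_cases[OF AB(2)])
    show "A \<oplus>\<^bsub>Rq\<^esub> B \<in> carrier Rq" "A \<oplus>\<^bsub>Rq\<^esub> B = B \<oplus>\<^bsub>Rq\<^esub> A"
      using AB G.a_closed G.a_comm unfolding Rq_simps cl by blast+
    show "A \<otimes>\<^bsub>Rq\<^esub> B \<in> carrier Rq"
      using AB self.Mq_smult_closed unfolding Rq_simps cl by blast
    show "A \<otimes>\<^bsub>Rq\<^esub> B = B \<otimes>\<^bsub>Rq\<^esub> A"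
      unfolding A(3) B(3) Rq_simps using self.fr_smult[OF A(1,2) _ B(2), of b] self.fr_smult[OF B(1,2) _ A(2), of a]
        A(1) B(1) S_R[OF A(2)] S_R[OF B(2)] by (simp add: R.m_comm)
    {
      fix C assume C: "C \<in> carrier Rq"
      show "A \<oplus>\<^bsub>Rq\<^esub> B \<oplus>\<^bsub>Rq\<^esub> C = A \<oplus>\<^bsub>Rq\<^esub> (B \<oplus>\<^bsub>Rq\<^esub> C)"
        using AB C G.a_assoc unfolding Rq_simps cl by blast
      show "A \<otimes>\<^bsub>Rq\<^esub> B \<otimes>\<^bsub>Rq\<^esub> C = A \<otimes>\<^bsub>Rq\<^esub> (B \<otimes>\<^bsub>Rq\<^esub> C)"
        using self.Mq_smult_assoc[OF AB, of C] C unfolding Rq_simps cl by simp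
      show "(A \<oplus>\<^bsub>Rq\<^esub> B) \<otimes>\<^bsub>Rq\<^esub> C = A \<otimes>\<^bsub>Rq\<^esub> C \<oplus>\<^bsub>Rq\<^esub> B \<otimes>\<^bsub>Rq\<^esub> C"
        using self.Mq_smult_l[OF AB, of C] C unfolding Rq_simps cl by simp
    }
  }
  show "\<zero>\<^bsub>Rq\<^esub> \<in> carrier Rq" "\<one>\<^bsub>Rq\<^esub> \<in> carrier Rq"
    unfolding Rq_simps using Rq_closed S_one by auto
  fix A assume A: "A \<in> carrier Rq"
  show "\<zero>\<^bsub>Rq\<^esub> \<oplus>\<^bsub>Rq\<^esub> A = A" using A G.l_zero unfolding z Rq_simps(1) cl by blast
  show "\<one>\<^bsub>Rq\<^esub> \<otimes>\<^bsub>Rq\<^esub> A = A" using self.Mq_smult_one[of A] A unfolding Rq_simps(2) cl by blast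
  show "\<exists>B\<in>carrier Rq. B \<oplus>\<^bsub>Rq\<^esub> A = \<zero>\<^bsub>Rq\<^esub>"
    using A G.l_neg[of A] G.a_inv_closed[of A] unfolding z Rq_simps(1) cl by blast
qed

lemma Mq_module: "module Rq Mq"
  by (intro moduleI Rq_cring Mq_abelian_group Mq_smult_closed Mq_smult_l Mq_smult_r Mq_smult_assoc Mq_smult_one)

end

sublocale loc_modl \<subseteq> Q: modl Rq Mq
  by (rule modl.intro[OF Mq_module])

lemma ideal_of_closed:
  fixes R (structure)
  assumes "cring R" "I \<subseteq> carrier R" "\<zero> \<in> I" "\<And>x y. x \<in> I \<Longrightarrow> y \<in> I \<Longrightarrow> x \<oplus> y \<in> I"
    and m: "\<And>a x. a \<in> carrier R \<Longrightarrow> x \<in> I \<Longrightarrow> a \<otimes> x \<in> I"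
  shows "ideal I R"
proof -
  interpret cring R by fact
  have n: "\<ominus> a \<in> I" if "a \<in> I" for a
  proof -
    have a: "a \<in> carrier R" using that assms(2) by blast
    have "\<ominus> \<one> \<otimes> a \<in> I" using m[of "\<ominus> \<one>" a] that by simp
    then show ?thesis using a by (simp add: l_minus)
  qed
  show ?thesis
  proof (rule idealI)
    show "ring R" by (rule ring_axioms)
    show "subgroup I (add_monoid R)"
      by (rule add.subgroupI) (use assms n in auto)
    fix a x assume ax: "a \<in> I" "x \<in> carrier R"
    then show "x \<otimes> a \<in> I" by (rule m[rotated])
    then show "a \<otimes> x \<in> I" using ax assms(2) m_comm[of a x] by auto
  qed
qed

section \<open>Contraction of submodules and extension of primes\<close>

context loc_modl
begin

definition con :: "('m \<times> 'a) set set \<Rightarrow> 'm set" where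
  "con K = {m \<in> carrier M. fr m \<one> \<in> K}"

text \<open>Multiplication by s/1 and by 1/s passes between m/s and m/1, so denominators do not
  matter for membership.\<close>

lemma fr_in_iff:
  assumes K: "submodule K Rq Mq" and m: "m \<in> carrier M" "s \<in> S"
  shows "fr m s \<in> K \<longleftrightarrow> m \<in> con K"
proof -
  note R = S_R[OF m(2)]
  have "self.fr s \<one> \<odot>\<^bsub>Mq\<^esub> fr m s = fr m \<one>"
    using fr_smult[OF R S_one m] fr_common[OF m(1) S_one m(2)] R by simp
  moreover have "self.fr \<one> s \<odot>\<^bsub>Mq\<^esub> fr m \<one> = fr m s"
    using fr_smult[OF R.one_closed m(2) m(1) S_one] R m(1) by simp
  ultimately have "fr m s \<in> K \<longleftrightarrow> fr m \<one> \<in> K"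
    using Q.submoduleE(4)[OF K] Rq_closed[OF R S_one] Rq_closed[OF R.one_closed m(2)] by metis
  then show ?thesis using m by (simp add: con_def)
qed

lemma con_sat:
  assumes K: "submodule K Rq Mq" shows "saturated_submodule R q M (con K)"
proof -
  note KD = Q.sub_closed[OF K]
  have sm: "a \<odot>\<^bsub>M\<^esub> m \<in> con K" if a: "a \<in> carrier R" and m: "m \<in> con K" for a m
  proof -
    have "self.fr a \<one> \<odot>\<^bsub>Mq\<^esub> fr m \<one> \<in> K"
      using Q.submoduleE(4)[OF K Rq_closed[OF a S_one]] m by (simp add: con_def)
    then show ?thesis using fr_smult[OF a S_one _ S_one, of m] a m by (simp add: con_def)
  qed
  have "submodule (con K) R M"
  proof (rule submoduleI)
    show "con K \<subseteq> carrier M" by (auto simp: con_def)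
    show "\<zero>\<^bsub>M\<^esub> \<in> con K" using KD(1) by (simp add: con_def zero_Mq)
    show "\<ominus>\<^bsub>M\<^esub> m \<in> con K" if m: "m \<in> con K" for m
    proof -
      have "\<ominus>\<^bsub>M\<^esub> m = (\<ominus> \<one>) \<odot>\<^bsub>M\<^esub> m" using m by (simp add: con_def smult_l_minus)
      then show ?thesis using sm[of "\<ominus> \<one>" m] m by simp
    qed
    show "m \<oplus>\<^bsub>M\<^esub> m' \<in> con K" if "m \<in> con K" "m' \<in> con K" for m m'
      using that KD(4)[of "fr m \<one>" "fr m' \<one>"] fr_add_same[OF _ _ S_one, of m m'] by (simp add: con_def)
  qed (rule sm)
  moreover have "m \<in> con K" if m: "m \<in> carrier M" and s: "s \<in> S" and c: "s \<odot>\<^bsub>M\<^esub> m \<in> con K" for m s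
  proof -
    have "fr (s \<odot>\<^bsub>M\<^esub> m) s \<in> K" using fr_in_iff[OF K _ s] c m S_R[OF s] by simp
    moreover have "fr (s \<odot>\<^bsub>M\<^esub> m) s = fr m \<one>" using fr_common[OF m S_one s] S_R[OF s] by simp
    ultimately show ?thesis using m by (simp add: con_def)
  qed
  ultimately show ?thesis unfolding saturated_submodule_def by blast
qed

lemma con_zero: "con {\<zero>\<^bsub>Mq\<^esub>} = satur R q M {\<zero>\<^bsub>M\<^esub>}"
  using fr_zero[OF _ S_one] by (auto simp: con_def satur_def)

lemma con_eq_carrier: "submodule K Rq Mq \<Longrightarrow> con K = carrier M \<longleftrightarrow> K = carrier Mq"
proof
  assume K: "submodule K Rq Mq" and c: "con K = carrier M"
  have "C \<in> K" if C: "C \<in> carrier Mq" for C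
  proof -
    obtain m s where "m \<in> carrier M" "s \<in> S" "C = fr m s" by (rule Mq_cases[OF C])
    then show ?thesis using fr_in_iff[OF K] c by simp
  qed
  then show "K = carrier Mq" using Q.sub_in[OF K] by blast
next
  assume "K = carrier Mq"
  then show "con K = carrier M" using fr_closed[OF _ S_one] by (auto simp: con_def)
qed

lemma zero_Mq_iff: "zero_module Mq \<longleftrightarrow> satur R q M {\<zero>\<^bsub>M\<^esub>} = carrier M"
  using con_eq_carrier[OF Q.sub_zero_submodule] unfolding con_zero zero_module_def by metis

lemma regular_mod_con:
  assumes K: "submodule K Rq Mq" and a: "a \<in> carrier R" "s \<in> S"
  shows "regular_mod Mq (self.fr a s) K \<longleftrightarrow> regular_mod M a (con K)"
proof
  assume r: "regular_mod Mq (self.fr a s) K"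
  show "regular_mod M a (con K)" unfolding regular_mod_def
  proof (intro ballI impI)
    fix m assume m: "m \<in> carrier M" "a \<odot>\<^bsub>M\<^esub> m \<in> con K"
    have "self.fr a s \<odot>\<^bsub>Mq\<^esub> fr m \<one> \<in> K"
      unfolding fr_smult[OF a m(1) S_one] using fr_in_iff[OF K _ S_mult[OF a(2) S_one]] m a(1) by simp
    then have "fr m \<one> \<in> K" using r fr_closed[OF m(1) S_one] unfolding regular_mod_def by blast
    then show "m \<in> con K" using m by (simp add: con_def)
  qed
next
  assume r: "regular_mod M a (con K)"
  show "regular_mod Mq (self.fr a s) K" unfolding regular_mod_def
  proof (intro ballI impI)
    fix C assume C: "C \<in> carrier Mq" "self.fr a s \<odot>\<^bsub>Mq\<^esub> C \<in> K"
    obtain m t where m: "m \<in> carrier M" "t \<in> S" "C = fr m t" by (rule Mq_cases[OF C(1)])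
    have "a \<odot>\<^bsub>M\<^esub> m \<in> con K" using C(2) unfolding m(3) fr_smult[OF a m(1,2)]
      using fr_in_iff[OF K _ S_mult[OF a(2) m(2)]] m a(1) by simp
    then have "m \<in> con K" using r m unfolding regular_mod_def by blast
    then show "C \<in> K" unfolding m(3) using fr_in_iff[OF K m(1,2)] by simp
  qed
qed

definition ext :: "'a set \<Rightarrow> ('a \<times> 'a) set set" where
  "ext p = {self.fr a s | a s. a \<in> p \<and> s \<in> S}"

text \<open>Extension followed by contraction is the identity on primes inside q: clearing
  denominators multiplies a by an element outside q, hence outside p.\<close>

lemma mem_ext:
  assumes p: "primeideal p R" "p \<subseteq> q" and a: "a \<in> carrier R" "s \<in> S"
  shows "self.fr a s \<in> ext p \<longleftrightarrow> a \<in> p"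
proof
  note id = primeideal.axioms(1)[OF p(1)]
  assume "self.fr a s \<in> ext p"
  then obtain b t where b: "b \<in> p" "t \<in> S" "self.fr a s = self.fr b t" by (auto simp: ext_def)
  have bR: "b \<in> carrier R" using ideal.Icarr[OF id b(1)] .
  obtain u where u: "u \<in> S" "u \<otimes> (t \<otimes> a) = u \<otimes> (s \<otimes> b)"
    using self.fr_eq[of a b s t] a b bR by auto
  have "u \<otimes> (s \<otimes> b) \<in> p" using ideal.I_l_closed[OF id] b(1) S_R[OF u(1)] S_R[OF a(2)] by auto
  then have "(u \<otimes> t) \<otimes> a \<in> p" using u(2) S_R[OF u(1)] S_R[OF b(2)] a(1) by (simp add: R.m_assoc)
  moreover have "u \<otimes> t \<notin> p" using S_mult[OF u(1) b(2)] p(2) by auto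
  ultimately show "a \<in> p" using primeideal.I_prime[OF p(1)] S_R[OF S_mult[OF u(1) b(2)]] a(1) by blast
next
  assume "a \<in> p" then show "self.fr a s \<in> ext p" using a by (auto simp: ext_def)
qed

lemma ext_cases:
  assumes "primeideal p R" "x \<in> ext p" obtains a s where "a \<in> p" "a \<in> carrier R" "s \<in> S" "x = self.fr a s"
  using assms ideal.Icarr[OF primeideal.axioms(1)[OF assms(1)]] unfolding ext_def by blast

lemma Rq_mult: "a \<in> carrier R \<Longrightarrow> s \<in> S \<Longrightarrow> b \<in> carrier R \<Longrightarrow> t \<in> S \<Longrightarrow>
    self.fr a s \<otimes>\<^bsub>Rq\<^esub> self.fr b t = self.fr (a \<otimes> b) (s \<otimes> t)"
  unfolding Rq_simps using self.fr_smult[of a s b t] by simp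

lemma Rq_add: "a \<in> carrier R \<Longrightarrow> s \<in> S \<Longrightarrow> b \<in> carrier R \<Longrightarrow> t \<in> S \<Longrightarrow>
    self.fr a s \<oplus>\<^bsub>Rq\<^esub> self.fr b t = self.fr (t \<otimes> a \<oplus> s \<otimes> b) (s \<otimes> t)"
  unfolding Rq_simps using self.fr_add[of a b s t] by simp

lemma ext_prime:
  assumes p: "primeideal p R" "p \<subseteq> q"
  shows "primeideal (ext p) Rq"
proof -
  note id = primeideal.axioms(1)[OF p(1)]
  note add = additive_subgroup.a_closed[OF ideal.axioms(1)[OF id]]
  have sub: "ext p \<subseteq> carrier Rq"
    using ideal.Icarr[OF id] Rq_closed unfolding ext_def by blast
  have "ideal (ext p) Rq"
  proof (rule ideal_of_closed[OF Rq_cring sub])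
    show "\<zero>\<^bsub>Rq\<^esub> \<in> ext p"
      unfolding Rq_simps mem_ext[OF p R.zero_closed S_one] by (rule additive_subgroup.zero_closed[OF ideal.axioms(1)[OF id]])
    fix x y assume x: "x \<in> ext p" and y: "y \<in> ext p"
    obtain a s where a: "a \<in> p" "a \<in> carrier R" "s \<in> S" "x = self.fr a s" by (rule ext_cases[OF p(1) x])
    obtain b t where b: "b \<in> p" "b \<in> carrier R" "t \<in> S" "y = self.fr b t" by (rule ext_cases[OF p(1) y])
    have "t \<otimes> a \<oplus> s \<otimes> b \<in> p"
      by (intro add ideal.I_l_closed[OF id a(1)] ideal.I_l_closed[OF id b(1)] S_R a(3) b(3))
    then show "x \<oplus>\<^bsub>Rq\<^esub> y \<in> ext p" unfolding a(4) b(4) Rq_add[OF a(2,3) b(2,3)] ext_def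
      using S_mult[OF a(3) b(3)] by blast
  next
    fix y x assume y: "y \<in> carrier Rq" and x: "x \<in> ext p"
    obtain a s where a: "a \<in> p" "a \<in> carrier R" "s \<in> S" "x = self.fr a s" by (rule ext_cases[OF p(1) x])
    obtain b t where b: "b \<in> carrier R" "t \<in> S" "y = self.fr b t" by (rule Rq_cases[OF y])
    show "y \<otimes>\<^bsub>Rq\<^esub> x \<in> ext p" unfolding a(4) b(3) Rq_mult[OF b(1,2) a(2,3)] ext_def
      using S_mult[OF b(2) a(3)] ideal.I_l_closed[OF id a(1) b(1)] by blast
  qed
  then show ?thesis
  proof (rule primeidealI[OF _ Rq_cring])
    show "carrier Rq \<noteq> ext p"
    proof
      assume "carrier Rq = ext p"
      then have "self.fr \<one> \<one> \<in> ext p" using Rq_closed[OF R.one_closed S_one] by simp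
      then have "\<one> \<in> p" unfolding mem_ext[OF p R.one_closed S_one] .
      then show False using p(2) S_one by auto
    qed
    fix x y assume x: "x \<in> carrier Rq" and y: "y \<in> carrier Rq" and xy: "x \<otimes>\<^bsub>Rq\<^esub> y \<in> ext p"
    obtain a s where a: "a \<in> carrier R" "s \<in> S" "x = self.fr a s" by (rule Rq_cases[OF x])
    obtain b t where b: "b \<in> carrier R" "t \<in> S" "y = self.fr b t" by (rule Rq_cases[OF y])
    have "a \<otimes> b \<in> p"
      using xy unfolding a(3) b(3) Rq_mult[OF a(1,2) b(1,2)] mem_ext[OF p R.m_closed[OF a(1) b(1)] S_mult[OF a(2) b(2)]] .
    then have "a \<in> p \<or> b \<in> p" by (rule primeideal.I_prime[OF p(1) a(1) b(1)])
    then show "x \<in> ext p \<or> y \<in> ext p"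
      unfolding a(3) b(3) mem_ext[OF p a(1,2)] mem_ext[OF p b(1,2)] .
  qed
qed

text \<open>A fraction whose numerator lies outside q is a unit, so a proper ideal contains
  none.\<close>

lemma ideal_le_ext:
  assumes J: "ideal J Rq" "J \<noteq> carrier Rq" shows "J \<subseteq> ext q"
proof
  fix x assume x: "x \<in> J"
  have xc: "x \<in> carrier Rq" using ideal.Icarr[OF J(1) x] .
  obtain a s where a: "a \<in> carrier R" "s \<in> S" "x = self.fr a s" by (rule Rq_cases[OF xc])
  have "a \<in> q"
  proof (rule ccontr)
    assume "a \<notin> q"
    then have aS: "a \<in> S" using a by simp
    note R = S_R[OF a(2)]
    have "self.fr s a \<otimes>\<^bsub>Rq\<^esub> x \<in> J" by (rule ideal.I_l_closed[OF J(1) x Rq_closed[OF R aS]])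
    moreover have "self.fr s a \<otimes>\<^bsub>Rq\<^esub> x = \<one>\<^bsub>Rq\<^esub>"
      unfolding a(3) Rq_mult[OF R aS a(1,2)] Rq_simps(4)
      by (rule self.fr_eqI[OF _ _ S_mult[OF aS a(2)] S_one S_one]) (use a R in \<open>simp_all add: R.m_comm\<close>)
    ultimately show False using ideal.one_imp_carrier[OF J(1)] J(2) by simp
  qed
  then show "x \<in> ext q" unfolding a(3) using mem_ext[OF prime subset_refl a(1,2)] by simp
qed

text \<open>Evaluates the definite description inside \<open>depth\<close>; the local ring has
  exactly one maximal ideal because everything outside \<open>ext q\<close> is a unit.\<close>

lemma the_maximalideal: "(THE m. maximalideal m Rq) = ext q"
proof (rule the_equality)
  note P = ext_prime[OF prime subset_refl]
  note I = primeideal.axioms(1)[OF P]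
  show M: "maximalideal (ext q) Rq"
    by (rule maximalidealI[OF I]) (use primeideal.I_notcarr[OF P] ideal_le_ext in blast)+
  fix m assume m: "maximalideal m Rq"
  have "m \<subseteq> ext q" by (rule ideal_le_ext[OF maximalideal.axioms(1)[OF m]]) (use maximalideal.I_notcarr[OF m] in simp)
  moreover have "ext q \<subseteq> carrier Rq" using ideal.Icarr[OF I] by blast
  ultimately have "ext q = m \<or> ext q = carrier Rq" using maximalideal.I_maximal[OF m I] by blast
  then show "m = ext q" using primeideal.I_notcarr[OF P] by auto
qed

text \<open>Extension is strictly monotone on the primes inside q, so each chain ending at q yields
  a chain of the same length in the local ring.\<close>

lemma height_le_krull_dim: "height R q \<le> krull_dim Rq"
  unfolding height_def
proof (rule SUP_least)
  fix ps assume "ps \<in> {ps. prime_chain R ps \<and> last ps = q}"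
  then have ne: "ps \<noteq> []" and ps: "set ps \<subseteq> Spec R" "sorted_wrt (\<subset>) ps" "last ps = q" by (auto simp: prime_chain_def)
  have le: "p \<subseteq> q" if pps: "p \<in> set ps" for p
  proof -
    obtain i where i: "i < length ps" "p = ps ! i" using pps by (auto simp: in_set_conv_nth)
    show ?thesis
    proof (cases "i = length ps - 1")
      case True then show ?thesis using i ps(3) last_conv_nth[OF ne] by auto
    next
      case False
      then have "ps ! i \<subset> ps ! (length ps - 1)" using i by (intro sorted_wrt_nth_less[OF ps(2)]) auto
      then show ?thesis using i ps(3) last_conv_nth[OF ne] by auto
    qed
  qed
  have pr: "primeideal p R" if "p \<in> set ps" for p using ps(1) that by (auto simp: Spec_def)
  have "sorted_wrt (\<subset>) (map ext ps)"
  proof -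
    have "ext a \<subset> ext b" if ab: "a \<in> set ps" "b \<in> set ps" "a \<subset> b" for a b
    proof -
      obtain c where c: "c \<in> b" "c \<notin> a" using ab by blast
      have cR: "c \<in> carrier R" using ideal.Icarr[OF primeideal.axioms(1)[OF pr[OF ab(2)]] c(1)] .
      have "self.fr c \<one> \<in> ext b" "self.fr c \<one> \<notin> ext a"
        using mem_ext[OF pr le cR S_one] ab c by auto
      moreover have "ext a \<subseteq> ext b" using ab(3) unfolding ext_def by blast
      ultimately show ?thesis by blast
    qed
    then show ?thesis unfolding sorted_wrt_map by (rule sorted_wrt_mono_rel[OF _ ps(2)])
  qed
  moreover have "set (map ext ps) \<subseteq> Spec Rq" using ext_prime[OF pr le] by (auto simp: Spec_def)
  ultimately have "prime_chain Rq (map ext ps)" using ne by (simp add: prime_chain_def)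
  then have "enat (length (map ext ps) - 1) \<le> krull_dim Rq"
    unfolding krull_dim_def by (intro SUP_upper) simp
  then show "enat (length ps - 1) \<le> krull_dim Rq" by simp
qed

end

section \<open>Regular sequences over the local ring versus steps inside M\<close>

sublocale prime_modl \<subseteq> L: loc_modl R M q
  by (intro loc_modl.intro loc_modl_axioms.intro modl_axioms primeideal_axioms)

context prime_modl
begin

text \<open>Contraction translates division by x/s into \<open>quot_step\<close>; the unit s
  disappears in the saturation.\<close>

lemma con_step:
  assumes K: "submodule K L.Rq L.Mq" and x: "x \<in> carrier R" "s \<in> carrier R - q"
  shows "L.con {h \<oplus>\<^bsub>L.Mq\<^esub> k | h k. h \<in> K \<and> k \<in> {L.self.fr x s \<odot>\<^bsub>L.Mq\<^esub> C | C. C \<in> carrier L.Mq}} = step (L.con K) x"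
    (is "L.con ?A = _")
proof
  note sR = L.S_R[OF x(2)]
  note xs = L.Rq_closed[OF x]
  have "(\<lambda>C. L.self.fr x s \<odot>\<^bsub>L.Mq\<^esub> C) \<in> module_hom L.Rq L.Mq L.Mq"
    by (rule module_homI) (simp_all add: xs L.Q.smult_r_distr L.Q.smult_commute)
  then have "submodule ((\<lambda>C. L.self.fr x s \<odot>\<^bsub>L.Mq\<^esub> C) ` carrier L.Mq) L.Rq L.Mq"
    by (rule L.Q.hom_image_submodule[OF L.Q.module_axioms _ L.Q.carrier_is_submodule])
  moreover have "(\<lambda>C. L.self.fr x s \<odot>\<^bsub>L.Mq\<^esub> C) ` carrier L.Mq = {L.self.fr x s \<odot>\<^bsub>L.Mq\<^esub> C | C. C \<in> carrier L.Mq}" by auto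
  ultimately have X: "submodule {L.self.fr x s \<odot>\<^bsub>L.Mq\<^esub> C | C. C \<in> carrier L.Mq} L.Rq L.Mq" by (simp only:)
  note A = L.Q.sum_submodule[OF K X]
  note cs = L.con_sat[OF K]
  note css = satur_submoduleD(1)[OF cs]
  show "step (L.con K) x \<subseteq> L.con ?A"
  proof (rule step_least[OF L.con_sat[OF A]])
    show "L.con K \<subseteq> L.con ?A"
    proof
      fix m assume m: "m \<in> L.con K"
      have "L.fr m \<one> = L.fr m \<one> \<oplus>\<^bsub>L.Mq\<^esub> \<zero>\<^bsub>L.Mq\<^esub>"
        using L.fr_closed[OF _ L.S_one, of m] m by (simp add: L.con_def)
      then have "L.fr m \<one> \<in> ?A" using m L.Q.sub_zero[OF X] unfolding L.con_def by blast
      then show "m \<in> L.con ?A" using m by (simp add: L.con_def)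
    qed
    fix m assume m: "m \<in> carrier M"
    have "L.fr (x \<odot>\<^bsub>M\<^esub> m) (s \<otimes> \<one>) = \<zero>\<^bsub>L.Mq\<^esub> \<oplus>\<^bsub>L.Mq\<^esub> (L.self.fr x s \<odot>\<^bsub>L.Mq\<^esub> L.fr m \<one>)"
      using L.fr_smult[OF x m L.S_one] L.fr_closed[OF _ L.S_mult[OF x(2) L.S_one], of "x \<odot>\<^bsub>M\<^esub> m"] x m by simp
    then have "L.fr (x \<odot>\<^bsub>M\<^esub> m) (s \<otimes> \<one>) \<in> ?A"
      using L.Q.sub_zero[OF K] L.fr_closed[OF m L.S_one] by blast
    then show "x \<odot>\<^bsub>M\<^esub> m \<in> L.con ?A"
      using L.fr_in_iff[OF A _ L.S_mult[OF x(2) L.S_one]] x m by simp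
  qed
  show "L.con ?A \<subseteq> step (L.con K) x"
  proof
    fix m assume "m \<in> L.con ?A"
    then obtain h C where m: "m \<in> carrier M" and h: "h \<in> K" and C: "C \<in> carrier L.Mq"
      and e: "L.fr m \<one> = h \<oplus>\<^bsub>L.Mq\<^esub> L.self.fr x s \<odot>\<^bsub>L.Mq\<^esub> C" unfolding L.con_def by blast
    obtain m' t where m': "m' \<in> carrier M" "t \<in> carrier R - q" "h = L.fr m' t"
      by (rule L.Mq_cases[OF L.Q.sub_in[OF K h]])
    obtain w t' where w: "w \<in> carrier M" "t' \<in> carrier R - q" "C = L.fr w t'" by (rule L.Mq_cases[OF C])
    note R = sR L.S_R[OF m'(2)] L.S_R[OF w(2)]
    note st = L.S_mult[OF x(2) w(2)]
    have xw: "x \<odot>\<^bsub>M\<^esub> w \<in> carrier M" using x w by simp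
    have m'K: "m' \<in> L.con K" using h L.fr_in_iff[OF K m'(1,2)] m'(3) by simp
    let ?n = "(s \<otimes> t') \<odot>\<^bsub>M\<^esub> m' \<oplus>\<^bsub>M\<^esub> t \<odot>\<^bsub>M\<^esub> (x \<odot>\<^bsub>M\<^esub> w)"
    have "L.fr m \<one> = L.fr ?n (t \<otimes> (s \<otimes> t'))"
      using e unfolding m'(3) w(3) L.fr_smult[OF x w(1,2)] L.fr_add[OF m'(1) xw m'(2) st] .
    then obtain u where u: "u \<in> carrier R - q" "u \<odot>\<^bsub>M\<^esub> ((t \<otimes> (s \<otimes> t')) \<odot>\<^bsub>M\<^esub> m) = u \<odot>\<^bsub>M\<^esub> (\<one> \<odot>\<^bsub>M\<^esub> ?n)"
      using L.fr_eq[OF m _ L.S_one L.S_mult[OF m'(2) st], of ?n] R m' w x by auto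
    have uR: "u \<in> carrier R" using u by simp
    have "(u \<otimes> (t \<otimes> (s \<otimes> t'))) \<odot>\<^bsub>M\<^esub> m = (u \<otimes> (s \<otimes> t')) \<odot>\<^bsub>M\<^esub> m' \<oplus>\<^bsub>M\<^esub> x \<odot>\<^bsub>M\<^esub> ((u \<otimes> t) \<odot>\<^bsub>M\<^esub> w)"
      using u(2) R uR m m'(1) w(1) x by (simp add: smult_r_distr smult_ac)
    moreover have "(u \<otimes> (s \<otimes> t')) \<odot>\<^bsub>M\<^esub> m' \<in> L.con K"
      using submoduleE(4)[OF css _ m'K] R uR by simp
    ultimately have "cong (L.con K) ((u \<otimes> (t \<otimes> (s \<otimes> t'))) \<odot>\<^bsub>M\<^esub> m) (x \<odot>\<^bsub>M\<^esub> ((u \<otimes> t) \<odot>\<^bsub>M\<^esub> w))"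
      using cong_of_sum[OF css] x w R uR by simp
    moreover have "u \<otimes> (t \<otimes> (s \<otimes> t')) \<in> carrier R - q" by (intro L.S_mult u m' x w)
    moreover have "(u \<otimes> t) \<odot>\<^bsub>M\<^esub> w \<in> carrier M" using uR R w by simp
    ultimately show "m \<in> step (L.con K) x" unfolding mem_step[OF css x(1)] using m by metis
  qed
qed

lemma step_carrier: "x \<in> carrier R \<Longrightarrow> step (carrier M) x = carrier M"
  using step_superset[OF carrier_is_submodule] sub_in[OF satur_submoduleD(1)[OF step_sat[OF carrier_is_submodule]]] by blast

text \<open>On the zero module even the zero of R is regular and may be repeated indefinitely; this
  reproduces depth(0) = infinity.\<close>

lemma depth_ge_carrier: "dge k (carrier M)"
proof (induction k)
  case (Suc k)
  have "\<zero> \<in> q" by (rule additive_subgroup.zero_closed[OF ideal.axioms(1)[OF is_ideal]])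
  moreover have "regular_mod M \<zero> (carrier M)" by (simp add: regular_mod_def)
  ultimately show ?case using Suc step_carrier[OF R.zero_closed] by auto
qed simp

lemma depth_ge_Suc: "dge (Suc k) H \<Longrightarrow> dge k H"
  by (induction k arbitrary: H) auto

lemma depth_ge_mono: "dge n H \<Longrightarrow> k \<le> n \<Longrightarrow> dge k H"
  by (induction n) (auto simp del: depth_ge.simps dest: depth_ge_Suc simp: le_Suc_eq)

abbreviation "cseq xs \<equiv> L.con (seq_submodule L.Rq L.Mq xs)"

lemma ext_carrier: "set xs \<subseteq> L.ext q \<Longrightarrow> set xs \<subseteq> carrier L.Rq"
  using ideal.Icarr[OF primeideal.axioms(1)[OF L.ext_prime[OF L.prime subset_refl]]] by blast

lemma ext_q_cases:
  assumes "x \<in> L.ext q" obtains a s where "a \<in> q" "a \<in> carrier R" "s \<in> carrier R - q" "x = L.self.fr a s"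
  by (rule L.ext_cases[OF L.prime assms])

lemma cseq_Nil: "cseq [] = satur R q M {\<zero>\<^bsub>M\<^esub>}"
  by (simp add: L.Q.seq_submodule_Nil L.con_zero)

lemma cseq_snoc:
  assumes "set xs \<subseteq> L.ext q" "a \<in> carrier R" "s \<in> carrier R - q"
  shows "cseq (xs @ [L.self.fr a s]) = step (cseq xs) a"
  unfolding L.Q.seq_submodule_snoc[OF ext_carrier[OF assms(1)] L.Rq_closed[OF assms(2,3)]]
  by (rule con_step[OF L.Q.seq_submodule_sub[OF ext_carrier[OF assms(1)]] assms(2,3)])

text \<open>Regularity is stated relative to initial segments, whereas \<open>depth_ge\<close> asks
  for what is still to come. The induction therefore runs over the length j of the remaining tail,
  starting from the empty one.\<close>

lemma depth_ge_of_regular: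
  assumes xs: "set xs \<subseteq> L.ext q"
    and reg: "\<And>i. i < length xs \<Longrightarrow> regular_mod L.Mq (xs ! i) (seq_submodule L.Rq L.Mq (take i xs))"
    and "j \<le> length xs"
  shows "dge j (cseq (take (length xs - j) xs))"
  using assms(3)
proof (induction j)
  case (Suc j)
  let ?i = "length xs - Suc j"
  have i: "?i < length xs" "length xs - j = Suc ?i" using Suc.prems by auto
  have "xs ! ?i \<in> L.ext q" using xs i by auto
  then obtain a s where a: "a \<in> q" "a \<in> carrier R" "s \<in> carrier R - q" "xs ! ?i = L.self.fr a s" by (rule ext_q_cases)
  have tk: "set (take ?i xs) \<subseteq> L.ext q" using xs set_take_subset[of ?i xs] by blast
  have "take (length xs - j) xs = take ?i xs @ [L.self.fr a s]"
    using i a(4) take_Suc_conv_app_nth[OF i(1)] by metis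
  then have "dge j (step (cseq (take ?i xs)) a)" using Suc.IH Suc.prems cseq_snoc[OF tk a(2,3)] by simp
  moreover have "regular_mod M a (cseq (take ?i xs))"
    using reg[OF i(1)] a L.regular_mod_con[OF L.Q.seq_submodule_sub[OF ext_carrier[OF tk]] a(2,3)] by simp
  ultimately show ?case using a(1) by auto
qed simp

text \<open>The accumulator \<open>ys\<close> records what has been divided out already; the
  elements supplied by \<open>depth_ge\<close> enter as fractions with denominator one.\<close>

lemma regular_of_depth_ge:
  assumes "set ys \<subseteq> L.ext q" "dge k (cseq ys)"
  shows "\<exists>zs. length zs = k \<and> set zs \<subseteq> L.ext q \<and>
    (\<forall>i<k. regular_mod L.Mq (zs ! i) (seq_submodule L.Rq L.Mq (ys @ take i zs)))"
  using assms
proof (induction k arbitrary: ys)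
  case (Suc k)
  obtain a where a: "a \<in> q" "regular_mod M a (cseq ys)" "dge k (step (cseq ys) a)" using Suc.prems by auto
  note aR = q_carrier[OF a(1)]
  let ?x = "L.self.fr a \<one>"
  have x: "?x \<in> L.ext q" using L.mem_ext[OF L.prime subset_refl aR L.S_one] a by simp
  have ys: "set (ys @ [?x]) \<subseteq> L.ext q" using Suc.prems(1) x by simp
  have "dge k (cseq (ys @ [?x]))" using a(3) cseq_snoc[OF Suc.prems(1) aR L.S_one] by simp
  then obtain zs where zs: "length zs = k" "set zs \<subseteq> L.ext q"
    "\<And>i. i < k \<Longrightarrow> regular_mod L.Mq (zs ! i) (seq_submodule L.Rq L.Mq ((ys @ [?x]) @ take i zs))"
    using Suc.IH[OF ys] by metis
  have "regular_mod L.Mq ((?x # zs) ! i) (seq_submodule L.Rq L.Mq (ys @ take i (?x # zs)))" if "i < Suc k" for i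
  proof (cases i)
    case 0
    then show ?thesis
      using a(2) L.regular_mod_con[OF L.Q.seq_submodule_sub[OF ext_carrier[OF Suc.prems(1)]] aR L.S_one] by simp
  next
    case (Suc j)
    then show ?thesis using zs(3)[of j] that by simp
  qed
  then show ?case using zs x by (intro exI[of _ "?x # zs"]) auto
qed simp

text \<open>Nakayama's lemma for the last clause of \<open>regular_sequence\<close>: a maximal
  saturated H contains qM, so every step by an element of q stays inside H.\<close>

lemma cseq_proper:
  assumes ne: "satur R q M {\<zero>\<^bsub>M\<^esub>} \<noteq> carrier M" and xs: "set xs \<subseteq> L.ext q"
  shows "seq_submodule L.Rq L.Mq xs \<noteq> carrier L.Mq"
proof -
  obtain H where H: "sat_sub H" "H \<noteq> carrier M" and qH: "\<forall>r\<in>q. \<forall>y\<in>carrier M. r \<odot>\<^bsub>M\<^esub> y \<in> H"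
    using maximal_saturated[OF ne] by (elim exE conjE)
  have "cseq xs \<subseteq> H" using xs
  proof (induction xs rule: rev_induct)
    case Nil
    show ?case unfolding cseq_Nil using sub_zero[OF satur_submoduleD(1)[OF H(1)]] by (intro satur_least[OF H(1)]) simp
  next
    case (snoc x xs)
    then have x: "x \<in> L.ext q" and xs: "set xs \<subseteq> L.ext q" by auto
    obtain a s where a: "a \<in> q" "a \<in> carrier R" "s \<in> carrier R - q" "x = L.self.fr a s" by (rule ext_q_cases[OF x])
    show ?case unfolding a(4) cseq_snoc[OF xs a(2,3)]
      by (rule step_least[OF H(1) snoc.IH[OF xs]]) (use qH a(1) in simp)
  qed
  then have "cseq xs \<noteq> carrier M" using H(2) sub_in[OF satur_submoduleD(1)[OF H(1)]] by blast
  then show ?thesis using L.con_eq_carrier[OF L.Q.seq_submodule_sub[OF ext_carrier[OF xs]]] by simp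
qed

text \<open>The bridge between regular sequences over the local ring and the recursion inside M. If
  M vanishes at q, both sides hold for all k.\<close>

theorem depth_ge_iff: "enat k \<le> depth L.Rq L.Mq \<longleftrightarrow> dge k (satur R q M {\<zero>\<^bsub>M\<^esub>})"
proof (cases "satur R q M {\<zero>\<^bsub>M\<^esub>} = carrier M")
  case True
  then show ?thesis
    using L.zero_Mq_iff depth_ge_carrier by (simp add: depth_def depth_in_def)
next
  case ne: False
  let ?X = "{xs. set xs \<subseteq> L.ext q \<and> regular_sequence L.Rq L.Mq xs}"
  have d: "depth L.Rq L.Mq = (SUP xs\<in>?X. enat (length xs))"
    using ne L.zero_Mq_iff by (simp add: depth_def depth_in_def L.the_maximalideal)
  show ?thesis
  proof
    assume k: "enat k \<le> depth L.Rq L.Mq"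
    show "dge k (satur R q M {\<zero>\<^bsub>M\<^esub>})"
    proof (cases k)
      case (Suc k')
      \<comment> \<open>The supremum may be infinite without being attained, so a sequence is
        extracted from the strict inequality for k - 1; its length is then at least k.\<close>
      then have "enat k' < (SUP xs\<in>?X. enat (length xs))" using k d by (simp add: Suc_ile_eq)
      then obtain xs where xs: "set xs \<subseteq> L.ext q" "regular_sequence L.Rq L.Mq xs" "k' < length xs"
        unfolding less_SUP_iff by auto
      have "dge (length xs) (cseq (take (length xs - length xs) xs))"
        by (rule depth_ge_of_regular[OF xs(1)]) (use xs(2) L.Q.regular_sequence_iff in auto)
      then have "dge (length xs) (satur R q M {\<zero>\<^bsub>M\<^esub>})" using cseq_Nil by simp
      then show ?thesis by (rule depth_ge_mono) (use xs(3) Suc in simp)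
    qed simp
  next
    assume "dge k (satur R q M {\<zero>\<^bsub>M\<^esub>})"
    then obtain zs where zs: "length zs = k" "set zs \<subseteq> L.ext q"
      "\<And>i. i < k \<Longrightarrow> regular_mod L.Mq (zs ! i) (seq_submodule L.Rq L.Mq ([] @ take i zs))"
      using regular_of_depth_ge[of "[]" k] cseq_Nil by auto
    have "regular_sequence L.Rq L.Mq zs"
      unfolding L.Q.regular_sequence_iff using zs ext_carrier[OF zs(2)] cseq_proper[OF ne zs(2)] by auto
    then have "zs \<in> ?X" using zs(2) by simp
    then show "enat k \<le> depth L.Rq L.Mq" unfolding d using zs(1) by (auto intro!: SUP_upper2[of zs])
  qed
qed

end

section \<open>Serre's condition\<close>

lemma Supp_iff:
  assumes "module R M" "q \<in> Spec R"
  shows "q \<in> Supp R M \<longleftrightarrow> satur R q M {\<zero>\<^bsub>M\<^esub>} \<noteq> carrier M"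
proof -
  interpret loc_modl R M q
    using assms by (intro loc_modl.intro loc_modl_axioms.intro modl.intro) (auto simp: Spec_def)
  show ?thesis using zero_Mq_iff assms by (simp add: Supp_def)
qed

lemma prime_modlI:
  "noetherian_ring R \<Longrightarrow> fg_module R M \<Longrightarrow> q \<in> Spec R \<Longrightarrow> prime_modl q R M"
  by (auto simp: fg_module_def Spec_def intro!: prime_modl.intro noeth_modl.intro modl.intro noeth_modl_axioms.intro)

text \<open>Testing every k below both n and the dimension replaces the minimum in (S_n), so that
  later proofs need no case distinction on the size of the dimension.\<close>

lemma serre_condition_iff:
  assumes "noetherian_ring R" "fg_module R M"
  shows "serre_condition R n M \<longleftrightarrow>
    (\<forall>q\<in>Spec R. \<forall>k\<le>n. satur R q M {\<zero>\<^bsub>M\<^esub>} \<noteq> carrier M \<and> enat k \<le> krull_dim (loc_ring R q) \<longrightarrow>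
       depth_ge R q M k (satur R q M {\<zero>\<^bsub>M\<^esub>}))"
proof -
  have d: "(min (enat n) e \<le> d) \<longleftrightarrow> (\<forall>k\<le>n. enat k \<le> e \<longrightarrow> enat k \<le> d)" for d e :: enat
  proof
    assume a: "\<forall>k\<le>n. enat k \<le> e \<longrightarrow> enat k \<le> d"
    show "min (enat n) e \<le> d"
    proof (cases "enat n \<le> e")
      case False
      \<comment> \<open>A dimension below n is finite and can itself be inserted for k.\<close>
      then obtain k where k: "e = enat k" "k \<le> n" by (cases e) auto
      then show ?thesis using a by (auto simp: min_def)
    qed (use a in \<open>auto simp: min_def\<close>)
  qed (auto intro: order_trans[rotated])
  have m: "module R M" using assms by (simp add: fg_module_def)
  have "serre_condition R n M \<longleftrightarrow> (\<forall>q\<in>Spec R. q \<in> Supp R M \<longrightarrow>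
      (\<forall>k\<le>n. enat k \<le> krull_dim (loc_ring R q) \<longrightarrow> enat k \<le> depth (loc_ring R q) (loc_module R q M)))"
    unfolding serre_condition_def d by (auto simp: Supp_def)
  also have "\<dots> \<longleftrightarrow> (\<forall>q\<in>Spec R. \<forall>k\<le>n. satur R q M {\<zero>\<^bsub>M\<^esub>} \<noteq> carrier M \<and> enat k \<le> krull_dim (loc_ring R q) \<longrightarrow>
       depth_ge R q M k (satur R q M {\<zero>\<^bsub>M\<^esub>}))"
    using Supp_iff[OF m] prime_modl.depth_ge_iff[OF prime_modlI[OF assms]] by (intro ball_cong refl) auto
  finally show ?thesis .
qed

text \<open>Positivity of k turns the bound into a strict one for k - 1, from which a member of the
  supremum can be extracted.\<close>

lemma height_chain:
  assumes "enat k \<le> height R p" "0 < k"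
  obtains ps where "prime_chain R ps" "last ps = p" "k < length ps"
proof -
  obtain k' where k': "k = Suc k'" using assms by (cases k) auto
  have "enat k' < height R p" using assms k' by (simp add: Suc_ile_eq)
  then show ?thesis using that unfolding height_def less_SUP_iff k' by fastforce
qed

text \<open>Append p' to a chain that ends at p and has at least k steps.\<close>

lemma height_le_mono:
  assumes "p \<subset> p'" "p' \<in> Spec R" "enat k \<le> height R p" "0 < k"
  shows "enat (Suc k) \<le> height R p'"
proof -
  obtain ps where ps: "prime_chain R ps" "last ps = p" "k < length ps" by (rule height_chain[OF assms(3,4)])
  then have ne: "ps \<noteq> []" by auto
  have "x \<subset> p'" if xps: "x \<in> set ps" for x
  proof -
    obtain i where i: "i < length ps" "x = ps ! i" using xps by (auto simp: in_set_conv_nth)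
    have "x \<subseteq> p"
    proof (cases "i = length ps - 1")
      case True then show ?thesis using i ps(2) last_conv_nth[OF ne] by auto
    next
      case False
      then have "ps ! i \<subset> ps ! (length ps - 1)"
        using i ps(1) by (intro sorted_wrt_nth_less[of "(\<subset>)" ps]) (auto simp: prime_chain_def)
      then show ?thesis using i ps(2) last_conv_nth[OF ne] by auto
    qed
    then show ?thesis using assms(1) by blast
  qed
  then have "prime_chain R (ps @ [p'])" using ps(1) assms(2) by (auto simp: prime_chain_def sorted_wrt_append)
  then have "enat (length (ps @ [p']) - 1) \<le> height R p'" unfolding height_def by (intro SUP_upper) simp
  then show ?thesis using ps(3) by (auto intro: order_trans[rotated])
qed

section \<open>Tensor products\<close>

lemma free_on_simps:
  "carrier (free_on R S) = {c. range c \<subseteq> carrier R \<and> finite {s. c s \<noteq> \<zero>\<^bsub>R\<^esub>} \<and> {s. c s \<noteq> \<zero>\<^bsub>R\<^esub>} \<subseteq> S}"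
  "\<zero>\<^bsub>free_on R S\<^esub> = (\<lambda>s. \<zero>\<^bsub>R\<^esub>)"
  "c \<oplus>\<^bsub>free_on R S\<^esub> d = (\<lambda>s. c s \<oplus>\<^bsub>R\<^esub> d s)"
  "a \<odot>\<^bsub>free_on R S\<^esub> c = (\<lambda>s. a \<otimes>\<^bsub>R\<^esub> c s)"
  by (simp_all add: free_on_def)

context cring
begin

lemma free_onD:
  assumes "c \<in> carrier (free_on R S)"
  shows "c s \<in> carrier R" "finite {s. c s \<noteq> \<zero>}" "{s. c s \<noteq> \<zero>} \<subseteq> S"
  using assms by (auto simp: free_on_simps)

lemma free_onI:
  assumes "\<And>s. c s \<in> carrier R" "finite A" "A \<subseteq> S" "\<And>s. s \<notin> A \<Longrightarrow> c s = \<zero>"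
  shows "c \<in> carrier (free_on R S)"
proof -
  have "{s. c s \<noteq> \<zero>} \<subseteq> A" using assms by blast
  then show ?thesis using assms finite_subset by (auto simp: free_on_simps)
qed

lemma free_on_module: "module R (free_on R S)"
proof (intro moduleI abelian_groupI' is_cring)
  let ?F = "free_on R S"
  fix c assume c: "c \<in> carrier ?F"
  show "\<zero>\<^bsub>?F\<^esub> \<oplus>\<^bsub>?F\<^esub> c = c" "\<one> \<odot>\<^bsub>?F\<^esub> c = c"
    using free_onD(1)[OF c] by (simp_all add: free_on_simps)
  have "(\<lambda>s. \<ominus> c s) \<in> carrier ?F"
    by (rule free_onI[OF _ free_onD(2,3)[OF c]]) (use free_onD(1)[OF c] in auto)
  then show "\<exists>d\<in>carrier ?F. d \<oplus>\<^bsub>?F\<^esub> c = \<zero>\<^bsub>?F\<^esub>"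
    by (rule bexI[rotated]) (use free_onD(1)[OF c] in \<open>simp add: free_on_simps l_neg\<close>)
  { fix a assume a: "a \<in> carrier R"
    show "a \<odot>\<^bsub>?F\<^esub> c \<in> carrier ?F"
      by (rule free_onI[OF _ free_onD(2,3)[OF c]]) (use free_onD(1)[OF c] a in \<open>auto simp: free_on_simps(4)\<close>)
    fix b assume b: "b \<in> carrier R"
    show "(a \<oplus> b) \<odot>\<^bsub>?F\<^esub> c = a \<odot>\<^bsub>?F\<^esub> c \<oplus>\<^bsub>?F\<^esub> b \<odot>\<^bsub>?F\<^esub> c"
      "(a \<otimes> b) \<odot>\<^bsub>?F\<^esub> c = a \<odot>\<^bsub>?F\<^esub> (b \<odot>\<^bsub>?F\<^esub> c)"
      using free_onD(1)[OF c] a b by (simp_all add: free_on_simps l_distr m_assoc) }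
  fix d assume d: "d \<in> carrier ?F"
  show "c \<oplus>\<^bsub>?F\<^esub> d \<in> carrier ?F"
    by (rule free_onI[of _ "{s. c s \<noteq> \<zero>} \<union> {s. d s \<noteq> \<zero>}"])
      (use free_onD[OF c] free_onD[OF d] in \<open>auto simp: free_on_simps(3)\<close>)
  show "c \<oplus>\<^bsub>?F\<^esub> d = d \<oplus>\<^bsub>?F\<^esub> c"
    using free_onD(1)[OF c] free_onD(1)[OF d] by (simp add: free_on_simps a_comm)
  { fix a assume a: "a \<in> carrier R"
    show "a \<odot>\<^bsub>?F\<^esub> (c \<oplus>\<^bsub>?F\<^esub> d) = a \<odot>\<^bsub>?F\<^esub> c \<oplus>\<^bsub>?F\<^esub> a \<odot>\<^bsub>?F\<^esub> d"
      using free_onD(1)[OF c] free_onD(1)[OF d] a by (simp add: free_on_simps r_distr) }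
  fix e assume e: "e \<in> carrier ?F"
  show "c \<oplus>\<^bsub>?F\<^esub> d \<oplus>\<^bsub>?F\<^esub> e = c \<oplus>\<^bsub>?F\<^esub> (d \<oplus>\<^bsub>?F\<^esub> e)"
    using free_onD(1)[OF c] free_onD(1)[OF d] free_onD(1)[OF e] by (simp add: free_on_simps a_assoc)
next
  show "\<zero>\<^bsub>free_on R S\<^esub> \<in> carrier (free_on R S)"
    by (rule free_onI[of _ "{}"]) (auto simp: free_on_simps(2))
qed

lemma free_gen_closed: "s \<in> S \<Longrightarrow> free_gen R s \<in> carrier (free_on R S)"
  by (rule free_onI[of _ "{s}"]) (auto simp: free_gen_def)

lemma free_on_span: "submodule_span R (free_on R S) (free_gen R ` S) = carrier (free_on R S)"
proof -
  interpret F: modl R "free_on R S" by (rule modl.intro[OF free_on_module])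
  have G: "free_gen R ` S \<subseteq> carrier (free_on R S)" by (simp add: image_subset_iff free_gen_closed)
  note Sp = F.span_submodule[OF G]
  let ?S = "submodule_span R (free_on R S) (free_gen R ` S)"
  have "c \<in> ?S" if "finite A" "A \<subseteq> S" "c \<in> carrier (free_on R S)" "\<And>s. s \<notin> A \<Longrightarrow> c s = \<zero>" for A c
    using that
  proof (induction A arbitrary: c)
    case empty
    then have "c = \<zero>\<^bsub>free_on R S\<^esub>" by (auto simp: free_on_simps(2))
    then show ?case using F.sub_zero[OF Sp] by simp
  next
    case (insert s A)
    let ?c = "\<lambda>t. if t = s then \<zero> else c t"
    have cR: "c t \<in> carrier R" for t using free_onD(1)[OF insert.prems(2)] .
    have c': "?c \<in> carrier (free_on R S)"
      by (rule free_onI[of _ A]) (use insert cR in auto)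
    have "?c \<in> ?S" by (rule insert.IH[OF _ c']) (use insert.prems in auto)
    moreover have "c s \<odot>\<^bsub>free_on R S\<^esub> free_gen R s \<in> ?S"
      using F.submoduleE(4)[OF Sp cR] F.span_superset[of "free_gen R ` S"] insert.prems by blast
    ultimately have "?c \<oplus>\<^bsub>free_on R S\<^esub> c s \<odot>\<^bsub>free_on R S\<^esub> free_gen R s \<in> ?S"
      by (rule F.submoduleE(5)[OF Sp])
    moreover have "?c \<oplus>\<^bsub>free_on R S\<^esub> c s \<odot>\<^bsub>free_on R S\<^esub> free_gen R s = c"
      using cR by (auto simp: free_on_simps free_gen_def)
    ultimately show ?case by simp
  qed
  note * = this
  have "c \<in> ?S" if c: "c \<in> carrier (free_on R S)" for c
    by (rule *[OF free_onD(2,3)[OF c] c]) auto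
  then show ?thesis using F.sub_in[OF Sp] by blast
qed

lemma free_on_lift:
  assumes T: "module R T" and b: "\<And>s. s \<in> S \<Longrightarrow> \<beta> s \<in> carrier T"
  obtains h where "h \<in> module_hom R (free_on R S) T" "\<And>s. s \<in> S \<Longrightarrow> h (free_gen R s) = \<beta> s"
proof -
  interpret T: modl R T by (rule modl.intro[OF T])
  interpret F: modl R "free_on R S" by (rule modl.intro[OF free_on_module])
  define h where "h c = (\<Oplus>\<^bsub>T\<^esub>s\<in>{s. c s \<noteq> \<zero>}. c s \<odot>\<^bsub>T\<^esub> \<beta> s)" for c
  \<comment> \<open>h sums over the support of c, which varies with c. Additivity needs one index
    set for c, d and their sum, so sums over larger finite sets have to agree with h.\<close>
  have hA: "h c = (\<Oplus>\<^bsub>T\<^esub>s\<in>A. c s \<odot>\<^bsub>T\<^esub> \<beta> s)"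
    if c: "\<And>s. c s \<in> carrier R" and A: "finite A" "A \<subseteq> S" "{s. c s \<noteq> \<zero>} \<subseteq> A" for c A
    unfolding h_def
    by (rule T.add.finprod_mono_neutral_cong_left) (use c A b in auto)
  have hom: "h \<in> module_hom R (free_on R S) T"
  proof (rule module_homI)
    fix c assume c: "c \<in> carrier (free_on R S)"
    note cD = free_onD[OF c]
    show "h c \<in> carrier T" unfolding h_def using cD b by (intro T.finsum_closed) auto
    { fix a assume a: "a \<in> carrier R"
      let ?A = "{s. c s \<noteq> \<zero>}"
      have "h (a \<odot>\<^bsub>free_on R S\<^esub> c) = (\<Oplus>\<^bsub>T\<^esub>s\<in>?A. (a \<otimes> c s) \<odot>\<^bsub>T\<^esub> \<beta> s)"
        unfolding free_on_simps by (rule hA) (use a cD in auto)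
      also have "\<dots> = (\<Oplus>\<^bsub>T\<^esub>s\<in>?A. a \<odot>\<^bsub>T\<^esub> (c s \<odot>\<^bsub>T\<^esub> \<beta> s))"
        by (rule T.finsum_cong') (use a cD b in \<open>auto simp: T.smult_assoc1\<close>)
      also have "\<dots> = a \<odot>\<^bsub>T\<^esub> h c"
        unfolding h_def by (rule T.finsum_smult_ldistr[symmetric]) (use a cD b in auto)
      finally show "h (a \<odot>\<^bsub>free_on R S\<^esub> c) = a \<odot>\<^bsub>T\<^esub> h c" . }
    fix d assume d: "d \<in> carrier (free_on R S)"
    note dD = free_onD[OF d]
    let ?A = "{s. c s \<noteq> \<zero>} \<union> {s. d s \<noteq> \<zero>}"
    have A: "finite ?A" "?A \<subseteq> S" using cD dD by auto
    have "h (c \<oplus>\<^bsub>free_on R S\<^esub> d) = (\<Oplus>\<^bsub>T\<^esub>s\<in>?A. (c s \<oplus> d s) \<odot>\<^bsub>T\<^esub> \<beta> s)"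
      unfolding free_on_simps by (rule hA[OF _ A]) (use cD dD in auto)
    also have "\<dots> = (\<Oplus>\<^bsub>T\<^esub>s\<in>?A. c s \<odot>\<^bsub>T\<^esub> \<beta> s \<oplus>\<^bsub>T\<^esub> d s \<odot>\<^bsub>T\<^esub> \<beta> s)"
      by (rule T.finsum_cong') (use A b cD(1) dD(1) in \<open>auto simp: T.smult_l_distr\<close>)
    also have "\<dots> = (\<Oplus>\<^bsub>T\<^esub>s\<in>?A. c s \<odot>\<^bsub>T\<^esub> \<beta> s) \<oplus>\<^bsub>T\<^esub> (\<Oplus>\<^bsub>T\<^esub>s\<in>?A. d s \<odot>\<^bsub>T\<^esub> \<beta> s)"
      by (rule T.finsum_addf) (use A(2) b cD(1) dD(1) in auto)
    also have "\<dots> = h c \<oplus>\<^bsub>T\<^esub> h d"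
      using hA[OF cD(1) A] hA[OF dD(1) A] by simp
    finally show "h (c \<oplus>\<^bsub>free_on R S\<^esub> d) = h c \<oplus>\<^bsub>T\<^esub> h d" .
  qed
  have "h (free_gen R s) = \<beta> s" if s: "s \<in> S" for s
  proof -
    have "h (free_gen R s) = (\<Oplus>\<^bsub>T\<^esub>t\<in>{s}. free_gen R s t \<odot>\<^bsub>T\<^esub> \<beta> t)"
      by (rule hA) (use s in \<open>auto simp: free_gen_def\<close>)
    also have "\<dots> = \<beta> s" using b[OF s] by (simp add: free_gen_def)
    finally show ?thesis .
  qed
  then show ?thesis using that hom by blast
qed

end

text \<open>The generators inside \<open>tensor_relations\<close>, named so that arguments about
  spans can address them.\<close>

definition tensor_rel_gens :: "('a, 'r) ring_scheme \<Rightarrow> ('a, 'm) module \<Rightarrow> ('a, 'n) module \<Rightarrow> ('m \<times> 'n \<Rightarrow> 'a) set" where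
  "tensor_rel_gens R M N =
     (let F = free_on R (carrier M \<times> carrier N); e = free_gen R in
        ({e (x \<oplus>\<^bsub>M\<^esub> x', y) \<ominus>\<^bsub>F\<^esub> (e (x, y) \<oplus>\<^bsub>F\<^esub> e (x', y)) | x x' y.
            x \<in> carrier M \<and> x' \<in> carrier M \<and> y \<in> carrier N} \<union>
         {e (x, y \<oplus>\<^bsub>N\<^esub> y') \<ominus>\<^bsub>F\<^esub> (e (x, y) \<oplus>\<^bsub>F\<^esub> e (x, y')) | x y y'.
            x \<in> carrier M \<and> y \<in> carrier N \<and> y' \<in> carrier N} \<union>
         {e (a \<odot>\<^bsub>M\<^esub> x, y) \<ominus>\<^bsub>F\<^esub> a \<odot>\<^bsub>F\<^esub> e (x, y) | a x y.
            a \<in> carrier R \<and> x \<in> carrier M \<and> y \<in> carrier N} \<union>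
         {e (x, a \<odot>\<^bsub>N\<^esub> y) \<ominus>\<^bsub>F\<^esub> a \<odot>\<^bsub>F\<^esub> e (x, y) | a x y.
            a \<in> carrier R \<and> x \<in> carrier M \<and> y \<in> carrier N}))"

lemma tensor_relations_eq:
  "tensor_relations R M N = submodule_span R (free_on R (carrier M \<times> carrier N)) (tensor_rel_gens R M N)"
  by (simp add: tensor_relations_def tensor_rel_gens_def Let_def)

locale tensor_pair = M: modl R M + N: modl R N
  for R :: "('a, 'r) ring_scheme" (structure) and M :: "('a, 'm) module" and N :: "('a, 'n) module"
begin

abbreviation "F \<equiv> free_on R (carrier M \<times> carrier N)"
abbreviation "K \<equiv> tensor_relations R M N"
abbreviation "T \<equiv> tensor_product R M N"
abbreviation "pt \<equiv> pure_tensor R M N"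

lemma F_modl: "modl R F"
  by (rule modl.intro[OF M.R.free_on_module])

lemma gen_closed: "x \<in> carrier M \<Longrightarrow> y \<in> carrier N \<Longrightarrow> free_gen R (x, y) \<in> carrier F"
  by (rule M.R.free_gen_closed) simp

lemma rel_gens_subset: "tensor_rel_gens R M N \<subseteq> carrier F"
proof -
  interpret F: modl R F by (rule F_modl)
  show ?thesis
    unfolding tensor_rel_gens_def Let_def
    by (auto intro!: F.M.minus_closed F.M.a_closed F.smult_closed gen_closed)
qed

lemma K_sub: "submodule K R F"
  unfolding tensor_relations_eq by (rule modl.span_submodule[OF F_modl rel_gens_subset])

lemma K_gens: "z \<in> tensor_rel_gens R M N \<Longrightarrow> z \<in> K"
  unfolding tensor_relations_eq using modl.span_superset[OF F_modl] by blast

lemma T_modl: "modl R T"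
  unfolding tensor_product_def by (rule modl.intro[OF modl.quot_module_module[OF F_modl K_sub]])

lemma T_module: "module R T"
  by (rule modl.axioms[OF T_modl])

lemma pt_closed: "x \<in> carrier M \<Longrightarrow> y \<in> carrier N \<Longrightarrow> pt x y \<in> carrier T"
  unfolding pure_tensor_def tensor_product_def quot_module_simps using gen_closed by blast

lemma pt_eqI:
  assumes "a \<in> carrier F" "b \<in> carrier F" "a \<ominus>\<^bsub>F\<^esub> b \<in> tensor_rel_gens R M N"
  shows "K +>\<^bsub>F\<^esub> a = K +>\<^bsub>F\<^esub> b"
  using modl.coset_eq_iff[OF F_modl K_sub assms(1,2)] K_gens[OF assms(3)] assms by (simp add: mod_cong_def)

lemma pt_add_l:
  assumes "x \<in> carrier M" "x' \<in> carrier M" "y \<in> carrier N"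
  shows "pt (x \<oplus>\<^bsub>M\<^esub> x') y = pt x y \<oplus>\<^bsub>T\<^esub> pt x' y"
proof -
  interpret F: modl R F by (rule F_modl)
  show ?thesis
    unfolding pure_tensor_def tensor_product_def F.coset_add[OF K_sub gen_closed[OF assms(1,3)] gen_closed[OF assms(2,3)]]
    by (rule pt_eqI) (use assms gen_closed in \<open>auto simp: tensor_rel_gens_def Let_def\<close>)
qed

lemma pt_add_r:
  assumes "x \<in> carrier M" "y \<in> carrier N" "y' \<in> carrier N"
  shows "pt x (y \<oplus>\<^bsub>N\<^esub> y') = pt x y \<oplus>\<^bsub>T\<^esub> pt x y'"
proof -
  interpret F: modl R F by (rule F_modl)
  show ?thesis
    unfolding pure_tensor_def tensor_product_def F.coset_add[OF K_sub gen_closed[OF assms(1,2)] gen_closed[OF assms(1,3)]]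
    by (rule pt_eqI) (use assms gen_closed in \<open>auto simp: tensor_rel_gens_def Let_def\<close>)
qed

lemma pt_smult_l:
  assumes "x \<in> carrier M" "y \<in> carrier N" "a \<in> carrier R"
  shows "pt (a \<odot>\<^bsub>M\<^esub> x) y = a \<odot>\<^bsub>T\<^esub> pt x y"
proof -
  interpret F: modl R F by (rule F_modl)
  show ?thesis
    unfolding pure_tensor_def tensor_product_def F.coset_smult[OF K_sub gen_closed[OF assms(1,2)] assms(3)]
    by (rule pt_eqI) (use assms gen_closed F.smult_closed in \<open>auto simp: tensor_rel_gens_def Let_def\<close>)
qed

lemma pt_smult_r:
  assumes "x \<in> carrier M" "y \<in> carrier N" "a \<in> carrier R"
  shows "pt x (a \<odot>\<^bsub>N\<^esub> y) = a \<odot>\<^bsub>T\<^esub> pt x y"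
proof -
  interpret F: modl R F by (rule F_modl)
  show ?thesis
    unfolding pure_tensor_def tensor_product_def F.coset_smult[OF K_sub gen_closed[OF assms(1,2)] assms(3)]
    by (rule pt_eqI) (use assms gen_closed F.smult_closed in \<open>auto simp: tensor_rel_gens_def Let_def\<close>)
qed

lemma pt_hom_r: "x \<in> carrier M \<Longrightarrow> (\<lambda>y. pt x y) \<in> module_hom R N T"
  by (rule module_homI) (simp_all add: pt_closed pt_add_r pt_smult_r)

lemma pt_hom_l: "y \<in> carrier N \<Longrightarrow> (\<lambda>x. pt x y) \<in> module_hom R M T"
  by (rule module_homI) (simp_all add: pt_closed pt_add_l pt_smult_l)

lemma tensor_hom_eq:
  assumes L: "module R L" and f: "f \<in> module_hom R T L" and g: "g \<in> module_hom R T L"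
    and fg: "\<And>x y. x \<in> carrier M \<Longrightarrow> y \<in> carrier N \<Longrightarrow> f (pt x y) = g (pt x y)" and z: "z \<in> carrier T"
  shows "f z = g z"
proof -
  interpret F: modl R F by (rule F_modl)
  have p: "(\<lambda>c. K +>\<^bsub>F\<^esub> c) \<in> module_hom R F T"
    unfolding tensor_product_def by (rule F.quot_proj_hom[OF K_sub])
  obtain c where c: "c \<in> carrier F" "z = K +>\<^bsub>F\<^esub> c"
    using z unfolding tensor_product_def quot_module_simps by blast
  have "f (K +>\<^bsub>F\<^esub> c) = g (K +>\<^bsub>F\<^esub> c)"
    by (rule F.hom_eq_on_span[OF L module_hom_comp[OF p f] module_hom_comp[OF p g] _ M.R.free_on_span _ c(1)])
      (use gen_closed fg in \<open>auto simp: pure_tensor_def\<close>)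
  then show ?thesis using c by simp
qed

lemma tensor_span:
  assumes H: "submodule H R T" and pt: "\<And>x y. x \<in> carrier M \<Longrightarrow> y \<in> carrier N \<Longrightarrow> pt x y \<in> H"
  shows "H = carrier T"
proof -
  interpret F: modl R F by (rule F_modl)
  interpret T: modl R T by (rule T_modl)
  have p: "(\<lambda>c. K +>\<^bsub>F\<^esub> c) \<in> module_hom R F T"
    unfolding tensor_product_def by (rule F.quot_proj_hom[OF K_sub])
  have S: "submodule {c \<in> carrier F. K +>\<^bsub>F\<^esub> c \<in> H} R F"
    by (rule F.module_hom_submodule_eq[OF T_module p H])
  have "submodule_span R F (free_gen R ` (carrier M \<times> carrier N)) \<subseteq> {c \<in> carrier F. K +>\<^bsub>F\<^esub> c \<in> H}"
    by (rule F.span_least[OF S]) (use pt gen_closed in \<open>auto simp: pure_tensor_def\<close>)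
  then have "carrier F \<subseteq> {c \<in> carrier F. K +>\<^bsub>F\<^esub> c \<in> H}" unfolding M.R.free_on_span .
  then have "carrier T \<subseteq> H" unfolding tensor_product_def quot_module_simps by blast
  then show ?thesis using T.sub_in[OF H] by blast
qed

text \<open>The universal property: bilinearity of \<beta> makes the induced map on the free module
  kill the four kinds of generators, so it factors through the quotient.\<close>

lemma tensor_lift:
  assumes L: "module R L"
    and c: "\<And>x y. x \<in> carrier M \<Longrightarrow> y \<in> carrier N \<Longrightarrow> \<beta> x y \<in> carrier L"
    and al: "\<And>x x' y. x \<in> carrier M \<Longrightarrow> x' \<in> carrier M \<Longrightarrow> y \<in> carrier N \<Longrightarrow> \<beta> (x \<oplus>\<^bsub>M\<^esub> x') y = \<beta> x y \<oplus>\<^bsub>L\<^esub> \<beta> x' y"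
    and ar: "\<And>x y y'. x \<in> carrier M \<Longrightarrow> y \<in> carrier N \<Longrightarrow> y' \<in> carrier N \<Longrightarrow> \<beta> x (y \<oplus>\<^bsub>N\<^esub> y') = \<beta> x y \<oplus>\<^bsub>L\<^esub> \<beta> x y'"
    and sl: "\<And>a x y. a \<in> carrier R \<Longrightarrow> x \<in> carrier M \<Longrightarrow> y \<in> carrier N \<Longrightarrow> \<beta> (a \<odot>\<^bsub>M\<^esub> x) y = a \<odot>\<^bsub>L\<^esub> \<beta> x y"
    and sr: "\<And>a x y. a \<in> carrier R \<Longrightarrow> x \<in> carrier M \<Longrightarrow> y \<in> carrier N \<Longrightarrow> \<beta> x (a \<odot>\<^bsub>N\<^esub> y) = a \<odot>\<^bsub>L\<^esub> \<beta> x y"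
  obtains h where "h \<in> module_hom R T L" "\<And>x y. x \<in> carrier M \<Longrightarrow> y \<in> carrier N \<Longrightarrow> h (pt x y) = \<beta> x y"
proof -
  interpret F: modl R F by (rule F_modl)
  interpret L: modl R L by (rule modl.intro[OF L])
  obtain k where k: "k \<in> module_hom R F L" and kg': "\<And>s. s \<in> carrier M \<times> carrier N \<Longrightarrow> k (free_gen R s) = (\<lambda>(x, y). \<beta> x y) s"
    by (rule M.R.free_on_lift[OF L, of "carrier M \<times> carrier N" "\<lambda>(x, y). \<beta> x y"]) (use c in auto)
  have kg: "k (free_gen R (x, y)) = \<beta> x y" if "x \<in> carrier M" "y \<in> carrier N" for x y using kg'[of "(x, y)"] that by simp
  note kk = module_homD[OF k]
  have z: "a \<in> carrier L \<Longrightarrow> a \<ominus>\<^bsub>L\<^esub> a = \<zero>\<^bsub>L\<^esub>" for a by (simp add: L.M.minus_eq L.M.r_neg)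
  have km: "k (u \<ominus>\<^bsub>F\<^esub> v) = k u \<ominus>\<^bsub>L\<^esub> k v" if "u \<in> carrier F" "v \<in> carrier F" for u v
    by (rule F.hom_minus[OF L k that])
  have ker: "submodule {u \<in> carrier F. k u \<in> {\<zero>\<^bsub>L\<^esub>}} R F"
    by (rule F.module_hom_submodule_eq[OF L k L.sub_zero_submodule])
  have "tensor_rel_gens R M N \<subseteq> {u \<in> carrier F. k u \<in> {\<zero>\<^bsub>L\<^esub>}}"
  proof
    fix u assume u: "u \<in> tensor_rel_gens R M N"
    have "k u = \<zero>\<^bsub>L\<^esub>"
      using u unfolding tensor_rel_gens_def Let_def
      by (elim UnE CollectE exE conjE) (simp_all add: km kk kg gen_closed al ar sl sr c z)
    then show "u \<in> {u \<in> carrier F. k u \<in> {\<zero>\<^bsub>L\<^esub>}}" using u rel_gens_subset by auto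
  qed
  then have "K \<subseteq> {u \<in> carrier F. k u \<in> {\<zero>\<^bsub>L\<^esub>}}" unfolding tensor_relations_eq by (rule F.span_least[OF ker])
  then have kK: "k u = \<zero>\<^bsub>L\<^esub>" if "u \<in> K" for u using that by blast
  obtain h where "h \<in> module_hom R (quot_module F K) L" "\<And>u. u \<in> carrier F \<Longrightarrow> h (K +>\<^bsub>F\<^esub> u) = k u"
    by (rule F.quot_factor[OF K_sub L k kK]) simp_all
  then show ?thesis using that kg gen_closed unfolding tensor_product_def pure_tensor_def by metis
qed

end

text \<open>\<open>tensor_map\<close> is a definite description. Existence comes from the universal
  property, uniqueness from agreement on pure tensors together with extensionality outside the
  carrier.\<close>

lemma tensor_map_props:
  assumes M: "module R M" and N: "module R N" and N': "module R N'" and f: "f \<in> module_hom R N N'"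
  shows "tensor_map R M N N' f \<in> module_hom R (tensor_product R M N) (tensor_product R M N')"
    and "\<And>x y. x \<in> carrier M \<Longrightarrow> y \<in> carrier N \<Longrightarrow>
      tensor_map R M N N' f (pure_tensor R M N x y) = pure_tensor R M N' x (f y)"
proof -
  interpret A: tensor_pair R M N by (intro tensor_pair.intro modl.intro M N)
  interpret B: tensor_pair R M N' by (intro tensor_pair.intro modl.intro M N')
  note ff = module_homD[OF f]
  let ?P = "\<lambda>h. h \<in> module_hom R A.T B.T \<and> h \<in> extensional (carrier A.T) \<and>
        (\<forall>x\<in>carrier M. \<forall>y\<in>carrier N. h (A.pt x y) = B.pt x (f y))"
  obtain h where h: "h \<in> module_hom R A.T B.T" "\<And>x y. x \<in> carrier M \<Longrightarrow> y \<in> carrier N \<Longrightarrow> h (A.pt x y) = B.pt x (f y)"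
    by (rule A.tensor_lift[OF B.T_module, of "\<lambda>x y. B.pt x (f y)"])
      (simp_all add: ff B.pt_closed B.pt_add_l B.pt_add_r B.pt_smult_l B.pt_smult_r)
  interpret AT: modl R A.T by (rule A.T_modl)
  let ?h = "restrict h (carrier A.T)"
  have "?h \<in> module_hom R A.T B.T"
    by (rule module_homI) (simp_all add: module_homD[OF h(1)])
  then have P: "?P ?h" using h(2) A.pt_closed by simp
  have "h' = ?h" if h': "?P h'" for h'
  proof
    fix z
    show "h' z = ?h z"
    proof (cases "z \<in> carrier A.T")
      case True
      show ?thesis
        by (rule A.tensor_hom_eq[OF B.T_module conjunct1[OF h'] conjunct1[OF P] _ True])
          (use h' h(2) A.pt_closed in simp)
    next
      case False
      then show ?thesis using h' by (auto simp: extensional_def)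
    qed
  qed
  then have "?P (tensor_map R M N N' f)" unfolding tensor_map_def by (rule theI[of ?P, OF P])
  then show "tensor_map R M N N' f \<in> module_hom R (tensor_product R M N) (tensor_product R M N')"
    and "\<And>x y. x \<in> carrier M \<Longrightarrow> y \<in> carrier N \<Longrightarrow>
      tensor_map R M N N' f (pure_tensor R M N x y) = pure_tensor R M N' x (f y)" by auto
qed

section \<open>Tensoring a presentation\<close>

lemma hom_finsum_hom:
  assumes "module R M" "module R L" "finite J" "\<And>j. j \<in> J \<Longrightarrow> f j \<in> module_hom R M L"
  shows "(\<lambda>x. \<Oplus>\<^bsub>L\<^esub>j\<in>J. f j x) \<in> module_hom R M L"
proof -
  interpret M: modl R M by (rule modl.intro) fact
  interpret L: modl R L by (rule modl.intro) fact
  note f = module_homD[OF assms(4)]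
  show ?thesis
  proof (rule module_homI, goal_cases)
    case (1 x) then show ?case using f by (intro L.finsum_closed) auto
  next
    case (2 x y)
    have "(\<Oplus>\<^bsub>L\<^esub>j\<in>J. f j (x \<oplus>\<^bsub>M\<^esub> y)) = (\<Oplus>\<^bsub>L\<^esub>j\<in>J. f j x \<oplus>\<^bsub>L\<^esub> f j y)"
      using f 2 by (intro L.finsum_cong') auto
    also have "\<dots> = (\<Oplus>\<^bsub>L\<^esub>j\<in>J. f j x) \<oplus>\<^bsub>L\<^esub> (\<Oplus>\<^bsub>L\<^esub>j\<in>J. f j y)"
      using f 2 by (intro L.finsum_addf) auto
    finally show ?case .
  next
    case (3 a x)
    have "(\<Oplus>\<^bsub>L\<^esub>j\<in>J. f j (a \<odot>\<^bsub>M\<^esub> x)) = (\<Oplus>\<^bsub>L\<^esub>j\<in>J. a \<odot>\<^bsub>L\<^esub> f j x)"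
      using f 3 by (intro L.finsum_cong') auto
    also have "\<dots> = a \<odot>\<^bsub>L\<^esub> (\<Oplus>\<^bsub>L\<^esub>j\<in>J. f j x)"
      using f 3 assms(3) by (intro L.finsum_smult_ldistr[symmetric]) auto
    finally show ?case .
  qed
qed

abbreviation rpow :: "('a, 'r) ring_scheme \<Rightarrow> 'i set \<Rightarrow> ('a, 'i \<Rightarrow> 'a) module" where
  "rpow R J \<equiv> pow_module (self_module R) J"

definition unit_vec :: "('a, 'r) ring_scheme \<Rightarrow> 'i set \<Rightarrow> 'i \<Rightarrow> 'i \<Rightarrow> 'a" where
  "unit_vec R J j = (\<lambda>k\<in>J. if k = j then \<one>\<^bsub>R\<^esub> else \<zero>\<^bsub>R\<^esub>)"

lemma rpow_module: "cring R \<Longrightarrow> module R (rpow R J)"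
  by (rule modl.pow_module_module[OF modl.intro[OF self_module_module]])

lemma unit_vec_closed: "cring R \<Longrightarrow> unit_vec R J j \<in> carrier (rpow R J)"
  using cring.cring_simprules by (auto simp: unit_vec_def cring.cring_simprules)

text \<open>Induction on the set of coordinates of v that are kept, the others being set to
  zero.\<close>

lemma rpow_hom_expand:
  fixes R (structure)
  assumes cr: "cring R" and L: "module R L" and h: "h \<in> module_hom R (rpow R J) L" and J: "finite J"
    and v: "v \<in> carrier (rpow R J)"
  shows "h v = (\<Oplus>\<^bsub>L\<^esub>j\<in>J. v j \<odot>\<^bsub>L\<^esub> h (unit_vec R J j))"
proof -
  interpret cring R by fact
  interpret L: modl R L by (rule modl.intro) fact
  interpret P: modl R "rpow R J" by (rule modl.intro[OF rpow_module[OF cr]])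
  note hh = module_homD[OF h]
  have vR: "v j \<in> carrier R" if "j \<in> J" for j using v that by auto
  have hu: "h (unit_vec R J j) \<in> carrier L" for j by (rule hh(1)[OF unit_vec_closed[OF cr]])
  let ?w = "\<lambda>J'. \<lambda>i\<in>J. if i \<in> J' then v i else \<zero>"
  have "h (?w J') = (\<Oplus>\<^bsub>L\<^esub>j\<in>J'. v j \<odot>\<^bsub>L\<^esub> h (unit_vec R J j))" if "finite J'" "J' \<subseteq> J" for J'
    using that
  proof (induction J')
    case empty
    have "?w {} = \<zero>\<^bsub>rpow R J\<^esub>" by (auto intro!: restrict_ext)
    then have "h (?w {}) = \<zero>\<^bsub>L\<^esub>" using P.hom_zero[OF L h] by (simp only:)
    then show ?case by (simp only: L.finsum_empty)
  next
    case (insert j J')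
    have j: "j \<in> J" using insert by simp
    have ih: "h (?w J') = (\<Oplus>\<^bsub>L\<^esub>j\<in>J'. v j \<odot>\<^bsub>L\<^esub> h (unit_vec R J j))"
      by (rule insert.IH) (use insert.prems in simp)
    have w: "?w J' \<in> carrier (rpow R J)" using vR by auto
    have "?w (insert j J') = v j \<odot>\<^bsub>rpow R J\<^esub> unit_vec R J j \<oplus>\<^bsub>rpow R J\<^esub> ?w J'"
      using insert vR by (auto simp: unit_vec_def intro!: restrict_ext)
    then have "h (?w (insert j J')) = v j \<odot>\<^bsub>L\<^esub> h (unit_vec R J j) \<oplus>\<^bsub>L\<^esub> h (?w J')"
      using hh(2)[OF P.smult_closed[OF vR[OF j] unit_vec_closed[OF cr]] w] hh(3)[OF vR[OF j] unit_vec_closed[OF cr]]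
      by (simp only:)
    also have "\<dots> = v j \<odot>\<^bsub>L\<^esub> h (unit_vec R J j) \<oplus>\<^bsub>L\<^esub> (\<Oplus>\<^bsub>L\<^esub>j\<in>J'. v j \<odot>\<^bsub>L\<^esub> h (unit_vec R J j))"
      by (simp only: ih)
    also have "\<dots> = (\<Oplus>\<^bsub>L\<^esub>j\<in>insert j J'. v j \<odot>\<^bsub>L\<^esub> h (unit_vec R J j))"
      using insert vR hu by (intro L.finsum_insert[symmetric]) auto
    finally show ?case .
  qed
  from this[OF J subset_refl] have "h (?w J) = (\<Oplus>\<^bsub>L\<^esub>j\<in>J. v j \<odot>\<^bsub>L\<^esub> h (unit_vec R J j))" .
  moreover have "?w J = v" using v by (auto simp: PiE_iff extensional_def fun_eq_iff)
  ultimately show ?thesis by (simp only:)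
qed

lemma rpow_lift:
  fixes R (structure)
  assumes cr: "cring R" and L: "module R L" and J: "finite J" and a: "\<And>j. j \<in> J \<Longrightarrow> a j \<in> carrier L"
  shows "(\<lambda>v. \<Oplus>\<^bsub>L\<^esub>j\<in>J. v j \<odot>\<^bsub>L\<^esub> a j) \<in> module_hom R (rpow R J) L"
    and "k \<in> J \<Longrightarrow> (\<Oplus>\<^bsub>L\<^esub>j\<in>J. unit_vec R J k j \<odot>\<^bsub>L\<^esub> a j) = a k"
proof -
  interpret cring R by fact
  interpret L: modl R L by (rule modl.intro) fact
  show "(\<lambda>v. \<Oplus>\<^bsub>L\<^esub>j\<in>J. v j \<odot>\<^bsub>L\<^esub> a j) \<in> module_hom R (rpow R J) L"
    by (rule hom_finsum_hom[OF rpow_module[OF cr] L J], rule module_homI)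
      (use a in \<open>auto simp: PiE_iff L.smult_l_distr L.smult_assoc1\<close>)
  assume k: "k \<in> J"
  have "(\<Oplus>\<^bsub>L\<^esub>j\<in>J. unit_vec R J k j \<odot>\<^bsub>L\<^esub> a j) = (\<Oplus>\<^bsub>L\<^esub>j\<in>J. if k = j then a j else \<zero>\<^bsub>L\<^esub>)"
    by (rule L.finsum_cong') (use a in \<open>auto simp: unit_vec_def\<close>)
  also have "\<dots> = a k" by (rule L.add.finprod_singleton[OF k J]) (use a in auto)
  finally show "(\<Oplus>\<^bsub>L\<^esub>j\<in>J. unit_vec R J k j \<odot>\<^bsub>L\<^esub> a j) = a k" .
qed

text \<open>An exact sequence R^I -> R^J -> N -> 0 in coordinates. Injectivity of the matrix is left
  to the individual lemmas, since it is wanted over R and over M separately.\<close>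

locale presentation = N: modl R N for R :: "('a, 'r) ring_scheme" (structure) and N :: "('a, 'n) module" +
  fixes J :: "'j set" and I :: "'i set" and C :: "'j \<Rightarrow> 'i \<Rightarrow> 'a" and \<pi> :: "('j \<Rightarrow> 'a) \<Rightarrow> 'n"
  assumes finJ: "finite J" and finI: "finite I" and C_closed: "j \<in> J \<Longrightarrow> i \<in> I \<Longrightarrow> C j i \<in> carrier R"
    and pi_hom: "\<pi> \<in> module_hom R (rpow R J) N" and pi_surj: "\<pi> ` carrier (rpow R J) = carrier N"
    and pi_ker: "v \<in> carrier (rpow R J) \<Longrightarrow>
      \<pi> v = \<zero>\<^bsub>N\<^esub> \<longleftrightarrow> v \<in> mat_apply (self_module R) J I C ` carrier (rpow R I)"
begin

lemma R_modl: "modl R (self_module R)"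
  by (rule modl.intro[OF self_module_module[OF N.R.is_cring]])

lemma RJ: "modl R (rpow R J)" and RI: "modl R (rpow R I)"
  by (rule modl.intro[OF rpow_module[OF N.R.is_cring]])+

abbreviation "\<Phi>R \<equiv> mat_apply (self_module R) J I C"

lemma PhiR_hom: "\<Phi>R \<in> module_hom R (rpow R I) (rpow R J)"
  by (rule modl.mat_apply_hom[OF R_modl finI C_closed])

definition "\<epsilon> j = \<pi> (unit_vec R J j)"

lemma eps_closed: "\<epsilon> j \<in> carrier N"
  unfolding \<epsilon>_def by (rule module_homD(1)[OF pi_hom unit_vec_closed[OF N.R.is_cring]])

lemma PhiR_unit:
  assumes "i \<in> I" "j \<in> J" shows "\<Phi>R (unit_vec R I i) j = C j i"
proof -
  interpret S: modl R "self_module R" by (rule R_modl)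
  have "\<Phi>R (unit_vec R I i) j = (\<Oplus>\<^bsub>self_module R\<^esub>k\<in>I. if i = k then C j k else \<zero>\<^bsub>self_module R\<^esub>)"
    unfolding mat_apply_def using assms C_closed
    by (simp del: self_module_simps(2), intro S.finsum_cong') (auto simp: unit_vec_def)
  also have "\<dots> = C j i" by (rule S.add.finprod_singleton[OF assms(1) finI]) (use assms C_closed in auto)
  finally show ?thesis .
qed

lemma hom_relation:
  assumes L: "module R L" and h: "h \<in> module_hom R N L" and i: "i \<in> I"
  shows "(\<Oplus>\<^bsub>L\<^esub>j\<in>J. C j i \<odot>\<^bsub>L\<^esub> h (\<epsilon> j)) = \<zero>\<^bsub>L\<^esub>"
proof -
  interpret L: modl R L by (rule modl.intro[OF L])
  let ?v = "\<Phi>R (unit_vec R I i)"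
  have v: "?v \<in> carrier (rpow R J)" by (rule module_homD(1)[OF PhiR_hom unit_vec_closed[OF N.R.is_cring]])
  have "\<pi> ?v = \<zero>\<^bsub>N\<^esub>" unfolding pi_ker[OF v] by (rule imageI[OF unit_vec_closed[OF N.R.is_cring]])
  then have "h (\<pi> ?v) = \<zero>\<^bsub>L\<^esub>" using N.hom_zero[OF L h] by simp
  moreover have "h (\<pi> ?v) = (\<Oplus>\<^bsub>L\<^esub>j\<in>J. ?v j \<odot>\<^bsub>L\<^esub> h (\<pi> (unit_vec R J j)))"
    by (rule rpow_hom_expand[OF N.R.is_cring L module_hom_comp[OF pi_hom h] finJ v])
  moreover have "\<dots> = (\<Oplus>\<^bsub>L\<^esub>j\<in>J. C j i \<odot>\<^bsub>L\<^esub> h (\<epsilon> j))"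
    using PhiR_unit[OF i] C_closed i module_homD(1)[OF h eps_closed]
    by (intro L.finsum_cong') (auto simp: \<epsilon>_def)
  ultimately show ?thesis by simp
qed

text \<open>Right exactness of the tensor product in coordinates, with \<Psi> sending m to the sum
  of the tensors of \<open>m j\<close> and \<open>\<epsilon> j\<close>. The kernel is bounded from
  above by constructing a map in the opposite direction, onto the J-th power of M modulo the image
  of C.\<close>

lemma tensor_presentation:
  assumes M: "module R M"
  shows "\<exists>\<Psi>\<in>module_hom R (pow_module M J) (tensor_product R M N).
     \<Psi> ` carrier (pow_module M J) = carrier (tensor_product R M N) \<and>
     (\<forall>m\<in>carrier (pow_module M J). \<Psi> m = \<zero>\<^bsub>tensor_product R M N\<^esub> \<longleftrightarrow> m \<in> mat_apply M J I C ` carrier (pow_module M I))"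
proof -
  interpret M: modl R M by (rule modl.intro[OF M])
  interpret A: tensor_pair R M N by (intro tensor_pair.intro M.modl_axioms N.modl_axioms)
  interpret T: modl R A.T by (rule A.T_modl)
  interpret MJ: modl R "pow_module M J" by (rule M.pow_modl)
  interpret MI: modl R "pow_module M I" by (rule M.pow_modl)
  define \<Psi> where "\<Psi> m = (\<Oplus>\<^bsub>A.T\<^esub>j\<in>J. A.pt (m j) (\<epsilon> j))" for m
  have hom: "\<Psi> \<in> module_hom R (pow_module M J) A.T"
    unfolding \<Psi>_def
    by (rule hom_finsum_hom[OF M.pow_module_module A.T_module finJ])
      (rule module_hom_comp[OF M.pow_eval_hom A.pt_hom_l[OF eps_closed]])
  have ptpi: "A.pt x (\<pi> v) = (\<Oplus>\<^bsub>A.T\<^esub>j\<in>J. v j \<odot>\<^bsub>A.T\<^esub> A.pt x (\<epsilon> j))" if x: "x \<in> carrier M" and v: "v \<in> carrier (rpow R J)" for x v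
    unfolding \<epsilon>_def by (rule rpow_hom_expand[OF N.R.is_cring A.T_module module_hom_comp[OF pi_hom A.pt_hom_r[OF x]] finJ v])
  have ptPi: "A.pt x (\<pi> v) = \<Psi> (\<lambda>j\<in>J. v j \<odot>\<^bsub>M\<^esub> x)" if x: "x \<in> carrier M" and v: "v \<in> carrier (rpow R J)" for x v
    unfolding ptpi[OF x v] \<Psi>_def
    by (rule T.finsum_cong') (use x v A.pt_smult_l[OF x eps_closed] A.pt_closed eps_closed in \<open>auto simp: PiE_iff\<close>)
  have surj: "\<Psi> ` carrier (pow_module M J) = carrier A.T"
  proof (rule A.tensor_span)
    show "submodule (\<Psi> ` carrier (pow_module M J)) R A.T"
      by (rule MJ.hom_image_submodule[OF A.T_module hom MJ.carrier_is_submodule])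
    fix x y assume x: "x \<in> carrier M" and "y \<in> carrier N"
    then obtain v where v: "v \<in> carrier (rpow R J)" "y = \<pi> v" using pi_surj by (metis imageE)
    have "(\<lambda>j\<in>J. v j \<odot>\<^bsub>M\<^esub> x) \<in> carrier (pow_module M J)" using x v by (auto simp: PiE_iff)
    then show "A.pt x y \<in> \<Psi> ` carrier (pow_module M J)" unfolding v(2) ptPi[OF x v(1)] by (rule imageI)
  qed
  have ker1: "\<Psi> (mat_apply M J I C u) = \<zero>\<^bsub>A.T\<^esub>" if u: "u \<in> carrier (pow_module M I)" for u
  proof -
    have uM: "u i \<in> carrier M" if "i \<in> I" for i using u that by auto
    have c: "C j i \<odot>\<^bsub>A.T\<^esub> A.pt (u i) (\<epsilon> j) \<in> carrier A.T" if "i \<in> I" "j \<in> J" for i j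
      using A.pt_closed[OF uM eps_closed] C_closed that by auto
    have "\<Psi> (mat_apply M J I C u) = (\<Oplus>\<^bsub>A.T\<^esub>j\<in>J. \<Oplus>\<^bsub>A.T\<^esub>i\<in>I. C j i \<odot>\<^bsub>A.T\<^esub> A.pt (u i) (\<epsilon> j))"
      unfolding \<Psi>_def
    proof (rule T.finsum_cong')
      fix j assume j: "j \<in> J"
      have "A.pt (mat_apply M J I C u j) (\<epsilon> j) = (\<Oplus>\<^bsub>A.T\<^esub>i\<in>I. A.pt (C j i \<odot>\<^bsub>M\<^esub> u i) (\<epsilon> j))"
        unfolding mat_apply_def using j uM C_closed
        by (simp, intro M.hom_finsum[OF A.T_module A.pt_hom_l[OF eps_closed]]) auto
      also have "\<dots> = (\<Oplus>\<^bsub>A.T\<^esub>i\<in>I. C j i \<odot>\<^bsub>A.T\<^esub> A.pt (u i) (\<epsilon> j))"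
        by (rule T.finsum_cong') (use j uM C_closed c A.pt_smult_l[OF _ eps_closed] in auto)
      finally show "A.pt (mat_apply M J I C u j) (\<epsilon> j) = (\<Oplus>\<^bsub>A.T\<^esub>i\<in>I. C j i \<odot>\<^bsub>A.T\<^esub> A.pt (u i) (\<epsilon> j))" .
    qed (use c in \<open>auto intro!: T.finsum_closed\<close>)
    also have "\<dots> = (\<Oplus>\<^bsub>A.T\<^esub>i\<in>I. \<Oplus>\<^bsub>A.T\<^esub>j\<in>J. C j i \<odot>\<^bsub>A.T\<^esub> A.pt (u i) (\<epsilon> j))"
      by (rule T.finsum_swap[OF finJ finI c])
    also have "\<dots> = (\<Oplus>\<^bsub>A.T\<^esub>i\<in>I. \<zero>\<^bsub>A.T\<^esub>)"
      by (rule T.finsum_cong') (use hom_relation[OF A.T_module A.pt_hom_r[OF uM]] in auto)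
    also have "\<dots> = \<zero>\<^bsub>A.T\<^esub>" by simp
    finally show ?thesis .
  qed
  have H: "submodule (mat_apply M J I C ` carrier (pow_module M I)) R (pow_module M J)"
    by (rule MI.hom_image_submodule[OF M.pow_module_module M.mat_apply_hom[OF finI C_closed] MI.carrier_is_submodule])
  let ?H = "mat_apply M J I C ` carrier (pow_module M I)"
  let ?Q = "quot_module (pow_module M J) ?H"
  interpret Q: modl R ?Q by (rule modl.intro[OF MJ.quot_module_module[OF H]])
  define vec where "vec x v = (\<lambda>j\<in>J. v j \<odot>\<^bsub>M\<^esub> x)" for x v
  have vec: "vec x v \<in> carrier (pow_module M J)" if "x \<in> carrier M" "v \<in> carrier (rpow R J)" for x v
    using that by (auto simp: vec_def PiE_iff)
  define ch where "ch y = (SOME v. v \<in> carrier (rpow R J) \<and> \<pi> v = y)" for y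
  have ch: "ch y \<in> carrier (rpow R J) \<and> \<pi> (ch y) = y" if "y \<in> carrier N" for y
  proof -
    have "\<exists>v. v \<in> carrier (rpow R J) \<and> \<pi> v = y" using that pi_surj by (metis imageE)
    then show ?thesis unfolding ch_def by (rule someI_ex)
  qed
  \<comment> \<open>The tensor of x and \<pi> v is to go to the class of the vector with entries
    \<open>v j\<close> times x. The preimage of y is chosen arbitrarily; \<open>well\<close> shows
    that the class does not depend on it.\<close>
  define \<beta> where "\<beta> x y = ?H +>\<^bsub>pow_module M J\<^esub> vec x (ch y)" for x y
  interpret RJ: modl R "rpow R J" by (rule RJ)
  \<comment> \<open>If v - w = Cr, then the two vectors differ by C applied to the vector with
    entries \<open>r i\<close> times x.\<close>
  have well: "?H +>\<^bsub>pow_module M J\<^esub> vec x v = ?H +>\<^bsub>pow_module M J\<^esub> vec x w"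
    if x: "x \<in> carrier M" and v: "v \<in> carrier (rpow R J)" and w: "w \<in> carrier (rpow R J)" and e: "\<pi> v = \<pi> w" for x v w
  proof -
    have d: "v \<ominus>\<^bsub>rpow R J\<^esub> w \<in> carrier (rpow R J)" by (rule RJ.minus_closed[OF v w])
    have "\<pi> (v \<ominus>\<^bsub>rpow R J\<^esub> w) = \<zero>\<^bsub>N\<^esub>"
      using RJ.hom_minus[OF N.module_axioms pi_hom v w] e module_homD(1)[OF pi_hom w] by (simp add: N.M.minus_eq N.M.r_neg)
    then obtain r where r: "r \<in> carrier (rpow R I)" "v \<ominus>\<^bsub>rpow R J\<^esub> w = \<Phi>R r" unfolding pi_ker[OF d] by blast
    let ?u = "\<lambda>i\<in>I. r i \<odot>\<^bsub>M\<^esub> x"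
    have u: "?u \<in> carrier (pow_module M I)" using r x by (auto simp: PiE_iff)
    have "(vec x v \<ominus>\<^bsub>pow_module M J\<^esub> vec x w) j = mat_apply M J I C ?u j" if j: "j \<in> J" for j
    proof -
      have vw: "v j \<in> carrier R" "w j \<in> carrier R" using v w j by auto
      have "(vec x v \<ominus>\<^bsub>pow_module M J\<^esub> vec x w) j = v j \<odot>\<^bsub>M\<^esub> x \<ominus>\<^bsub>M\<^esub> w j \<odot>\<^bsub>M\<^esub> x"
        using M.pow_minus[OF vec[OF x v] vec[OF x w] j] j by (simp add: vec_def)
      also have "\<dots> = (v j \<oplus> (\<ominus> \<one>) \<otimes> w j) \<odot>\<^bsub>M\<^esub> x"
        using vw x by (simp add: M.smult_l_distr M.smult_assoc1 M.smult_l_minus M.M.minus_eq)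
      also have "v j \<oplus> (\<ominus> \<one>) \<otimes> w j = \<Phi>R r j"
      proof -
        have "\<Phi>R r j \<oplus> w j = v j"
        proof -
          have "(v \<ominus>\<^bsub>rpow R J\<^esub> w) \<oplus>\<^bsub>rpow R J\<^esub> w = v" using RJ.cong_diff(1)[of "carrier (rpow R J)" v w] v w d by (simp add: mod_cong_def del: pow_module_simps)
          then have "\<Phi>R r \<oplus>\<^bsub>rpow R J\<^esub> w = v" unfolding r(2) .
          from fun_cong[OF this, of j] show ?thesis using j by simp
        qed
        moreover have "\<Phi>R r j \<in> carrier R" using module_homD(1)[OF PhiR_hom r(1)] j by auto
        ultimately show ?thesis using vw(2)
          by (metis N.R.a_assoc N.R.a_inv_closed N.R.l_minus N.R.l_one N.R.one_closed N.R.r_neg N.R.r_zero)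
      qed
      also have "\<Phi>R r j \<odot>\<^bsub>M\<^esub> x = mat_apply M J I C ?u j"
      proof -
        have rR: "r i \<in> carrier R" if "i \<in> I" for i using r(1) that by auto
        have "\<Phi>R r j = (\<Oplus>\<^bsub>R\<^esub>i\<in>I. C j i \<otimes> r i)"
          unfolding mat_apply_def using j self_module_finsum[OF N.R.is_cring, of I "\<lambda>i. C j i \<otimes> r i"] rR C_closed[OF j] by simp
        then have "\<Phi>R r j \<odot>\<^bsub>M\<^esub> x = (\<Oplus>\<^bsub>M\<^esub>i\<in>I. (C j i \<otimes> r i) \<odot>\<^bsub>M\<^esub> x)"
          using M.finsum_smult_rdistr[OF finI x, of "\<lambda>i. C j i \<otimes> r i"] rR C_closed[OF j] by simp
        also have "\<dots> = (\<Oplus>\<^bsub>M\<^esub>i\<in>I. C j i \<odot>\<^bsub>M\<^esub> ?u i)"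
          by (rule M.finsum_cong') (use rR C_closed[OF j] x in \<open>auto simp: M.smult_assoc1\<close>)
        finally show ?thesis unfolding mat_apply_def using j by simp
      qed
      finally show ?thesis .
    qed
    moreover have "vec x v \<ominus>\<^bsub>pow_module M J\<^esub> vec x w \<in> carrier (pow_module M J)" by (rule MJ.minus_closed[OF vec[OF x v] vec[OF x w]])
    moreover have "mat_apply M J I C ?u \<in> carrier (pow_module M J)" using M.mat_apply_closed C_closed u by blast
    ultimately have "vec x v \<ominus>\<^bsub>pow_module M J\<^esub> vec x w = mat_apply M J I C ?u" unfolding pow_module_simps by (intro PiE_ext)
    then have "vec x v \<ominus>\<^bsub>pow_module M J\<^esub> vec x w \<in> ?H" using u by (simp only: imageI)
    then show ?thesis unfolding MJ.coset_eq_iff[OF H vec[OF x v] vec[OF x w]] mod_cong_def using vec[OF x v] vec[OF x w] by blast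
  qed
  have b: "\<beta> x (\<pi> v) = ?H +>\<^bsub>pow_module M J\<^esub> vec x v" if x: "x \<in> carrier M" and v: "v \<in> carrier (rpow R J)" for x v
    unfolding \<beta>_def by (rule well[OF x _ v]) (use ch[OF module_homD(1)[OF pi_hom v]] in auto)
  have ex: "\<exists>v\<in>carrier (rpow R J). y = \<pi> v" if "y \<in> carrier N" for y using that pi_surj by blast
  obtain h where h: "h \<in> module_hom R A.T ?Q" "\<And>x y. x \<in> carrier M \<Longrightarrow> y \<in> carrier N \<Longrightarrow> h (A.pt x y) = \<beta> x y"
  proof (rule A.tensor_lift[OF Q.module_axioms, of \<beta>])
    fix x y assume x: "x \<in> carrier M" and y: "y \<in> carrier N"
    obtain v where v: "v \<in> carrier (rpow R J)" "y = \<pi> v" using ex[OF y] by blast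
    have vR: "v j \<in> carrier R" if "j \<in> J" for j using v(1) that by auto
    show "\<beta> x y \<in> carrier ?Q" unfolding v(2) b[OF x v(1)] quot_module_simps using vec[OF x v(1)] by blast
    { fix x' assume x': "x' \<in> carrier M"
      have "vec (x \<oplus>\<^bsub>M\<^esub> x') v = vec x v \<oplus>\<^bsub>pow_module M J\<^esub> vec x' v"
        using vR x x' by (auto simp: vec_def M.smult_r_distr intro!: restrict_ext)
      then show "\<beta> (x \<oplus>\<^bsub>M\<^esub> x') y = \<beta> x y \<oplus>\<^bsub>?Q\<^esub> \<beta> x' y"
        unfolding v(2) b[OF x v(1)] b[OF x' v(1)] b[OF M.a_closed[OF x x'] v(1)] MJ.coset_add[OF H vec[OF x v(1)] vec[OF x' v(1)]]
        by (simp only:) }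
    { fix y' assume y': "y' \<in> carrier N"
      obtain w where w: "w \<in> carrier (rpow R J)" "y' = \<pi> w" using ex[OF y'] by blast
      have wR: "w j \<in> carrier R" if "j \<in> J" for j using w(1) that by auto
      have "vec x (v \<oplus>\<^bsub>rpow R J\<^esub> w) = vec x v \<oplus>\<^bsub>pow_module M J\<^esub> vec x w"
        using vR wR x by (auto simp: vec_def M.smult_l_distr intro!: restrict_ext)
      then show "\<beta> x (y \<oplus>\<^bsub>N\<^esub> y') = \<beta> x y \<oplus>\<^bsub>?Q\<^esub> \<beta> x y'"
        unfolding v(2) w(2) module_homD(2)[OF pi_hom v(1) w(1), symmetric] b[OF x v(1)] b[OF x w(1)]
          b[OF x RJ.a_closed[OF v(1) w(1)]] MJ.coset_add[OF H vec[OF x v(1)] vec[OF x w(1)]]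
        by (simp only:) }
    { fix a assume a: "a \<in> carrier R"
      have "vec (a \<odot>\<^bsub>M\<^esub> x) v = a \<odot>\<^bsub>pow_module M J\<^esub> vec x v" "vec x (a \<odot>\<^bsub>rpow R J\<^esub> v) = a \<odot>\<^bsub>pow_module M J\<^esub> vec x v"
        using vR x a by (auto simp: vec_def M.smult_assoc1 M.smult_commute intro!: restrict_ext)
      then show "\<beta> (a \<odot>\<^bsub>M\<^esub> x) y = a \<odot>\<^bsub>?Q\<^esub> \<beta> x y" "\<beta> x (a \<odot>\<^bsub>N\<^esub> y) = a \<odot>\<^bsub>?Q\<^esub> \<beta> x y"
        unfolding v(2) module_homD(3)[OF pi_hom a v(1), symmetric] b[OF x v(1)] b[OF M.smult_closed[OF a x] v(1)]
          b[OF x RJ.smult_closed[OF a v(1)]] MJ.coset_smult[OF H vec[OF x v(1)] a]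
        by (simp_all only:) }
  qed simp
  \<comment> \<open>h composed with \<Psi> is the projection, which forces the kernel of \<Psi> into
    the image of C.\<close>
  have hPi: "h (\<Psi> m) = ?H +>\<^bsub>pow_module M J\<^esub> m" if m: "m \<in> carrier (pow_module M J)" for m
  proof -
    have mM: "m j \<in> carrier M" if "j \<in> J" for j using m that by auto
    have vm: "vec (m j) (unit_vec R J j) \<in> carrier (pow_module M J)" if "j \<in> J" for j
      by (rule vec[OF mM[OF that] unit_vec_closed[OF N.R.is_cring]])
    have "h (\<Psi> m) = (\<Oplus>\<^bsub>?Q\<^esub>j\<in>J. h (A.pt (m j) (\<epsilon> j)))"
      unfolding \<Psi>_def by (rule T.hom_finsum[OF Q.module_axioms h(1) A.pt_closed[OF mM eps_closed]])
    also have "\<dots> = (\<Oplus>\<^bsub>?Q\<^esub>j\<in>J. ?H +>\<^bsub>pow_module M J\<^esub> vec (m j) (unit_vec R J j))"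
      by (rule Q.finsum_cong') (use h(2)[OF mM eps_closed] b[OF mM unit_vec_closed[OF N.R.is_cring]] vm
        module_homD(1)[OF MJ.quot_proj_hom[OF H]] in \<open>auto simp: \<epsilon>_def simp del: pow_module_simps\<close>)
    also have "\<dots> = ?H +>\<^bsub>pow_module M J\<^esub> (\<Oplus>\<^bsub>pow_module M J\<^esub>j\<in>J. vec (m j) (unit_vec R J j))"
      by (rule MJ.hom_finsum[OF Q.module_axioms MJ.quot_proj_hom[OF H] vm, symmetric])
    also have "(\<Oplus>\<^bsub>pow_module M J\<^esub>j\<in>J. vec (m j) (unit_vec R J j)) = m" (is "?s = m")
    proof -
      have sc: "?s \<in> carrier (pow_module M J)" by (rule MJ.finsum_closed) (use vm in \<open>simp del: pow_module_simps\<close>)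
      have "?s k = m k" if k: "k \<in> J" for k
      proof -
        have "?s k = (\<Oplus>\<^bsub>M\<^esub>j\<in>J. vec (m j) (unit_vec R J j) k)"
          by (rule MJ.hom_finsum[OF M M.pow_eval_hom[OF k] vm])
        also have "\<dots> = (\<Oplus>\<^bsub>M\<^esub>j\<in>J. if k = j then m j else \<zero>\<^bsub>M\<^esub>)"
          by (rule M.finsum_cong') (use mM k in \<open>auto simp: vec_def unit_vec_def\<close>)
        also have "\<dots> = m k" by (rule M.add.finprod_singleton[OF k finJ]) (use mM in auto)
        finally show ?thesis .
      qed
      then show ?thesis using sc m unfolding pow_module_simps by (intro PiE_ext)
    qed
    finally show ?thesis .
  qed
  have ker2: "m \<in> ?H" if m: "m \<in> carrier (pow_module M J)" and z: "\<Psi> m = \<zero>\<^bsub>A.T\<^esub>" for m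
  proof -
    have "h (\<Psi> m) = ?H" unfolding z T.hom_zero[OF Q.module_axioms h(1)] quot_module_simps by (rule refl)
    then show ?thesis using MJ.coset_eq_sub[OF H m] hPi[OF m] by simp
  qed
  show ?thesis
  proof (rule bexI[OF _ hom], intro conjI ballI iffI)
    show "\<Psi> ` carrier (pow_module M J) = carrier A.T" by (rule surj)
    fix m assume m: "m \<in> carrier (pow_module M J)"
    show "m \<in> ?H" if "\<Psi> m = \<zero>\<^bsub>A.T\<^esub>" using ker2[OF m that] .
    show "\<Psi> m = \<zero>\<^bsub>A.T\<^esub>" if "m \<in> ?H" using that ker1 by blast
  qed
qed

end

subsection \<open>Depth of presented modules\<close>

context matrix_modl
begin

lemma satur_zero_common:
  assumes "finite B" "\<And>i. i \<in> B \<Longrightarrow> u i \<in> satur R q M {\<zero>\<^bsub>M\<^esub>}"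
  obtains t where "t \<in> carrier R - q" "\<And>i. i \<in> B \<Longrightarrow> t \<odot>\<^bsub>M\<^esub> u i = \<zero>\<^bsub>M\<^esub>"
proof -
  have "\<exists>t\<in>carrier R - q. \<forall>i\<in>B. t \<odot>\<^bsub>M\<^esub> u i = \<zero>\<^bsub>M\<^esub>"
  proof (rule common_denominator[OF assms(1)])
    fix i assume "i \<in> B"
    then show "\<exists>s\<in>carrier R - q. s \<odot>\<^bsub>M\<^esub> u i = \<zero>\<^bsub>M\<^esub>" using assms(2) by (auto simp: satur_def)
  next
    fix i s t assume "i \<in> B" "s \<in> carrier R - q" "t \<in> carrier R - q" "s \<odot>\<^bsub>M\<^esub> u i = \<zero>\<^bsub>M\<^esub>"
    then show "(t \<otimes> s) \<odot>\<^bsub>M\<^esub> u i = \<zero>\<^bsub>M\<^esub>" using assms(2)[of i] by (simp add: satur_def smult_assoc1)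
  qed
  then show ?thesis using that by blast
qed

text \<open>Exactness of localization: a kernel vector at q becomes a kernel vector in M after
  multiplication by one t outside q.\<close>

lemma inj_mod_satur_zero:
  assumes "\<And>u. u \<in> carrier (pow_module M I) \<Longrightarrow> (\<And>j. j \<in> J \<Longrightarrow> \<Phi> u j = \<zero>\<^bsub>M\<^esub>) \<Longrightarrow> (\<And>i. i \<in> I \<Longrightarrow> u i = \<zero>\<^bsub>M\<^esub>)"
  shows "inj_mod (satur R q M {\<zero>\<^bsub>M\<^esub>})"
  unfolding inj_mod_def
proof (intro ballI impI)
  fix u i assume u: "u \<in> carrier (pow_module M I)" "\<forall>j\<in>J. \<Phi> u j \<in> satur R q M {\<zero>\<^bsub>M\<^esub>}" and i: "i \<in> I"
  obtain t where t: "t \<in> carrier R - q" "\<And>j. j \<in> J \<Longrightarrow> t \<odot>\<^bsub>M\<^esub> \<Phi> u j = \<zero>\<^bsub>M\<^esub>"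
    using satur_zero_common[OF finJ, of "\<Phi> u"] u(2) by metis
  have tR: "t \<in> carrier R" using t by simp
  have "(\<lambda>i\<in>I. t \<odot>\<^bsub>M\<^esub> u i) i = \<zero>\<^bsub>M\<^esub>"
    by (rule assms[OF smult_pow[OF tR u(1)] _ i]) (use Phi_smult[OF tR u(1)] t(2) in simp)
  then show "u i \<in> satur R q M {\<zero>\<^bsub>M\<^esub>}" using i t(1) powI[OF u(1) i] by (auto simp: satur_def)
qed

text \<open>Localizing commutes with forming the cokernel. The inclusion from right to left needs a
  common denominator for the finitely many coordinates.\<close>

lemma presented_pullback:
  assumes T: "module R T" and \<Psi>: "\<Psi> \<in> module_hom R (pow_module M J) T"
    and ker: "\<forall>m\<in>carrier (pow_module M J). \<Psi> m = \<zero>\<^bsub>T\<^esub> \<longleftrightarrow> m \<in> \<Phi> ` carrier (pow_module M I)"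
  shows "{m \<in> carrier (pow_module M J). \<Psi> m \<in> satur R q T {\<zero>\<^bsub>T\<^esub>}} = coker_sub (satur R q M {\<zero>\<^bsub>M\<^esub>})"
proof -
  interpret T: modl R T by (rule modl.intro[OF T])
  note Zs = satur_submoduleD(1)[OF satur_sat_sub[OF sub_zero_submodule]]
  note h = module_homD[OF \<Psi>]
  show ?thesis
  proof (intro subset_antisym subsetI)
    fix m assume "m \<in> {m \<in> carrier (pow_module M J). \<Psi> m \<in> satur R q T {\<zero>\<^bsub>T\<^esub>}}"
    then obtain s where m: "m \<in> carrier (pow_module M J)" and s: "s \<in> carrier R - q" "s \<odot>\<^bsub>T\<^esub> \<Psi> m = \<zero>\<^bsub>T\<^esub>" by (auto simp: satur_def)
    have sR: "s \<in> carrier R" using s by simp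
    have sm: "s \<odot>\<^bsub>pow_module M J\<^esub> m \<in> carrier (pow_module M J)" by (rule P.smult_closed[OF sR m])
    have "\<Psi> (s \<odot>\<^bsub>pow_module M J\<^esub> m) = \<zero>\<^bsub>T\<^esub>" using h(3)[OF sR m] s(2) by simp
    then obtain u where u: "u \<in> carrier (pow_module M I)" "s \<odot>\<^bsub>pow_module M J\<^esub> m = \<Phi> u" using ker sm by blast
    have "cong (satur R q M {\<zero>\<^bsub>M\<^esub>}) (s \<odot>\<^bsub>M\<^esub> m j) (\<Phi> u j)" if j: "j \<in> J" for j
    proof -
      have "s \<odot>\<^bsub>M\<^esub> m j = \<Phi> u j" using fun_cong[OF u(2), of j] j by simp
      then show ?thesis using cong_refl[OF Zs Phi_closed[OF u(1) j]] by simp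
    qed
    then show "m \<in> coker_sub (satur R q M {\<zero>\<^bsub>M\<^esub>})" unfolding mem_coker[OF Zs] using m u(1) s(1) by blast
  next
    fix m assume "m \<in> coker_sub (satur R q M {\<zero>\<^bsub>M\<^esub>})"
    then obtain s u where m: "m \<in> carrier (pow_module M J)" and s: "s \<in> carrier R - q" and u: "u \<in> carrier (pow_module M I)"
      and su: "\<And>j. j \<in> J \<Longrightarrow> cong (satur R q M {\<zero>\<^bsub>M\<^esub>}) (s \<odot>\<^bsub>M\<^esub> m j) (\<Phi> u j)" unfolding mem_coker[OF Zs] by blast
    have sR: "s \<in> carrier R" using s by simp
    obtain t where t: "t \<in> carrier R - q" "\<And>j. j \<in> J \<Longrightarrow> t \<odot>\<^bsub>M\<^esub> (s \<odot>\<^bsub>M\<^esub> m j \<ominus>\<^bsub>M\<^esub> \<Phi> u j) = \<zero>\<^bsub>M\<^esub>"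
      using satur_zero_common[OF finJ, of "\<lambda>j. s \<odot>\<^bsub>M\<^esub> m j \<ominus>\<^bsub>M\<^esub> \<Phi> u j"] su unfolding mod_cong_def by metis
    have tR: "t \<in> carrier R" using t by simp
    have e: "(t \<otimes> s) \<odot>\<^bsub>M\<^esub> m j = \<Phi> (\<lambda>i\<in>I. t \<odot>\<^bsub>M\<^esub> u i) j" if j: "j \<in> J" for j
    proof -
      have "(t \<otimes> s) \<odot>\<^bsub>M\<^esub> m j \<ominus>\<^bsub>M\<^esub> t \<odot>\<^bsub>M\<^esub> \<Phi> u j = \<zero>\<^bsub>M\<^esub>"
        using t(2)[OF j] tR sR powI[OF m j] Phi_closed[OF u j]
        by (simp add: M.minus_eq smult_r_distr smult_r_minus smult_assoc1)
      then show ?thesis using minus_zero_eq tR sR powI[OF m j] Phi_closed[OF u j] Phi_smult[OF tR u j] by simp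
    qed
    have ts: "t \<otimes> s \<in> carrier R" using tR sR by simp
    have "(t \<otimes> s) \<odot>\<^bsub>pow_module M J\<^esub> m = \<Phi> (\<lambda>i\<in>I. t \<odot>\<^bsub>M\<^esub> u i)"
      using e by (auto simp: mat_apply_def intro!: restrict_ext)
    then have "\<Psi> ((t \<otimes> s) \<odot>\<^bsub>pow_module M J\<^esub> m) = \<zero>\<^bsub>T\<^esub>"
      using ker P.smult_closed[OF ts m] smult_pow[OF tR u] by blast
    then have "(t \<otimes> s) \<odot>\<^bsub>T\<^esub> \<Psi> m = \<zero>\<^bsub>T\<^esub>" using h(3)[OF ts m] by simp
    then show "m \<in> {m \<in> carrier (pow_module M J). \<Psi> m \<in> satur R q T {\<zero>\<^bsub>T\<^esub>}}"
      using m h(1)[OF m] compl_mult[OF t(1) s] by (auto simp: satur_def)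
  qed
qed

text \<open>Reduces the depth of a presented module to \<open>coker_sub\<close>, to which the depth
  lemmas for matrices apply.\<close>

lemma presented_depth:
  assumes T: "prime_modl q R T" and \<Psi>: "\<Psi> \<in> module_hom R (pow_module M J) T" "\<Psi> ` carrier (pow_module M J) = carrier T"
    and ker: "\<forall>m\<in>carrier (pow_module M J). \<Psi> m = \<zero>\<^bsub>T\<^esub> \<longleftrightarrow> m \<in> \<Phi> ` carrier (pow_module M I)"
  shows "depth_ge R q T k (satur R q T {\<zero>\<^bsub>T\<^esub>}) \<longleftrightarrow> P.dge k (coker_sub (satur R q M {\<zero>\<^bsub>M\<^esub>}))"
proof -
  interpret T: prime_modl q R T by (rule T)
  show ?thesis
    using depth_ge_pullback[OF P.prime_modl_axioms T \<Psi> T.satur_sat_sub[OF T.sub_zero_submodule], of k]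
      presented_pullback[OF T.module_axioms \<Psi>(1) ker] by simp
qed

text \<open>A denominator that kills all coordinates of m also kills its image; so the support of T
  lies in that of M.\<close>

lemma presented_supp:
  assumes T: "module R T" and \<Psi>: "\<Psi> \<in> module_hom R (pow_module M J) T" "\<Psi> ` carrier (pow_module M J) = carrier T"
    and z: "satur R q M {\<zero>\<^bsub>M\<^esub>} = carrier M"
  shows "satur R q T {\<zero>\<^bsub>T\<^esub>} = carrier T"
proof -
  interpret T: modl R T by (rule modl.intro[OF T])
  note h = module_homD[OF \<Psi>(1)]
  have "y \<in> satur R q T {\<zero>\<^bsub>T\<^esub>}" if y: "y \<in> carrier T" for y
  proof -
    obtain m where m: "m \<in> carrier (pow_module M J)" "y = \<Psi> m" using y \<Psi>(2) by (metis imageE)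
    obtain t where t: "t \<in> carrier R - q" "\<And>j. j \<in> J \<Longrightarrow> t \<odot>\<^bsub>M\<^esub> m j = \<zero>\<^bsub>M\<^esub>"
      using satur_zero_common[OF finJ, of m] powI[OF m(1)] z by metis
    have tR: "t \<in> carrier R" using t by simp
    have "t \<odot>\<^bsub>pow_module M J\<^esub> m = \<zero>\<^bsub>pow_module M J\<^esub>" using t(2) by (auto intro!: restrict_ext)
    then have "t \<odot>\<^bsub>T\<^esub> \<Psi> m = \<zero>\<^bsub>T\<^esub>" using h(3)[OF tR m(1)] P.hom_zero[OF T \<Psi>(1)] by metis
    then show ?thesis using t(1) m h(1) by (auto simp: satur_def)
  qed
  then show ?thesis by (auto simp: satur_def)
qed

end

lemma fg_hom_image:
  assumes "fg_module R M" "module R N" "f \<in> module_hom R M N" "f ` carrier M = carrier N"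
  shows "fg_module R N"
proof -
  interpret M: modl R M using assms(1) by (auto simp: fg_module_def intro: modl.intro)
  interpret N: modl R N by (rule modl.intro) fact
  obtain A where A: "finite A" "A \<subseteq> carrier M" "submodule_span R M A = carrier M"
    using assms unfolding fg_module_def by auto
  have fA: "f ` A \<subseteq> carrier N" using A(2) module_homD(1)[OF assms(3)] by blast
  note S = N.span_submodule[OF fA]
  have "submodule_span R M A \<subseteq> {x \<in> carrier M. f x \<in> submodule_span R N (f ` A)}"
    by (rule M.span_least[OF M.module_hom_submodule_eq[OF assms(2,3) S]]) (use A(2) N.span_superset[of "f ` A"] in auto)
  then have "carrier N \<subseteq> submodule_span R N (f ` A)" unfolding A(3) assms(4)[symmetric] by blast
  then have "submodule_span R N (f ` A) = carrier N" using N.sub_in[OF S] by blast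
  then show ?thesis unfolding fg_module_def using A(1) fA assms(2) by blast
qed

section \<open>Lifting along surjections\<close>

text \<open>
  \<^const>\<open>projective_module\<close> tests the lifting property on a single carrier type; other modules
  are copied to that type along an injection.
\<close>

definition transport :: "('c \<Rightarrow> 'd) \<Rightarrow> ('a, 'c) module \<Rightarrow> ('a, 'd) module" where
  "transport \<iota> A =
     \<lparr>carrier = \<iota> ` carrier A, mult = undefined, one = undefined, zero = \<iota> \<zero>\<^bsub>A\<^esub>,
      add = (\<lambda>x y. \<iota> (the_inv_into (carrier A) \<iota> x \<oplus>\<^bsub>A\<^esub> the_inv_into (carrier A) \<iota> y)),
      smult = (\<lambda>a x. \<iota> (a \<odot>\<^bsub>A\<^esub> the_inv_into (carrier A) \<iota> x))\<rparr>"

lemma transport_simps: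
  "carrier (transport \<iota> A) = \<iota> ` carrier A"
  "\<zero>\<^bsub>transport \<iota> A\<^esub> = \<iota> \<zero>\<^bsub>A\<^esub>"
  "x \<oplus>\<^bsub>transport \<iota> A\<^esub> y = \<iota> (the_inv_into (carrier A) \<iota> x \<oplus>\<^bsub>A\<^esub> the_inv_into (carrier A) \<iota> y)"
  "a \<odot>\<^bsub>transport \<iota> A\<^esub> x = \<iota> (a \<odot>\<^bsub>A\<^esub> the_inv_into (carrier A) \<iota> x)"
  by (simp_all add: transport_def)

lemma transport_props:
  assumes A: "module R A" and inj: "inj_on \<iota> (carrier A)"
  shows "module R (transport \<iota> A)"
    and "\<iota> \<in> module_hom R A (transport \<iota> A)"
    and "the_inv_into (carrier A) \<iota> \<in> module_hom R (transport \<iota> A) A"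
proof -
  interpret A: modl R A by (rule modl.intro) fact
  note inv = the_inv_into_f_f[OF inj]
  show "module R (transport \<iota> A)"
  proof (intro moduleI abelian_groupI' A.R.is_cring)
    fix x assume "x \<in> carrier (transport \<iota> A)"
    then obtain x' where x': "x' \<in> carrier A" "x = \<iota> x'" by (auto simp: transport_simps)
    show "\<zero>\<^bsub>transport \<iota> A\<^esub> \<oplus>\<^bsub>transport \<iota> A\<^esub> x = x" "\<one>\<^bsub>R\<^esub> \<odot>\<^bsub>transport \<iota> A\<^esub> x = x"
      using x' by (simp_all add: transport_simps inv)
    show "\<exists>y\<in>carrier (transport \<iota> A). y \<oplus>\<^bsub>transport \<iota> A\<^esub> x = \<zero>\<^bsub>transport \<iota> A\<^esub>"
      using x' by (intro bexI[of _ "\<iota> (\<ominus>\<^bsub>A\<^esub> x')"]) (simp_all add: transport_simps inv A.M.l_neg)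
    { fix a assume a: "a \<in> carrier R"
      then show "a \<odot>\<^bsub>transport \<iota> A\<^esub> x \<in> carrier (transport \<iota> A)" using x' by (simp add: transport_simps inv)
      fix b assume b: "b \<in> carrier R"
      show "(a \<oplus>\<^bsub>R\<^esub> b) \<odot>\<^bsub>transport \<iota> A\<^esub> x = a \<odot>\<^bsub>transport \<iota> A\<^esub> x \<oplus>\<^bsub>transport \<iota> A\<^esub> b \<odot>\<^bsub>transport \<iota> A\<^esub> x"
        "(a \<otimes>\<^bsub>R\<^esub> b) \<odot>\<^bsub>transport \<iota> A\<^esub> x = a \<odot>\<^bsub>transport \<iota> A\<^esub> (b \<odot>\<^bsub>transport \<iota> A\<^esub> x)"
        using x' a b by (simp_all add: transport_simps inv A.smult_l_distr A.smult_assoc1) }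
    fix y assume "y \<in> carrier (transport \<iota> A)"
    then obtain y' where y': "y' \<in> carrier A" "y = \<iota> y'" by (auto simp: transport_simps)
    show "x \<oplus>\<^bsub>transport \<iota> A\<^esub> y \<in> carrier (transport \<iota> A)" "x \<oplus>\<^bsub>transport \<iota> A\<^esub> y = y \<oplus>\<^bsub>transport \<iota> A\<^esub> x"
      using x' y' by (simp_all add: transport_simps inv A.M.a_comm)
    { fix a assume a: "a \<in> carrier R"
      then show "a \<odot>\<^bsub>transport \<iota> A\<^esub> (x \<oplus>\<^bsub>transport \<iota> A\<^esub> y) = a \<odot>\<^bsub>transport \<iota> A\<^esub> x \<oplus>\<^bsub>transport \<iota> A\<^esub> a \<odot>\<^bsub>transport \<iota> A\<^esub> y"
        using x' y' by (simp add: transport_simps inv A.smult_r_distr) }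
    fix z assume "z \<in> carrier (transport \<iota> A)"
    then obtain z' where z': "z' \<in> carrier A" "z = \<iota> z'" by (auto simp: transport_simps)
    show "x \<oplus>\<^bsub>transport \<iota> A\<^esub> y \<oplus>\<^bsub>transport \<iota> A\<^esub> z = x \<oplus>\<^bsub>transport \<iota> A\<^esub> (y \<oplus>\<^bsub>transport \<iota> A\<^esub> z)"
      using x' y' z' by (simp add: transport_simps inv A.M.a_assoc)
  qed (simp add: transport_simps)
  show "\<iota> \<in> module_hom R A (transport \<iota> A)"
    by (rule module_homI) (simp_all add: transport_simps inv)
  show "the_inv_into (carrier A) \<iota> \<in> module_hom R (transport \<iota> A) A"
    by (rule module_homI) (auto simp: transport_simps inv)
qed

text \<open>Injectivity of g makes the pointwise preimages unique and therefore linear, so the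
  factorization exists for every source L, projective or not.\<close>

lemma hom_through_inj:
  assumes A: "module R A" and B: "module R B" and L: "module R L" and g: "g \<in> module_hom R A B" "inj_on g (carrier A)"
    and f: "f \<in> module_hom R L B" "\<And>x. x \<in> carrier L \<Longrightarrow> f x \<in> g ` carrier A"
  shows "\<exists>k\<in>module_hom R L A. \<forall>x\<in>carrier L. g (k x) = f x"
proof -
  interpret A: modl R A by (rule modl.intro) fact
  interpret L: modl R L by (rule modl.intro) fact
  note gg = module_homD[OF g(1)] and ff = module_homD[OF f(1)]
  define k where "k x = (SOME y. y \<in> carrier A \<and> g y = f x)" for x
  have k: "k x \<in> carrier A \<and> g (k x) = f x" if x: "x \<in> carrier L" for x
    unfolding k_def
  proof (rule someI_ex)
    from f(2)[OF x] obtain y where "f x = g y" "y \<in> carrier A" by (rule imageE)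
    then show "\<exists>y. y \<in> carrier A \<and> g y = f x" by auto
  qed
  note inj = inj_onD[OF g(2)]
  have "k \<in> module_hom R L A"
  proof (rule module_homI)
    show "k x \<in> carrier A" if "x \<in> carrier L" for x using k[OF that] by simp
    show "k (x \<oplus>\<^bsub>L\<^esub> y) = k x \<oplus>\<^bsub>A\<^esub> k y" if "x \<in> carrier L" "y \<in> carrier L" for x y
      by (rule inj) (use k[OF that(1)] k[OF that(2)] k[of "x \<oplus>\<^bsub>L\<^esub> y"] that in \<open>simp_all add: gg ff\<close>)
    show "k (a \<odot>\<^bsub>L\<^esub> x) = a \<odot>\<^bsub>A\<^esub> k x" if "a \<in> carrier R" "x \<in> carrier L" for a x
      by (rule inj) (use k[OF that(2)] k[of "a \<odot>\<^bsub>L\<^esub> x"] that in \<open>simp_all add: gg ff\<close>)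
  qed
  then show ?thesis by (rule bexI[rotated]) (use k in simp)
qed

lemma hom_restrict_codomain:
  "h \<in> module_hom R Q B \<Longrightarrow> (\<And>x. x \<in> carrier Q \<Longrightarrow> h x \<in> K) \<Longrightarrow> h \<in> module_hom R Q (B\<lparr>carrier := K\<rparr>)"
  by (auto simp: module_hom_def)

text \<open>A is copied to the list type along \<iota>. The target B may be of any size: it is
  replaced by the image of g, and that image injects into A by a choice of preimages, hence into the
  list type.\<close>

lemma projective_lift:
  fixes P :: "('a, 'p) module" and A :: "('a, 'c) module" and B :: "('a, 'd) module" and \<iota> :: "'c \<Rightarrow> ('a \<times> 'p) list"
  assumes P: "projective_module R P" and A: "module R A" and B: "module R B" and g: "g \<in> module_hom R A B"
    and h: "h \<in> module_hom R P B" "\<And>x. x \<in> carrier P \<Longrightarrow> h x \<in> g ` carrier A" and inj: "inj_on \<iota> (carrier A)"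
  shows "\<exists>k\<in>module_hom R P A. \<forall>x\<in>carrier P. g (k x) = h x"
proof -
  interpret A: modl R A by (rule modl.intro) fact
  interpret B: modl R B by (rule modl.intro) fact
  define B0 where "B0 = B\<lparr>carrier := g ` carrier A\<rparr>"
  have K: "submodule (g ` carrier A) R B" by (rule A.hom_image_submodule[OF B g A.carrier_is_submodule])
  have B0: "module R B0" unfolding B0_def by (rule submodule.submodule_is_module[OF K B])
  have g0: "g \<in> module_hom R A B0" unfolding B0_def by (rule hom_restrict_codomain[OF g]) simp
  have h0: "h \<in> module_hom R P B0" unfolding B0_def by (rule hom_restrict_codomain[OF h])
  have c0: "carrier B0 = g ` carrier A" by (simp add: B0_def)
  define \<sigma> where "\<sigma> y = (SOME x. x \<in> carrier A \<and> g x = y)" for y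
  have \<sigma>: "\<sigma> y \<in> carrier A \<and> g (\<sigma> y) = y" if "y \<in> carrier B0" for y
    unfolding \<sigma>_def by (rule someI_ex) (use that c0 in auto)
  define \<kappa> where "\<kappa> y = \<iota> (\<sigma> y)" for y
  have ik: "inj_on \<kappa> (carrier B0)"
  proof (rule inj_onI)
    fix y y' assume y: "y \<in> carrier B0" "y' \<in> carrier B0" "\<kappa> y = \<kappa> y'"
    then have "\<sigma> y = \<sigma> y'" using inj_onD[OF inj] \<sigma> unfolding \<kappa>_def by metis
    then show "y = y'" using \<sigma>[OF y(1)] \<sigma>[OF y(2)] by metis
  qed
  note tA = transport_props[OF A inj] and tB = transport_props[OF B0 ik]
  let ?g = "\<lambda>x. \<kappa> (g (the_inv_into (carrier A) \<iota> x))"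
  have g': "?g \<in> module_hom R (transport \<iota> A) (transport \<kappa> B0)"
    by (rule module_hom_comp[OF module_hom_comp[OF tA(3) g0] tB(2)])
  have sg: "?g ` carrier (transport \<iota> A) = carrier (transport \<kappa> B0)"
    unfolding transport_simps c0 by (auto simp: the_inv_into_f_f[OF inj] image_image)
  have h': "(\<lambda>x. \<kappa> (h x)) \<in> module_hom R P (transport \<kappa> B0)" by (rule module_hom_comp[OF h0 tB(2)])
  obtain k where k: "k \<in> module_hom R P (transport \<iota> A)" "\<forall>x\<in>carrier P. ?g (k x) = \<kappa> (h x)"
    using P tA(1) tB(1) g' sg h' unfolding projective_module_def by blast
  let ?k = "\<lambda>x. the_inv_into (carrier A) \<iota> (k x)"
  have hk: "?k \<in> module_hom R P A" by (rule module_hom_comp[OF k(1) tA(3)])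
  have "g (?k x) = h x" if x: "x \<in> carrier P" for x
    using k(2) x inj_onD[OF ik] module_homD(1)[OF g0 module_homD(1)[OF hk x]] module_homD(1)[OF h0 x] by metis
  note gk = this
  show ?thesis by (rule bexI[OF _ hk], rule ballI, rule gk)
qed

text \<open>Lifts are prescribed on the unit vectors by choosing preimages along g and extended
  linearly.\<close>

lemma rpow_projective:
  fixes \<iota> :: "('j \<Rightarrow> 'a) \<Rightarrow> 'p"
  assumes cr: "cring R" and J: "finite J" and inj: "inj_on \<iota> (carrier (rpow R J))"
  shows "projective_module R (transport \<iota> (rpow R J))"
  unfolding projective_module_def
proof (intro conjI allI impI)
  note rp = rpow_module[OF cr, of J]
  note t = transport_props[OF rp inj]
  show "module R (transport \<iota> (rpow R J))" by (rule t(1))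
  fix A B :: "('a, ('a \<times> 'p) list) module" and g h
  assume "module R A \<and> module R B \<and> g \<in> module_hom R A B \<and> g ` carrier A = carrier B \<and> h \<in> module_hom R (transport \<iota> (rpow R J)) B"
  then have A: "module R A" and B: "module R B" and g: "g \<in> module_hom R A B" "g ` carrier A = carrier B"
    and h: "h \<in> module_hom R (transport \<iota> (rpow R J)) B" by auto
  interpret A: modl R A by (rule modl.intro) fact
  interpret B: modl R B by (rule modl.intro) fact
  let ?dec = "the_inv_into (carrier (rpow R J)) \<iota>"
  have hi: "(\<lambda>v. h (\<iota> v)) \<in> module_hom R (rpow R J) B" by (rule module_hom_comp[OF t(2) h])
  have "\<exists>a\<in>carrier A. g a = h (\<iota> (unit_vec R J j))" for j
    using module_homD(1)[OF hi unit_vec_closed[OF cr, of J j]] g(2) by (metis imageE)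
  then obtain a where a: "\<And>j. a j \<in> carrier A \<and> g (a j) = h (\<iota> (unit_vec R J j))" by metis
  have l: "(\<lambda>v. \<Oplus>\<^bsub>A\<^esub>j\<in>J. v j \<odot>\<^bsub>A\<^esub> a j) \<in> module_hom R (rpow R J) A"
    by (rule rpow_lift(1)[OF cr A J]) (use a in blast)
  let ?k = "\<lambda>x. \<Oplus>\<^bsub>A\<^esub>j\<in>J. ?dec x j \<odot>\<^bsub>A\<^esub> a j"
  have k: "?k \<in> module_hom R (transport \<iota> (rpow R J)) A" by (rule module_hom_comp[OF t(3) l])
  have "g (?k x) = h x" if x: "x \<in> carrier (transport \<iota> (rpow R J))" for x
  proof -
    obtain v where v: "v \<in> carrier (rpow R J)" "x = \<iota> v" using x unfolding transport_simps by blast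
    have d: "?dec x = v" unfolding v(2) by (rule the_inv_into_f_f[OF inj v(1)])
    have vR: "v j \<in> carrier R" if "j \<in> J" for j using v(1) that by auto
    have "g (?k x) = (\<Oplus>\<^bsub>B\<^esub>j\<in>J. g (v j \<odot>\<^bsub>A\<^esub> a j))"
      unfolding d by (rule A.hom_finsum[OF B g(1)]) (use vR a in blast)
    also have "\<dots> = (\<Oplus>\<^bsub>B\<^esub>j\<in>J. v j \<odot>\<^bsub>B\<^esub> h (\<iota> (unit_vec R J j)))"
      by (rule B.finsum_cong') (use vR a module_homD(3)[OF g(1)] module_homD(1)[OF hi unit_vec_closed[OF cr]] in \<open>auto simp del: pow_module_simps\<close>)
    also have "\<dots> = h (\<iota> v)" by (rule rpow_hom_expand[OF cr B hi J v(1), symmetric])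
    finally show ?thesis using v(2) by simp
  qed
  note gk = this
  show "\<exists>k\<in>module_hom R (transport \<iota> (rpow R J)) A. \<forall>x\<in>carrier (transport \<iota> (rpow R J)). g (k x) = h x"
    by (rule bexI[OF _ k], rule ballI, rule gk)
qed

text \<open>A function on a finite set is coded by the list of its values; the second components are
  padding.\<close>

lemma ex_list_code:
  assumes "finite J" shows "\<exists>\<iota> :: ('j \<Rightarrow> 'a) \<Rightarrow> ('a \<times> 'b) list. inj_on \<iota> (J \<rightarrow>\<^sub>E S)"
proof -
  obtain js where js: "set js = J" using finite_list[OF assms] by blast
  have "inj_on (\<lambda>v. map (\<lambda>j. (v j, undefined :: 'b)) js) (J \<rightarrow>\<^sub>E S)"
    by (rule inj_onI) (rule PiE_ext, auto simp: js)
  then show ?thesis by blast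
qed

text \<open>Embeds the element type of a projective module into the list type on which its lifting
  property is tested.\<close>

lemma inj_single_code: "inj_on (\<lambda>x. [(undefined, x)]) A"
  by (rule inj_onI) simp

lemma hom_add:
  assumes "module R M" "module R L" "f \<in> module_hom R M L" "g \<in> module_hom R M L"
  shows "(\<lambda>x. f x \<oplus>\<^bsub>L\<^esub> g x) \<in> module_hom R M L"
proof -
  interpret L: modl R L by (rule modl.intro) fact
  show ?thesis
    by (rule module_homI)
      (use module_homD[OF assms(3)] module_homD[OF assms(4)] in \<open>auto simp: L.M.a_ac L.smult_r_distr\<close>)
qed

lemma hom_diff:
  assumes "module R M" "module R L" "f \<in> module_hom R M L" "g \<in> module_hom R M L"
  shows "(\<lambda>x. f x \<ominus>\<^bsub>L\<^esub> g x) \<in> module_hom R M L"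
proof -
  interpret L: modl R L by (rule modl.intro) fact
  show ?thesis
    by (rule module_homI)
      (use module_homD[OF assms(3)] module_homD[OF assms(4)] in
        \<open>auto simp: L.M.minus_eq L.M.minus_add L.M.a_ac L.smult_r_distr L.smult_r_minus\<close>)
qed

lemma hom_id: "(\<lambda>x. x) \<in> module_hom R M M"
  by (auto simp: module_hom_def)

lemma hom_const_zero: "module R L \<Longrightarrow> (\<lambda>x. \<zero>\<^bsub>L\<^esub>) \<in> module_hom R M L"
proof -
  assume "module R L"
  then interpret L: modl R L by (rule modl.intro)
  show ?thesis by (rule module_homI) auto
qed

lemma rpow_hom_eq:
  assumes cr: "cring R" and L: "module R L" and J: "finite J" and f: "f \<in> module_hom R (rpow R J) L" and g: "g \<in> module_hom R (rpow R J) L"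
    and fg: "\<And>j. j \<in> J \<Longrightarrow> f (unit_vec R J j) = g (unit_vec R J j)" and v: "v \<in> carrier (rpow R J)"
  shows "f v = g v"
proof -
  interpret L: modl R L by (rule modl.intro) fact
  have vR: "v j \<in> carrier R" if "j \<in> J" for j using v that by auto
  have "(\<Oplus>\<^bsub>L\<^esub>j\<in>J. v j \<odot>\<^bsub>L\<^esub> f (unit_vec R J j)) = (\<Oplus>\<^bsub>L\<^esub>j\<in>J. v j \<odot>\<^bsub>L\<^esub> g (unit_vec R J j))"
    by (rule L.finsum_cong') (use fg vR module_homD(1)[OF g unit_vec_closed[OF cr]] in auto)
  then show ?thesis
    unfolding rpow_hom_expand[OF cr L f J v] rpow_hom_expand[OF cr L g J v] .
qed

section \<open>Projective resolutions and Tor\<close>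

context presentation
begin

lemma rpowJ_module: "module R (rpow R J)" and rpowI_module: "module R (rpow R I)"
  by (rule rpow_module[OF N.R.is_cring])+

lemma mat_apply_vec:
  assumes M: "module R M" and x: "x \<in> carrier M" and r: "r \<in> carrier (rpow R I)" and j: "j \<in> J"
  shows "mat_apply M J I C (\<lambda>i\<in>I. r i \<odot>\<^bsub>M\<^esub> x) j = \<Phi>R r j \<odot>\<^bsub>M\<^esub> x"
proof -
  interpret M: modl R M by (rule modl.intro[OF M])
  have rR: "r i \<in> carrier R" if "i \<in> I" for i using r that by auto
  have "\<Phi>R r j = (\<Oplus>\<^bsub>R\<^esub>i\<in>I. C j i \<otimes> r i)"
    unfolding mat_apply_def using j self_module_finsum[OF N.R.is_cring, of I "\<lambda>i. C j i \<otimes> r i"] rR C_closed[OF j] by simp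
  then have "\<Phi>R r j \<odot>\<^bsub>M\<^esub> x = (\<Oplus>\<^bsub>M\<^esub>i\<in>I. (C j i \<otimes> r i) \<odot>\<^bsub>M\<^esub> x)"
    using M.finsum_smult_rdistr[OF finI x, of "\<lambda>i. C j i \<otimes> r i"] rR C_closed[OF j] by simp
  also have "\<dots> = (\<Oplus>\<^bsub>M\<^esub>i\<in>I. C j i \<odot>\<^bsub>M\<^esub> (\<lambda>i\<in>I. r i \<odot>\<^bsub>M\<^esub> x) i)"
    by (rule M.finsum_cong') (use rR C_closed[OF j] x in \<open>auto simp: M.smult_assoc1\<close>)
  finally show ?thesis unfolding mat_apply_def using j by simp
qed

lemma pi_Phi: "u \<in> carrier (rpow R I) \<Longrightarrow> \<pi> (\<Phi>R u) = \<zero>\<^bsub>N\<^esub>"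
  using pi_ker[OF module_homD(1)[OF PhiR_hom]] by blast

lemma lift_augmentation:
  fixes P0 :: "('a, 'p) module"
  assumes "projective_module R P0" "e \<in> module_hom R P0 N"
  shows "\<exists>\<alpha>\<in>module_hom R P0 (rpow R J). \<forall>x\<in>carrier P0. \<pi> (\<alpha> x) = e x"
proof -
  obtain \<iota> :: "('j \<Rightarrow> 'a) \<Rightarrow> ('a \<times> 'p) list" where "inj_on \<iota> (J \<rightarrow>\<^sub>E carrier R)"
    using ex_list_code[OF finJ] by blast
  then have i: "inj_on \<iota> (carrier (rpow R J))" by simp
  show ?thesis
    by (rule projective_lift[OF assms(1) rpowJ_module N.module_axioms pi_hom assms(2) _ i])
      (use module_homD(1)[OF assms(2)] pi_surj in blast)
qed

text \<open>
  A complex of projectives resolving \<open>N\<close> is compared with the presentation (\<open>\<alpha>\<close> and \<open>\<beta>\<close> below);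
  \<open>b = \<beta> \<alpha>\<close> is homotopic to the identity and vanishes in degrees at least \<open>2\<close>.
\<close>

lemma comparison:
  fixes P :: "nat \<Rightarrow> ('a, 'p) module"
  assumes res: "projective_resolution R N P d e" and inj: "inj_on \<Phi>R (carrier (rpow R I))"
  shows "\<exists>\<alpha>0 \<alpha>1 c b. \<alpha>0 \<in> module_hom R (P 0) (rpow R J) \<and> \<alpha>1 \<in> module_hom R (P 1) (rpow R I) \<and>
    (\<forall>p\<in>carrier (P 1). \<Phi>R (\<alpha>1 p) = \<alpha>0 (d 0 p)) \<and>
    (\<forall>i\<in>I. c i \<in> carrier (P 1)) \<and>
    (\<forall>i. b i \<in> module_hom R (P i) (P i)) \<and>
    (\<forall>p\<in>carrier (P 1). b 1 p = (\<Oplus>\<^bsub>P 1\<^esub>i\<in>I. \<alpha>1 p i \<odot>\<^bsub>P 1\<^esub> c i)) \<and>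
    (\<forall>i p. b (Suc (Suc i)) p = \<zero>\<^bsub>P (Suc (Suc i))\<^esub>) \<and>
    (\<forall>i. \<exists>h\<in>module_hom R (P i) (P (Suc i)). \<exists>h'\<in>module_hom R (P (Suc i)) (P (Suc (Suc i))).
       \<forall>p\<in>carrier (P (Suc i)). p = (b (Suc i) p \<oplus>\<^bsub>P (Suc i)\<^esub> h (d i p)) \<oplus>\<^bsub>P (Suc i)\<^esub> d (Suc i) (h' p))"
proof -
  have proj: "\<And>i. projective_module R (P i)" and dh: "\<And>i. d i \<in> module_hom R (P (Suc i)) (P i)"
    and eh: "e \<in> module_hom R (P 0) N" and es: "e ` carrier (P 0) = carrier N"
    and ex0: "d 0 ` carrier (P 1) = module_ker (P 0) N e"
    and exS: "\<And>i. d (Suc i) ` carrier (P (Suc (Suc i))) = module_ker (P (Suc i)) (P i) (d i)"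
    using res by (auto simp: projective_resolution_def)
  have Pm: "module R (P i)" for i using proj[of i] by (simp add: projective_module_def)
  have Pl: "modl R (P i)" for i by (rule modl.intro[OF Pm])
  note dD = module_homD[OF dh] and eD = module_homD[OF eh]
  have ed: "e (d 0 p) = \<zero>\<^bsub>N\<^esub>" if "p \<in> carrier (P 1)" for p
  proof -
    have "d 0 p \<in> module_ker (P 0) N e" unfolding ex0[symmetric] using that by simp
    then show ?thesis by (simp add: module_ker_def)
  qed
  have dd: "d i (d (Suc i) p) = \<zero>\<^bsub>P i\<^esub>" if "p \<in> carrier (P (Suc (Suc i)))" for i p
  proof -
    have "d (Suc i) p \<in> module_ker (P (Suc i)) (P i) (d i)" unfolding exS[symmetric] using that by simp
    then show ?thesis by (simp add: module_ker_def)
  qed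
  obtain \<alpha>0 where a0: "\<alpha>0 \<in> module_hom R (P 0) (rpow R J)" "\<And>x. x \<in> carrier (P 0) \<Longrightarrow> \<pi> (\<alpha>0 x) = e x"
    using lift_augmentation[OF proj eh] by blast
  have dh0: "d 0 \<in> module_hom R (P 1) (P 0)" using dh[of 0] by simp
  \<comment> \<open>Injectivity of C takes the place of projectivity: \<alpha>0 after
    \<open>d 0\<close> has values in the kernel of \<pi>, which is the image of C, and preimages
    under C are unique.\<close>
  obtain \<alpha>1 where a1: "\<alpha>1 \<in> module_hom R (P 1) (rpow R I)" "\<And>p. p \<in> carrier (P 1) \<Longrightarrow> \<Phi>R (\<alpha>1 p) = \<alpha>0 (d 0 p)"
  proof -
    have "\<alpha>0 (d 0 p) \<in> \<Phi>R ` carrier (rpow R I)" if p: "p \<in> carrier (P 1)" for p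
    proof -
      have dp: "d 0 p \<in> carrier (P 0)" using module_homD(1)[OF dh0 p] .
      show ?thesis unfolding pi_ker[OF module_homD(1)[OF a0(1) dp], symmetric] a0(2)[OF dp] by (rule ed[OF p])
    qed
    then show ?thesis
      using hom_through_inj[OF rpowI_module rpowJ_module Pm PhiR_hom inj module_hom_comp[OF dh0 a0(1)]] that by blast
  qed
  \<comment> \<open>The maps back, \<beta>0 and later \<beta>1, start from free modules and are
    prescribed on unit vectors, by preimages along e and along \<open>d 0\<close>.\<close>
  have "\<exists>b\<in>carrier (P 0). e b = \<epsilon> j" for j using eps_closed[of j] es by (metis imageE)
  then obtain bb where bb: "\<And>j. bb j \<in> carrier (P 0) \<and> e (bb j) = \<epsilon> j" by metis
  define \<beta>0 where "\<beta>0 v = (\<Oplus>\<^bsub>P 0\<^esub>j\<in>J. v j \<odot>\<^bsub>P 0\<^esub> bb j)" for v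
  have b0h: "\<beta>0 \<in> module_hom R (rpow R J) (P 0)"
    unfolding \<beta>0_def by (rule rpow_lift(1)[OF N.R.is_cring Pm finJ]) (use bb in blast)
  have b0u: "\<beta>0 (unit_vec R J j) = bb j" if "j \<in> J" for j
    unfolding \<beta>0_def by (rule rpow_lift(2)[OF N.R.is_cring Pm finJ _ that]) (use bb in blast)
  have eb0: "e (\<beta>0 v) = \<pi> v" if v: "v \<in> carrier (rpow R J)" for v
    by (rule rpow_hom_eq[OF N.R.is_cring N.module_axioms finJ module_hom_comp[OF b0h eh] pi_hom _ v])
      (use b0u bb in \<open>simp add: \<epsilon>_def\<close>)
  have "\<exists>c\<in>carrier (P 1). d 0 c = \<beta>0 (\<Phi>R (unit_vec R I i))" for i
  proof -
    note u = unit_vec_closed[OF N.R.is_cring, of I i]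
    note pu = module_homD(1)[OF PhiR_hom u]
    have "\<beta>0 (\<Phi>R (unit_vec R I i)) \<in> module_ker (P 0) N e"
      unfolding module_ker_def using module_homD(1)[OF b0h pu] eb0[OF pu] pi_Phi[OF u] by simp
    then show ?thesis unfolding ex0[symmetric] by (metis imageE)
  qed
  then obtain c where c: "\<And>i. c i \<in> carrier (P 1) \<and> d 0 (c i) = \<beta>0 (\<Phi>R (unit_vec R I i))" by metis
  define \<beta>1 where "\<beta>1 u = (\<Oplus>\<^bsub>P 1\<^esub>i\<in>I. u i \<odot>\<^bsub>P 1\<^esub> c i)" for u
  have b1h: "\<beta>1 \<in> module_hom R (rpow R I) (P 1)"
    unfolding \<beta>1_def by (rule rpow_lift(1)[OF N.R.is_cring Pm finI]) (use c in blast)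
  have b1u: "\<beta>1 (unit_vec R I i) = c i" if "i \<in> I" for i
    unfolding \<beta>1_def by (rule rpow_lift(2)[OF N.R.is_cring Pm finI _ that]) (use c in blast)
  have db1: "d 0 (\<beta>1 u) = \<beta>0 (\<Phi>R u)" if u: "u \<in> carrier (rpow R I)" for u
    by (rule rpow_hom_eq[OF N.R.is_cring Pm finI module_hom_comp[OF b1h dh0] module_hom_comp[OF PhiR_hom b0h] _ u])
      (use b1u c in simp)
  define b where "b i = (if i = 0 then (\<lambda>p. \<beta>0 (\<alpha>0 p)) else if i = 1 then (\<lambda>p. \<beta>1 (\<alpha>1 p)) else (\<lambda>p. \<zero>\<^bsub>P i\<^esub>))" for i
  have bh: "b i \<in> module_hom R (P i) (P i)" for i
  proof -
    consider "i = 0" | "i = 1" | "i \<noteq> 0" "i \<noteq> 1" by blast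
    then show ?thesis
      by cases (simp_all add: b_def module_hom_comp[OF a0(1) b0h] module_hom_comp[OF a1(1) b1h, simplified] hom_const_zero[OF Pm])
  qed
  note bD = module_homD[OF bh]
  have bS: "d i (b (Suc i) p) = b i (d i p)" if p: "p \<in> carrier (P (Suc i))" for i p
  proof -
    consider "i = 0" | "i = 1" | k where "i = Suc (Suc k)" by (metis One_nat_def not0_implies_Suc)
    then show ?thesis
    proof cases
      case 1
      have p1: "p \<in> carrier (P 1)" using p 1 by simp
      show ?thesis unfolding 1 b_def using db1[OF module_homD(1)[OF a1(1) p1]] a1(2)[OF p1] by simp
    next
      case 2
      have dp: "d 1 p \<in> carrier (P 1)" using dD(1)[of p 1] p 2 by simp
      have p2: "p \<in> carrier (P (Suc (Suc 0)))" using p 2 by simp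
      \<comment> \<open>The chain map has to vanish from degree two on: C kills \<alpha>1 of a
        boundary because d d = 0, and C is injective.\<close>
      have "\<Phi>R (\<alpha>1 (d 1 p)) = \<alpha>0 (d 0 (d (Suc 0) p))" using a1(2)[OF dp] by simp
      also have "\<dots> = \<Phi>R \<zero>\<^bsub>rpow R I\<^esub>"
        unfolding dd[OF p2] modl.hom_zero[OF Pl rpowJ_module a0(1)] modl.hom_zero[OF RI rpowJ_module PhiR_hom] ..
      finally have e: "\<Phi>R (\<alpha>1 (d 1 p)) = \<Phi>R \<zero>\<^bsub>rpow R I\<^esub>" .
      have "\<zero>\<^bsub>rpow R I\<^esub> \<in> carrier (rpow R I)" by auto
      from inj_onD[OF inj e module_homD(1)[OF a1(1) dp] this] have "\<alpha>1 (d 1 p) = \<zero>\<^bsub>rpow R I\<^esub>" .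
      then have "b 1 (d 1 p) = \<zero>\<^bsub>P 1\<^esub>" unfolding b_def using modl.hom_zero[OF RI Pm b1h] by simp
      moreover have "d 1 (b (Suc 1) p) = \<zero>\<^bsub>P 1\<^esub>" unfolding b_def using modl.hom_zero[OF Pl Pm dh[of 1]] by simp
      ultimately show ?thesis unfolding 2 by simp
    next
      case 3
      then show ?thesis unfolding b_def using modl.hom_zero[OF Pl Pm dh[of i]] by simp
    qed
  qed
  \<comment> \<open>The defect of p, namely p - bp - hdp, is a cycle by the hypothesis on h, hence a
    boundary by exactness. Lifting it along d by projectivity gives the next homotopy.\<close>
  have step: "\<exists>h'\<in>module_hom R (P (Suc i)) (P (Suc (Suc i))). \<forall>p\<in>carrier (P (Suc i)).
        p = (b (Suc i) p \<oplus>\<^bsub>P (Suc i)\<^esub> h (d i p)) \<oplus>\<^bsub>P (Suc i)\<^esub> d (Suc i) (h' p)"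
    if h: "h \<in> module_hom R (P i) (P (Suc i))"
      and hp: "\<And>p. p \<in> carrier (P (Suc i)) \<Longrightarrow> d i p = b i (d i p) \<oplus>\<^bsub>P i\<^esub> d i (h (d i p))" for i h
  proof -
    interpret Q: modl R "P (Suc i)" by (rule Pl)
    interpret Qi: modl R "P i" by (rule Pl)
    note hD = module_homD[OF h]
    let ?r = "\<lambda>p. p \<ominus>\<^bsub>P (Suc i)\<^esub> (b (Suc i) p \<oplus>\<^bsub>P (Suc i)\<^esub> h (d i p))"
    have r: "?r \<in> module_hom R (P (Suc i)) (P (Suc i))"
      by (rule hom_diff[OF Pm Pm hom_id hom_add[OF Pm Pm bh module_hom_comp[OF dh h]]])
    have "?r p \<in> d (Suc i) ` carrier (P (Suc (Suc i)))" if p: "p \<in> carrier (P (Suc i))" for p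
    proof -
      have c: "b (Suc i) p \<in> carrier (P (Suc i))" "h (d i p) \<in> carrier (P (Suc i))"
        using bD(1)[OF p] hD(1)[OF dD(1)[OF p]] by auto
      have "d i (?r p) = d i p \<ominus>\<^bsub>P i\<^esub> (b i (d i p) \<oplus>\<^bsub>P i\<^esub> d i (h (d i p)))"
        using Q.hom_minus[OF Pm dh p Q.M.a_closed[OF c]] dD(2)[OF c] bS[OF p] by simp
      also have "\<dots> = \<zero>\<^bsub>P i\<^esub>" using hp[OF p] dD(1)[OF p] by (metis Qi.M.r_neg Qi.M.minus_eq)
      finally show ?thesis unfolding exS module_ker_def using module_homD(1)[OF r p] by simp
    qed
    then obtain h' where h': "h' \<in> module_hom R (P (Suc i)) (P (Suc (Suc i)))" "\<And>p. p \<in> carrier (P (Suc i)) \<Longrightarrow> d (Suc i) (h' p) = ?r p"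
      using projective_lift[OF proj Pm Pm dh r _ inj_single_code] by blast
    have "p = (b (Suc i) p \<oplus>\<^bsub>P (Suc i)\<^esub> h (d i p)) \<oplus>\<^bsub>P (Suc i)\<^esub> d (Suc i) (h' p)" if p: "p \<in> carrier (P (Suc i))" for p
    proof -
      have "b (Suc i) p \<oplus>\<^bsub>P (Suc i)\<^esub> h (d i p) \<in> carrier (P (Suc i))"
        using bD(1)[OF p] hD(1)[OF dD(1)[OF p]] by auto
      then show ?thesis unfolding h'(2)[OF p] using p
        by (simp add: Q.M.minus_eq Q.M.a_comm[of p] Q.M.r_neg2)
    qed
    then show ?thesis using h'(1) by blast
  qed
  \<comment> \<open>The homotopy identity is claimed on boundaries \<open>d i p\<close> alone. There
    the term with h d vanishes, so degree zero and the higher degrees share one statement, which is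
    exactly what \<open>step\<close> consumes.\<close>
  have G: "\<exists>h\<in>module_hom R (P i) (P (Suc i)). \<forall>p\<in>carrier (P (Suc i)). d i p = b i (d i p) \<oplus>\<^bsub>P i\<^esub> d i (h (d i p))" for i
  proof (induction i)
    case 0
    interpret Q0: modl R "P 0" by (rule Pl)
    let ?r = "\<lambda>p. p \<ominus>\<^bsub>P 0\<^esub> b 0 p"
    have r: "?r \<in> module_hom R (P 0) (P 0)" by (rule hom_diff[OF Pm Pm hom_id bh])
    have "?r p \<in> d 0 ` carrier (P 1)" if p: "p \<in> carrier (P 0)" for p
    proof -
      have "e (b 0 p) = e p" unfolding b_def using eb0[OF module_homD(1)[OF a0(1) p]] a0(2)[OF p] by simp
      then have "e (?r p) = \<zero>\<^bsub>N\<^esub>"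
        using Q0.hom_minus[OF N.module_axioms eh p bD(1)[OF p]] eD(1)[OF p] by (simp add: N.M.minus_eq N.M.r_neg)
      then show ?thesis unfolding ex0 module_ker_def using module_homD(1)[OF r p] by simp
    qed
    then obtain h where h: "h \<in> module_hom R (P 0) (P 1)" "\<And>p. p \<in> carrier (P 0) \<Longrightarrow> d 0 (h p) = ?r p"
      using projective_lift[OF proj Pm Pm dh0 r _ inj_single_code] by blast
    have "p = b 0 p \<oplus>\<^bsub>P 0\<^esub> d 0 (h p)" if p: "p \<in> carrier (P 0)" for p
      unfolding h(2)[OF p] using p bD(1)[OF p] by (simp add: Q0.M.minus_eq Q0.M.a_comm[of p] Q0.M.r_neg2)
    then show ?case using h(1) dD(1)[of _ 0] by (intro bexI[of _ h]) auto
  next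
    case (Suc i)
    interpret Q: modl R "P (Suc i)" by (rule Pl)
    obtain h where h: "h \<in> module_hom R (P i) (P (Suc i))" "\<And>p. p \<in> carrier (P (Suc i)) \<Longrightarrow> d i p = b i (d i p) \<oplus>\<^bsub>P i\<^esub> d i (h (d i p))"
      using Suc by blast
    obtain h' where h': "h' \<in> module_hom R (P (Suc i)) (P (Suc (Suc i)))"
      "\<And>p. p \<in> carrier (P (Suc i)) \<Longrightarrow> p = (b (Suc i) p \<oplus>\<^bsub>P (Suc i)\<^esub> h (d i p)) \<oplus>\<^bsub>P (Suc i)\<^esub> d (Suc i) (h' p)"
      using step[OF h] by blast
    have "d (Suc i) p = b (Suc i) (d (Suc i) p) \<oplus>\<^bsub>P (Suc i)\<^esub> d (Suc i) (h' (d (Suc i) p))" if p: "p \<in> carrier (P (Suc (Suc i)))" for p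
    proof -
      note dp = dD(1)[OF p]
      have "h (d i (d (Suc i) p)) = \<zero>\<^bsub>P (Suc i)\<^esub>" unfolding dd[OF p] by (rule modl.hom_zero[OF Pl Pm h(1)])
      then show ?thesis using h'(2)[OF dp] bD(1)[OF dp] by simp
    qed
    then show ?case using h'(1) by blast
  qed
  have "b 1 p = (\<Oplus>\<^bsub>P 1\<^esub>i\<in>I. \<alpha>1 p i \<odot>\<^bsub>P 1\<^esub> c i)" for p
    by (simp add: b_def \<beta>1_def)
  moreover have "\<exists>h\<in>module_hom R (P i) (P (Suc i)). \<exists>h'\<in>module_hom R (P (Suc i)) (P (Suc (Suc i))).
       \<forall>p\<in>carrier (P (Suc i)). p = (b (Suc i) p \<oplus>\<^bsub>P (Suc i)\<^esub> h (d i p)) \<oplus>\<^bsub>P (Suc i)\<^esub> d (Suc i) (h' p)" for i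
  proof -
    obtain h where h: "h \<in> module_hom R (P i) (P (Suc i))"
      "\<forall>p\<in>carrier (P (Suc i)). d i p = b i (d i p) \<oplus>\<^bsub>P i\<^esub> d i (h (d i p))"
      using G[of i] by (elim bexE)
    show ?thesis by (rule bexI[OF _ h(1)], rule step[OF h(1)], rule bspec[OF h(2)])
  qed
  moreover have "b (Suc (Suc i)) p = \<zero>\<^bsub>P (Suc (Suc i))\<^esub>" for i p by (simp add: b_def)
  ultimately show ?thesis using a0(1) a1 c bh
    by (intro exI[of _ \<alpha>0] exI[of _ \<alpha>1] exI[of _ c] exI[of _ b] conjI ballI allI) (simp_all only:)
qed

text \<open>The homotopy consists of homomorphisms, hence survives tensoring: a cycle z equals bz
  plus a boundary. In degrees at least two b is zero; in degree one it factors through the I-th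
  power of M, where z becomes a kernel vector of the injective C.\<close>

lemma tensor_exact:
  fixes P :: "nat \<Rightarrow> ('a, 'p) module" and M :: "('a, 'm) module"
  assumes res: "projective_resolution R N P d e" and inj: "inj_on \<Phi>R (carrier (rpow R I))"
    and M: "module R M" and injM: "inj_on (mat_apply M J I C) (carrier (pow_module M I))"
    and z: "z \<in> carrier (tensor_product R M (P (Suc i)))"
    and dz: "tensor_map R M (P (Suc i)) (P i) (d i) z = \<zero>\<^bsub>tensor_product R M (P i)\<^esub>"
  shows "z \<in> tensor_map R M (P (Suc (Suc i))) (P (Suc i)) (d (Suc i)) ` carrier (tensor_product R M (P (Suc (Suc i))))"
proof -
  obtain \<alpha>0 \<alpha>1 c b where a0: "\<alpha>0 \<in> module_hom R (P 0) (rpow R J)" and a1: "\<alpha>1 \<in> module_hom R (P 1) (rpow R I)"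
    and Pa1': "\<forall>p\<in>carrier (P 1). \<Phi>R (\<alpha>1 p) = \<alpha>0 (d 0 p)"
    and c': "\<forall>i\<in>I. c i \<in> carrier (P 1)"
    and bh': "\<forall>i. b i \<in> module_hom R (P i) (P i)"
    and b1': "\<forall>p\<in>carrier (P 1). b 1 p = (\<Oplus>\<^bsub>P 1\<^esub>i\<in>I. \<alpha>1 p i \<odot>\<^bsub>P 1\<^esub> c i)"
    and b2': "\<forall>i p. b (Suc (Suc i)) p = \<zero>\<^bsub>P (Suc (Suc i))\<^esub>"
    and hom': "\<forall>i. \<exists>h\<in>module_hom R (P i) (P (Suc i)). \<exists>h'\<in>module_hom R (P (Suc i)) (P (Suc (Suc i))).
       \<forall>p\<in>carrier (P (Suc i)). p = (b (Suc i) p \<oplus>\<^bsub>P (Suc i)\<^esub> h (d i p)) \<oplus>\<^bsub>P (Suc i)\<^esub> d (Suc i) (h' p)"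
    using comparison[OF res inj] by (elim exE conjE)
  note Pa1 = bspec[OF Pa1'] and c = bspec[OF c'] and bh = spec[OF bh'] and b1 = bspec[OF b1']
    and b2 = b2'[rule_format] and hom = spec[OF hom']
  obtain h h' where h: "h \<in> module_hom R (P i) (P (Suc i))" and h': "h' \<in> module_hom R (P (Suc i)) (P (Suc (Suc i)))"
    and hh: "\<And>p. p \<in> carrier (P (Suc i)) \<Longrightarrow> p = (b (Suc i) p \<oplus>\<^bsub>P (Suc i)\<^esub> h (d i p)) \<oplus>\<^bsub>P (Suc i)\<^esub> d (Suc i) (h' p)"
    using hom[of i] by (elim bexE) metis
  have Pm: "module R (P i)" for i using res by (simp add: projective_resolution_def projective_module_def)
  have dh: "d i \<in> module_hom R (P (Suc i)) (P i)" for i using res by (simp add: projective_resolution_def)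
  interpret M: modl R M by (rule modl.intro[OF M])
  have tp: "tensor_pair R M (P i)" for i by (intro tensor_pair.intro M.modl_axioms modl.intro Pm)
  interpret S: tensor_pair R M "P (Suc i)" by (rule tp)
  interpret TS: modl R S.T by (rule S.T_modl)
  note Tm = tensor_pair.T_module[OF tp]
  let ?tm = "\<lambda>i j f. tensor_map R M (P i) (P j) f"
  note tmh = tensor_map_props(1)[OF M Pm Pm] and tmp = tensor_map_props(2)[OF M Pm Pm]
  let ?f = "\<lambda>z. (?tm (Suc i) (Suc i) (b (Suc i)) z \<oplus>\<^bsub>S.T\<^esub> ?tm i (Suc i) h (?tm (Suc i) i (d i) z))
      \<oplus>\<^bsub>S.T\<^esub> ?tm (Suc (Suc i)) (Suc i) (d (Suc i)) (?tm (Suc i) (Suc (Suc i)) h' z)"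
  have fh: "?f \<in> module_hom R S.T S.T"
    by (intro hom_add Tm tmh bh module_hom_comp[OF tmh[OF dh] tmh[OF h]] module_hom_comp[OF tmh[OF h'] tmh[OF dh]])
  have "z = ?f z"
  proof (rule S.tensor_hom_eq[OF Tm hom_id fh _ z])
    fix x p assume x: "x \<in> carrier M" and p: "p \<in> carrier (P (Suc i))"
    note c1 = module_homD(1)[OF bh p] and c2 = module_homD(1)[OF dh p] and c3 = module_homD(1)[OF h' p]
    note c4 = module_homD(1)[OF h c2] and c5 = module_homD(1)[OF dh c3]
    have "?f (S.pt x p) = (S.pt x (b (Suc i) p) \<oplus>\<^bsub>S.T\<^esub> S.pt x (h (d i p))) \<oplus>\<^bsub>S.T\<^esub> S.pt x (d (Suc i) (h' p))"
      using tmp[OF bh x p] tmp[OF dh x p] tmp[OF h x c2] tmp[OF h' x p] tmp[OF dh x c3] by simp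
    also have "\<dots> = S.pt x ((b (Suc i) p \<oplus>\<^bsub>P (Suc i)\<^esub> h (d i p)) \<oplus>\<^bsub>P (Suc i)\<^esub> d (Suc i) (h' p))"
      using S.pt_add_r[OF x c1 c4] S.pt_add_r[OF x S.N.M.a_closed[OF c1 c4] c5] by simp
    also have "\<dots> = S.pt x p" using hh[OF p] by simp
    finally show "S.pt x p = ?f (S.pt x p)" by simp
  qed
  moreover have "?tm i (Suc i) h (?tm (Suc i) i (d i) z) = \<zero>\<^bsub>S.T\<^esub>"
    unfolding dz by (rule modl.hom_zero[OF modl.intro[OF Tm] Tm tmh[OF h]])
  moreover have "?tm (Suc i) (Suc i) (b (Suc i)) z = \<zero>\<^bsub>S.T\<^esub>"
  proof (cases i)
    case (Suc k)
    show ?thesis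
    proof (rule S.tensor_hom_eq[OF Tm tmh[OF bh] hom_const_zero[OF Tm] _ z])
      fix x p assume x: "x \<in> carrier M" and p: "p \<in> carrier (P (Suc i))"
      have "?tm (Suc i) (Suc i) (b (Suc i)) (S.pt x p) = S.pt x \<zero>\<^bsub>P (Suc i)\<^esub>"
        using tmp[OF bh x p] b2[of k p] Suc by simp
      also have "\<dots> = \<zero>\<^bsub>S.T\<^esub>" by (rule S.N.hom_zero[OF Tm S.pt_hom_r[OF x]])
      finally show "?tm (Suc i) (Suc i) (b (Suc i)) (S.pt x p) = \<zero>\<^bsub>S.T\<^esub>" .
    qed
  next
    case 0
    interpret P0: tensor_pair R M "P 0" by (rule tp)
    interpret P1: tensor_pair R M "P 1" by (rule tp)
    interpret T1: modl R P1.T by (rule P1.T_modl)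
    interpret MI: modl R "pow_module M I" by (rule M.pow_modl)
    interpret MJ: modl R "pow_module M J" by (rule M.pow_modl)
    have dh0: "d 0 \<in> module_hom R (P 1) (P 0)" using dh[of 0] by simp
    have lift: "\<exists>A\<in>module_hom R (tensor_product R M Q) (pow_module M B). \<forall>x\<in>carrier M. \<forall>p\<in>carrier Q. A (pure_tensor R M Q x p) = (\<lambda>i\<in>B. \<alpha> p i \<odot>\<^bsub>M\<^esub> x)"
      if Q: "module R Q" and a: "\<alpha> \<in> module_hom R Q (rpow R B)" for Q :: "('a, 'p) module" and B :: "'k set" and \<alpha>
    proof -
      interpret T: tensor_pair R M Q by (intro tensor_pair.intro M.modl_axioms modl.intro Q)
      have aR: "\<alpha> p i \<in> carrier R" if "p \<in> carrier Q" "i \<in> B" for p i using module_homD(1)[OF a that(1)] that(2) by auto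
      obtain A where "A \<in> module_hom R T.T (pow_module M B)"
        "\<And>x p. x \<in> carrier M \<Longrightarrow> p \<in> carrier Q \<Longrightarrow> A (T.pt x p) = (\<lambda>i\<in>B. \<alpha> p i \<odot>\<^bsub>M\<^esub> x)"
        by (rule T.tensor_lift[OF M.pow_module_module[of B], of "\<lambda>x p. \<lambda>i\<in>B. \<alpha> p i \<odot>\<^bsub>M\<^esub> x"])
          (auto simp: aR module_homD[OF a] M.smult_r_distr M.smult_l_distr M.smult_commute M.smult_assoc1 intro!: restrict_ext)
      then show ?thesis by blast
    qed
    obtain A1 where A1: "A1 \<in> module_hom R P1.T (pow_module M I)"
      "\<And>x p. x \<in> carrier M \<Longrightarrow> p \<in> carrier (P 1) \<Longrightarrow> A1 (P1.pt x p) = (\<lambda>i\<in>I. \<alpha>1 p i \<odot>\<^bsub>M\<^esub> x)"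
      using lift[OF Pm a1] by blast
    obtain A0 where A0: "A0 \<in> module_hom R P0.T (pow_module M J)"
      "\<And>x p. x \<in> carrier M \<Longrightarrow> p \<in> carrier (P 0) \<Longrightarrow> A0 (P0.pt x p) = (\<lambda>j\<in>J. \<alpha>0 p j \<odot>\<^bsub>M\<^esub> x)"
      using lift[OF Pm a0] by blast
    have z1: "z \<in> carrier P1.T" using z 0 by simp
    have dz1: "?tm 1 0 (d 0) z = \<zero>\<^bsub>P0.T\<^esub>" using dz 0 by simp
    have PhM: "mat_apply M J I C \<in> module_hom R (pow_module M I) (pow_module M J)" by (rule M.mat_apply_hom[OF finI C_closed])
    \<comment> \<open>\<open>A1\<close> and \<open>A0\<close> are \<alpha>1 and \<alpha>0 tensored
      with M, under the identification of M tensor R^I with the I-th power of M. The square with C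
      commutes, as seen on pure tensors.\<close>
    have "mat_apply M J I C (A1 z) = A0 (?tm 1 0 (d 0) z)"
    proof (rule P1.tensor_hom_eq[OF M.pow_module_module module_hom_comp[OF A1(1) PhM] module_hom_comp[OF tmh[OF dh0] A0(1)] _ z1])
      fix x p assume x: "x \<in> carrier M" and p: "p \<in> carrier (P 1)"
      have "A0 (?tm 1 0 (d 0) (P1.pt x p)) = (\<lambda>j\<in>J. \<alpha>0 (d 0 p) j \<odot>\<^bsub>M\<^esub> x)"
        using tmp[OF dh0 x p] A0(2)[OF x module_homD(1)[OF dh0 p]] by simp
      also have "\<dots> = mat_apply M J I C (A1 (P1.pt x p))"
        unfolding A1(2)[OF x p] using mat_apply_vec[OF M x module_homD(1)[OF a1 p]] Pa1[OF p]
        by (auto simp: fun_eq_iff) (simp add: mat_apply_def)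
      finally show "mat_apply M J I C (A1 (P1.pt x p)) = A0 (?tm 1 0 (d 0) (P1.pt x p))" by simp
    qed
    also have "\<dots> = mat_apply M J I C \<zero>\<^bsub>pow_module M I\<^esub>"
      unfolding dz1 modl.hom_zero[OF P0.T_modl M.pow_module_module A0(1)] MI.hom_zero[OF M.pow_module_module PhM] ..
    finally have A1z: "A1 z = \<zero>\<^bsub>pow_module M I\<^esub>"
      by (rule inj_onD[OF injM]) (rule module_homD(1)[OF A1(1) z1], rule MI.M.zero_closed)
    define \<gamma> where "\<gamma> u = (\<Oplus>\<^bsub>P1.T\<^esub>i\<in>I. P1.pt (u i) (c i))" for u
    have gh: "\<gamma> \<in> module_hom R (pow_module M I) P1.T"
      unfolding \<gamma>_def
      by (rule hom_finsum_hom[OF M.pow_module_module Tm finI]) (rule module_hom_comp[OF M.pow_eval_hom P1.pt_hom_l[OF c]])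
    have "?tm 1 1 (b 1) z = \<gamma> (A1 z)"
    proof (rule P1.tensor_hom_eq[OF Tm tmh[OF bh] module_hom_comp[OF A1(1) gh] _ z1])
      fix x p assume x: "x \<in> carrier M" and p: "p \<in> carrier (P 1)"
      have aR: "\<alpha>1 p i \<in> carrier R" if "i \<in> I" for i using module_homD(1)[OF a1 p] that by auto
      have "?tm 1 1 (b 1) (P1.pt x p) = P1.pt x (\<Oplus>\<^bsub>P 1\<^esub>i\<in>I. \<alpha>1 p i \<odot>\<^bsub>P 1\<^esub> c i)" using tmp[OF bh x p] b1[OF p] by simp
      also have "\<dots> = (\<Oplus>\<^bsub>P1.T\<^esub>i\<in>I. P1.pt x (\<alpha>1 p i \<odot>\<^bsub>P 1\<^esub> c i))"
        by (rule P1.N.hom_finsum[OF Tm P1.pt_hom_r[OF x]], rule P1.N.smult_closed[OF aR c])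
      also have "\<dots> = \<gamma> (A1 (P1.pt x p))"
        unfolding \<gamma>_def A1(2)[OF x p]
        by (rule T1.finsum_cong') (use P1.pt_smult_r[OF x c aR] P1.pt_smult_l[OF x c aR] T1.smult_closed[OF aR P1.pt_closed[OF x c]] in
              \<open>auto simp del: One_nat_def\<close>)
      finally show "?tm 1 1 (b 1) (P1.pt x p) = \<gamma> (A1 (P1.pt x p))" .
    qed
    also have "\<dots> = \<zero>\<^bsub>P1.T\<^esub>" unfolding A1z by (rule MI.hom_zero[OF Tm gh])
    finally show ?thesis using 0 by simp
  qed
  moreover have "?tm (Suc (Suc i)) (Suc i) (d (Suc i)) (?tm (Suc i) (Suc (Suc i)) h' z) \<in> carrier S.T"
    by (intro module_homD(1)[OF tmh[OF dh]] module_homD(1)[OF tmh[OF h']] z)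
  ultimately have "z = ?tm (Suc (Suc i)) (Suc i) (d (Suc i)) (?tm (Suc i) (Suc (Suc i)) h' z)" by simp
  then show ?thesis using module_homD(1)[OF tmh[OF h'] z] by (rule image_eqI)
qed

end

section \<open>The short resolution, vanishing of Tor, and projective dimension\<close>

context presentation
begin

text \<open>\<open>proj_dim\<close> and \<open>some_resolution\<close> see only complexes on the
  list type, so R^I -> R^J -> N is copied there.\<close>

lemma ex_short_resolution:
  assumes inj: "inj_on \<Phi>R (carrier (rpow R I))"
  shows "\<exists>(P :: nat \<Rightarrow> ('a, ('a \<times> 'n) list) module) d e.
    projective_resolution R N P d e \<and> (\<forall>i>1. zero_module (P i))"
proof -
  note cr = N.R.is_cring
  obtain \<iota>J :: "('j \<Rightarrow> 'a) \<Rightarrow> ('a \<times> 'n) list" where "inj_on \<iota>J (J \<rightarrow>\<^sub>E carrier R)" using ex_list_code[OF finJ] by blast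
  then have iJ: "inj_on \<iota>J (carrier (rpow R J))" by simp
  obtain \<iota>I :: "('i \<Rightarrow> 'a) \<Rightarrow> ('a \<times> 'n) list" where "inj_on \<iota>I (I \<rightarrow>\<^sub>E carrier R)" using ex_list_code[OF finI] by blast
  then have iI: "inj_on \<iota>I (carrier (rpow R I))" by simp
  \<comment> \<open>The zero modules in degrees at least two are realized as R to the power of the
    empty set, so that \<open>rpow_projective\<close> covers them as well.\<close>
  obtain \<iota>Z :: "('j \<Rightarrow> 'a) \<Rightarrow> ('a \<times> 'n) list" where "inj_on \<iota>Z ({} \<rightarrow>\<^sub>E carrier R)" using ex_list_code[OF finite.emptyI] by blast
  then have iZ: "inj_on \<iota>Z (carrier (rpow R {}))" by simp
  note tJ = transport_props[OF rpowJ_module iJ] and tI = transport_props[OF rpowI_module iI]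
  define PJ where "PJ = transport \<iota>J (rpow R J)"
  define PI where "PI = transport \<iota>I (rpow R I)"
  define PZ where "PZ = transport \<iota>Z (rpow R {})"
  define P where "P i = (if i = 0 then PJ else if i = 1 then PI else PZ)" for i :: nat
  let ?dJ = "the_inv_into (carrier (rpow R J)) \<iota>J" and ?dI = "the_inv_into (carrier (rpow R I)) \<iota>I"
  define e where "e x = \<pi> (?dJ x)" for x
  define d0 where "d0 x = \<iota>J (\<Phi>R (?dI x))" for x
  define d where "d i = (if i = 0 then d0 else (\<lambda>x. \<zero>\<^bsub>P i\<^esub>))" for i :: nat
  have proj: "projective_module R (P i)" for i
    unfolding P_def PJ_def PI_def PZ_def
    using rpow_projective[OF cr finJ iJ] rpow_projective[OF cr finI iI] rpow_projective[OF cr finite.emptyI iZ] by simp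
  have Pm: "module R (P i)" for i using proj[of i] by (simp add: projective_module_def)
  have z: "zero_module PZ"
    unfolding zero_module_def PZ_def transport_simps by (auto simp: restrict_def)
  have d0h: "d0 \<in> module_hom R PI PJ"
    unfolding d0_def PI_def PJ_def by (rule module_hom_comp[OF module_hom_comp[OF tI(3) PhiR_hom] tJ(2)])
  have dh: "d i \<in> module_hom R (P (Suc i)) (P i)" for i
  proof (cases "i = 0")
    case True
    then show ?thesis using d0h by (simp add: d_def P_def)
  next
    case False
    then have "d i = (\<lambda>x. \<zero>\<^bsub>P i\<^esub>)" by (simp add: d_def)
    then show ?thesis using hom_const_zero[OF Pm[of i]] by (simp only:)
  qed
  have eh: "e \<in> module_hom R (P 0) N"
    unfolding e_def P_def PJ_def using module_hom_comp[OF tJ(3) pi_hom] by simp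
  have eJ: "e (\<iota>J v) = \<pi> v" if "v \<in> carrier (rpow R J)" for v
    unfolding e_def by (simp only: the_inv_into_f_f[OF iJ that])
  have dI: "d0 (\<iota>I u) = \<iota>J (\<Phi>R u)" if "u \<in> carrier (rpow R I)" for u
    unfolding d0_def by (simp only: the_inv_into_f_f[OF iI that])
  have cJ: "carrier PJ = \<iota>J ` carrier (rpow R J)" and cI: "carrier PI = \<iota>I ` carrier (rpow R I)"
    unfolding PJ_def PI_def transport_simps by (rule refl)+
  have es: "e ` carrier PJ = carrier N"
    unfolding cJ image_image pi_surj[symmetric] by (rule image_cong[OF refl eJ])
  have ker0: "d0 ` carrier PI = module_ker PJ N e"
  proof -
    have "d0 ` carrier PI = \<iota>J ` \<Phi>R ` carrier (rpow R I)"
      unfolding cI image_image by (rule image_cong[OF refl dI])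
    also have "\<dots> = \<iota>J ` {v \<in> carrier (rpow R J). \<pi> v = \<zero>\<^bsub>N\<^esub>}"
      using pi_ker module_homD(1)[OF PhiR_hom] by (intro arg_cong[where f = "\<lambda>A. \<iota>J ` A"]) blast
    also have "\<dots> = module_ker PJ N e"
      unfolding module_ker_def cJ using eJ by auto
    finally show ?thesis .
  qed
  have zI: "\<zero>\<^bsub>rpow R I\<^esub> \<in> carrier (rpow R I)" by auto
  have ker1: "module_ker PI PJ d0 = {\<zero>\<^bsub>PI\<^esub>}"
  proof -
    have "u = \<zero>\<^bsub>rpow R I\<^esub>" if u: "u \<in> carrier (rpow R I)" and e0: "d0 (\<iota>I u) = \<zero>\<^bsub>PJ\<^esub>" for u
    proof -
      have "\<iota>J (\<Phi>R u) = \<iota>J \<zero>\<^bsub>rpow R J\<^esub>" using e0 unfolding dI[OF u] PJ_def transport_simps .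
      moreover have "\<zero>\<^bsub>rpow R J\<^esub> \<in> carrier (rpow R J)" by auto
      ultimately have "\<Phi>R u = \<zero>\<^bsub>rpow R J\<^esub>" by (rule inj_onD[OF iJ _ module_homD(1)[OF PhiR_hom u]])
      then have "\<Phi>R u = \<Phi>R \<zero>\<^bsub>rpow R I\<^esub>" unfolding modl.hom_zero[OF RI rpowJ_module PhiR_hom] .
      then show ?thesis by (rule inj_onD[OF inj _ u zI])
    qed
    note only = this
    have zz: "\<zero>\<^bsub>PI\<^esub> = \<iota>I \<zero>\<^bsub>rpow R I\<^esub>" unfolding PI_def transport_simps ..
    have dz: "d0 \<zero>\<^bsub>PI\<^esub> = \<zero>\<^bsub>PJ\<^esub>"
    proof -
      have "module R PI" "module R PJ" using Pm[of 1] Pm[of 0] by (simp_all add: P_def)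
      then show ?thesis by (rule modl.hom_zero[OF modl.intro _ d0h])
    qed
    have mem: "\<zero>\<^bsub>PI\<^esub> \<in> module_ker PI PJ d0"
      unfolding module_ker_def cI mem_Collect_eq
      by (rule conjI[OF _ dz]) (subst zz, rule imageI[OF zI])
    have "x = \<zero>\<^bsub>PI\<^esub>" if x: "x \<in> module_ker PI PJ d0" for x
    proof -
      have "x \<in> \<iota>I ` carrier (rpow R I)" and x0: "d0 x = \<zero>\<^bsub>PJ\<^esub>" using x unfolding module_ker_def cI mem_Collect_eq by (rule conjunct1, rule conjunct2)
      then obtain u where u: "u \<in> carrier (rpow R I)" "x = \<iota>I u" by (metis imageE)
      show ?thesis unfolding u(2) zz by (rule arg_cong[OF only[OF u(1) x0[unfolded u(2)]]])
    qed
    note uniq = this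
    show ?thesis
      by (rule equalityI; rule subsetI; unfold singleton_iff) (erule uniq, erule ssubst, rule mem)
  qed
  have "projective_resolution R N P d e"
    unfolding projective_resolution_def
  proof (intro conjI allI)
    show "e ` carrier (P 0) = carrier N" using es by (simp add: P_def)
    show "d 0 ` carrier (P 1) = module_ker (P 0) N e" using ker0 by (simp add: P_def d_def)
    fix i
    have ne: "carrier (P (Suc (Suc i))) \<noteq> {}" by (simp add: P_def PZ_def transport_simps PiE_empty_domain)
    have "d (Suc i) ` carrier (P (Suc (Suc i))) = {\<zero>\<^bsub>P (Suc i)\<^esub>}" unfolding d_def by (simp add: image_constant_conv ne)
    also have "\<dots> = module_ker (P (Suc i)) (P i) (d i)"
    proof (cases i)
      case 0
      then show ?thesis using ker1 by (simp add: P_def d_def)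
    next
      case (Suc k)
      then have "carrier (P (Suc i)) = {\<zero>\<^bsub>P (Suc i)\<^esub>}" using z by (simp add: P_def zero_module_def)
      then show ?thesis unfolding module_ker_def d_def using Suc by auto
    qed
    finally show "d (Suc i) ` carrier (P (Suc (Suc i))) = module_ker (P (Suc i)) (P i) (d i)" .
  qed (rule proj dh eh)+
  moreover have "zero_module (P i)" if "i > 1" for i using z that by (simp add: P_def)
  ultimately show ?thesis by blast
qed

text \<open>\<open>some_resolution\<close> is an arbitrary choice. The short resolution guarantees
  that the choice succeeds, and \<open>tensor_exact\<close> applies to whatever was chosen.\<close>

lemma tor_vanishes:
  assumes inj: "inj_on \<Phi>R (carrier (rpow R I))"
    and M: "module R M" and injM: "inj_on (mat_apply M J I C) (carrier (pow_module M I))" and i: "i \<ge> 1"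
  shows "zero_module (tor R i M N)"
proof -
  obtain j where j: "i = Suc j" using i by (cases i) auto
  obtain P d e where s: "some_resolution R N = (P, d, e)" by (cases "some_resolution R N") auto
  have "\<exists>x. (case x of (P :: nat \<Rightarrow> ('a, ('a \<times> 'n) list) module, d, e) \<Rightarrow> projective_resolution R N P d e)"
    using ex_short_resolution[OF inj] by auto
  then have "case some_resolution R N of (P, d, e) \<Rightarrow> projective_resolution R N P d e"
    unfolding some_resolution_def by (rule someI_ex)
  then have res: "projective_resolution R N P d e" unfolding s by simp
  have Pm: "module R (P i)" for i using res by (simp add: projective_resolution_def projective_module_def)
  have dh: "d i \<in> module_hom R (P (Suc i)) (P i)" for i using res by (simp add: projective_resolution_def)
  let ?T = "\<lambda>k. tensor_product R M (P k)"
  let ?\<delta> = "\<lambda>k. tensor_map R M (P (Suc k)) (P k) (d k)"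
  have Tm: "module R (?T k)" for k
    by (rule tensor_pair.T_module) (intro tensor_pair.intro modl.intro M Pm)
  have \<delta>: "?\<delta> k \<in> module_hom R (?T (Suc k)) (?T k)" for k by (rule tensor_map_props(1)[OF M Pm Pm dh])
  let ?Z = "module_ker (?T (Suc j)) (?T j) (?\<delta> j)"
  let ?B = "?\<delta> (Suc j) ` carrier (?T (Suc (Suc j)))"
  interpret T: modl R "?T (Suc j)" by (rule modl.intro[OF Tm])
  have ddz: "?\<delta> j (?\<delta> (Suc j) w) = \<zero>\<^bsub>?T j\<^esub>" if w: "w \<in> carrier (?T (Suc (Suc j)))" for w
  proof (rule tensor_pair.tensor_hom_eq[OF _ Tm module_hom_comp[OF \<delta> \<delta>] hom_const_zero[OF Tm] _ w])
    show "tensor_pair R M (P (Suc (Suc j)))" by (intro tensor_pair.intro modl.intro M Pm)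
    fix x y assume x: "x \<in> carrier M" and y: "y \<in> carrier (P (Suc (Suc j)))"
    have dy: "d (Suc j) y \<in> carrier (P (Suc j))" by (rule module_homD(1)[OF dh y])
    have "d (Suc j) y \<in> module_ker (P (Suc j)) (P j) (d j)"
      using res y unfolding projective_resolution_def by blast
    then have "d j (d (Suc j) y) = \<zero>\<^bsub>P j\<^esub>" by (simp add: module_ker_def)
    moreover have tp: "tensor_pair R M (P j)" by (intro tensor_pair.intro modl.intro M Pm)
    ultimately show "?\<delta> j (?\<delta> (Suc j) (pure_tensor R M (P (Suc (Suc j))) x y)) = \<zero>\<^bsub>?T j\<^esub>"
      using tensor_map_props(2)[OF M Pm Pm dh x y] tensor_map_props(2)[OF M Pm Pm dh x dy]
        modl.hom_zero[OF modl.intro[OF Pm] Tm tensor_pair.pt_hom_r[OF tp x]] by simp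
  qed
  have BZ: "?B = ?Z"
  proof
    show "?B \<subseteq> ?Z" using ddz module_homD(1)[OF \<delta>] unfolding module_ker_def by blast
    show "?Z \<subseteq> ?B" using tensor_exact[OF res inj M injM] unfolding module_ker_def by blast
  qed
  have Zeq: "?Z = {z \<in> carrier (?T (Suc j)). ?\<delta> j z \<in> {\<zero>\<^bsub>?T j\<^esub>}}" by (simp add: module_ker_def)
  have Zs: "submodule ?Z R (?T (Suc j))"
    unfolding Zeq by (rule T.module_hom_submodule_eq[OF Tm \<delta> modl.sub_zero_submodule[OF modl.intro[OF Tm]]])
  interpret Z: modl R "(?T (Suc j))\<lparr>carrier := ?Z\<rparr>"
    by (rule modl.intro[OF submodule.submodule_is_module[OF Zs Tm]])
  have "zero_module (quot_module ((?T (Suc j))\<lparr>carrier := ?Z\<rparr>) ?B)"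
    unfolding BZ using Z.zero_quot_module[OF Z.carrier_is_submodule] by simp
  then show ?thesis unfolding tor_def s j by (simp add: Let_def)
qed

text \<open>A resolution concentrated in degree zero makes N isomorphic to the projective module
  \<open>P 0\<close>, so the presentation splits and C has a left inverse. This is what excludes
  projective dimension zero.\<close>

lemma splitting_of_projective:
  fixes P :: "nat \<Rightarrow> ('a, 'p) module"
  assumes inj: "inj_on \<Phi>R (carrier (rpow R I))"
    and res: "projective_resolution R N P d e" and z: "\<And>i. i > 0 \<Longrightarrow> zero_module (P i)"
  shows "\<exists>D. (\<forall>i\<in>I. \<forall>j\<in>J. D i j \<in> carrier R) \<and>
    (\<forall>i\<in>I. \<forall>i'\<in>I. (\<Oplus>\<^bsub>R\<^esub>j\<in>J. D i j \<otimes> C j i') = (if i = i' then \<one> else \<zero>))"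
proof -
  note cr = N.R.is_cring
  have proj: "projective_module R (P i)" and dh: "d i \<in> module_hom R (P (Suc i)) (P i)" for i
    using res by (auto simp: projective_resolution_def)
  have eh: "e \<in> module_hom R (P 0) N" and es: "e ` carrier (P 0) = carrier N"
    and ex0: "d 0 ` carrier (P 1) = module_ker (P 0) N e"
    using res by (auto simp: projective_resolution_def)
  have Pm: "module R (P i)" for i using proj[of i] by (simp add: projective_module_def)
  interpret P0: modl R "P 0" by (rule modl.intro[OF Pm])
  interpret RJ: modl R "rpow R J" by (rule RJ)
  interpret RI: modl R "rpow R I" by (rule RI)
  have "carrier (P 1) = {\<zero>\<^bsub>P 1\<^esub>}" using z[of 1] by (simp add: zero_module_def)
  then have "module_ker (P 0) N e = {\<zero>\<^bsub>P 0\<^esub>}"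
    unfolding ex0[symmetric] using modl.hom_zero[OF modl.intro[OF Pm[of 1]] Pm[of 0]] dh[of 0] by simp
  then have ker: "p = \<zero>\<^bsub>P 0\<^esub>" if "p \<in> carrier (P 0)" "e p = \<zero>\<^bsub>N\<^esub>" for p
    using that by (auto simp: module_ker_def)
  have einj: "inj_on e (carrier (P 0))"
  proof (rule inj_onI)
    fix p p' assume p: "p \<in> carrier (P 0)" "p' \<in> carrier (P 0)" "e p = e p'"
    have "e (p \<ominus>\<^bsub>P 0\<^esub> p') = \<zero>\<^bsub>N\<^esub>"
      using P0.hom_minus[OF N.module_axioms eh p(1,2)] p(3) module_homD(1)[OF eh p(2)] by (simp add: N.M.minus_eq N.M.r_neg)
    then show "p = p'" using ker[OF P0.M.minus_closed[OF p(1,2)]] P0.minus_zero_eq[OF p(1,2)] by blast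
  qed
  obtain \<alpha> where a: "\<alpha> \<in> module_hom R (P 0) (rpow R J)" "\<And>x. x \<in> carrier (P 0) \<Longrightarrow> \<pi> (\<alpha> x) = e x"
    using lift_augmentation[OF proj eh] by blast
  have "\<pi> v \<in> e ` carrier (P 0)" if "v \<in> carrier (rpow R J)" for v
    unfolding es by (rule module_homD(1)[OF pi_hom that])
  then obtain k where k: "k \<in> module_hom R (rpow R J) (P 0)" "\<And>v. v \<in> carrier (rpow R J) \<Longrightarrow> e (k v) = \<pi> v"
    using hom_through_inj[OF Pm N.module_axioms rpowJ_module eh einj pi_hom] by blast
  \<comment> \<open>k is \<pi> followed by the inverse of e, and \<alpha> lifts e. Subtracting their
    composite from the identity leaves a map into the image of C that is the identity on this image;
    dividing it by C gives the left inverse.\<close>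
  let ?\<rho> = "\<lambda>v. v \<ominus>\<^bsub>rpow R J\<^esub> \<alpha> (k v)"
  have rh: "?\<rho> \<in> module_hom R (rpow R J) (rpow R J)"
    by (rule hom_diff[OF rpowJ_module rpowJ_module hom_id module_hom_comp[OF k(1) a(1)]])
  have "?\<rho> v \<in> \<Phi>R ` carrier (rpow R I)" if v: "v \<in> carrier (rpow R J)" for v
  proof -
    note kv = module_homD(1)[OF k(1) v]
    have "\<pi> (?\<rho> v) = \<pi> v \<ominus>\<^bsub>N\<^esub> \<pi> (\<alpha> (k v))"
      by (rule RJ.hom_minus[OF N.module_axioms pi_hom v module_homD(1)[OF a(1) kv]])
    also have "\<dots> = \<zero>\<^bsub>N\<^esub>" unfolding a(2)[OF kv] k(2)[OF v] using module_homD(1)[OF pi_hom v] by (simp add: N.M.minus_eq N.M.r_neg)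
    finally show ?thesis using pi_ker[OF module_homD(1)[OF rh v]] by blast
  qed
  then obtain \<psi> where \<psi>: "\<psi> \<in> module_hom R (rpow R J) (rpow R I)" "\<And>v. v \<in> carrier (rpow R J) \<Longrightarrow> \<Phi>R (\<psi> v) = ?\<rho> v"
    using hom_through_inj[OF rpowI_module rpowJ_module rpowJ_module PhiR_hom inj rh] by blast
  have \<psi>\<Phi>: "\<psi> (\<Phi>R u) = u" if u: "u \<in> carrier (rpow R I)" for u
  proof -
    note pu = module_homD(1)[OF PhiR_hom u]
    have "k (\<Phi>R u) = \<zero>\<^bsub>P 0\<^esub>" by (rule ker[OF module_homD(1)[OF k(1) pu]]) (simp only: k(2)[OF pu] pi_Phi[OF u])
    then have "\<alpha> (k (\<Phi>R u)) = \<zero>\<^bsub>rpow R J\<^esub>" by (simp only: P0.hom_zero[OF rpowJ_module a(1)])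
    then have "?\<rho> (\<Phi>R u) = \<Phi>R u"
      using pu RJ.neg_zero by (simp only: RJ.M.minus_eq RJ.M.r_zero)
    then have "\<Phi>R (\<psi> (\<Phi>R u)) = \<Phi>R u" using \<psi>(2)[OF pu] by (simp only:)
    then show ?thesis by (rule inj_onD[OF inj _ module_homD(1)[OF \<psi>(1) pu] u])
  qed
  define D where "D i j = \<psi> (unit_vec R J j) i" for i j
  have DR: "D i j \<in> carrier R" if "i \<in> I" for i j
    using module_homD(1)[OF \<psi>(1) unit_vec_closed[OF cr, of J j]] that by (auto simp: D_def)
  have "(\<Oplus>\<^bsub>R\<^esub>j\<in>J. D i j \<otimes> C j i') = (if i = i' then \<one> else \<zero>)" if i: "i \<in> I" "i' \<in> I" for i i'
  proof -
    interpret S: modl R "self_module R" by (rule R_modl)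
    have ev: "(\<lambda>v. \<psi> v i) \<in> module_hom R (rpow R J) (self_module R)"
      by (rule module_hom_comp[OF \<psi>(1) S.pow_eval_hom[OF i(1)]])
    let ?v = "\<Phi>R (unit_vec R I i')"
    note u = unit_vec_closed[OF cr, of I i']
    have "\<psi> ?v i = (\<Oplus>\<^bsub>self_module R\<^esub>j\<in>J. ?v j \<odot>\<^bsub>self_module R\<^esub> \<psi> (unit_vec R J j) i)"
      by (rule rpow_hom_expand[OF cr S.module_axioms ev finJ module_homD(1)[OF PhiR_hom u]])
    also have "\<dots> = (\<Oplus>\<^bsub>self_module R\<^esub>j\<in>J. D i j \<otimes> C j i')"
      by (rule S.finsum_cong') (use PhiR_unit[OF i(2)] C_closed i DR[OF i(1)] in \<open>auto simp: D_def N.R.m_comm\<close>)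
    also have "\<dots> = (\<Oplus>\<^bsub>R\<^esub>j\<in>J. D i j \<otimes> C j i')"
      by (rule self_module_finsum[OF cr]) (use C_closed i DR[OF i(1)] in auto)
    finally show ?thesis unfolding \<psi>\<Phi>[OF u] using i by (simp add: unit_vec_def)
  qed
  then show ?thesis using DR by blast
qed

lemma proj_dim_eq_1:
  assumes inj: "inj_on \<Phi>R (carrier (rpow R I))"
    and ns: "\<not> (\<exists>D. (\<forall>i\<in>I. \<forall>j\<in>J. D i j \<in> carrier R) \<and>
    (\<forall>i\<in>I. \<forall>i'\<in>I. (\<Oplus>\<^bsub>R\<^esub>j\<in>J. D i j \<otimes> C j i') = (if i = i' then \<one> else \<zero>)))"
  shows "proj_dim R N = 1"
proof (rule antisym)
  let ?S = "{n. \<exists>(P :: nat \<Rightarrow> ('a, ('a \<times> 'n) list) module) d e. projective_resolution R N P d e \<and> (\<forall>i>n. zero_module (P i))}"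
  have "1 \<in> ?S" using ex_short_resolution[OF inj] by simp
  then have "(INF n\<in>?S. enat n) \<le> enat 1" by (rule INF_lower)
  then show "proj_dim R N \<le> 1" by (simp add: proj_dim_def one_enat_def)
  have "1 \<le> enat n" if n: "n \<in> ?S" for n
  proof (cases n)
    case 0
    then obtain P :: "nat \<Rightarrow> ('a, ('a \<times> 'n) list) module" and d e where
      res: "projective_resolution R N P d e" and z: "\<forall>i>0. zero_module (P i)"
      using n by auto
    from notE[OF ns splitting_of_projective[OF inj res]] z show ?thesis by simp
  qed (simp add: one_enat_def)
  then show "1 \<le> proj_dim R N" unfolding proj_dim_def by (intro INF_greatest)
qed

end

section \<open>Free modules and the transpose\<close>

lemma (in modl) inj_on_of_kernel:
  assumes "module R N" "f \<in> module_hom R M N" "\<And>x. x \<in> carrier M \<Longrightarrow> f x = \<zero>\<^bsub>N\<^esub> \<Longrightarrow> x = \<zero>\<^bsub>M\<^esub>"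
  shows "inj_on f (carrier M)"
proof (rule inj_onI)
  interpret N: modl R N by (rule modl.intro) fact
  fix x y assume xy: "x \<in> carrier M" "y \<in> carrier M" "f x = f y"
  have "f (x \<ominus>\<^bsub>M\<^esub> y) = \<zero>\<^bsub>N\<^esub>"
    using hom_minus[OF assms(1,2) xy(1,2)] xy(3) module_homD(1)[OF assms(2) xy(2)] by (simp add: N.M.minus_eq N.M.r_neg)
  then show "x = y" using assms(3)[OF M.minus_closed[OF xy(1,2)]] minus_zero_eq[OF xy(1,2)] by blast
qed

text \<open>\<open>module_basis\<close> sums over the support of the coefficients. With B finite
  this equals the sum over all of B, which is linear in the coefficients, and the coordinate map is
  the inverse of that linear bijection.\<close>

lemma fg_free_coordinates:
  fixes F :: "('a, 'f) module"
  assumes cr: "cring R" and F: "fg_free_module R F"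
  shows "\<exists>B co. finite B \<and> B \<subseteq> carrier F \<and> co \<in> module_hom R F (rpow R B) \<and>
    (\<forall>x\<in>carrier F. (\<Oplus>\<^bsub>F\<^esub>b\<in>B. co x b \<odot>\<^bsub>F\<^esub> b) = x) \<and> (\<forall>b\<in>B. co b = unit_vec R B b)"
proof -
  obtain B where B: "finite B" "module_basis R F B" using F by (auto simp: fg_free_module_def)
  have Fm: "module R F" using F by (simp add: fg_free_module_def)
  interpret F: modl R F by (rule modl.intro[OF Fm])
  have BF: "B \<subseteq> carrier F" using B(2) by (simp add: module_basis_def)
  define full where "full v = (\<Oplus>\<^bsub>F\<^esub>b\<in>B. v b \<odot>\<^bsub>F\<^esub> b)" for v
  have fh: "full \<in> module_hom R (rpow R B) F"
    unfolding full_def by (rule rpow_lift(1)[OF cr Fm B(1)]) (use BF in blast)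
  have fu: "full (unit_vec R B b) = b" if "b \<in> B" for b
    unfolding full_def by (rule rpow_lift(2)[OF cr Fm B(1) _ that]) (use BF in blast)
  have filt: "(\<Oplus>\<^bsub>F\<^esub>b\<in>{b \<in> B. v b \<noteq> \<zero>\<^bsub>R\<^esub>}. v b \<odot>\<^bsub>F\<^esub> b) = full v" if v: "v \<in> carrier (rpow R B)" for v
    unfolding full_def by (rule F.add.finprod_mono_neutral_cong_left) (use B(1) BF v in auto)
  have ex1: "\<exists>!v. v \<in> carrier (rpow R B) \<and> x = full v" if x: "x \<in> carrier F" for x
  proof -
    have "\<exists>!c. c \<in> B \<rightarrow>\<^sub>E carrier R \<and> finite {b \<in> B. c b \<noteq> \<zero>\<^bsub>R\<^esub>} \<and>
        x = (\<Oplus>\<^bsub>F\<^esub>b\<in>{b \<in> B. c b \<noteq> \<zero>\<^bsub>R\<^esub>}. c b \<odot>\<^bsub>F\<^esub> b)"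
      using B(2) x by (auto simp: module_basis_def)
    moreover have "(c \<in> B \<rightarrow>\<^sub>E carrier R \<and> finite {b \<in> B. c b \<noteq> \<zero>\<^bsub>R\<^esub>} \<and>
        x = (\<Oplus>\<^bsub>F\<^esub>b\<in>{b \<in> B. c b \<noteq> \<zero>\<^bsub>R\<^esub>}. c b \<odot>\<^bsub>F\<^esub> b)) \<longleftrightarrow> (c \<in> carrier (rpow R B) \<and> x = full c)" for c
      using filt[of c] B(1) by auto
    ultimately show ?thesis by simp
  qed
  have inj: "inj_on full (carrier (rpow R B))"
    by (rule inj_onI) (use ex1 module_homD(1)[OF fh] in metis)
  have "x \<in> full ` carrier (rpow R B)" if "x \<in> carrier F" for x using ex1[OF that] by blast
  note onto = this
  obtain co where co: "co \<in> module_hom R F (rpow R B)" "\<forall>x\<in>carrier F. full (co x) = x"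
  proof -
    have "\<exists>k\<in>module_hom R F (rpow R B). \<forall>x\<in>carrier F. full (k x) = x"
      by (rule hom_through_inj[OF rpow_module[OF cr] Fm Fm fh inj hom_id]) (rule onto)
    then show ?thesis using that by (elim bexE)
  qed
  have "co b = unit_vec R B b" if b: "b \<in> B" for b
    by (rule inj_onD[OF inj _ module_homD(1)[OF co(1)] unit_vec_closed[OF cr]]) (use co(2) fu[OF b] b BF in auto)
  then show ?thesis using B(1) BF co unfolding full_def by blast
qed

lemma dual_simps:
  "carrier (dual_module R F) = module_hom R F (self_module R) \<inter> extensional (carrier F)"
  "\<zero>\<^bsub>dual_module R F\<^esub> = (\<lambda>x\<in>carrier F. \<zero>\<^bsub>R\<^esub>)"
  "f \<oplus>\<^bsub>dual_module R F\<^esub> g = (\<lambda>x\<in>carrier F. f x \<oplus>\<^bsub>R\<^esub> g x)"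
  "a \<odot>\<^bsub>dual_module R F\<^esub> f = (\<lambda>x\<in>carrier F. a \<otimes>\<^bsub>R\<^esub> f x)"
  by (simp_all add: dual_module_def)

lemma dual_module_module:
  fixes R (structure)
  assumes F: "module R F" shows "module R (dual_module R F)"
proof -
  interpret F: modl R F by (rule modl.intro[OF F])
  let ?D = "dual_module R F"
  have S: "module R (self_module R)" by (rule self_module_module[OF F.R.is_cring])
  have mem: "restrict h (carrier F) \<in> carrier ?D" if h: "h \<in> module_hom R F (self_module R)" for h
  proof -
    have "restrict h (carrier F) \<in> module_hom R F (self_module R)"
      by (rule module_homI) (use module_homD[OF h] in auto)
    then show ?thesis by (simp add: dual_simps)
  qed
  have D: "h \<in> module_hom R F (self_module R)" "h \<in> extensional (carrier F)" if "h \<in> carrier ?D" for h using that by (auto simp: dual_simps)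
  have DR: "h x \<in> carrier R" if "h \<in> carrier ?D" "x \<in> carrier F" for h x using module_homD(1)[OF D(1)[OF that(1)] that(2)] by simp
  have eqI: "h = h'" if "h \<in> extensional (carrier F)" "h' \<in> extensional (carrier F)" "\<And>x. x \<in> carrier F \<Longrightarrow> h x = h' x" for h h'
    using that by (rule extensionalityI)
  have smul: "(\<lambda>x. a \<otimes> h x) \<in> module_hom R F (self_module R)" if a: "a \<in> carrier R" and h: "h \<in> carrier ?D" for a h
    by (rule module_homI) (use module_homD[OF D(1)[OF h]] a in \<open>auto simp: F.R.r_distr F.R.m_lcomm\<close>)
  show ?thesis
  proof (intro moduleI abelian_groupI' F.R.is_cring)
    fix h assume h: "h \<in> carrier ?D"
    show "\<zero>\<^bsub>?D\<^esub> \<oplus>\<^bsub>?D\<^esub> h = h" "\<one> \<odot>\<^bsub>?D\<^esub> h = h"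
      by (rule eqI; use D(2)[OF h] DR[OF h] in \<open>simp add: dual_simps\<close>)+
    show "\<exists>g\<in>carrier ?D. g \<oplus>\<^bsub>?D\<^esub> h = \<zero>\<^bsub>?D\<^esub>"
    proof (rule bexI)
      show "(\<lambda>x\<in>carrier F. (\<ominus> \<one>) \<otimes> h x) \<in> carrier ?D" by (rule mem[OF smul[OF _ h]]) simp
      show "(\<lambda>x\<in>carrier F. (\<ominus> \<one>) \<otimes> h x) \<oplus>\<^bsub>?D\<^esub> h = \<zero>\<^bsub>?D\<^esub>"
        by (rule eqI) (use DR[OF h] in \<open>simp_all add: dual_simps F.R.l_minus F.R.l_neg\<close>)
    qed
    { fix a assume a: "a \<in> carrier R"
      show "a \<odot>\<^bsub>?D\<^esub> h \<in> carrier ?D" unfolding dual_simps(4) by (rule mem[OF smul[OF a h]])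
      fix b assume b: "b \<in> carrier R"
      show "(a \<oplus> b) \<odot>\<^bsub>?D\<^esub> h = a \<odot>\<^bsub>?D\<^esub> h \<oplus>\<^bsub>?D\<^esub> b \<odot>\<^bsub>?D\<^esub> h"
        by (rule eqI) (use DR[OF h] a b in \<open>simp_all add: dual_simps F.R.l_distr\<close>)
      show "(a \<otimes> b) \<odot>\<^bsub>?D\<^esub> h = a \<odot>\<^bsub>?D\<^esub> (b \<odot>\<^bsub>?D\<^esub> h)"
        by (rule eqI) (use DR[OF h] a b in \<open>simp_all add: dual_simps F.R.m_assoc\<close>) }
    fix g assume g: "g \<in> carrier ?D"
    have "(\<lambda>x. h x \<oplus>\<^bsub>self_module R\<^esub> g x) \<in> module_hom R F (self_module R)"
      by (rule hom_add[OF F S D(1)[OF h] D(1)[OF g]])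
    from mem[OF this] show "h \<oplus>\<^bsub>?D\<^esub> g \<in> carrier ?D" by (simp add: dual_simps(3))
    show "h \<oplus>\<^bsub>?D\<^esub> g = g \<oplus>\<^bsub>?D\<^esub> h"
      by (rule eqI) (use DR[OF h] DR[OF g] in \<open>simp_all add: dual_simps F.R.a_comm\<close>)
    { fix a assume a: "a \<in> carrier R"
      show "a \<odot>\<^bsub>?D\<^esub> (h \<oplus>\<^bsub>?D\<^esub> g) = a \<odot>\<^bsub>?D\<^esub> h \<oplus>\<^bsub>?D\<^esub> a \<odot>\<^bsub>?D\<^esub> g"
        by (rule eqI) (use DR[OF h] DR[OF g] a in \<open>simp_all add: dual_simps F.R.r_distr\<close>) }
    fix k assume k: "k \<in> carrier ?D"
    show "h \<oplus>\<^bsub>?D\<^esub> g \<oplus>\<^bsub>?D\<^esub> k = h \<oplus>\<^bsub>?D\<^esub> (g \<oplus>\<^bsub>?D\<^esub> k)"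
      by (rule eqI) (use DR[OF h] DR[OF g] DR[OF k] in \<open>simp_all add: dual_simps F.R.a_assoc\<close>)
  next
    have "(\<lambda>x. \<zero>\<^bsub>self_module R\<^esub>) \<in> module_hom R F (self_module R)" by (rule hom_const_zero[OF S])
    from mem[OF this] show "\<zero>\<^bsub>?D\<^esub> \<in> carrier ?D" by (simp add: dual_simps(2))
  qed
qed

lemma dual_map_hom:
  assumes "module R F1" "module R F0" "f \<in> module_hom R F1 F0"
  shows "dual_map F1 f \<in> module_hom R (dual_module R F0) (dual_module R F1)"
proof -
  interpret F1: modl R F1 by (rule modl.intro) fact
  note f = module_homD[OF assms(3)]
  show ?thesis
  proof (rule module_homI)
    fix g assume g: "g \<in> carrier (dual_module R F0)"
    then have gh: "g \<in> module_hom R F0 (self_module R)" by (simp add: dual_simps)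
    have "(\<lambda>x\<in>carrier F1. g (f x)) \<in> module_hom R F1 (self_module R)"
      by (rule module_homI) (use module_homD[OF module_hom_comp[OF assms(3) gh]] in simp_all)
    then show "dual_map F1 f g \<in> carrier (dual_module R F1)" by (simp add: dual_simps dual_map_def)
  qed (auto simp: dual_simps dual_map_def f intro!: restrict_ext)
qed

text \<open>Coordinates with respect to a finite basis identify \<open>Hom(F, R)\<close> with \<open>R\<^sup>B\<close>.\<close>

locale free_coordinates = F: modl R F for R :: "('a, 'r) ring_scheme" (structure) and F :: "('a, 'f) module" +
  fixes B :: "'f set" and co :: "'f \<Rightarrow> 'f \<Rightarrow> 'a"
  assumes finB: "finite B" and BF: "B \<subseteq> carrier F" and co_hom: "co \<in> module_hom R F (rpow R B)"
    and expand: "x \<in> carrier F \<Longrightarrow> (\<Oplus>\<^bsub>F\<^esub>b\<in>B. co x b \<odot>\<^bsub>F\<^esub> b) = x"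
    and co_basis: "b \<in> B \<Longrightarrow> co b = unit_vec R B b"
begin

abbreviation "D \<equiv> dual_module R F"

lemma S_module: "module R (self_module R)"
  by (rule self_module_module[OF F.R.is_cring])

lemma co_closed: "x \<in> carrier F \<Longrightarrow> b \<in> B \<Longrightarrow> co x b \<in> carrier R"
  using module_homD(1)[OF co_hom, of x] by auto

lemma hom_expand:
  assumes L: "module R L" and h: "h \<in> module_hom R F L" and x: "x \<in> carrier F"
  shows "h x = (\<Oplus>\<^bsub>L\<^esub>b\<in>B. co x b \<odot>\<^bsub>L\<^esub> h b)"
proof -
  interpret L: modl R L by (rule modl.intro[OF L])
  have "h x = h (\<Oplus>\<^bsub>F\<^esub>b\<in>B. co x b \<odot>\<^bsub>F\<^esub> b)" using expand[OF x] by simp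
  also have "\<dots> = (\<Oplus>\<^bsub>L\<^esub>b\<in>B. h (co x b \<odot>\<^bsub>F\<^esub> b))"
    by (rule F.hom_finsum[OF L h]) (use co_closed[OF x] BF in blast)
  also have "\<dots> = (\<Oplus>\<^bsub>L\<^esub>b\<in>B. co x b \<odot>\<^bsub>L\<^esub> h b)"
    by (rule L.finsum_cong') (use co_closed[OF x] BF module_homD[OF h] in auto)
  finally show ?thesis .
qed

definition lin :: "('f \<Rightarrow> 'a) \<Rightarrow> 'f \<Rightarrow> 'a" where
  "lin v = (\<lambda>x\<in>carrier F. \<Oplus>\<^bsub>self_module R\<^esub>b\<in>B. co x b \<odot>\<^bsub>self_module R\<^esub> v b)"

lemma lin_dual: "v \<in> carrier (rpow R B) \<Longrightarrow> lin v \<in> carrier D"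
proof -
  assume v: "v \<in> carrier (rpow R B)"
  have h: "(\<lambda>x. \<Oplus>\<^bsub>self_module R\<^esub>b\<in>B. co x b \<odot>\<^bsub>self_module R\<^esub> v b) \<in> module_hom R F (self_module R)"
    by (rule module_hom_comp[OF co_hom rpow_lift(1)[OF F.R.is_cring S_module finB]]) (use v in auto)
  have "lin v \<in> module_hom R F (self_module R)"
    unfolding lin_def by (rule module_homI) (use module_homD[OF h] in \<open>simp_all del: self_module_simps\<close>)
  then show ?thesis by (simp add: dual_simps lin_def)
qed

lemma lin_basis: "v \<in> carrier (rpow R B) \<Longrightarrow> b \<in> B \<Longrightarrow> lin v b = v b"
proof -
  assume v: "v \<in> carrier (rpow R B)" and b: "b \<in> B"
  have "(\<Oplus>\<^bsub>self_module R\<^esub>j\<in>B. unit_vec R B b j \<odot>\<^bsub>self_module R\<^esub> v j) = v b"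
    by (rule rpow_lift(2)[OF F.R.is_cring S_module finB _ b]) (use v in auto)
  then show ?thesis unfolding lin_def using b BF by (simp add: co_basis subset_iff del: self_module_simps)
qed

lemma dual_restrict: "\<phi> \<in> carrier D \<Longrightarrow> restrict \<phi> B \<in> carrier (rpow R B)"
  using BF by (auto simp: dual_simps module_hom_def subset_iff)

lemma lin_restrict:
  assumes "\<phi> \<in> carrier D" shows "lin (restrict \<phi> B) = \<phi>"
proof (rule extensionalityI)
  have ph: "\<phi> \<in> module_hom R F (self_module R)" using assms by (simp add: dual_simps)
  interpret S: modl R "self_module R" by (rule modl.intro[OF S_module])
  show "lin (restrict \<phi> B) \<in> extensional (carrier F)" by (simp add: lin_def)
  show "\<phi> \<in> extensional (carrier F)" using assms by (simp add: dual_simps)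
  fix x assume x: "x \<in> carrier F"
  have "lin (restrict \<phi> B) x = (\<Oplus>\<^bsub>self_module R\<^esub>b\<in>B. co x b \<odot>\<^bsub>self_module R\<^esub> restrict \<phi> B b)"
    unfolding lin_def using x by simp
  also have "\<dots> = (\<Oplus>\<^bsub>self_module R\<^esub>b\<in>B. co x b \<odot>\<^bsub>self_module R\<^esub> \<phi> b)"
    by (rule S.finsum_cong') (use co_closed[OF x] BF module_homD(1)[OF ph] in auto)
  also have "\<dots> = \<phi> x" by (rule hom_expand[OF S_module ph x, symmetric])
  finally show "lin (restrict \<phi> B) x = \<phi> x" .
qed

lemma lin_hom: "lin \<in> module_hom R (rpow R B) D"
proof (rule module_homI)
  interpret D: modl R D by (rule modl.intro[OF dual_module_module[OF F.module_axioms]])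
  show "lin v \<in> carrier D" if "v \<in> carrier (rpow R B)" for v by (rule lin_dual[OF that])
  show "lin (v \<oplus>\<^bsub>rpow R B\<^esub> w) = lin v \<oplus>\<^bsub>D\<^esub> lin w" if v: "v \<in> carrier (rpow R B)" and w: "w \<in> carrier (rpow R B)" for v w
  proof -
    have "restrict (lin v \<oplus>\<^bsub>D\<^esub> lin w) B = v \<oplus>\<^bsub>rpow R B\<^esub> w"
      using BF by (auto simp: dual_simps lin_basis[OF v] lin_basis[OF w] subset_iff intro!: restrict_ext)
    then show ?thesis using lin_restrict[OF D.a_closed[OF lin_dual[OF v] lin_dual[OF w]]] by simp
  qed
  show "lin (a \<odot>\<^bsub>rpow R B\<^esub> v) = a \<odot>\<^bsub>D\<^esub> lin v" if a: "a \<in> carrier R" and v: "v \<in> carrier (rpow R B)" for a v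
  proof -
    have "restrict (a \<odot>\<^bsub>D\<^esub> lin v) B = a \<odot>\<^bsub>rpow R B\<^esub> v"
      using BF by (auto simp: dual_simps lin_basis[OF v] subset_iff intro!: restrict_ext)
    then show ?thesis using lin_restrict[OF D.smult_closed[OF a lin_dual[OF v]]] by simp
  qed
qed

end

lemma ex_free_coordinates:
  assumes "cring R" "fg_free_module R F"
  obtains B co where "free_coordinates R F B co"
proof -
  obtain B co where "finite B" "B \<subseteq> carrier F" "co \<in> module_hom R F (rpow R B)"
    "\<forall>x\<in>carrier F. (\<Oplus>\<^bsub>F\<^esub>b\<in>B. co x b \<odot>\<^bsub>F\<^esub> b) = x" "\<forall>b\<in>B. co b = unit_vec R B b"
    using fg_free_coordinates[OF assms] by (elim exE conjE)
  moreover have "modl R F" using assms(2) by (auto simp: fg_free_module_def intro: modl.intro)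
  ultimately show ?thesis by (intro that[of B co] free_coordinates.intro free_coordinates_axioms.intro) auto
qed

section \<open>The transpose of X as the cokernel of a matrix\<close>

locale transposed_presentation = A: free_coordinates R F1 B1 co1 + E: free_coordinates R F0 B0 co0
  for R :: "('a, 'r) ring_scheme" (structure) and F1 :: "('a, 'f1) module" and B1 co1
    and F0 :: "('a, 'f0) module" and B0 co0 +
  fixes X :: "('a, 'x) module" and f :: "'f1 \<Rightarrow> 'f0" and g :: "'f0 \<Rightarrow> 'x"
  assumes X: "module R X" and f: "f \<in> module_hom R F1 F0" and g: "g \<in> module_hom R F0 X"
    and fg: "f ` carrier F1 = module_ker F0 X g" and gs: "g ` carrier F0 = carrier X"
begin

text \<open>The matrix of the dual of f, from coordinates on the dual of F0 to coordinates on the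
  dual of F1. It is the transpose of the matrix of f, whence the row index j in B1.\<close>

definition C :: "'f1 \<Rightarrow> 'f0 \<Rightarrow> 'a" where "C j i = co0 (f j) i"

abbreviation "N \<equiv> transpose_of R F1 F0 f"
abbreviation "K \<equiv> dual_map F1 f ` carrier (dual_module R F0)"

definition \<pi> :: "('f1 \<Rightarrow> 'a) \<Rightarrow> ('f1 \<Rightarrow> 'a) set" where "\<pi> v = K +>\<^bsub>dual_module R F1\<^esub> A.lin v"

lemma X_modl: "modl R X" by (rule modl.intro[OF X])

lemma fB: "j \<in> B1 \<Longrightarrow> f j \<in> carrier F0"
  using module_homD(1)[OF f] A.BF by blast

lemma C_closed: "j \<in> B1 \<Longrightarrow> i \<in> B0 \<Longrightarrow> C j i \<in> carrier R"
  unfolding C_def by (rule E.co_closed[OF fB])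

lemma K_sub: "submodule K R (dual_module R F1)"
  by (rule modl.hom_image_submodule[OF modl.intro[OF dual_module_module[OF E.F.module_axioms]]
        dual_module_module[OF A.F.module_axioms] dual_map_hom[OF A.F.module_axioms E.F.module_axioms f]
        module.carrier_is_submodule[OF dual_module_module[OF E.F.module_axioms]]])

lemma dual_map_basis:
  assumes p: "\<phi> \<in> carrier (dual_module R F0)" and j: "j \<in> B1"
  shows "dual_map F1 f \<phi> j = mat_apply (self_module R) B1 B0 C (restrict \<phi> B0) j"
proof -
  interpret S: modl R "self_module R" by (rule modl.intro[OF A.S_module])
  have ph: "\<phi> \<in> module_hom R F0 (self_module R)" using p by (simp add: dual_simps)
  have "dual_map F1 f \<phi> j = \<phi> (f j)" using j A.BF by (auto simp: dual_map_def)
  also have "\<dots> = (\<Oplus>\<^bsub>self_module R\<^esub>i\<in>B0. co0 (f j) i \<odot>\<^bsub>self_module R\<^esub> \<phi> i)"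
    by (rule E.hom_expand[OF A.S_module ph fB[OF j]])
  also have "\<dots> = (\<Oplus>\<^bsub>self_module R\<^esub>i\<in>B0. C j i \<odot>\<^bsub>self_module R\<^esub> restrict \<phi> B0 i)"
    by (rule S.finsum_cong') (use E.co_closed[OF fB[OF j]] E.BF module_homD(1)[OF ph] in \<open>auto simp: C_def\<close>)
  finally show ?thesis using j by (simp add: mat_apply_def)
qed

sublocale pres: presentation R N B1 B0 C \<pi>
proof (intro presentation.intro presentation_axioms.intro)
  note D1 = dual_module_module[OF A.F.module_axioms]
  interpret D1: modl R "dual_module R F1" by (rule modl.intro[OF D1])
  interpret S: modl R "self_module R" by (rule modl.intro[OF A.S_module])
  show "modl R N" unfolding transpose_of_def coker_def by (rule modl.intro[OF D1.quot_module_module[OF K_sub]])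
  show "finite B1" "finite B0" by (rule A.finB E.finB)+
  show "C j i \<in> carrier R" if "j \<in> B1" "i \<in> B0" for j i by (rule C_closed[OF that])
  show "\<pi> \<in> module_hom R (rpow R B1) N"
    unfolding transpose_of_def coker_def \<pi>_def by (rule module_hom_comp[OF A.lin_hom D1.quot_proj_hom[OF K_sub]])
  show "\<pi> ` carrier (rpow R B1) = carrier N"
  proof
    show "\<pi> ` carrier (rpow R B1) \<subseteq> carrier N"
      unfolding transpose_of_def coker_def quot_module_simps \<pi>_def using A.lin_dual by blast
    show "carrier N \<subseteq> \<pi> ` carrier (rpow R B1)"
    proof
      fix y assume "y \<in> carrier N"
      then obtain \<phi> where p: "\<phi> \<in> carrier (dual_module R F1)" "y = K +>\<^bsub>dual_module R F1\<^esub> \<phi>"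
        unfolding transpose_of_def coker_def quot_module_simps by blast
      have "y = \<pi> (restrict \<phi> B1)" unfolding \<pi>_def A.lin_restrict[OF p(1)] by (rule p(2))
      then show "y \<in> \<pi> ` carrier (rpow R B1)" by (rule image_eqI[OF _ A.dual_restrict[OF p(1)]])
    qed
  qed
  fix v assume v: "v \<in> carrier (rpow R B1)"
  have "\<pi> v = \<zero>\<^bsub>N\<^esub> \<longleftrightarrow> A.lin v \<in> K"
    unfolding \<pi>_def transpose_of_def coker_def quot_module_simps by (rule D1.coset_eq_sub[OF K_sub A.lin_dual[OF v]])
  also have "\<dots> \<longleftrightarrow> v \<in> mat_apply (self_module R) B1 B0 C ` carrier (rpow R B0)"
  proof
    assume "A.lin v \<in> K"
    then obtain \<phi> where p: "\<phi> \<in> carrier (dual_module R F0)" "A.lin v = dual_map F1 f \<phi>" by blast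
    note r = E.dual_restrict[OF p(1)]
    have mc: "mat_apply (self_module R) B1 B0 C (restrict \<phi> B0) \<in> carrier (rpow R B1)"
      by (rule S.mat_apply_closed[OF C_closed r])
    have "v j = mat_apply (self_module R) B1 B0 C (restrict \<phi> B0) j" if j: "j \<in> B1" for j
      using A.lin_basis[OF v j] p(2) dual_map_basis[OF p(1) j] by simp
    then have "v = mat_apply (self_module R) B1 B0 C (restrict \<phi> B0)"
      using v mc unfolding pow_module_simps by (intro PiE_ext)
    then show "v \<in> mat_apply (self_module R) B1 B0 C ` carrier (rpow R B0)" by (rule image_eqI[OF _ r])
  next
    assume "v \<in> mat_apply (self_module R) B1 B0 C ` carrier (rpow R B0)"
    then obtain u where u: "u \<in> carrier (rpow R B0)" "v = mat_apply (self_module R) B1 B0 C u" by blast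
    note lu = E.lin_dual[OF u(1)]
    have ru: "restrict (E.lin u) B0 = u"
      using E.lin_basis[OF u(1)] u(1) by (auto simp: fun_eq_iff PiE_iff extensional_def)
    have dm: "dual_map F1 f (E.lin u) \<in> carrier (dual_module R F1)"
      by (rule module_homD(1)[OF dual_map_hom[OF A.F.module_axioms E.F.module_axioms f] lu])
    have "restrict (dual_map F1 f (E.lin u)) B1 = v"
      using dual_map_basis[OF lu] v ru u(2) by (auto simp: fun_eq_iff PiE_iff extensional_def)
    then have "A.lin v = dual_map F1 f (E.lin u)" using A.lin_restrict[OF dm] by simp
    then show "A.lin v \<in> K" by (rule image_eqI[OF _ lu])
  qed
  finally show "\<pi> v = \<zero>\<^bsub>N\<^esub> \<longleftrightarrow> v \<in> mat_apply (self_module R) B1 B0 C ` carrier (rpow R B0)" .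
qed

lemma gB: "i \<in> B0 \<Longrightarrow> g i \<in> carrier X"
  using module_homD(1)[OF g] E.BF by blast

lemma X_span: "submodule_span R X (g ` B0) = carrier X"
proof -
  interpret X: modl R X by (rule X_modl)
  have gX: "g ` B0 \<subseteq> carrier X" using gB by blast
  note S = X.span_submodule[OF gX]
  have "g y \<in> submodule_span R X (g ` B0)" if y: "y \<in> carrier F0" for y
    unfolding E.hom_expand[OF X g y]
    by (rule X.submodule_finsum[OF S], rule X.submoduleE(4)[OF S E.co_closed[OF y]])
      (use X.span_superset[of "g ` B0"] in auto)
  then have "carrier X \<subseteq> submodule_span R X (g ` B0)" unfolding gs[symmetric] by blast
  then show ?thesis using X.sub_in[OF S] by blast
qed

lemma X_relation: "j \<in> B1 \<Longrightarrow> (\<Oplus>\<^bsub>X\<^esub>i\<in>B0. C j i \<odot>\<^bsub>X\<^esub> g i) = \<zero>\<^bsub>X\<^esub>"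
proof -
  assume j: "j \<in> B1"
  have "f j \<in> module_ker F0 X g" unfolding fg[symmetric] using j A.BF by blast
  then show ?thesis using E.hom_expand[OF X g fB[OF j]] by (simp add: module_ker_def C_def)
qed

text \<open>Since s annihilates the generators of X, s times each basis vector i of F0 lies in the
  kernel of g, hence equals f of some \<open>y i\<close>; the coordinates of \<open>y i\<close> form
  row i of D.\<close>

lemma splitting:
  assumes s: "s \<in> carrier R" and sg: "\<And>i. i \<in> B0 \<Longrightarrow> s \<odot>\<^bsub>X\<^esub> g i = \<zero>\<^bsub>X\<^esub>"
  shows "\<exists>D. (\<forall>i\<in>B0. \<forall>j\<in>B1. D i j \<in> carrier R) \<and>
    (\<forall>i\<in>B0. \<forall>i'\<in>B0. (\<Oplus>\<^bsub>R\<^esub>j\<in>B1. D i j \<otimes> C j i') = (if i = i' then s else \<zero>))"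
proof -
  interpret S: modl R "self_module R" by (rule modl.intro[OF A.S_module])
  have iF: "i \<in> carrier F0" if "i \<in> B0" for i using that E.BF by blast
  have "\<exists>y\<in>carrier F1. f y = s \<odot>\<^bsub>F0\<^esub> i" if i: "i \<in> B0" for i
  proof -
    have "s \<odot>\<^bsub>F0\<^esub> i \<in> module_ker F0 X g"
      unfolding module_ker_def using module_homD(3)[OF g s iF[OF i]] sg[OF i] s iF[OF i] by simp
    then show ?thesis unfolding fg[symmetric] by (metis imageE)
  qed
  then obtain y where y: "\<And>i. i \<in> B0 \<Longrightarrow> y i \<in> carrier F1 \<and> f (y i) = s \<odot>\<^bsub>F0\<^esub> i" by metis
  have "(\<Oplus>\<^bsub>R\<^esub>j\<in>B1. co1 (y i) j \<otimes> C j i') = (if i = i' then s else \<zero>)" if i: "i \<in> B0" "i' \<in> B0" for i i'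
  proof -
    have yi: "y i \<in> carrier F1" "f (y i) = s \<odot>\<^bsub>F0\<^esub> i" using y[OF i(1)] by auto
    have h: "(\<lambda>x. co0 (f x) i') \<in> module_hom R F1 (self_module R)"
      by (rule module_hom_comp[OF module_hom_comp[OF f E.co_hom] S.pow_eval_hom[OF i(2)]])
    have "co0 (f (y i)) i' = (\<Oplus>\<^bsub>self_module R\<^esub>j\<in>B1. co1 (y i) j \<odot>\<^bsub>self_module R\<^esub> co0 (f j) i')"
      by (rule A.hom_expand[OF A.S_module h yi(1)])
    also have "\<dots> = (\<Oplus>\<^bsub>R\<^esub>j\<in>B1. co1 (y i) j \<otimes> C j i')"
      unfolding C_def[symmetric] self_module_simps
      by (rule self_module_finsum[OF A.F.R.is_cring]) (use A.co_closed[OF yi(1)] C_closed i in auto)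
    finally have "(\<Oplus>\<^bsub>R\<^esub>j\<in>B1. co1 (y i) j \<otimes> C j i') = co0 (s \<odot>\<^bsub>F0\<^esub> i) i'" unfolding yi(2) by simp
    also have "\<dots> = (if i = i' then s else \<zero>)"
      unfolding module_homD(3)[OF E.co_hom s iF[OF i(1)]] E.co_basis[OF i(1)] using i s by (simp add: unit_vec_def)
    finally show ?thesis .
  qed
  then show ?thesis using A.co_closed y by (intro exI[of _ "\<lambda>i. co1 (y i)"]) auto
qed

text \<open>The vector of generators of X satisfies Cg = 0, so g = DCg = 0.\<close>

lemma X_zero_of_splitting:
  assumes D: "\<forall>i\<in>B0. \<forall>j\<in>B1. D i j \<in> carrier R"
    and DC: "\<forall>i\<in>B0. \<forall>i'\<in>B0. (\<Oplus>\<^bsub>R\<^esub>j\<in>B1. D i j \<otimes> C j i') = (if i = i' then \<one> else \<zero>)"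
  shows "carrier X = {\<zero>\<^bsub>X\<^esub>}"
proof -
  interpret X: modl R X by (rule X_modl)
  let ?u = "\<lambda>i\<in>B0. g i"
  have u: "?u \<in> carrier (pow_module X B0)" using gB by auto
  have Z: "mat_apply X B1 B0 C ?u j = \<zero>\<^bsub>X\<^esub>" if j: "j \<in> B1" for j
  proof -
    have "mat_apply X B1 B0 C ?u j = (\<Oplus>\<^bsub>X\<^esub>i\<in>B0. C j i \<odot>\<^bsub>X\<^esub> g i)"
      unfolding mat_apply_def using j by (simp, intro X.finsum_cong') (use C_closed gB in auto)
    then show ?thesis using X_relation[OF j] by simp
  qed
  have c: "mat_apply X B0 B1 D (mat_apply X B1 B0 C ?u) = \<one> \<odot>\<^bsub>pow_module X B0\<^esub> ?u"
    by (rule X.mat_apply_compose[OF E.finB A.finB C_closed _ _ _ u]) (use D DC in auto)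
  have "g i = \<zero>\<^bsub>X\<^esub>" if i: "i \<in> B0" for i
  proof -
    have "mat_apply X B0 B1 D (mat_apply X B1 B0 C ?u) i \<in> {\<zero>\<^bsub>X\<^esub>}"
      by (rule X.mat_apply_mem[OF X.sub_zero_submodule _ _ i]) (use D Z in auto)
    then show ?thesis unfolding c using i gB by simp
  qed
  then have "submodule_span R X (g ` B0) \<subseteq> {\<zero>\<^bsub>X\<^esub>}"
    by (intro X.span_least[OF X.sub_zero_submodule]) auto
  then show ?thesis unfolding X_span by auto
qed

text \<open>A torsion module has no nonzero functional.\<close>

lemma torsion_inj:
  assumes tor: "torsion_module R X"
  shows "inj_on (mat_apply (self_module R) B1 B0 C) (carrier (rpow R B0))"
proof (rule modl.inj_on_of_kernel[OF pres.RI pres.rpowJ_module pres.PhiR_hom])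
  fix u assume u: "u \<in> carrier (rpow R B0)" and z: "mat_apply (self_module R) B1 B0 C u = \<zero>\<^bsub>rpow R B1\<^esub>"
  interpret S: modl R "self_module R" by (rule modl.intro[OF A.S_module])
  note lu = E.lin_dual[OF u]
  have lh: "E.lin u \<in> module_hom R F0 (self_module R)" using lu by (simp add: dual_simps)
  have ru: "restrict (E.lin u) B0 = u"
    using E.lin_basis[OF u] u by (auto simp: fun_eq_iff PiE_iff extensional_def)
  have lf: "E.lin u (f j) = \<zero>" if j: "j \<in> B1" for j
  proof -
    have "E.lin u (f j) = dual_map F1 f (E.lin u) j" using j A.BF by (auto simp: dual_map_def)
    also have "\<dots> = mat_apply (self_module R) B1 B0 C u j" unfolding dual_map_basis[OF lu j] ru ..
    also have "\<dots> = \<zero>" unfolding z using j by simp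
    finally show ?thesis .
  qed
  have lfx: "E.lin u (f x) = \<zero>" if x: "x \<in> carrier F1" for x
  proof -
    have "E.lin u (f x) = (\<Oplus>\<^bsub>self_module R\<^esub>j\<in>B1. co1 x j \<odot>\<^bsub>self_module R\<^esub> E.lin u (f j))"
      by (rule A.hom_expand[OF A.S_module module_hom_comp[OF f lh] x])
    also have "\<dots> \<in> {\<zero>\<^bsub>self_module R\<^esub>}"
      by (rule S.submodule_finsum[OF S.sub_zero_submodule]) (use lf A.co_closed[OF x] in simp)
    finally show ?thesis by simp
  qed
  have "u i = \<zero>" if i: "i \<in> B0" for i
  proof -
    have iF: "i \<in> carrier F0" using i E.BF by blast
    \<comment> \<open>The multiple of i by this nonzerodivisor lies in the kernel of g, which is the
      image of f, and there the functional vanishes.\<close>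
    obtain a where a: "nonzero_divisor R a" "a \<odot>\<^bsub>X\<^esub> g i = \<zero>\<^bsub>X\<^esub>" using tor gB[OF i] by (auto simp: torsion_module_def)
    have aR: "a \<in> carrier R" using a(1) by (simp add: nonzero_divisor_def)
    have "a \<odot>\<^bsub>F0\<^esub> i \<in> module_ker F0 X g"
      unfolding module_ker_def using module_homD(3)[OF g aR iF] a(2) aR iF by simp
    then obtain x where x: "x \<in> carrier F1" "a \<odot>\<^bsub>F0\<^esub> i = f x" unfolding fg[symmetric] by blast
    have "a \<otimes> E.lin u i = \<zero>" using module_homD(3)[OF lh aR iF] lfx[OF x(1)] x(2) by simp
    then have "E.lin u i = \<zero>" using a(1) module_homD(1)[OF lh iF] by (simp add: nonzero_divisor_def)
    then show ?thesis using E.lin_basis[OF u i] by simp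
  qed
  moreover have "\<zero>\<^bsub>rpow R B0\<^esub> \<in> carrier (rpow R B0)" by auto
  ultimately show "u = \<zero>\<^bsub>rpow R B0\<^esub>" using u by (auto simp: fun_eq_iff PiE_iff extensional_def)
qed

end

section \<open>Free torsion modules\<close>

lemma zero_module_free:
  assumes "module R M" "zero_module M"
  shows "free_module R M"
proof -
  interpret M: modl R M by (rule modl.intro) fact
  have "module_basis R M {}"
    using assms(2) by (auto simp: module_basis_def zero_module_def)
  then show ?thesis using assms(1) by (auto simp: free_module_def)
qed

text \<open>A basis element would be killed by a nonzerodivisor a of R. Uniqueness of the expansion
  of zero makes a vanish in the local ring, so that some u outside q satisfies au = 0, which is
  impossible; the basis is empty.\<close>

lemma (in loc_modl) free_torsion_zero:
  assumes free: "free_module Rq Mq" and tor: "torsion_module R M"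
  shows "satur R q M {\<zero>\<^bsub>M\<^esub>} = carrier M"
proof -
  obtain B where B: "module_basis Rq Mq B" using free by (auto simp: free_module_def)
  have BM: "B \<subseteq> carrier Mq" using B by (simp add: module_basis_def)
  have "b \<notin> B" for b
  proof
    assume b: "b \<in> B"
    obtain x s where x: "x \<in> carrier M" "s \<in> S" "b = fr x s" by (rule Mq_cases[OF subsetD[OF BM b]])
    obtain a where a: "nonzero_divisor R a" "a \<odot>\<^bsub>M\<^esub> x = \<zero>\<^bsub>M\<^esub>" using tor x(1) by (auto simp: torsion_module_def)
    have aR: "a \<in> carrier R" using a(1) by (simp add: nonzero_divisor_def)
    let ?a = "self.fr a \<one>"
    have aq: "?a \<in> carrier Rq" by (rule Rq_closed[OF aR S_one])
    have ab: "?a \<odot>\<^bsub>Mq\<^esub> b = \<zero>\<^bsub>Mq\<^esub>"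
      unfolding x(3) fr_smult[OF aR S_one x(1,2)] a(2) zero_Mq
      by (rule fr_eqI[OF _ _ S_mult[OF S_one x(2)] S_one S_one]) (use S_R[OF x(2)] in simp_all)
    let ?c = "\<lambda>b'\<in>B. if b' = b then ?a else \<zero>\<^bsub>Rq\<^esub>" and ?z = "\<lambda>b'\<in>B. \<zero>\<^bsub>Rq\<^esub>"
    let ?P = "\<lambda>c. c \<in> B \<rightarrow>\<^sub>E carrier Rq \<and> finite {b \<in> B. c b \<noteq> \<zero>\<^bsub>Rq\<^esub>} \<and>
        \<zero>\<^bsub>Mq\<^esub> = (\<Oplus>\<^bsub>Mq\<^esub>b\<in>{b \<in> B. c b \<noteq> \<zero>\<^bsub>Rq\<^esub>}. c b \<odot>\<^bsub>Mq\<^esub> b)"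
    have z0: "\<zero>\<^bsub>Rq\<^esub> \<in> carrier Rq" using Rq_closed[OF R.zero_closed S_one] by (simp add: Rq_simps(3))
    have ex: "\<exists>!c. ?P c"
      by (rule bspec[OF conjunct2[OF B[unfolded module_basis_def]] Q.M.zero_closed])
    obtain P where P: "\<And>c. ?P c \<Longrightarrow> P c" and Pex: "\<exists>!c. P c"
      using ex by (rule that[of ?P, rotated])
    have Pz: "?P ?z"
    proof -
      have e: "{b' \<in> B. ?z b' \<noteq> \<zero>\<^bsub>Rq\<^esub>} = {}" by auto
      show ?thesis unfolding e using z0 by simp
    qed
    \<comment> \<open>Expansions are summed over nonzero coefficients, hence the distinction whether
      a/1 is zero.\<close>
    have Pc: "?P ?c"
    proof (cases "?a = \<zero>\<^bsub>Rq\<^esub>")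
      case True
      show ?thesis unfolding True if_cancel by (rule Pz)
    next
      case False
      then have e: "{b' \<in> B. ?c b' \<noteq> \<zero>\<^bsub>Rq\<^esub>} = {b}" using b by auto
      have "(\<Oplus>\<^bsub>Mq\<^esub>b'\<in>{b}. ?c b' \<odot>\<^bsub>Mq\<^esub> b') = (\<Oplus>\<^bsub>Mq\<^esub>b'\<in>{b}. \<zero>\<^bsub>Mq\<^esub>)"
        by (rule Q.M.finsum_cong') (use ab b in auto)
      then have "\<zero>\<^bsub>Mq\<^esub> = (\<Oplus>\<^bsub>Mq\<^esub>b'\<in>{b}. ?c b' \<odot>\<^bsub>Mq\<^esub> b')" by simp
      moreover have "?c \<in> B \<rightarrow>\<^sub>E carrier Rq" using aq z0 by auto
      ultimately show ?thesis unfolding e by simp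
    qed
    have "?c = ?z" using Pex P[OF Pc] P[OF Pz] by blast
    then have "?c b = ?z b" by (rule fun_cong)
    then have "self.fr a \<one> = self.fr \<zero> \<one>" using b by (simp add: Rq_simps(3))
    then obtain u where u: "u \<in> S" "u \<otimes> (\<one> \<otimes> a) = u \<otimes> (\<one> \<otimes> \<zero>)"
      using self.fr_eq[of a \<zero> \<one> \<one>] aR S_one by auto
    have "a \<otimes> u = \<zero>" using u(2) S_R[OF u(1)] aR by (simp add: R.m_comm)
    then have "u = \<zero>" using a(1) S_R[OF u(1)] by (simp add: nonzero_divisor_def)
    then show False using u(1) additive_subgroup.zero_closed[OF ideal.axioms(1)[OF primeideal.axioms(1)[OF prime]]] by simp
  qed
  then have "B = {}" by blast
  then have "x = \<zero>\<^bsub>Mq\<^esub>" if "x \<in> carrier Mq" for x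
    using B that unfolding module_basis_def by auto
  then have "zero_module Mq" unfolding zero_module_def using Q.M.zero_closed by blast
  then show ?thesis using zero_Mq_iff by simp
qed

lemma ring_supp:
  assumes cr: "cring R" and q: "q \<in> Spec R"
  shows "satur R q (self_module R) {\<zero>\<^bsub>self_module R\<^esub>} \<noteq> carrier (self_module R)"
proof
  interpret cring R by fact
  have pr: "primeideal q R" using q by (simp add: Spec_def)
  assume "satur R q (self_module R) {\<zero>\<^bsub>self_module R\<^esub>} = carrier (self_module R)"
  then have "\<one>\<^bsub>R\<^esub> \<in> satur R q (self_module R) {\<zero>\<^bsub>self_module R\<^esub>}" by simp
  then obtain s where s: "s \<in> carrier R" "s \<notin> q" "s = \<zero>\<^bsub>R\<^esub>" by (auto simp: satur_def)
  then show False using additive_subgroup.zero_closed[OF ideal.axioms(1)[OF primeideal.axioms(1)[OF pr]]] by simp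
qed

section \<open>Tensoring with the transpose of a torsion module\<close>

theorem theorem2p4:
  fixes R :: "('a, 'r) ring_scheme"
    and n :: nat
    and \<pp> :: "'a set"
    and X :: "('a, 'x) module"
    and F1 :: "('a, 'f1) module"
    and F0 :: "('a, 'f0) module"
    and f :: "'f1 \<Rightarrow> 'f0"
    and g :: "'f0 \<Rightarrow> 'x"
    and N :: "('a, ('f1 \<Rightarrow> 'a) set) module"
    and M :: "('a, 'm) module"
  assumes "cring R" and "noetherian_ring R"
    and "\<pp> \<in> Spec R" and "grade R \<pp> \<ge> 1" and "height R \<pp> = enat (n + 1)"
    and "fg_module R X"
    and "free_presentation R F1 F0 X f g" and "N = transpose_of R F1 F0 f"
    and "serre_condition R (n + 1) (self_module R)"
    and "torsion_module R X"
    and "\<not> free_module (loc_ring R \<pp>) (loc_module R \<pp> X)"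
    and "\<forall>\<qq>\<in>Spec R. \<not> \<pp> \<subseteq> \<qq> \<longrightarrow> free_module (loc_ring R \<qq>) (loc_module R \<qq> X)"
    and "fg_module R M" and "\<not> zero_module M"
    and "serre_condition R (n + 2) M" and "\<pp> \<notin> Supp R M"
  shows "serre_condition R (n + 1) (tensor_product R M N) \<and>
         ((\<forall>i\<ge>1. zero_module (tor R i M N)) \<and> proj_dim R N = 1) \<and>
         (serre_condition R n N \<and> \<not> serre_condition R (n + 1) N)"
proof -
  note cr = \<open>cring R\<close> and no = \<open>noetherian_ring R\<close> and pS = \<open>\<pp> \<in> Spec R\<close>
  note fgX = \<open>fg_module R X\<close> and fgM = \<open>fg_module R M\<close> and fgR = self_module_fg[OF cr]
  have fp: "fg_free_module R F1" "fg_free_module R F0" "f \<in> module_hom R F1 F0" "g \<in> module_hom R F0 X"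
    "f ` carrier F1 = module_ker F0 X g" "g ` carrier F0 = carrier X"
    using \<open>free_presentation R F1 F0 X f g\<close> by (auto simp: free_presentation_def)
  have Xm: "module R X" and Mm: "module R M" using fgX fgM by (auto simp: fg_module_def)
  obtain B1 co1 where c1: "free_coordinates R F1 B1 co1" by (rule ex_free_coordinates[OF cr fp(1)])
  obtain B0 co0 where c0: "free_coordinates R F0 B0 co0" by (rule ex_free_coordinates[OF cr fp(2)])
  interpret tp: transposed_presentation R F1 B1 co1 F0 B0 co0 X f g
    by (intro transposed_presentation.intro transposed_presentation_axioms.intro c1 c0 Xm fp)
  have NN: "N = tp.N" by fact
  let ?C = tp.C
  have mm: "matrix_modl q R L B1 B0 ?C" if "fg_module R L" "q \<in> Spec R" for q and L :: "('a, 'l) module"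
    by (intro matrix_modl.intro matrix_modl_axioms.intro prime_modlI no that tp.A.finB tp.E.finB tp.C_closed)
  have lm: "loc_modl R L q" if "module R L" "q \<in> Spec R" for q and L :: "('a, 'l) module"
    using that by (intro loc_modl.intro modl.intro loc_modl_axioms.intro) (auto simp: Spec_def)

  have injR: "inj_on (mat_apply (self_module R) B1 B0 ?C) (carrier (rpow R B0))"
    by (rule tp.torsion_inj) fact

  \<comment> \<open>The zero module is free on the empty basis, so a localization that is not free
    is nonzero.\<close>
  have Xp: "satur R \<pp> X {\<zero>\<^bsub>X\<^esub>} \<noteq> carrier X"
  proof
    interpret XP: loc_modl R X \<pp> by (rule lm[OF Xm pS])
    assume "satur R \<pp> X {\<zero>\<^bsub>X\<^esub>} = carrier X"
    then have "zero_module XP.Mq" using XP.zero_Mq_iff by simp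
    then show False using zero_module_free[OF XP.Mq_module] \<open>\<not> free_module (loc_ring R \<pp>) (loc_module R \<pp> X)\<close> by simp
  qed

  \<comment> \<open>One s outside q kills the finitely many generators of X, and
    \<open>splitting\<close> turns it into DC = s.\<close>
  have split: "\<exists>s\<in>carrier R - q. \<exists>D. (\<forall>i\<in>B0. \<forall>j\<in>B1. D i j \<in> carrier R) \<and>
      (\<forall>i\<in>B0. \<forall>i'\<in>B0. (\<Oplus>\<^bsub>R\<^esub>j\<in>B1. D i j \<otimes>\<^bsub>R\<^esub> ?C j i') = (if i = i' then s else \<zero>\<^bsub>R\<^esub>))"
    if q: "q \<in> Spec R" "\<not> \<pp> \<subseteq> q" for q
  proof -
    interpret XQ: loc_modl R X q by (rule lm[OF Xm q(1)])
    interpret XM: matrix_modl q R X B1 B0 ?C by (rule mm[OF fgX q(1)])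
    have "satur R q X {\<zero>\<^bsub>X\<^esub>} = carrier X"
      by (rule XQ.free_torsion_zero) (use assms(10,12) q in auto)
    then obtain s where s: "s \<in> carrier R - q" "\<And>i. i \<in> B0 \<Longrightarrow> s \<odot>\<^bsub>X\<^esub> g i = \<zero>\<^bsub>X\<^esub>"
      using XM.satur_zero_common[OF tp.E.finB, of g] tp.gB by metis
    then show ?thesis using tp.splitting[of s] by (intro bexI[OF _ s(1)]) blast
  qed

  \<comment> \<open>Local dimension is at least n+1 at every prime over \<pp>, and, by
    \<open>dim2\<close>, at least n+2 strictly above \<pp>. The two bounds are matched to (S_{n+1})
    for R and (S_{n+2}) for M.\<close>
  have dim1: "enat (n + 1) \<le> krull_dim (loc_ring R q)" if q: "q \<in> Spec R" "\<pp> \<subseteq> q" for q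
  proof -
    have "enat (n + 1) \<le> height R q"
    proof (cases "q = \<pp>")
      case True then show ?thesis using assms(5) by simp
    next
      case False
      then have "enat (Suc (n + 1)) \<le> height R q"
        using height_le_mono[of \<pp> q R "n + 1"] q assms(5) by auto
      then show ?thesis by (rule order_trans[rotated]) simp
    qed
    then show ?thesis
      using loc_modl.height_le_krull_dim[OF lm[OF self_module_module[OF cr] q(1)]] order_trans by blast
  qed
  have dim2: "enat (n + 2) \<le> krull_dim (loc_ring R q)" if q: "q \<in> Spec R" "\<pp> \<subset> q" for q
  proof -
    have "enat (Suc (n + 1)) \<le> height R q" using height_le_mono[OF q(2,1), of "n + 1"] assms(5) by auto
    then show ?thesis
      using loc_modl.height_le_krull_dim[OF lm[OF self_module_module[OF cr] q(1)]] order_trans by fastforce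
  qed

  have SM: "depth_ge R q M k (satur R q M {\<zero>\<^bsub>M\<^esub>})"
    if "q \<in> Spec R" "k \<le> n + 2" "satur R q M {\<zero>\<^bsub>M\<^esub>} \<noteq> carrier M" "enat k \<le> krull_dim (loc_ring R q)" for q k
    using assms(15) that unfolding serre_condition_iff[OF no fgM] by blast
  have SR: "depth_ge R q (self_module R) k (satur R q (self_module R) {\<zero>\<^bsub>self_module R\<^esub>})"
    if "q \<in> Spec R" "k \<le> n + 1" "enat k \<le> krull_dim (loc_ring R q)" for q k
    using assms(9) that ring_supp[OF cr that(1)] unfolding serre_condition_iff[OF no fgR] by blast

  text \<open>An associated prime of the kernel on \<open>M\<close> has height \<open>0\<close>, so the matrix splits there.\<close>

  interpret Mo: modl R M by (rule modl.intro[OF Mm])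
  have kerM: "u = \<zero>\<^bsub>pow_module M B0\<^esub>"
    if u: "u \<in> carrier (pow_module M B0)" and z: "mat_apply M B1 B0 ?C u = \<zero>\<^bsub>pow_module M B1\<^esub>" for u
  proof (rule ccontr)
    assume ne: "u \<noteq> \<zero>\<^bsub>pow_module M B0\<^esub>"
    interpret P0: noeth_modl R "pow_module M B0"
      by (intro noeth_modl.intro noeth_modl_axioms.intro Mo.pow_modl no Mo.pow_fg fgM tp.E.finB)
    have hom: "mat_apply M B1 B0 ?C \<in> module_hom R (pow_module M B0) (pow_module M B1)"
      by (rule Mo.mat_apply_hom[OF tp.E.finB tp.C_closed])
    \<comment> \<open>The associated prime belongs to the whole vector u, so q is the full
      annihilator of the multiple w.\<close>
    obtain c where c: "c \<in> carrier R" "primeideal (ann_mod R (pow_module M B0) {\<zero>\<^bsub>pow_module M B0\<^esub>} (c \<odot>\<^bsub>pow_module M B0\<^esub> u)) R"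
      using P0.ex_assoc_prime[OF P0.sub_zero_submodule u] ne by blast
    define w where "w = c \<odot>\<^bsub>pow_module M B0\<^esub> u"
    define q where "q = ann_mod R (pow_module M B0) {\<zero>\<^bsub>pow_module M B0\<^esub>} w"
    have w: "w \<in> carrier (pow_module M B0)" unfolding w_def by (rule P0.smult_closed[OF c(1) u])
    have qS: "q \<in> Spec R" using c(2) by (simp add: Spec_def q_def w_def)
    have memq: "r \<in> q \<longleftrightarrow> r \<in> carrier R \<and> r \<odot>\<^bsub>pow_module M B0\<^esub> w = \<zero>\<^bsub>pow_module M B0\<^esub>" for r
      unfolding q_def ann_mod_def by (simp del: pow_module_simps)
    interpret MQ: matrix_modl q R M B1 B0 ?C by (rule mm[OF fgM qS])
    have wz: "mat_apply M B1 B0 ?C w = \<zero>\<^bsub>pow_module M B1\<^esub>"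
      unfolding w_def module_homD(3)[OF hom c(1) u] z by (rule MQ.P.smult_r_null[OF c(1)])
    \<comment> \<open>Were all entries zero at q, a common denominator outside q would annihilate
      w.\<close>
    have "\<exists>i\<in>B0. w i \<notin> satur R q M {\<zero>\<^bsub>M\<^esub>}"
    proof (rule ccontr)
      assume "\<not> (\<exists>i\<in>B0. w i \<notin> satur R q M {\<zero>\<^bsub>M\<^esub>})"
      then obtain t where t: "t \<in> carrier R - q" "\<And>i. i \<in> B0 \<Longrightarrow> t \<odot>\<^bsub>M\<^esub> w i = \<zero>\<^bsub>M\<^esub>"
        using MQ.satur_zero_common[OF tp.E.finB, of w] by metis
      then have "t \<odot>\<^bsub>pow_module M B0\<^esub> w = \<zero>\<^bsub>pow_module M B0\<^esub>" by (auto intro!: restrict_ext)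
      then show False using t(1) memq by blast
    qed
    then obtain i where i: "i \<in> B0" "w i \<notin> satur R q M {\<zero>\<^bsub>M\<^esub>}" by blast
    have wi: "w i \<in> carrier M" by (rule MQ.powI[OF w i(1)])
    have "r \<odot>\<^bsub>M\<^esub> w i \<in> satur R q M {\<zero>\<^bsub>M\<^esub>}" if r: "r \<in> q" for r
    proof -
      have "r \<odot>\<^bsub>pow_module M B0\<^esub> w = \<zero>\<^bsub>pow_module M B0\<^esub>" using memq r by blast
      from fun_cong[OF this, of i] have "r \<odot>\<^bsub>M\<^esub> w i = \<zero>\<^bsub>M\<^esub>" using i(1) by simp
      then show ?thesis using MQ.satur_superset[OF Mo.sub_zero_submodule] by auto
    qed
    \<comment> \<open>The entry \<open>w i\<close> is a nonzero socle element, so M has depth zero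
      at q. If q contained \<pp>, the dimension there would be at least n+1, and (S_{n+2}) would
      give positive depth.\<close>
    then have "\<not> socle_free q M (satur R q M {\<zero>\<^bsub>M\<^esub>})" using i(2) wi by (auto simp: socle_free_def)
    then have nd: "\<not> depth_ge R q M (Suc 0) (satur R q M {\<zero>\<^bsub>M\<^esub>})" using MQ.depth_ge_socle_free by blast
    have supp: "satur R q M {\<zero>\<^bsub>M\<^esub>} \<noteq> carrier M" using i(2) wi by blast
    have "\<not> \<pp> \<subseteq> q"
    proof
      assume "\<pp> \<subseteq> q"
      then have "enat (n + 1) \<le> krull_dim (loc_ring R q)" by (rule dim1[OF qS])
      then have "enat (Suc 0) \<le> krull_dim (loc_ring R q)" by (rule order_trans[rotated]) simp
      then show False using SM[OF qS _ supp, of "Suc 0"] nd by simp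
    qed
    then obtain s D where s: "s \<in> carrier R - q" and D: "\<forall>i\<in>B0. \<forall>j\<in>B1. D i j \<in> carrier R"
      and DC: "\<forall>i\<in>B0. \<forall>i'\<in>B0. (\<Oplus>\<^bsub>R\<^esub>j\<in>B1. D i j \<otimes>\<^bsub>R\<^esub> ?C j i') = (if i = i' then s else \<zero>\<^bsub>R\<^esub>)"
      using split[OF qS] by blast
    have DR: "\<And>j i. j \<in> B1 \<Longrightarrow> i \<in> B0 \<Longrightarrow> D i j \<in> carrier R" using D by blast
    \<comment> \<open>Now sw = DCw = 0, although s lies outside the annihilator of w.\<close>
    have "mat_apply M B0 B1 D (mat_apply M B1 B0 ?C w) = s \<odot>\<^bsub>pow_module M B0\<^esub> w"
      by (rule Mo.mat_apply_compose[OF tp.E.finB tp.A.finB tp.C_closed DR _ _ w]) (use s DC in auto)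
    moreover have "mat_apply M B0 B1 D (mat_apply M B1 B0 ?C w) = \<zero>\<^bsub>pow_module M B0\<^esub>"
      unfolding wz by (rule MQ.P.hom_zero[OF Mo.pow_module_module Mo.mat_apply_hom[OF tp.A.finB DR]])
    ultimately show False using s memq by auto
  qed
  have injM: "inj_on (mat_apply M B1 B0 ?C) (carrier (pow_module M B0))"
    by (rule modl.inj_on_of_kernel[OF Mo.pow_modl Mo.pow_module_module Mo.mat_apply_hom[OF tp.E.finB tp.C_closed] kerM])

  have inj_modL: "matrix_modl.inj_mod L B1 B0 ?C (satur R q L {\<zero>\<^bsub>L\<^esub>})"
    if L: "fg_module R L" and q: "q \<in> Spec R" and inj: "inj_on (mat_apply L B1 B0 ?C) (carrier (pow_module L B0))"
    for q and L :: "('a, 'l) module"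
  proof -
    interpret L: matrix_modl q R L B1 B0 ?C by (rule mm[OF L q])
    show ?thesis
    proof (rule L.inj_mod_satur_zero)
      fix u i assume u: "u \<in> carrier (pow_module L B0)" and z: "\<And>j. j \<in> B1 \<Longrightarrow> mat_apply L B1 B0 ?C u j = \<zero>\<^bsub>L\<^esub>" and i: "i \<in> B0"
      have z0: "\<zero>\<^bsub>pow_module L B0\<^esub> \<in> carrier (pow_module L B0)" by auto
      have "mat_apply L B1 B0 ?C u = \<zero>\<^bsub>pow_module L B1\<^esub>" using z by (auto simp: mat_apply_def intro!: restrict_ext)
      also have "\<dots> = mat_apply L B1 B0 ?C \<zero>\<^bsub>pow_module L B0\<^esub>"
        by (rule modl.hom_zero[OF L.pow_modl L.pow_module_module L.Phi_hom, symmetric])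
      finally have "u = \<zero>\<^bsub>pow_module L B0\<^esub>" by (rule inj_onD[OF inj _ u z0])
      then show "u i = \<zero>\<^bsub>L\<^esub>" using i by simp
    qed
  qed
  have coker_split: "depth_ge R q (pow_module L B1) k (matrix_modl.coker_sub q R L B1 B0 ?C (satur R q L {\<zero>\<^bsub>L\<^esub>}))"
    if L: "fg_module R L" and q: "q \<in> Spec R" "\<not> \<pp> \<subseteq> q" and k: "depth_ge R q L k (satur R q L {\<zero>\<^bsub>L\<^esub>})"
    for q k and L :: "('a, 'l) module"
  proof -
    interpret L: matrix_modl q R L B1 B0 ?C by (rule mm[OF L q(1)])
    obtain s D where s: "s \<in> carrier R - q" and D: "\<forall>i\<in>B0. \<forall>j\<in>B1. D i j \<in> carrier R"
      and DC: "\<forall>i\<in>B0. \<forall>i'\<in>B0. (\<Oplus>\<^bsub>R\<^esub>j\<in>B1. D i j \<otimes>\<^bsub>R\<^esub> ?C j i') = (if i = i' then s else \<zero>\<^bsub>R\<^esub>)"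
      using split[OF q] by blast
    show ?thesis
      by (rule L.depth_coker_split[where D = D, OF _ s _ L.satur_sat_sub[OF L.sub_zero_submodule] k]) (use D DC in auto)
  qed
  have coker_inj: "depth_ge R q (pow_module L B1) k (matrix_modl.coker_sub q R L B1 B0 ?C (satur R q L {\<zero>\<^bsub>L\<^esub>}))"
    if L: "fg_module R L" and q: "q \<in> Spec R" and inj: "inj_on (mat_apply L B1 B0 ?C) (carrier (pow_module L B0))"
      and k: "depth_ge R q L (Suc k) (satur R q L {\<zero>\<^bsub>L\<^esub>})"
    for q k and L :: "('a, 'l) module"
  proof -
    interpret L: matrix_modl q R L B1 B0 ?C by (rule mm[OF L q])
    show ?thesis by (rule L.depth_coker[OF L.satur_sat_sub[OF L.sub_zero_submodule] inj_modL[OF L q inj] k])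
  qed

  have Nm: "module R N" unfolding NN by (rule tp.pres.N.module_axioms)
  have fgN: "fg_module R N" unfolding NN
    by (rule fg_hom_image[OF modl.pow_fg[OF modl.intro[OF self_module_module[OF cr]] fgR tp.A.finB]
          tp.pres.N.module_axioms tp.pres.pi_hom tp.pres.pi_surj])
  let ?T = "tensor_product R M N"
  obtain \<Psi> where Ps: "\<Psi> \<in> module_hom R (pow_module M B1) ?T" "\<Psi> ` carrier (pow_module M B1) = carrier ?T"
    "\<forall>m\<in>carrier (pow_module M B1). \<Psi> m = \<zero>\<^bsub>?T\<^esub> \<longleftrightarrow> m \<in> mat_apply M B1 B0 ?C ` carrier (pow_module M B0)"
    using tp.pres.tensor_presentation[OF Mm] unfolding NN[symmetric] by blast
  have Tm: "module R ?T"
    by (rule tensor_pair.T_module) (intro tensor_pair.intro modl.intro Mm Nm)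
  have fgT: "fg_module R ?T" by (rule fg_hom_image[OF Mo.pow_fg[OF fgM tp.A.finB] Tm Ps(1,2)])
  have depthN: "depth_ge R q N k (satur R q N {\<zero>\<^bsub>N\<^esub>}) \<longleftrightarrow>
      depth_ge R q (rpow R B1) k (matrix_modl.coker_sub q R (self_module R) B1 B0 ?C (satur R q (self_module R) {\<zero>\<^bsub>self_module R\<^esub>}))"
    if q: "q \<in> Spec R" for q k
  proof -
    interpret L: matrix_modl q R "self_module R" B1 B0 ?C by (rule mm[OF fgR q])
    show ?thesis
      by (rule L.presented_depth[OF prime_modlI[OF no fgN q]], unfold NN,
          rule tp.pres.pi_hom, rule tp.pres.pi_surj, rule ballI, rule tp.pres.pi_ker)
  qed

  have "serre_condition R (n + 1) ?T"
    unfolding serre_condition_iff[OF no fgT]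
  proof (intro ballI allI impI)
    fix q k assume q: "q \<in> Spec R" and k: "k \<le> n + 1"
      and "satur R q ?T {\<zero>\<^bsub>?T\<^esub>} \<noteq> carrier ?T \<and> enat k \<le> krull_dim (loc_ring R q)"
    then have ne: "satur R q ?T {\<zero>\<^bsub>?T\<^esub>} \<noteq> carrier ?T" and kd: "enat k \<le> krull_dim (loc_ring R q)" by auto
    interpret L: matrix_modl q R M B1 B0 ?C by (rule mm[OF fgM q])
    have supp: "satur R q M {\<zero>\<^bsub>M\<^esub>} \<noteq> carrier M" using L.presented_supp[OF Tm Ps(1,2)] ne by blast
    have "L.P.dge k (L.coker_sub (satur R q M {\<zero>\<^bsub>M\<^esub>}))"
    proof (cases "\<pp> \<subseteq> q")
      case False
      show ?thesis by (rule coker_split[OF fgM q False SM[OF q _ supp kd]]) (use k in simp)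
    next
      case True
      have "q \<noteq> \<pp>" using supp Supp_iff[OF Mm pS] assms(16) by blast
      \<comment> \<open>Since \<pp> is not in the support of M, q lies strictly above it. The
        additional dimension pays for the cokernel: depth n+2 of M leaves n+1.\<close>
      then have "enat (n + 2) \<le> krull_dim (loc_ring R q)" using True by (intro dim2[OF q]) auto
      then have "L.dge (Suc (n + 1)) (satur R q M {\<zero>\<^bsub>M\<^esub>})" using SM[OF q _ supp, of "n + 2"] by (simp del: depth_ge.simps)
      then show ?thesis by (rule L.P.depth_ge_mono[OF coker_inj[OF fgM q injM] k])
    qed
    then show "depth_ge R q ?T k (satur R q ?T {\<zero>\<^bsub>?T\<^esub>})"
      using L.presented_depth[OF prime_modlI[OF no fgT q] Ps] by blast
  qed
  moreover have "\<forall>i\<ge>1. zero_module (tor R i M N)"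
    unfolding NN using tp.pres.tor_vanishes[OF injR Mm injM] by blast
  moreover have "proj_dim R N = 1"
    unfolding NN
  proof (rule tp.pres.proj_dim_eq_1[OF injR], rule notI, elim exE conjE)
    fix D assume "\<forall>i\<in>B0. \<forall>j\<in>B1. D i j \<in> carrier R"
      "\<forall>i\<in>B0. \<forall>i'\<in>B0. (\<Oplus>\<^bsub>R\<^esub>j\<in>B1. D i j \<otimes>\<^bsub>R\<^esub> ?C j i') = (if i = i' then \<one>\<^bsub>R\<^esub> else \<zero>\<^bsub>R\<^esub>)"
    then have "carrier X = {\<zero>\<^bsub>X\<^esub>}" by (rule tp.X_zero_of_splitting)
    moreover interpret XM: matrix_modl \<pp> R X B1 B0 ?C by (rule mm[OF fgX pS])
    have "{\<zero>\<^bsub>X\<^esub>} \<subseteq> satur R \<pp> X {\<zero>\<^bsub>X\<^esub>}" by (rule XM.satur_superset[OF XM.sub_zero_submodule])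
    ultimately show False using Xp by (auto simp: satur_def)
  qed
  moreover have "serre_condition R n N"
    unfolding serre_condition_iff[OF no fgN]
  proof (intro ballI allI impI)
    fix q k assume q: "q \<in> Spec R" and k: "k \<le> n"
      and "satur R q N {\<zero>\<^bsub>N\<^esub>} \<noteq> carrier N \<and> enat k \<le> krull_dim (loc_ring R q)"
    then have kd: "enat k \<le> krull_dim (loc_ring R q)" by auto
    interpret L: matrix_modl q R "self_module R" B1 B0 ?C by (rule mm[OF fgR q])
    have "L.P.dge k (L.coker_sub (satur R q (self_module R) {\<zero>\<^bsub>self_module R\<^esub>}))"
    proof (cases "\<pp> \<subseteq> q")
      case False
      show ?thesis by (rule coker_split[OF fgR q False SR[OF q _ kd]]) (use k in simp)
    next
      case True
      \<comment> \<open>(S_{n+1}) gives depth n+1 of R at q, of which the cokernel loses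
        one.\<close>
      have "L.dge (Suc n) (satur R q (self_module R) {\<zero>\<^bsub>self_module R\<^esub>})"
        using SR[OF q _ dim1[OF q True]] by (simp del: depth_ge.simps self_module_simps)
      then show ?thesis by (rule L.P.depth_ge_mono[OF coker_inj[OF fgR q injR] k])
    qed
    then show "depth_ge R q N k (satur R q N {\<zero>\<^bsub>N\<^esub>})" using depthN[OF q] by blast
  qed
  moreover have "\<not> serre_condition R (n + 1) N"
  proof
    assume sN: "serre_condition R (n + 1) N"
    interpret L: matrix_modl \<pp> R "self_module R" B1 B0 ?C by (rule mm[OF fgR pS])
    interpret NP: prime_modl \<pp> R N by (rule prime_modlI[OF no fgN pS])
    interpret XP: prime_modl \<pp> R X by (rule prime_modlI[OF no fgX pS])
    let ?Z = "satur R \<pp> (self_module R) {\<zero>\<^bsub>self_module R\<^esub>}"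
    note dp = dim1[OF pS subset_refl]
    have "depth_ge R \<pp> N (n + 1) (satur R \<pp> N {\<zero>\<^bsub>N\<^esub>})"
    \<comment> \<open>(S_{n+1}) says nothing outside the support. If N vanished at \<pp>, its depth
      would be infinite by convention, and the contradiction below covers this case too.\<close>
    proof (cases "satur R \<pp> N {\<zero>\<^bsub>N\<^esub>} = carrier N")
      case True then show ?thesis by (simp only: NP.depth_ge_carrier)
    next
      case False
      then show ?thesis using sN pS dp unfolding serre_condition_iff[OF no fgN] by blast
    qed
    then have dN: "L.P.dge (n + 1) (L.coker_sub ?Z)" using depthN[OF pS] by blast
    have dR: "L.dge (n + 1) ?Z" by (rule SR[OF pS _ dp]) simp
    note Zs = L.satur_sat_sub[OF L.sub_zero_submodule]
    \<comment> \<open>Depth n+2 would produce a chain of n+3 primes ending at \<pp>, against its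
      height n+1. Together with \<open>dR\<close>, the depth of R at \<pp> is exactly n+1.\<close>
    have ndR: "\<not> L.dge (Suc (n + 1)) ?Z"
    proof
      assume d: "L.dge (Suc (n + 1)) ?Z"
      have "?Z \<subseteq> \<pp>"
      proof
        fix a assume "a \<in> ?Z"
        then obtain s where s: "a \<in> carrier R" "s \<in> carrier R" "s \<notin> \<pp>" "s \<otimes>\<^bsub>R\<^esub> a = \<zero>\<^bsub>R\<^esub>" by (auto simp: satur_def)
        have "\<zero>\<^bsub>R\<^esub> \<in> \<pp>" by (rule additive_subgroup.zero_closed[OF ideal.axioms(1)[OF L.is_ideal]])
        then show "a \<in> \<pp>" using L.I_prime[OF s(2,1)] s(3,4) by auto
      qed
      then obtain ps where ps: "prime_chain R ps" "last ps = \<pp>" "length ps = Suc (Suc (n + 1))"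
        using depth_prime_chain[OF L.prime_modl_axioms Zs _ d] by blast
      have "enat (length ps - 1) \<le> height R \<pp>"
        unfolding height_def by (rule SUP_upper) (use ps in simp)
      then show False using ps(3) assms(5) by simp
    qed
    \<comment> \<open>The vector stems from X, but its properties concern R alone, so it can be used
      for the matrix acting on powers of R.\<close>
    obtain v i0 where v: "\<And>i. i \<in> B0 \<Longrightarrow> v i \<in> carrier R" "i0 \<in> B0" "v i0 \<notin> \<pp>"
      "\<And>j. j \<in> B1 \<Longrightarrow> (\<Oplus>\<^bsub>R\<^esub>i\<in>B0. ?C j i \<otimes>\<^bsub>R\<^esub> v i) \<in> \<pp>"
      using XP.residual_vector[of g B0 B1 ?C] tp.gB tp.X_span tp.E.finB tp.C_closed tp.X_relation Xp by blast
    show False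
      by (rule L.no_residual_kernel[OF Zs inj_modL[OF fgR pS injR] dR dN ndR v])
  qed
  ultimately show ?thesis by blast
qed

end
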